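(* For every formal power series $L(z,\bar z,u)\colon\mathbb C^n_z\to\mathbb C^n_{\bar z}\times\mathbb C_w$ without constant terms corresponding to a strongly nondegenerate almost CR structure and every $r\in\mathbb R$, there exist unique formal power series $f(z,\bar z,u)\in\mathbb C^n$ and $g(z,\bar z,u)\in\mathbb R$ without constant and linear terms such that $g_{u^2}(0)=r$ and the map $h=\mathrm{id}+(f,g)$ transforms $L$ into $L'$ satisfying the normalization $$\tilde L'^{\bar z'}_{z'^a\bar z'^bu'^c}=0,$$ $$\tilde L'^{w'}_{z'^a\bar z'^bu'^c}+\overline{\tilde L'^{w'}_{z'^b\bar z'^au'^c}}=0,\qquad \tilde L'^{w'}_{z'\bar z'u'^{c+1}}=0,\qquad \tilde L'^{w'}_{z'^{a+2}\bar z'u'^c}=0,$$ $$\mathbf{tr}(\tilde L'^{w'}_{z'^2\bar z'^2u'^c})=0,\qquad \mathbf{tr}^2(\tilde L'^{w'}_{z'^3\bar z'^2u'^c})=0,\qquad \mathbf{tr}^3(\tilde L'^{w'}_{z'^3\bar z'^3u'^c})=0,$$ for all $a,b,c\ge0$ (all derivatives at $0$). Furthermore, each partial derivative of $L'$, $f$, $g$ at $0$ is given by a universal polynomial in $r$ and (finitely many) derivatives of $L$.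
   Context: Coordinates $(z,u)=(x+iy,u)\in\mathbb C^n\times\mathbb R$. The complexified tangent space at each point is identified with $\mathbb C^n_z\times\mathbb C^n_{\bar z}\times\mathbb C_w$ (coordinates $dz,d\bar z$, and $dw$ extending $du$). A formal power series $L(z,\bar z,u)=(L^{\bar z},L^w)$ with values complex-linear maps $\mathbb C^n_z\to\mathbb C^n_{\bar z}\times\mathbb C_w$ and $L(0)=0$ represents the formal hypersurface type almost CR structure whose $(1,0)$ bundle $H^{1,0}$ is the graph $(d\bar z,dw)=L(z,\bar z,u)\,dz$. The map $z'=z+f$, $u'=u+g$ transforms $L$ into the $L'=(L'^{\bar z'},L'^{w'})$ representing the transformed structure in the coordinates $(z',u')$: $$g_z+g_{\bar z}L^{\bar z}+(1+g_u)L^w=L'^{w'}(\mathrm{id}+f_z+f_{\bar z}L^{\bar z}+f_uL^w),$$ $$\bar f_z+(\mathrm{id}+\bar f_{\bar z})L^{\bar z}+\bar f_uL^w=L'^{\bar z'}(\mathrm{id}+f_z+f_{\bar z}L^{\bar z}+f_uL^w),$$ with $L'$ taken at $(z,\bar z,u)+(f,\bar f,g)(z,\bar z,u)$. Strong nondegeneracy (at $0$): write $L^w_{\bar z}(\bar\xi;\eta)$, $L^w_z(\xi;\eta)$ for the derivatives of $L^w$ at $0$ in the direction $\bar\xi$ (in $\bar z$), resp. $\xi$ (in $z$), evaluated on $\eta\in\mathbb C^n_z$. The Levi form at $0$ is $\mathcal L(\bar\xi,\eta)=\frac1{2i}\big(L^w_{\bar z}(\bar\xi;\eta)-\overline{L^w_{\bar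 z}(\bar\eta;\xi)}\big)$ and the transversal component of the non-integrability tensor is $\mathcal N^w(\xi,\eta)=L^w_z(\xi;\eta)-L^w_z(\eta;\xi)$. The structure is strongly nondegenerate if $\mathcal L$ is nondegenerate and $6i\mathcal L(\bar\xi,\eta)+\mathcal N^w(\xi,\eta)=0$ for all $\eta$ implies $\xi=0$. The evaluation along the Euler vector field $e(z)=\sum_jz_j\frac{\partial}{\partial z_j}$ is $\tilde L:=L(z,\bar z,u)e(z)=(\tilde L^{\bar z},\tilde L^w)$, and similarly $\tilde L'$ in the coordinates $(z',u')$. For a formal power series $q(z,\bar z,u)$, $q_{z^a\bar z^bu^c}$ denotes the derivative at $0$ regarded as a multihomogeneous polynomial of degree $a$ in $z$, $b$ in $\bar z$, $c$ in $u$, i.e. $a!\,b!\,c!$ times the corresponding multihomogeneous component of $q$. Trace: if the Levi form at $0$ is $\mathcal L=\sum_{j,k}c_{jk}\,d\bar z_j\otimes dz_k$ (it is the same for $L$ and $L'$), then $\mathbf{tr}:=\sum_{j,k}c^{jk}\frac{\partial^2}{\partial\bar z_j\partial z_k}$, where $(c^{jk})$ is the inverse matrix of $(c_{jk})$, with the index convention $\sum_kc^{jk}c_{lk}=\delta_{jl}$. $\mathbf{tr}^l$ is $\mathbf{tr}$ applied $l$ times.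
   Formalization: "Universal polynomial" becomes P/Q: P in r, derivatives of L and conjugates; Q only in first-order ones, nonzero for every strongly nondegenerate L. Literally false otherwise: n=1, L^z̄=0, L^w=ic z̄+a z z̄ (c real, nonzero) gives f_{z^2}(0)=a/(2ic). *)

theory Defs
  imports "HOL-Analysis.Analysis" "HOL-Library.Poly_Mapping"
begin

section \<open>Formal power series in finitely many commuting variables\<close>

text \<open>A multi-exponent is a function \<open>'v \<Rightarrow> nat\<close> on the finite type \<open>'v\<close> of variables; a formal
  power series is its family of complex coefficients.\<close>

typedef 'v mps = "UNIV :: (('v \<Rightarrow> nat) \<Rightarrow> complex) set"
  morphisms mcoeff Abs_mps by simp

setup_lifting type_definition_mps

lemma mps_eqI: "(\<And>\<alpha>. mcoeff p \<alpha> = mcoeff q \<alpha>) \<Longrightarrow> p = q"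
  by (metis mcoeff_inject ext)

definition exp_splits :: "('v \<Rightarrow> nat) \<Rightarrow> (('v \<Rightarrow> nat) \<times> ('v \<Rightarrow> nat)) set" where
  "exp_splits \<alpha> = {(\<beta>, \<gamma>). \<forall>v. \<beta> v + \<gamma> v = \<alpha> v}"

lemma finite_exp_le: "finite {\<beta>. \<forall>v. \<beta> v \<le> (\<alpha> v :: nat)}"
  for \<alpha> :: "'v::finite \<Rightarrow> nat"
proof -
  have "{\<beta>. \<forall>v. \<beta> v \<le> \<alpha> v} = PiE UNIV (\<lambda>v. {..\<alpha> v})"
    by (auto simp: PiE_def Pi_def)
  then show ?thesis by (simp add: finite_PiE)
qed

lemma finite_exp_splits [simp]: "finite (exp_splits \<alpha>)"
  for \<alpha> :: "'v::finite \<Rightarrow> nat"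
proof (rule finite_subset)
  show "exp_splits \<alpha> \<subseteq> {\<beta>. \<forall>v. \<beta> v \<le> \<alpha> v} \<times> {\<beta>. \<forall>v. \<beta> v \<le> \<alpha> v}"
    by (auto simp: exp_splits_def) (metis le_add1, metis le_add2)
qed (simp add: finite_exp_le)

instantiation mps :: (finite) comm_ring_1
begin

lift_definition zero_mps :: "'a mps" is "\<lambda>\<alpha>. 0" .
lift_definition one_mps :: "'a mps" is "\<lambda>\<alpha>. if \<alpha> = (\<lambda>v. 0) then 1 else 0" .
lift_definition plus_mps :: "'a mps \<Rightarrow> 'a mps \<Rightarrow> 'a mps" is "\<lambda>p q \<alpha>. p \<alpha> + q \<alpha>" .
lift_definition minus_mps :: "'a mps \<Rightarrow> 'a mps \<Rightarrow> 'a mps" is "\<lambda>p q \<alpha>. p \<alpha> - q \<alpha>" .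
lift_definition uminus_mps :: "'a mps \<Rightarrow> 'a mps" is "\<lambda>p \<alpha>. - p \<alpha>" .
lift_definition times_mps :: "'a mps \<Rightarrow> 'a mps \<Rightarrow> 'a mps"
  is "\<lambda>p q \<alpha>. \<Sum>(\<beta>, \<gamma>) \<in> exp_splits \<alpha>. p \<beta> * q \<gamma>" .

instance
proof
  fix p q s :: "'a mps"
  show "p * q * s = p * (q * s)"
  proof transfer
    fix p q s :: "('a \<Rightarrow> nat) \<Rightarrow> complex"
    have "(\<Sum>(\<beta>, \<gamma>)\<in>exp_splits \<alpha>. (\<Sum>(\<beta>, \<gamma>)\<in>exp_splits \<beta>. p \<beta> * q \<gamma>) * s \<gamma>)
        = (\<Sum>(\<beta>, \<gamma>)\<in>exp_splits \<alpha>. p \<beta> * (\<Sum>(\<beta>, \<gamma>)\<in>exp_splits \<gamma>. q \<beta> * s \<gamma>))"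
      (is "?l = ?r") for \<alpha>
    proof -
      have "?l = (\<Sum>x\<in>exp_splits \<alpha>. \<Sum>y\<in>exp_splits (fst x). p (fst y) * q (snd y) * s (snd x))"
        by (simp add: case_prod_unfold sum_distrib_right)
      also have "\<dots> = (\<Sum>(x, y)\<in>Sigma (exp_splits \<alpha>) (\<lambda>x. exp_splits (fst x)).
                        p (fst y) * q (snd y) * s (snd x))"
        by (rule sum.Sigma) auto
      also have "\<dots> = (\<Sum>(x, y)\<in>Sigma (exp_splits \<alpha>) (\<lambda>x. exp_splits (snd x)).
                        p (fst x) * (q (fst y) * s (snd y)))"
        by (rule sum.reindex_bij_witness
              [where j = "\<lambda>(x, y). ((fst y, \<lambda>v. snd y v + snd x v), (snd y, snd x))"
                 and i = "\<lambda>(x, y). ((\<lambda>v. fst x v + fst y v, snd y), (fst x, fst y))"])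
           (auto simp: exp_splits_def add.assoc mult.assoc, simp flip: add.assoc)
      also have "\<dots> = (\<Sum>x\<in>exp_splits \<alpha>. \<Sum>y\<in>exp_splits (snd x). p (fst x) * (q (fst y) * s (snd y)))"
        by (rule sum.Sigma [symmetric]) auto
      also have "\<dots> = ?r"
        by (simp add: case_prod_unfold sum_distrib_left)
      finally show ?thesis .
    qed
    then show "(\<lambda>\<alpha>. \<Sum>(\<beta>, \<gamma>)\<in>exp_splits \<alpha>. (\<Sum>(\<beta>, \<gamma>)\<in>exp_splits \<beta>. p \<beta> * q \<gamma>) * s \<gamma>) =
      (\<lambda>\<alpha>. \<Sum>(\<beta>, \<gamma>)\<in>exp_splits \<alpha>. p \<beta> * (\<Sum>(\<beta>, \<gamma>)\<in>exp_splits \<gamma>. q \<beta> * s \<gamma>))"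
      by (rule ext)
  qed
  show "p * q = q * p"
  proof transfer
    fix p q :: "('a \<Rightarrow> nat) \<Rightarrow> complex"
    show "(\<lambda>\<alpha>. \<Sum>(\<beta>, \<gamma>)\<in>exp_splits \<alpha>. p \<beta> * q \<gamma>) = (\<lambda>\<alpha>. \<Sum>(\<beta>, \<gamma>)\<in>exp_splits \<alpha>. q \<beta> * p \<gamma>)"
      by (rule ext, rule sum.reindex_bij_witness [where i = prod.swap and j = prod.swap])
         (auto simp: exp_splits_def add.commute mult.commute)
  qed
  show "1 * p = p"
  proof transfer
    fix p :: "('a \<Rightarrow> nat) \<Rightarrow> complex"
    have "(\<Sum>(\<beta>, \<gamma>)\<in>exp_splits \<alpha>. (if \<beta> = (\<lambda>v :: 'a. 0 :: nat) then 1 else 0) * p \<gamma>) = p \<alpha>" for \<alpha>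
    proof -
      have "(\<Sum>(\<beta>, \<gamma>)\<in>exp_splits \<alpha>. (if \<beta> = (\<lambda>v :: 'a. 0 :: nat) then 1 else 0) * p \<gamma>)
          = (\<Sum>(\<beta>, \<gamma>)\<in>{((\<lambda>v. 0), \<alpha>)}. (if \<beta> = (\<lambda>v :: 'a. 0 :: nat) then 1 else 0) * p \<gamma>)"
        by (rule sum.mono_neutral_right, simp, simp add: exp_splits_def)
           (auto simp: exp_splits_def fun_eq_iff split: if_splits)
      then show ?thesis by simp
    qed
    then show "(\<lambda>\<alpha>. \<Sum>(\<beta>, \<gamma>)\<in>exp_splits \<alpha>. (if \<beta> = (\<lambda>v :: 'a. 0 :: nat) then 1 else 0) * p \<gamma>) = p" 
      by (rule ext)
  qed
  show "(p + q) * s = p * s + q * s"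
    by transfer (simp add: case_prod_unfold sum.distrib distrib_right)
  show "(0::'a mps) \<noteq> 1"
    by transfer (auto simp: fun_eq_iff)
qed (transfer; simp add: fun_eq_iff)+

end

definition edeg :: "('v::finite \<Rightarrow> nat) \<Rightarrow> nat" where
  "edeg \<alpha> = (\<Sum>v\<in>UNIV. \<alpha> v)"

definition mconst :: "complex \<Rightarrow> 'v mps" where
  "mconst c = Abs_mps (\<lambda>\<alpha>. if \<alpha> = (\<lambda>v. 0) then c else 0)"

definition mvar :: "'v \<Rightarrow> 'v mps" where
  "mvar v = Abs_mps (\<lambda>\<alpha>. if \<alpha> = (\<lambda>v. 0)(v := 1) then 1 else 0)"

definition mderiv :: "'v \<Rightarrow> 'v mps \<Rightarrow> 'v mps" where
  "mderiv v q = Abs_mps (\<lambda>\<alpha>. of_nat (Suc (\<alpha> v)) * mcoeff q (\<alpha>(v := Suc (\<alpha> v))))"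

text \<open>The partial derivative of multi-order \<open>\<alpha>\<close> at \<open>0\<close>.\<close>

definition deriv_at0 :: "('v::finite \<Rightarrow> nat) \<Rightarrow> 'v mps \<Rightarrow> complex" where
  "deriv_at0 \<alpha> q = of_nat (\<Prod>v\<in>UNIV. fact (\<alpha> v)) * mcoeff q \<alpha>"

text \<open>Substitution of the series \<open>\<sigma> v\<close> for the variables \<open>v\<close>.  It is meaningful when all \<open>\<sigma> v\<close> have
  zero constant term: then \<open>\<Prod>v. \<sigma> v ^ \<beta> v\<close> contributes only to exponents of total degree at least
  \<open>edeg \<beta>\<close>, so the truncated sum is the full one.\<close>

definition msubst :: "'v::finite mps \<Rightarrow> ('v \<Rightarrow> 'v mps) \<Rightarrow> 'v mps" where
  "msubst q \<sigma> = Abs_mps (\<lambda>\<alpha>. \<Sum>\<beta> | edeg \<beta> \<le> edeg \<alpha>.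
      mcoeff q \<beta> * mcoeff (\<Prod>v\<in>UNIV. \<sigma> v ^ \<beta> v) \<alpha>)"

definition vanishes_to_order :: "nat \<Rightarrow> 'v::finite mps \<Rightarrow> bool" where
  "vanishes_to_order k q \<longleftrightarrow> (\<forall>\<alpha>. edeg \<alpha> < k \<longrightarrow> mcoeff q \<alpha> = 0)"


section \<open>Series in the coordinates of \<open>\<complex>\<^sup>n \<times> \<real>\<close>\<close>

datatype 'n cvar = Z 'n | Zbar 'n | U

instance cvar :: (finite) finite
proof
  have "(UNIV :: 'a cvar set) = range Z \<union> range Zbar \<union> {U}"
    by (auto simp: image_iff) (metis cvar.exhaust)
  then show "finite (UNIV :: 'a cvar set)"
    by (metis finite.emptyI finite.insertI finite_UnI finite_imageI finite)
qed

type_synonym 'n ser = "'n cvar mps"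

primrec cvar_conj :: "'n cvar \<Rightarrow> 'n cvar" where
  "cvar_conj (Z j) = Zbar j"
| "cvar_conj (Zbar j) = Z j"
| "cvar_conj U = U"

text \<open>The complex conjugate series, with \<open>z\<close> and \<open>zbar\<close> conjugate to each other and \<open>u\<close> real;
  \<open>ser_conj q = q\<close> says that \<open>q\<close> is real-valued.\<close>

definition ser_conj :: "'n ser \<Rightarrow> 'n ser" where
  "ser_conj q = Abs_mps (\<lambda>\<alpha>. cnj (mcoeff q (\<alpha> \<circ> cvar_conj)))"

definition vec_conj :: "'n ser ^ 'n \<Rightarrow> 'n ser ^ 'n" where
  "vec_conj f = (\<chi> i. ser_conj (f $ i))"

text \<open>\<open>mhom q a b c\<close> is the derivative of \<open>q\<close> at \<open>0\<close> of order \<open>a\<close> in \<open>z\<close>, \<open>b\<close> in \<open>zbar\<close>, \<open>c\<close> in \<open>u\<close>,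
  as a multihomogeneous polynomial.\<close>

definition mhom :: "'n::finite ser \<Rightarrow> nat \<Rightarrow> nat \<Rightarrow> nat \<Rightarrow> 'n ser" where
  "mhom q a b c = Abs_mps (\<lambda>\<alpha>.
     if (\<Sum>j\<in>UNIV. \<alpha> (Z j)) = a \<and> (\<Sum>j\<in>UNIV. \<alpha> (Zbar j)) = b \<and> \<alpha> U = c
     then fact a * fact b * fact c * mcoeff q \<alpha> else 0)"


section \<open>Almost CR structures and their transformation\<close>

text \<open>A structure \<open>(d zbar, dw) = L dz\<close> is the pair of the matrix \<open>Lzb L\<close> (row index: \<open>d zbar\<close>,
  column index: \<open>dz\<close>) and the row vector \<open>Lw L\<close>.\<close>

type_synonym 'n cr_graph = "('n ser ^ 'n ^ 'n) \<times> ('n ser ^ 'n)"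

abbreviation Lzb :: "'n::finite cr_graph \<Rightarrow> 'n ser ^ 'n ^ 'n" where "Lzb \<equiv> fst"
abbreviation Lw :: "'n::finite cr_graph \<Rightarrow> 'n ser ^ 'n" where "Lw \<equiv> snd"

definition no_constant_term :: "'n::finite cr_graph \<Rightarrow> bool" where
  "no_constant_term L \<longleftrightarrow>
     (\<forall>i k. vanishes_to_order 1 (Lzb L $ i $ k)) \<and> (\<forall>k. vanishes_to_order 1 (Lw L $ k))"

definition grad_z :: "'n ser \<Rightarrow> 'n ser ^ 'n" where
  "grad_z q = (\<chi> k. mderiv (Z k) q)"

definition grad_zb :: "'n ser \<Rightarrow> 'n ser ^ 'n" where
  "grad_zb q = (\<chi> k. mderiv (Zbar k) q)"

definition jac_z :: "'n ser ^ 'n \<Rightarrow> 'n ser ^ 'n ^ 'n" where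
  "jac_z f = (\<chi> i k. mderiv (Z k) (f $ i))"

definition jac_zb :: "'n ser ^ 'n \<Rightarrow> 'n ser ^ 'n ^ 'n" where
  "jac_zb f = (\<chi> i k. mderiv (Zbar k) (f $ i))"

text \<open>The product \<open>f\<^sub>u \<cdot> l\<close> of the column \<open>f\<^sub>u\<close> with a row vector \<open>l\<close>.\<close>

definition du_outer :: "'n::finite ser ^ 'n \<Rightarrow> 'n ser ^ 'n \<Rightarrow> 'n ser ^ 'n ^ 'n" where
  "du_outer f l = (\<chi> i k. mderiv U (f $ i) * l $ k)"

definition coord_change :: "'n::finite ser ^ 'n \<Rightarrow> 'n ser \<Rightarrow> 'n cvar \<Rightarrow> 'n ser" where
  "coord_change f g v = mvar v +
     (case v of Z i \<Rightarrow> f $ i | Zbar i \<Rightarrow> vec_conj f $ i | U \<Rightarrow> g)"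

definition cr_subst :: "'n::finite cr_graph \<Rightarrow> ('n cvar \<Rightarrow> 'n ser) \<Rightarrow> 'n cr_graph" where
  "cr_subst L \<sigma> = ((\<chi> i k. msubst (Lzb L $ i $ k) \<sigma>), (\<chi> k. msubst (Lw L $ k) \<sigma>))"

definition transforms ::
  "'n::finite cr_graph \<Rightarrow> 'n ser ^ 'n \<Rightarrow> 'n ser \<Rightarrow> 'n cr_graph \<Rightarrow> bool" where
  "transforms L f g L' \<longleftrightarrow>
     (let L'h = cr_subst L' (coord_change f g);
          J = mat 1 + jac_z f + jac_zb f ** Lzb L + du_outer f (Lw L)
      in grad_z g + grad_zb g v* Lzb L + (1 + mderiv U g) *s Lw L = Lw L'h v* J \<and>
         jac_z (vec_conj f) + (mat 1 + jac_zb (vec_conj f)) ** Lzb L + du_outer (vec_conj f) (Lw L)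
           = Lzb L'h ** J)"


section \<open>Levi form, non-integrability tensor, strong nondegeneracy\<close>

text \<open>\<open>dLw_zb L \<zeta> \<eta>\<close> and \<open>dLw_z L \<xi> \<eta>\<close> are bilinear; the first argument of \<open>dLw_zb L\<close> is a
  tangent vector in \<open>zbar\<close>, to be instantiated with a conjugate \<open>cnj_vec \<xi>\<close>.\<close>

definition dLw_zb :: "'n::finite cr_graph \<Rightarrow> complex ^ 'n \<Rightarrow> complex ^ 'n \<Rightarrow> complex" where
  "dLw_zb L \<zeta> \<eta> = (\<Sum>j\<in>UNIV. \<Sum>k\<in>UNIV.
     mcoeff (mderiv (Zbar j) (Lw L $ k)) (\<lambda>v. 0) * \<zeta> $ j * \<eta> $ k)"

definition dLw_z :: "'n::finite cr_graph \<Rightarrow> complex ^ 'n \<Rightarrow> complex ^ 'n \<Rightarrow> complex" where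
  "dLw_z L \<xi> \<eta> = (\<Sum>j\<in>UNIV. \<Sum>k\<in>UNIV.
     mcoeff (mderiv (Z j) (Lw L $ k)) (\<lambda>v. 0) * \<xi> $ j * \<eta> $ k)"

definition cnj_vec :: "complex ^ 'n \<Rightarrow> complex ^ 'n" where
  "cnj_vec \<xi> = (\<chi> j. cnj (\<xi> $ j))"

text \<open>\<open>levi L \<xi> \<eta>\<close> is the Levi form at the pair of \<open>\<xi>bar\<close> and \<open>\<eta>\<close>, thus antilinear in \<open>\<xi>\<close>.\<close>

definition levi :: "'n::finite cr_graph \<Rightarrow> complex ^ 'n \<Rightarrow> complex ^ 'n \<Rightarrow> complex" where
  "levi L \<xi> \<eta> = 1 / (2 * \<i>) * (dLw_zb L (cnj_vec \<xi>) \<eta> - cnj (dLw_zb L (cnj_vec \<eta>) \<xi>))"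

definition nonint_w :: "'n::finite cr_graph \<Rightarrow> complex ^ 'n \<Rightarrow> complex ^ 'n \<Rightarrow> complex" where
  "nonint_w L \<xi> \<eta> = dLw_z L \<xi> \<eta> - dLw_z L \<eta> \<xi>"

definition strongly_nondegenerate :: "'n::finite cr_graph \<Rightarrow> bool" where
  "strongly_nondegenerate L \<longleftrightarrow>
     (\<forall>\<xi>. (\<forall>\<eta>. levi L \<xi> \<eta> = 0) \<longrightarrow> \<xi> = 0) \<and>
     (\<forall>\<xi>. (\<forall>\<eta>. 6 * \<i> * levi L \<xi> \<eta> + nonint_w L \<xi> \<eta> = 0) \<longrightarrow> \<xi> = 0)"


section \<open>The normalization\<close>

definition levi_matrix :: "'n::finite cr_graph \<Rightarrow> complex ^ 'n ^ 'n" where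
  "levi_matrix L = (\<chi> j k. levi L (axis j 1) (axis k 1))"

text \<open>The entries of the transposed matrix in the inverse realize the index convention
  \<open>\<Sum>k. c\<^sup>j\<^sup>k * c\<^sub>l\<^sub>k = \<delta>\<^sub>j\<^sub>l\<close>.\<close>

definition levi_trace :: "'n::finite cr_graph \<Rightarrow> 'n ser \<Rightarrow> 'n ser" where
  "levi_trace L q = (\<Sum>j\<in>UNIV. \<Sum>k\<in>UNIV.
     mconst (matrix_inv (transpose (levi_matrix L)) $ j $ k) * mderiv (Zbar j) (mderiv (Z k) q))"

definition euler_field :: "'n::finite ser ^ 'n" where
  "euler_field = (\<chi> k. mvar (Z k))"

definition euler_zb :: "'n::finite cr_graph \<Rightarrow> 'n ser ^ 'n" where
  "euler_zb L = Lzb L *v euler_field"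

definition euler_w :: "'n::finite cr_graph \<Rightarrow> 'n ser" where
  "euler_w L = (\<Sum>k\<in>UNIV. Lw L $ k * euler_field $ k)"

definition normalized :: "'n::finite cr_graph \<Rightarrow> bool" where
  "normalized L \<longleftrightarrow> (\<forall>a b c.
     (\<forall>i. mhom (euler_zb L $ i) a b c = 0) \<and>
     mhom (euler_w L) a b c + ser_conj (mhom (euler_w L) b a c) = 0 \<and>
     mhom (euler_w L) 1 1 (c + 1) = 0 \<and>
     mhom (euler_w L) (a + 2) 1 c = 0 \<and>
     levi_trace L (mhom (euler_w L) 2 2 c) = 0 \<and>
     (levi_trace L ^^ 2) (mhom (euler_w L) 3 2 c) = 0 \<and>
     (levi_trace L ^^ 3) (mhom (euler_w L) 3 3 c) = 0)"

text \<open>\<open>f\<close> and the real series \<open>g\<close> have no constant and linear terms, \<open>g\<^sub>u\<^sub>u(0) = r\<close>, and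
  \<open>id + (f, g)\<close> transforms \<open>L\<close> into the normalized structure \<open>L'\<close>.\<close>

definition normalizes ::
  "'n::finite cr_graph \<Rightarrow> real \<Rightarrow> 'n ser ^ 'n \<Rightarrow> 'n ser \<Rightarrow> 'n cr_graph \<Rightarrow> bool" where
  "normalizes L r f g L' \<longleftrightarrow>
     (\<forall>i. vanishes_to_order 2 (f $ i)) \<and> vanishes_to_order 2 g \<and> ser_conj g = g \<and>
     deriv_at0 ((\<lambda>v. 0)(U := 2)) g = of_real r \<and>
     no_constant_term L' \<and> transforms L f g L' \<and> normalized L'"


section \<open>Universal polynomials in the derivatives of \<open>L\<close>\<close>

datatype 'n entry = EntZb 'n 'n | EntW 'n

primrec entry_of :: "'n::finite cr_graph \<Rightarrow> 'n entry \<Rightarrow> 'n ser" where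
  "entry_of L (EntZb i k) = Lzb L $ i $ k"
| "entry_of L (EntW k) = Lw L $ k"

text \<open>The indeterminates: the parameter \<open>r\<close>, the derivatives of the entries of \<open>L\<close> at \<open>0\<close> and their
  complex conjugates (equivalently, polynomials are taken in the real and imaginary parts of the
  derivatives).\<close>

datatype 'n jet = JetParam | JetDeriv "'n entry" "'n cvar \<Rightarrow> nat" | JetCnj "'n entry" "'n cvar \<Rightarrow> nat"

primrec jet_value :: "'n::finite cr_graph \<Rightarrow> real \<Rightarrow> 'n jet \<Rightarrow> complex" where
  "jet_value L r JetParam = of_real r"
| "jet_value L r (JetDeriv e \<alpha>) = deriv_at0 \<alpha> (entry_of L e)"
| "jet_value L r (JetCnj e \<alpha>) = cnj (deriv_at0 \<alpha> (entry_of L e))"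

text \<open>Polynomials with complex coefficients in indeterminates \<open>'x\<close> (each involving only finitely many
  of them), and their evaluation.\<close>

type_synonym 'x cpoly = "('x \<Rightarrow>\<^sub>0 nat) \<Rightarrow>\<^sub>0 complex"

definition poly_eval :: "'x cpoly \<Rightarrow> ('x \<Rightarrow> complex) \<Rightarrow> complex" where
  "poly_eval P x = (\<Sum>m\<in>Poly_Mapping.keys P. Poly_Mapping.lookup P m * (\<Prod>i\<in>Poly_Mapping.keys m. x i ^ Poly_Mapping.lookup m i))"

definition poly_vars :: "'x cpoly \<Rightarrow> 'x set" where
  "poly_vars P = (\<Union>m\<in>Poly_Mapping.keys P. Poly_Mapping.keys m)"

definition first_order_jets :: "'n::finite jet set" where
  "first_order_jets = {JetDeriv e \<alpha> | e \<alpha>. edeg \<alpha> = 1} \<union> {JetCnj e \<alpha> | e \<alpha>. edeg \<alpha> = 1}"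

text \<open>A quantity \<open>\<Phi>\<close> attached to the normalization is universal if it is the value of one polynomial
  in \<open>r\<close> and finitely many derivatives of \<open>L\<close>, the same for all \<open>L\<close> and \<open>r\<close>, up to a denominator
  \<open>Q\<close> which is a universal polynomial in the first order derivatives of \<open>L\<close> only and vanishes for
  no strongly nondegenerate \<open>L\<close>.  Thus for a prescribed linear part of \<open>L\<close>, in particular for a
  prescribed Levi form, the quantity is a polynomial in \<open>r\<close> and the derivatives of \<open>L\<close>.

  The denominator cannot be avoided: inverses of the Levi form and of the operator in the
  definition of strong nondegeneracy enter the normalization.  For \<open>n = 1\<close>, \<open>Lzb L = 0\<close> and
  \<open>Lw L = i c zbar + a z zbar\<close> with \<open>c\<close> real and nonzero one finds \<open>f\<^sub>z\<^sub>z(0) = a / (2 i c)\<close>.\<close>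

definition universal ::
  "(('n::finite) ser ^ 'n \<Rightarrow> 'n ser \<Rightarrow> 'n cr_graph \<Rightarrow> complex) \<Rightarrow> bool" where
  "universal \<Phi> \<longleftrightarrow> (\<exists>P Q :: 'n jet cpoly. poly_vars Q \<subseteq> first_order_jets \<and>
     (\<forall>L r. no_constant_term L \<longrightarrow> strongly_nondegenerate L \<longrightarrow>
        poly_eval Q (jet_value L r) \<noteq> 0 \<and>
        (\<forall>f g L'. normalizes L r f g L' \<longrightarrow>
           \<Phi> f g L' = poly_eval P (jet_value L r) / poly_eval Q (jet_value L r))))"

end

theory Submission
  imports Defs
begin

text \<open>Let \<open>X\<^sub>k\<close> be the frame of \<open>H\<^sup>1\<^sup>,\<^sup>0\<close> projecting to \<open>\<partial>/\<partial>z\<^sub>k\<close>.  The map \<open>h = (z + f, u + g)\<close>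
  transforms \<open>L\<close> into \<open>L'\<close> iff \<open>X\<^sub>k h\<^sub>u = \<Sum>i. (L'\<^sub>w\<^sub>,\<^sub>i \<circ> h) X\<^sub>k h\<^sub>i\<close> and likewise for the conjugate
  components of \<open>h\<close>, which makes \<open>L'\<close> a function of \<open>(f, g)\<close>.
  The terms of \<open>g\<close> quadratic in \<open>z\<close>, \<open>zbar\<close> are forced and reduce the linear part of \<open>L\<^sup>w\<close> to the
  sum of a skew form in \<open>z\<close> and the Levi form.  Give \<open>z\<close>, \<open>zbar\<close> the weight 1 and \<open>u\<close> the weight 2.
  Along the Euler field the lowest weight part of the equations is linear in \<open>(f, g)\<close>, with \<open>X\<close>
  replaced by \<open>D = e + i q \<partial>/\<partial>u\<close>, \<open>q\<close> the Levi polynomial.  Its tangential part \<open>D fbar = -p\<close>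
  leaves the components \<open>\<phi>\<^sub>a\<close> of \<open>f\<close> of bidegree \<open>(a, 0)\<close> free, and the vanishing of the real part of
  the transversal component determines \<open>g\<close> up to its component \<open>\<psi>\<close> of bidegree \<open>(0, 0)\<close>.  The other
  normalization conditions are then ordinary differential equations in \<open>u\<close> for \<open>\<psi>\<close> and \<open>\<phi>\<^sub>a\<close>, because
  the trace and the multiplication by \<open>q\<close> satisfy an \<open>sl\<^sub>2\<close> commutation relation; the second condition
  of strong nondegeneracy enters in the equation for \<open>\<phi>\<^sub>0\<close>.  The remaining terms of the full equation
  raise the weight, so the linear solution operator turns it into a contraction, whose
  iteration expresses each coefficient by finitely many operations in the ring of functions
  considered in \<open>universal\<close>.\<close>

section \<open>Calculus of formal power series\<close>

text \<open>The value of \<open>L'\<close> is taken at the shifted point, so \<open>L'\<close> is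
  carried along as a further unknown with a fixed point equation of its own; \<open>h\<close> is
  never inverted. The bidegrees in the normalization match the free data: the Levi pairing of
  \<open>\<phi>\<^sub>1\<close> with \<open>zbar\<close> enters at (2, 2) only through its real
  part, at (1, 1) and (3, 3) only through its imaginary part. Eliminating the latter leaves
  \<open>q^3\<close> times the third derivative of \<open>\<psi>\<close>, whence the three traces.
  Eliminating \<open>\<phi>\<^sub>2\<close> between (2, 1) and (3, 2) leaves the second derivative
  of the torsion pairing of \<open>\<phi>\<^sub>0\<close> plus three times the conjugate of its Levi
  pairing; as the torsion is halved, this is the origin of the factor \<open>6 i\<close>. The
  equations have order 3 for \<open>\<psi>\<close>, 2 for \<open>\<phi>\<^sub>0\<close>, 1 for
  \<open>\<phi>\<^sub>1\<close> and 0 for the rest. Without constant and linear terms the only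
  initial value left open is \<open>g\<^sub>u\<^sub>u(0)\<close>, which explains \<open>r\<close>.
  Each \<open>u\<close>-derivative costs weight 2, regained by \<open>q\<close> or by integration,
  so solving the linear problem loses no weight. One stability estimate then yields both uniqueness
  and the contraction.\<close>

declare zero_mps.rep_eq [simp] plus_mps.rep_eq [simp] minus_mps.rep_eq [simp] uminus_mps.rep_eq [simp]

lemma mcoeff_Abs_mps [simp]: "mcoeff (Abs_mps f) = f"
  by (simp add: Abs_mps_inverse)

lemma mcoeff_sum: "mcoeff (\<Sum>i\<in>A. f i) \<alpha> = (\<Sum>i\<in>A. mcoeff (f i :: 'v::finite mps) \<alpha>)"
  by (induction A rule: infinite_finite_induct) auto

lemma mcoeff_times:
  "mcoeff (p * q :: 'v::finite mps) \<alpha> = (\<Sum>x\<in>exp_splits \<alpha>. mcoeff p (fst x) * mcoeff q (snd x))"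
  by (simp add: times_mps.rep_eq case_prod_unfold)

lemma mcoeff_one: "mcoeff (1 :: 'v::finite mps) \<alpha> = (if \<alpha> = (\<lambda>v. 0) then 1 else 0)"
  by (simp add: one_mps.rep_eq)

lemma mcoeff_mconst: "mcoeff (mconst c) \<alpha> = (if \<alpha> = (\<lambda>v. 0) then c else 0)"
  by (simp add: mconst_def)

lemma mcoeff_mvar: "mcoeff (mvar v) \<alpha> = (if \<alpha> = (\<lambda>v. 0)(v := 1) then 1 else 0)"
  by (simp add: mvar_def)

lemma mcoeff_mderiv [simp]:
  "mcoeff (mderiv v q) \<alpha> = of_nat (Suc (\<alpha> v)) * mcoeff q (\<alpha>(v := Suc (\<alpha> v)))"
  by (simp add: mderiv_def)

lemma exp_splitsD: "x \<in> exp_splits \<alpha> \<Longrightarrow> fst x v + snd x v = \<alpha> v"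
  by (auto simp: exp_splits_def)

lemma exp_splits_snd:
  assumes "x \<in> exp_splits \<alpha>" shows "snd x = (\<lambda>v. \<alpha> v - fst x v)"
proof
  fix v show "snd x v = \<alpha> v - fst x v" using exp_splitsD[OF assms, of v] by simp
qed

lemma mcoeff_times_single:
  fixes p q :: "'v::finite mps"
  assumes "\<And>\<gamma>. \<gamma> \<noteq> \<beta> \<Longrightarrow> mcoeff p \<gamma> = 0"
  shows "mcoeff (p * q) \<alpha> = (if \<forall>v. \<beta> v \<le> \<alpha> v then mcoeff p \<beta> * mcoeff q (\<lambda>v. \<alpha> v - \<beta> v) else 0)"
proof (cases "\<forall>v. \<beta> v \<le> \<alpha> v")
  case True
  have "(\<Sum>x\<in>exp_splits \<alpha>. mcoeff p (fst x) * mcoeff q (snd x))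
      = (\<Sum>x\<in>{(\<beta>, \<lambda>v. \<alpha> v - \<beta> v)}. mcoeff p (fst x) * mcoeff q (snd x))"
  proof (rule sum.mono_neutral_right)
    show "\<forall>x\<in>exp_splits \<alpha> - {(\<beta>, \<lambda>v. \<alpha> v - \<beta> v)}. mcoeff p (fst x) * mcoeff q (snd x) = 0"
    proof
      fix x assume x: "x \<in> exp_splits \<alpha> - {(\<beta>, \<lambda>v. \<alpha> v - \<beta> v)}"
      have "fst x \<noteq> \<beta>"
      proof
        assume "fst x = \<beta>"
        moreover have "snd x = (\<lambda>v. \<alpha> v - fst x v)" using x by (intro exp_splits_snd) simp
        ultimately have "x = (\<beta>, \<lambda>v. \<alpha> v - \<beta> v)" by (intro prod_eqI) simp_all
        with x show False by simp
      qed
      then show "mcoeff p (fst x) * mcoeff q (snd x) = 0" using assms by simp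
    qed
    show "{(\<beta>, \<lambda>v. \<alpha> v - \<beta> v)} \<subseteq> exp_splits \<alpha>" using True by (simp add: exp_splits_def)
  qed simp
  then show ?thesis using True by (simp add: mcoeff_times)
next
  case False
  have "mcoeff (p * q) \<alpha> = 0"
    unfolding mcoeff_times
  proof (intro sum.neutral ballI)
    fix x assume x: "x \<in> exp_splits \<alpha>"
    from False obtain v where "\<not> \<beta> v \<le> \<alpha> v" by blast
    then have "fst x v \<noteq> \<beta> v" using exp_splitsD[OF x, of v] by linarith
    then have "fst x \<noteq> \<beta>" by auto
    then show "mcoeff p (fst x) * mcoeff q (snd x) = 0" using assms by simp
  qed
  then show ?thesis unfolding if_not_P[OF False] .
qed

lemma mcoeff_mconst_times [simp]:
  "mcoeff (mconst c * q :: 'v::finite mps) \<alpha> = c * mcoeff q \<alpha>"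
  by (subst mcoeff_times_single[where \<beta> = "\<lambda>_. 0"]) (simp_all add: mcoeff_mconst)

lemma mcoeff_mvar_times:
  "mcoeff (mvar v * q :: 'v::finite mps) \<alpha> = (if \<alpha> v = 0 then 0 else mcoeff q (\<alpha>(v := \<alpha> v - 1)))"
proof -
  have "(\<forall>w. ((\<lambda>v. 0)(v := 1)) w \<le> \<alpha> w) \<longleftrightarrow> \<alpha> v \<noteq> 0"
    by (simp add: Suc_le_eq)
  moreover have "(\<lambda>w. \<alpha> w - ((\<lambda>v. 0)(v := 1)) w) = \<alpha>(v := \<alpha> v - 1)" by (rule ext) simp
  ultimately show ?thesis
    by (subst mcoeff_times_single[where \<beta> = "(\<lambda>_. 0)(v := 1)"]) (simp_all add: mcoeff_mvar)
qed

lemma mconst_0 [simp]: "mconst 0 = (0 :: 'v::finite mps)"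
  by (rule mps_eqI) (simp add: mcoeff_mconst)

lemma mconst_1 [simp]: "mconst 1 = (1 :: 'v::finite mps)"
  by (rule mps_eqI) (simp add: mcoeff_mconst mcoeff_one)

lemma mconst_add: "mconst (a + b) = (mconst a + mconst b :: 'v::finite mps)"
  by (rule mps_eqI) (simp add: mcoeff_mconst)

lemma mconst_diff: "mconst (a - b) = (mconst a - mconst b :: 'v::finite mps)"
  by (rule mps_eqI) (simp add: mcoeff_mconst)

lemma mconst_minus: "mconst (- a) = (- mconst a :: 'v::finite mps)"
  by (rule mps_eqI) (simp add: mcoeff_mconst)

lemma mconst_mult: "mconst (a * b) = (mconst a * mconst b :: 'v::finite mps)"
  by (rule mps_eqI) (simp, simp add: mcoeff_mconst)

lemma mconst_sum: "mconst (\<Sum>i\<in>A. f i) = (\<Sum>i\<in>A. mconst (f i) :: 'v::finite mps)"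
  by (induction A rule: infinite_finite_induct) (auto simp: mconst_add)

lemma mconst_of_nat: "mconst (of_nat n) = (of_nat n :: 'v::finite mps)"
  by (induction n) (auto simp: mconst_add)

lemma mconst_numeral: "mconst (numeral n) = (numeral n :: 'v::finite mps)"
  using mconst_of_nat[of "numeral n"] by simp

lemma mderiv_0 [simp]: "mderiv v 0 = (0 :: 'v::finite mps)"
  by (rule mps_eqI) simp

lemma mderiv_add: "mderiv v (p + q :: 'v::finite mps) = mderiv v p + mderiv v q"
  by (rule mps_eqI) (simp add: algebra_simps)

lemma mderiv_diff: "mderiv v (p - q :: 'v::finite mps) = mderiv v p - mderiv v q"
  by (rule mps_eqI) (simp add: algebra_simps)

lemma mderiv_minus: "mderiv v (- q :: 'v::finite mps) = - mderiv v q"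
  by (rule mps_eqI) (simp add: algebra_simps)

lemma mderiv_sum: "mderiv v (\<Sum>i\<in>A. f i :: 'v::finite mps) = (\<Sum>i\<in>A. mderiv v (f i))"
  by (induction A rule: infinite_finite_induct) (auto simp: mderiv_add)

lemma mderiv_mconst [simp]: "mderiv v (mconst c) = (0 :: 'v::finite mps)"
  by (rule mps_eqI) (auto simp: mcoeff_mconst fun_eq_iff split: if_splits)

lemma mderiv_mvar: "mderiv v (mvar w) = (if v = w then 1 else 0 :: 'v::finite mps)"
proof (rule mps_eqI)
  fix \<alpha>
  have "\<alpha>(v := Suc (\<alpha> v)) = (\<lambda>v. 0)(w := 1) \<longleftrightarrow> v = w \<and> \<alpha> = (\<lambda>v. 0)"
    by (auto simp: fun_eq_iff split: if_splits)
  then show "mcoeff (mderiv v (mvar w)) \<alpha> = mcoeff (if v = w then 1 else 0) \<alpha>"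
    by (auto simp: mcoeff_mvar mcoeff_one)
qed

lemma mderiv_commute: "mderiv v (mderiv w q) = mderiv w (mderiv v (q :: 'v::finite mps))"
  by (cases "v = w") (auto intro!: mps_eqI simp: fun_upd_twist)

lemma mderiv_mvar_times:
  "mderiv v (mvar w * q) = mderiv v (mvar w) * q + mvar w * mderiv v (q :: 'v::finite mps)"
proof (rule mps_eqI)
  fix \<alpha>
  show "mcoeff (mderiv v (mvar w * q)) \<alpha> = mcoeff (mderiv v (mvar w) * q + mvar w * mderiv v q) \<alpha>"
  proof (cases "v = w")
    case True
    then show ?thesis
      by (auto simp: mderiv_mvar mcoeff_mvar_times distrib_right)
  next
    case False
    then show ?thesis
      by (auto simp: mderiv_mvar mcoeff_mvar_times fun_upd_twist)
  qed
qed

subsection \<open>Weights\<close>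

definition wdeg :: "('v::finite \<Rightarrow> nat) \<Rightarrow> ('v \<Rightarrow> nat) \<Rightarrow> nat" where
  "wdeg \<omega> \<alpha> = (\<Sum>v\<in>UNIV. \<omega> v * \<alpha> v)"

text \<open>The filtration by weighted order. The weight stays a parameter since several gradings of
  the same ring are in use: total degree, \<open>wt\<close> with \<open>u\<close> of weight 2, and
  the degree \<open>zwt\<close> plus \<open>zbwt\<close> that ignores \<open>u\<close>.\<close>

definition van :: "('v::finite \<Rightarrow> nat) \<Rightarrow> nat \<Rightarrow> 'v mps \<Rightarrow> bool" where
  "van \<omega> k q \<longleftrightarrow> (\<forall>\<alpha>. wdeg \<omega> \<alpha> < k \<longrightarrow> mcoeff q \<alpha> = 0)"

lemma edeg_eq_wdeg: "edeg \<alpha> = wdeg (\<lambda>_. 1) \<alpha>"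
  by (simp add: edeg_def wdeg_def)

lemma vanishes_to_order_eq_van: "vanishes_to_order k q \<longleftrightarrow> van (\<lambda>_. 1) k q"
  by (simp add: vanishes_to_order_def van_def edeg_eq_wdeg)

lemma wdeg_upd: "wdeg \<omega> (\<alpha>(v := n)) + \<omega> v * \<alpha> v = wdeg \<omega> \<alpha> + \<omega> v * n"
proof -
  have "wdeg \<omega> \<beta> = \<omega> v * \<beta> v + (\<Sum>w\<in>UNIV - {v}. \<omega> w * \<beta> w)" for \<beta>
    unfolding wdeg_def by (rule sum.remove) auto
  note this[of \<alpha>] this[of "\<alpha>(v := n)"]
  moreover have "(\<Sum>w\<in>UNIV - {v}. \<omega> w * (\<alpha>(v := n)) w) = (\<Sum>w\<in>UNIV - {v}. \<omega> w * \<alpha> w)"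
    by (rule sum.cong) auto
  ultimately show ?thesis by simp
qed

lemma wdeg_upd_Suc: "wdeg \<omega> (\<alpha>(v := Suc (\<alpha> v))) = wdeg \<omega> \<alpha> + \<omega> v"
  using wdeg_upd[of \<omega> \<alpha> v "Suc (\<alpha> v)"] by simp

lemma wdeg_upd_pred: "\<alpha> v \<noteq> 0 \<Longrightarrow> wdeg \<omega> (\<alpha>(v := \<alpha> v - 1)) + \<omega> v = wdeg \<omega> \<alpha>"
  using wdeg_upd_Suc[of \<omega> "\<alpha>(v := \<alpha> v - 1)" v] by simp

lemma wdeg_splits: "x \<in> exp_splits \<alpha> \<Longrightarrow> wdeg \<omega> (fst x) + wdeg \<omega> (snd x) = wdeg \<omega> \<alpha>"
  by (auto simp: exp_splits_def wdeg_def simp flip: sum.distrib distrib_left)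

lemma wdeg_0 [simp]: "wdeg \<omega> (\<lambda>v. 0) = 0"
  by (simp add: wdeg_def)

lemma wdeg_unit [simp]: "wdeg \<omega> ((\<lambda>v. 0)(v := n)) = \<omega> v * n"
  using wdeg_upd[of \<omega> "\<lambda>_. 0" v n] by simp

lemma van_0 [simp]: "van \<omega> k 0"
  by (simp add: van_def)

lemma van_zero_order [simp]: "van \<omega> 0 q"
  by (simp add: van_def)

lemma van_mono: "van \<omega> k q \<Longrightarrow> j \<le> k \<Longrightarrow> van \<omega> j q"
  by (auto simp: van_def)

lemma van_add: "van \<omega> k p \<Longrightarrow> van \<omega> k q \<Longrightarrow> van \<omega> k (p + q)"
  by (auto simp: van_def)

lemma van_diff: "van \<omega> k p \<Longrightarrow> van \<omega> k q \<Longrightarrow> van \<omega> k (p - q)"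
  by (auto simp: van_def)

lemma van_minus: "van \<omega> k p \<Longrightarrow> van \<omega> k (- p)"
  by (auto simp: van_def)

lemma van_sum: "(\<And>i. i \<in> A \<Longrightarrow> van \<omega> k (f i)) \<Longrightarrow> van \<omega> k (\<Sum>i\<in>A. f i)"
  by (auto simp: van_def mcoeff_sum intro: sum.neutral)

lemma van_mult: assumes "van \<omega> j p" "van \<omega> k q" shows "van \<omega> (j + k) (p * q)"
  unfolding van_def
proof (intro allI impI)
  fix \<alpha> assume a: "wdeg \<omega> \<alpha> < j + k"
  show "mcoeff (p * q) \<alpha> = 0"
    unfolding mcoeff_times
  proof (intro sum.neutral ballI)
    fix x assume "x \<in> exp_splits \<alpha>"
    from wdeg_splits[OF this, of \<omega>] a have "wdeg \<omega> (fst x) < j \<or> wdeg \<omega> (snd x) < k" by linarith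
    then show "mcoeff p (fst x) * mcoeff q (snd x) = 0" using assms by (auto simp: van_def)
  qed
qed

lemma van_mult': "van \<omega> j p \<Longrightarrow> van \<omega> k q \<Longrightarrow> i \<le> j + k \<Longrightarrow> van \<omega> i (p * q)"
  using van_mult van_mono by blast

lemma van_mvar: "j \<le> \<omega> v \<Longrightarrow> van \<omega> j (mvar v)"
  by (auto simp: van_def mcoeff_mvar)

lemma van_mderiv: "van \<omega> (k + \<omega> v) q \<Longrightarrow> van \<omega> k (mderiv v q)"
  by (auto simp: van_def wdeg_upd_Suc)

lemma van_all_eq_0: "(\<And>k. van \<omega> k q) \<Longrightarrow> q = (0 :: 'v::finite mps)"
  by (rule mps_eqI) (metis lessI van_def zero_mps.rep_eq)

lemma finite_edeg_le: "finite {\<beta> :: 'v::finite \<Rightarrow> nat. edeg \<beta> \<le> N}"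
proof (rule finite_subset)
  show "{\<beta> :: 'v \<Rightarrow> nat. edeg \<beta> \<le> N} \<subseteq> {\<beta>. \<forall>v. \<beta> v \<le> N}"
  proof clarify
    fix \<beta> :: "'v \<Rightarrow> nat" and v assume "edeg \<beta> \<le> N"
    moreover have "\<beta> v \<le> edeg \<beta>" unfolding edeg_def by (rule member_le_sum) auto
    ultimately show "\<beta> v \<le> N" by simp
  qed
qed (rule finite_exp_le)

definition mmono :: "('v \<Rightarrow> nat) \<Rightarrow> complex \<Rightarrow> 'v mps" where
  "mmono \<beta> c = Abs_mps (\<lambda>\<alpha>. if \<alpha> = \<beta> then c else 0)"

text \<open>By density of the polynomials, an identity between continuous additive operations needs
  to be checked only for products with a single variable.\<close>

lemma mps_density:
  fixes \<Delta> :: "'v::finite mps \<Rightarrow> 'w::finite mps"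
  assumes add: "\<And>p q. \<Delta> (p + q) = \<Delta> p + \<Delta> q"
    and cont: "\<And>k q. van (\<lambda>_. 1) (k + N) q \<Longrightarrow> van (\<lambda>_. 1) k (\<Delta> q)"
    and const: "\<And>c. \<Delta> (mconst c) = 0"
    and step: "\<And>v q. \<Delta> q = 0 \<Longrightarrow> \<Delta> (mvar v * q) = 0"
  shows "\<Delta> q = 0"
proof -
  have \<Delta>0: "\<Delta> 0 = 0" using const[of 0] by simp
  have \<Delta>sum: "\<Delta> (\<Sum>i\<in>A. f i) = (\<Sum>i\<in>A. \<Delta> (f i))" for A and f :: "('v \<Rightarrow> nat) \<Rightarrow> 'v mps"
    by (induction A rule: infinite_finite_induct) (auto simp: \<Delta>0 add)
  have \<Delta>mono: "\<Delta> (mmono \<beta> c) = 0" for \<beta> c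
  proof (induction "edeg \<beta>" arbitrary: \<beta>)
    case 0
    then have "\<beta> = (\<lambda>_. 0)" by (auto simp: edeg_def)
    then have "mmono \<beta> c = mconst c" by (simp add: mmono_def mconst_def)
    then show ?case by (simp add: const)
  next
    case (Suc n)
    have "\<not> (\<forall>v. \<beta> v = 0)"
    proof
      assume "\<forall>v. \<beta> v = 0"
      then have "edeg \<beta> = 0" by (simp add: edeg_def)
      with Suc(2) show False by simp
    qed
    then obtain v where v: "\<beta> v \<noteq> 0" by blast
    let ?\<beta> = "\<beta>(v := \<beta> v - 1)"
    have "edeg ?\<beta> = n" using wdeg_upd_pred[of \<beta> v "\<lambda>_. 1"] v Suc(2) by (simp add: edeg_eq_wdeg)
    then have "\<Delta> (mmono ?\<beta> c) = 0" using Suc(1) by metis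
    moreover have "mmono \<beta> c = mvar v * mmono ?\<beta> c"
    proof (rule mps_eqI)
      fix \<alpha> :: "'v \<Rightarrow> nat"
      have "\<alpha>(v := \<alpha> v - 1) = ?\<beta> \<longleftrightarrow> \<alpha> = \<beta>" if "\<alpha> v \<noteq> 0"
      proof
        assume eq: "\<alpha>(v := \<alpha> v - 1) = ?\<beta>"
        have "\<alpha> w = \<beta> w" for w
          using fun_cong[OF eq, of w] fun_cong[OF eq, of v] v that by (cases "w = v") simp_all
        then show "\<alpha> = \<beta>" by (rule ext)
      qed simp
      then show "mcoeff (mmono \<beta> c) \<alpha> = mcoeff (mvar v * mmono ?\<beta> c) \<alpha>"
        using v by (auto simp: mcoeff_mvar_times mmono_def)
    qed
    ultimately show ?case using step by metis
  qed
  have "van (\<lambda>_. 1) k (\<Delta> q)" for k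
  proof -
    \<comment> \<open>\<open>t\<close> is a Taylor polynomial of \<open>q\<close>. It is annihilated
      by \<open>\<Delta>\<close>, and the remainder has so high an order that its image has order
      \<open>k\<close> even though \<open>\<Delta>\<close> may lose \<open>N\<close> orders.\<close>
    define t where "t = (\<Sum>\<beta>|edeg \<beta> \<le> k + N. mmono \<beta> (mcoeff q \<beta>))"
    have "mcoeff t \<alpha> = (if edeg \<alpha> \<le> k + N then mcoeff q \<alpha> else 0)" for \<alpha>
      by (simp add: t_def mcoeff_sum mmono_def finite_edeg_le)
    then have "van (\<lambda>_. 1) (k + N) (q - t)" by (auto simp: van_def edeg_eq_wdeg)
    then have "van (\<lambda>_. 1) k (\<Delta> (q - t))" by (rule cont)
    moreover have "\<Delta> t = 0" by (simp add: t_def \<Delta>sum \<Delta>mono)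
    moreover have "\<Delta> q = \<Delta> (q - t) + \<Delta> t" using add[of "q - t" t] by simp
    ultimately show ?thesis by simp
  qed
  then show ?thesis by (rule van_all_eq_0)
qed

lemma mderiv_mult: "mderiv v (p * q :: 'v::finite mps) = mderiv v p * q + p * mderiv v q"
proof -
  define \<Delta> where "\<Delta> p = mderiv v (p * q) - mderiv v p * q - p * mderiv v q" for p :: "'v mps"
  have "\<Delta> p = 0"
  proof (rule mps_density[where N = 1 and \<Delta> = \<Delta>])
    show "\<Delta> (p + p') = \<Delta> p + \<Delta> p'" for p p' by (simp add: \<Delta>_def mderiv_add algebra_simps)
    show "van (\<lambda>_. 1) k (\<Delta> p)" if "van (\<lambda>_. 1) (k + 1) p" for k p
    proof -
      have "van (\<lambda>_. 1) k (mderiv v (p * q))"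
        by (intro van_mderiv van_mult'[OF that van_zero_order]) simp
      moreover have "van (\<lambda>_. 1) k (mderiv v p * q)"
        using that by (intro van_mult'[where j = k and k = 0] van_mderiv) auto
      moreover have "van (\<lambda>_. 1) k (p * mderiv v q)"
        by (rule van_mult'[OF that van_zero_order]) simp
      ultimately show ?thesis by (auto simp: \<Delta>_def intro: van_diff)
    qed
    show "\<Delta> (mconst c) = 0" for c
      unfolding \<Delta>_def mderiv_mconst
      by (rule mps_eqI) (simp only: minus_mps.rep_eq zero_mps.rep_eq mcoeff_mderiv mcoeff_mconst_times mult_zero_left, simp)
    show "\<Delta> (mvar w * p) = 0" if "\<Delta> p = 0" for w p
    proof -
      have "mderiv v (p * q) = mderiv v p * q + p * mderiv v q"
        using that unfolding \<Delta>_def by (simp add: diff_eq_eq add.commute)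
      then show ?thesis
        unfolding \<Delta>_def mult.assoc mderiv_mvar_times[of v w]
        by (simp only: distrib_left distrib_right mult.assoc) simp
    qed
  qed
  then show ?thesis by (simp add: \<Delta>_def algebra_simps)
qed

subsection \<open>Substitution\<close>

definition spow :: "('v::finite \<Rightarrow> 'w::finite mps) \<Rightarrow> ('v \<Rightarrow> nat) \<Rightarrow> 'w mps" where
  "spow \<sigma> \<beta> = (\<Prod>v\<in>UNIV. \<sigma> v ^ \<beta> v)"

lemma van_pow: "van \<omega> k q \<Longrightarrow> van \<omega> (k * n) (q ^ n)"
  by (induction n) (auto intro!: van_mult)

lemma van_prod: "(\<And>i. i \<in> A \<Longrightarrow> van \<omega> (k i) (f i)) \<Longrightarrow> van \<omega> (\<Sum>i\<in>A. k i) (\<Prod>i\<in>A. f i)"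
  by (induction A rule: infinite_finite_induct) (auto intro!: van_mult)

text \<open>Induction step for powers and products: agreement up to \<open>d\<close> beyond the
  guaranteed order survives multiplication, so two substitutions can be compared monomial by
  monomial.\<close>

lemma van_mult_diff:
  assumes "van \<omega> j p" "van \<omega> j p'" "van \<omega> k q" "van \<omega> k q'"
    and "van \<omega> (j + d) (p - p')" "van \<omega> (k + d) (q - q')"
  shows "van \<omega> (j + k + d) (p * q - p' * q')"
proof -
  have "p * q - p' * q' = (p - p') * q + p' * (q - q')" by (simp add: algebra_simps)
  moreover have "van \<omega> (j + k + d) ((p - p') * q)"
    by (rule van_mult'[OF assms(5,3)]) simp
  moreover have "van \<omega> (j + k + d) (p' * (q - q'))"
    by (rule van_mult'[OF assms(2,6)]) simp
  ultimately show ?thesis by (simp add: van_add)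
qed

lemma van_pow_diff:
  assumes "van \<omega> k p" "van \<omega> k q" "van \<omega> (k + d) (p - q)"
  shows "van \<omega> (k * n + d) (p ^ n - q ^ n)"
proof (induction n)
  case (Suc n)
  have "van \<omega> (k + k * n + d) (p * p ^ n - q * q ^ n)"
    using assms Suc by (intro van_mult_diff van_pow) auto
  then show ?case by (simp add: algebra_simps)
qed auto

lemma van_prod_diff:
  assumes "\<And>i. i \<in> A \<Longrightarrow> van \<omega> (k i) (f i)" "\<And>i. i \<in> A \<Longrightarrow> van \<omega> (k i) (g i)"
    "\<And>i. i \<in> A \<Longrightarrow> van \<omega> (k i + d) (f i - g i)"
  shows "van \<omega> ((\<Sum>i\<in>A. k i) + d) ((\<Prod>i\<in>A. f i) - (\<Prod>i\<in>A. g i))"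
  using assms
  by (induction A rule: infinite_finite_induct) (auto intro!: van_mult_diff van_prod)

lemma van_spow: "(\<And>v. van \<omega>' (\<omega> v) (\<sigma> v)) \<Longrightarrow> van \<omega>' (wdeg \<omega> \<beta>) (spow \<sigma> \<beta>)"
  unfolding spow_def wdeg_def by (intro van_prod van_pow) auto

lemma van_spow_diff:
  "(\<And>v. van \<omega>' (\<omega> v) (\<sigma> v)) \<Longrightarrow> (\<And>v. van \<omega>' (\<omega> v) (\<tau> v)) \<Longrightarrow> (\<And>v. van \<omega>' (\<omega> v + d) (\<sigma> v - \<tau> v)) \<Longrightarrow>
    van \<omega>' (wdeg \<omega> \<beta> + d) (spow \<sigma> \<beta> - spow \<tau> \<beta>)"
  unfolding spow_def wdeg_def by (intro van_prod_diff van_pow van_pow_diff) auto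

lemma spow_upd_Suc: "spow \<sigma> (\<beta>(v := Suc (\<beta> v))) = \<sigma> v * spow \<sigma> \<beta>"
proof -
  have "spow \<sigma> \<gamma> = \<sigma> v ^ \<gamma> v * (\<Prod>w\<in>UNIV - {v}. \<sigma> w ^ \<gamma> w)" for \<gamma>
    unfolding spow_def by (rule prod.remove) auto
  note this[of \<beta>] this[of "\<beta>(v := Suc (\<beta> v))"]
  moreover have "(\<Prod>w\<in>UNIV - {v}. \<sigma> w ^ (\<beta>(v := Suc (\<beta> v))) w) = (\<Prod>w\<in>UNIV - {v}. \<sigma> w ^ \<beta> w)"
    by (rule prod.cong) auto
  ultimately show ?thesis by (simp add: mult.assoc)
qed

lemma mcoeff_msubst: "mcoeff (msubst q \<sigma>) \<alpha> = (\<Sum>\<beta>|edeg \<beta> \<le> edeg \<alpha>. mcoeff q \<beta> * mcoeff (spow \<sigma> \<beta>) \<alpha>)"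
  by (simp add: msubst_def spow_def)

text \<open>Monomials of higher degree contribute nothing, so the truncation bound in
  \<open>msubst\<close> may be raised. Sums belonging to different exponents can then be given one
  common range.\<close>

lemma mcoeff_msubst_le:
  assumes "\<And>v. van (\<lambda>_. 1) 1 (\<sigma> v)" "edeg \<alpha> \<le> N"
  shows "mcoeff (msubst q \<sigma>) \<alpha> = (\<Sum>\<beta>|edeg \<beta> \<le> N. mcoeff q \<beta> * mcoeff (spow \<sigma> \<beta>) \<alpha>)"
  unfolding mcoeff_msubst
proof (rule sum.mono_neutral_left)
  show "\<forall>\<beta>\<in>{\<beta>. edeg \<beta> \<le> N} - {\<beta>. edeg \<beta> \<le> edeg \<alpha>}. mcoeff q \<beta> * mcoeff (spow \<sigma> \<beta>) \<alpha> = 0"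
    using van_spow[of "\<lambda>_. 1" "\<lambda>_. 1" \<sigma>] assms(1) by (auto simp: van_def edeg_eq_wdeg)
qed (use assms(2) finite_edeg_le in auto)

lemma msubst_add: "msubst (p + q) \<sigma> = msubst p \<sigma> + msubst q \<sigma>"
  by (rule mps_eqI) (simp add: mcoeff_msubst algebra_simps sum.distrib)

lemma msubst_diff: "msubst (p - q) \<sigma> = msubst p \<sigma> - msubst q \<sigma>"
  by (rule mps_eqI) (simp add: mcoeff_msubst algebra_simps sum_subtractf)

lemma msubst_0 [simp]: "msubst 0 \<sigma> = 0"
  by (rule mps_eqI) (simp add: mcoeff_msubst)

lemma msubst_sum: "msubst (\<Sum>i\<in>A. f i) \<sigma> = (\<Sum>i\<in>A. msubst (f i) \<sigma>)"
  by (induction A rule: infinite_finite_induct) (auto simp: msubst_add)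

lemma msubst_mconst_times: "msubst (mconst c * q) \<sigma> = mconst c * msubst q \<sigma>"
  by (rule mps_eqI) (simp add: mcoeff_msubst sum_distrib_left mult.assoc)

lemma msubst_mconst [simp]: "msubst (mconst c) \<sigma> = mconst c"
proof (rule mps_eqI)
  fix \<alpha>
  have "(\<Sum>\<beta>|edeg \<beta> \<le> edeg \<alpha>. mcoeff (mconst c) \<beta> * mcoeff (spow \<sigma> \<beta>) \<alpha>) 
      = (\<Sum>\<beta>\<in>{\<lambda>_. 0}. mcoeff (mconst c) \<beta> * mcoeff (spow \<sigma> \<beta>) \<alpha>)"
    by (rule sum.mono_neutral_right) (auto simp: finite_edeg_le mcoeff_mconst, simp add: edeg_eq_wdeg)
  then show "mcoeff (msubst (mconst c) \<sigma>) \<alpha> = mcoeff (mconst c) \<alpha>"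
    by (simp add: mcoeff_msubst mcoeff_mconst spow_def mcoeff_one)
qed

lemma msubst_1 [simp]: "msubst 1 \<sigma> = 1"
  using msubst_mconst[of 1 \<sigma>] by simp

lemma van_msubst:
  assumes "van \<omega> k q" "\<And>v. van \<omega> (\<omega> v) (\<sigma> v)" shows "van \<omega> k (msubst q \<sigma>)"
  unfolding van_def mcoeff_msubst
proof (intro allI impI sum.neutral ballI)
  fix \<alpha> \<beta> assume "wdeg \<omega> \<alpha> < k"
  then show "mcoeff q \<beta> * mcoeff (spow \<sigma> \<beta>) \<alpha> = 0"
    using van_spow[of \<omega> \<omega> \<sigma> \<beta>] assms by (cases "wdeg \<omega> \<beta> < k") (auto simp: van_def)
qed

text \<open>Serves twice: with \<open>\<tau>\<close> equal to \<open>mvar\<close> it says that a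
  substitution close to the identity changes a series only in higher weight, and with two coordinate
  changes it is the Lipschitz estimate behind the contraction.\<close>

lemma van_msubst_diff:
  assumes "van \<omega> k q" "\<And>v. van \<omega> (\<omega> v) (\<sigma> v)" "\<And>v. van \<omega> (\<omega> v) (\<tau> v)"
    "\<And>v. van \<omega> (\<omega> v + d) (\<sigma> v - \<tau> v)"
  shows "van \<omega> (k + d) (msubst q \<sigma> - msubst q \<tau>)"
proof -
  have eq: "mcoeff (msubst q \<sigma> - msubst q \<tau>) \<alpha>
      = (\<Sum>\<beta>|edeg \<beta> \<le> edeg \<alpha>. mcoeff q \<beta> * mcoeff (spow \<sigma> \<beta> - spow \<tau> \<beta>) \<alpha>)" for \<alpha>
    by (simp add: mcoeff_msubst right_diff_distrib sum_subtractf)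
  show ?thesis
    unfolding van_def eq
  proof (intro allI impI sum.neutral ballI)
    fix \<alpha> \<beta> assume "wdeg \<omega> \<alpha> < k + d"
    moreover have "van \<omega> (wdeg \<omega> \<beta> + d) (spow \<sigma> \<beta> - spow \<tau> \<beta>)"
      using assms by (intro van_spow_diff)
    moreover have "wdeg \<omega> \<beta> < k \<or> k + d \<le> wdeg \<omega> \<beta> + d" by linarith
    ultimately have "mcoeff q \<beta> = 0 \<or> mcoeff (spow \<sigma> \<beta> - spow \<tau> \<beta>) \<alpha> = 0"
      using assms(1) unfolding van_def by (meson less_le_trans)
    then show "mcoeff q \<beta> * mcoeff (spow \<sigma> \<beta> - spow \<tau> \<beta>) \<alpha> = 0"
      by (simp only: mult_eq_0_iff)
  qed
qed

lemma msubst_mvar_times: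
  fixes \<sigma> :: "'v::finite \<Rightarrow> 'v mps"
  assumes \<sigma>: "\<And>v. van (\<lambda>_. 1) 1 (\<sigma> v)"
  shows "msubst (mvar v * q) \<sigma> = \<sigma> v * msubst q \<sigma>"
proof (rule mps_eqI)
  fix \<alpha> :: "'v \<Rightarrow> nat"
  let ?N = "edeg \<alpha>"
  have "mcoeff (\<sigma> v * msubst q \<sigma>) \<alpha>
      = (\<Sum>x\<in>exp_splits \<alpha>. mcoeff (\<sigma> v) (fst x) * (\<Sum>\<beta>|edeg \<beta> \<le> ?N. mcoeff q \<beta> * mcoeff (spow \<sigma> \<beta>) (snd x)))"
    unfolding mcoeff_times
  proof (rule sum.cong)
    fix x assume "x \<in> exp_splits \<alpha>"
    then have "edeg (snd x) \<le> ?N" using wdeg_splits[of x \<alpha> "\<lambda>_. 1"] by (simp add: edeg_eq_wdeg)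
    then show "mcoeff (\<sigma> v) (fst x) * mcoeff (msubst q \<sigma>) (snd x) =
        mcoeff (\<sigma> v) (fst x) * (\<Sum>\<beta>|edeg \<beta> \<le> ?N. mcoeff q \<beta> * mcoeff (spow \<sigma> \<beta>) (snd x))"
      by (simp add: mcoeff_msubst_le[where \<sigma> = \<sigma>, OF \<sigma>])
  qed simp
  also have "\<dots> = (\<Sum>\<beta>|edeg \<beta> \<le> ?N. mcoeff q \<beta> * mcoeff (\<sigma> v * spow \<sigma> \<beta>) \<alpha>)"
    unfolding mcoeff_times sum_distrib_left
    by (subst sum.swap) (simp add: algebra_simps)
  \<comment> \<open>Multiplication by \<open>\<sigma> v\<close> raises the exponent of
    \<open>v\<close> by one. The exponents reached have total degree up to \<open>Suc ?N\<close>,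
    which the enlarged truncation permits.\<close>
  also have "\<dots> = (\<Sum>\<beta>|edeg \<beta> \<le> Suc ?N \<and> \<beta> v \<noteq> 0. mcoeff q (\<beta>(v := \<beta> v - 1)) * mcoeff (spow \<sigma> \<beta>) \<alpha>)"
  proof (rule sum.reindex_bij_witness[where i = "\<lambda>\<beta>. \<beta>(v := \<beta> v - 1)" and j = "\<lambda>\<beta>. \<beta>(v := Suc (\<beta> v))"])
    fix \<beta> :: "'v \<Rightarrow> nat" assume "\<beta> \<in> {\<beta>. edeg \<beta> \<le> Suc ?N \<and> \<beta> v \<noteq> 0}"
    then show "\<beta>(v := \<beta> v - 1) \<in> {\<beta>. edeg \<beta> \<le> edeg \<alpha>}"
      using wdeg_upd_pred[of \<beta> v "\<lambda>_. 1"] by (auto simp: edeg_eq_wdeg)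
  next
    fix \<beta> :: "'v \<Rightarrow> nat" assume "\<beta> \<in> {\<beta>. edeg \<beta> \<le> ?N}"
    then show "\<beta>(v := Suc (\<beta> v)) \<in> {\<beta>. edeg \<beta> \<le> Suc (edeg \<alpha>) \<and> \<beta> v \<noteq> 0}"
      using wdeg_upd_Suc[of "\<lambda>_. 1" \<beta> v] by (auto simp: edeg_eq_wdeg)
  qed (auto simp: spow_upd_Suc)
  also have "\<dots> = (\<Sum>\<beta>|edeg \<beta> \<le> Suc ?N. mcoeff (mvar v * q) \<beta> * mcoeff (spow \<sigma> \<beta>) \<alpha>)"
    by (rule sum.mono_neutral_cong_left) (auto simp: finite_edeg_le mcoeff_mvar_times)
  also have "\<dots> = mcoeff (msubst (mvar v * q) \<sigma>) \<alpha>"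
    by (rule mcoeff_msubst_le[where \<sigma> = \<sigma>, OF \<sigma>, symmetric]) simp
  finally show "mcoeff (msubst (mvar v * q) \<sigma>) \<alpha> = mcoeff (\<sigma> v * msubst q \<sigma>) \<alpha>" by simp
qed

lemma msubst_mvar:
  fixes \<sigma> :: "'v::finite \<Rightarrow> 'v mps"
  assumes "\<And>v. van (\<lambda>_. 1) 1 (\<sigma> v)"
  shows "msubst (mvar v) \<sigma> = \<sigma> v"
  using msubst_mvar_times[where \<sigma> = \<sigma> and v = v and q = 1, OF assms] by simp

lemma van_order_msubst:
  "van (\<lambda>_. 1) k q \<Longrightarrow> (\<And>v. van (\<lambda>_. 1) 1 (\<sigma> v)) \<Longrightarrow> van (\<lambda>_. 1) k (msubst q \<sigma>)"
  by (rule van_msubst) auto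

lemma msubst_mult:
  fixes \<sigma> :: "'v::finite \<Rightarrow> 'v mps"
  assumes \<sigma>: "\<And>v. van (\<lambda>_. 1) 1 (\<sigma> v)"
  shows "msubst (p * q) \<sigma> = msubst p \<sigma> * msubst q \<sigma>"
proof -
  define \<Delta> where "\<Delta> p = msubst (p * q) \<sigma> - msubst p \<sigma> * msubst q \<sigma>" for p
  have "\<Delta> p = 0"
  proof (rule mps_density[where N = 0 and \<Delta> = \<Delta>])
    show "\<Delta> (p + p') = \<Delta> p + \<Delta> p'" for p p' by (simp add: \<Delta>_def msubst_add algebra_simps)
    show "van (\<lambda>_. 1) k (\<Delta> p)" if "van (\<lambda>_. 1) (k + 0) p" for k p
      unfolding \<Delta>_def using that
      by (intro van_diff van_order_msubst van_mult'[where j = k and k = 0] \<sigma>) auto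
    show "\<Delta> (mconst c) = 0" for c by (simp add: \<Delta>_def msubst_mconst_times)
    show "\<Delta> (mvar w * p) = 0" if "\<Delta> p = 0" for w p
      using that by (simp add: \<Delta>_def mult.assoc msubst_mvar_times[where \<sigma> = \<sigma>, OF \<sigma>] flip: right_diff_distrib)
  qed
  then show ?thesis by (simp add: \<Delta>_def)
qed

lemma msubst_mvar_id: "msubst q mvar = (q :: 'v::finite mps)"
proof -
  have 1: "van (\<lambda>_. 1) 1 (mvar v)" for v :: 'v by (rule van_mvar) simp
  have "msubst q mvar - q = 0"
  proof (rule mps_density[where N = 0 and \<Delta> = "\<lambda>q. msubst q mvar - q"])
    show "van (\<lambda>_. 1) k (msubst p mvar - p)" if "van (\<lambda>_. 1) (k + 0) p" for k and p :: "'v mps"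
      using that by (intro van_diff van_order_msubst 1) auto
    show "msubst (mvar v * p) mvar - mvar v * p = 0" if "msubst p mvar - p = 0" for v and p :: "'v mps"
      using that by (simp only: msubst_mvar_times[where \<sigma> = mvar, OF 1] right_minus_eq)
  qed (simp_all add: msubst_add)
  then show ?thesis by simp
qed

lemma msubst_msubst:
  fixes \<sigma> :: "'v::finite \<Rightarrow> 'v mps"
  assumes \<sigma>: "\<And>v. van (\<lambda>_. 1) 1 (\<sigma> v)" and \<tau>: "\<And>v. van (\<lambda>_. 1) 1 (\<tau> v)"
  shows "msubst (msubst q \<sigma>) \<tau> = msubst q (\<lambda>v. msubst (\<sigma> v) \<tau>)"
proof -
  have \<sigma>\<tau>: "\<And>v. van (\<lambda>_. 1) 1 (msubst (\<sigma> v) \<tau>)" by (intro van_order_msubst \<sigma> \<tau>)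
  have "msubst (msubst q \<sigma>) \<tau> - msubst q (\<lambda>v. msubst (\<sigma> v) \<tau>) = 0"
  proof (rule mps_density[where N = 0 and \<Delta> = "\<lambda>q. msubst (msubst q \<sigma>) \<tau> - msubst q (\<lambda>v. msubst (\<sigma> v) \<tau>)"])
    show "van (\<lambda>_. 1) k (msubst (msubst p \<sigma>) \<tau> - msubst p (\<lambda>v. msubst (\<sigma> v) \<tau>))" if "van (\<lambda>_. 1) (k + 0) p" for k p
      using that by (intro van_diff van_order_msubst \<sigma> \<tau>) auto
    show "msubst (msubst (mvar v * p) \<sigma>) \<tau> - msubst (mvar v * p) (\<lambda>v. msubst (\<sigma> v) \<tau>) = 0"
      if "msubst (msubst p \<sigma>) \<tau> - msubst p (\<lambda>v. msubst (\<sigma> v) \<tau>) = 0" for v p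
      using that by (simp only: msubst_mvar_times[where \<sigma> = \<sigma>, OF \<sigma>] msubst_mult[where \<sigma> = \<tau>, OF \<tau>] msubst_mvar_times[where \<sigma> = "\<lambda>v. msubst (\<sigma> v) \<tau>", OF \<sigma>\<tau>] right_minus_eq)
  qed (simp_all add: msubst_add)
  then show ?thesis by simp
qed

definition vfield :: "('v::finite \<Rightarrow> 'v mps) \<Rightarrow> 'v mps \<Rightarrow> 'v mps" where
  "vfield \<xi> q = (\<Sum>w\<in>UNIV. \<xi> w * mderiv w q)"

lemma vfield_add: "vfield \<xi> (p + q) = vfield \<xi> p + vfield \<xi> q"
  by (simp add: vfield_def mderiv_add algebra_simps sum.distrib)

lemma vfield_diff: "vfield \<xi> (p - q) = vfield \<xi> p - vfield \<xi> q"
  by (simp add: vfield_def mderiv_diff algebra_simps sum_subtractf)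

lemma vfield_mult: "vfield \<xi> (p * q) = vfield \<xi> p * q + p * vfield \<xi> q"
  by (simp add: vfield_def mderiv_mult algebra_simps sum.distrib sum_distrib_left)

lemma vfield_mconst [simp]: "vfield \<xi> (mconst c) = 0"
  by (simp add: vfield_def)

lemma vfield_mvar [simp]: "vfield \<xi> (mvar v) = \<xi> v"
  by (simp add: vfield_def mderiv_mvar if_distrib cong: if_cong)

text \<open>\<open>a w\<close> is the guaranteed weight of the coefficient of the derivation in
  \<open>w\<close>: each summand loses \<open>\<omega> w\<close> and gains \<open>a w\<close>. The
  condition is additive because subtraction of naturals truncates.\<close>

lemma van_vfield: 
  assumes "van \<omega> k q" "\<And>w. van \<omega> (a w) (\<xi> w)" "\<And>w. j + \<omega> w \<le> k + a w"
  shows "van \<omega> j (vfield \<xi> q)"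
  unfolding vfield_def
proof (rule van_sum)
  fix w
  have "van \<omega> (k - \<omega> w) (mderiv w q)"
  proof (cases "\<omega> w \<le> k")
    case True
    then show ?thesis using assms(1) by (intro van_mderiv) auto
  qed auto
  then show "van \<omega> j (\<xi> w * mderiv w q)"
    using assms(2)[of w] assms(3)[of w] by (intro van_mult'[where j = "a w" and k = "k - \<omega> w"]) auto
qed

lemma vfield_msubst:
  fixes \<sigma> :: "'v::finite \<Rightarrow> 'v mps"
  assumes \<sigma>: "\<And>v. van (\<lambda>_. 1) 1 (\<sigma> v)"
  shows "vfield \<xi> (msubst q \<sigma>) = (\<Sum>w\<in>UNIV. msubst (mderiv w q) \<sigma> * vfield \<xi> (\<sigma> w))"
proof -
  define \<Delta> where "\<Delta> q = vfield \<xi> (msubst q \<sigma>) - (\<Sum>w\<in>UNIV. msubst (mderiv w q) \<sigma> * vfield \<xi> (\<sigma> w))" for q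
  have "\<Delta> q = 0"
  proof (rule mps_density[where N = 1 and \<Delta> = \<Delta>])
    show "\<Delta> (p + p') = \<Delta> p + \<Delta> p'" for p p'
      by (simp add: \<Delta>_def msubst_add mderiv_add vfield_add algebra_simps sum.distrib)
    show "van (\<lambda>_. 1) k (\<Delta> p)" if p: "van (\<lambda>_. 1) (k + 1) p" for k p
    proof -
      have "van (\<lambda>_. 1) k (vfield \<xi> (msubst p \<sigma>))"
        by (rule van_vfield[where a = "\<lambda>_. 0", OF van_order_msubst[where \<sigma> = \<sigma>, OF p \<sigma>]]) auto
      moreover have "van (\<lambda>_. 1) k (msubst (mderiv w p) \<sigma> * vfield \<xi> (\<sigma> w))" for w
        using p by (intro van_mult'[where j = k and k = 0] van_order_msubst \<sigma> van_mderiv) auto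
      ultimately show ?thesis unfolding \<Delta>_def by (intro van_diff van_sum)
    qed
    show "\<Delta> (mconst c) = 0" for c by (simp add: \<Delta>_def)
    show "\<Delta> (mvar v * p) = 0" if "\<Delta> p = 0" for v p
    proof -
      have "(\<Sum>w\<in>UNIV. msubst (mderiv w (mvar v * p)) \<sigma> * vfield \<xi> (\<sigma> w))
          = (\<Sum>w\<in>UNIV. (if w = v then msubst p \<sigma> * vfield \<xi> (\<sigma> v) else 0)
              + \<sigma> v * (msubst (mderiv w p) \<sigma> * vfield \<xi> (\<sigma> w)))"
        by (rule sum.cong)
          (auto simp: mderiv_mult mderiv_mvar msubst_add msubst_mvar_times[where \<sigma> = \<sigma>, OF \<sigma>] algebra_simps)
      also have "\<dots> = msubst p \<sigma> * vfield \<xi> (\<sigma> v) + \<sigma> v * vfield \<xi> (msubst p \<sigma>)"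
        using that by (simp add: sum.distrib \<Delta>_def flip: sum_distrib_left)
      finally show ?thesis
        unfolding \<Delta>_def msubst_mvar_times[where \<sigma> = \<sigma>, OF \<sigma>] vfield_mult by (simp add: mult.commute)
    qed
  qed
  then show ?thesis by (simp add: \<Delta>_def)
qed

subsection \<open>Multipliers\<close>

definition mscale :: "(('v \<Rightarrow> nat) \<Rightarrow> complex) \<Rightarrow> 'v mps \<Rightarrow> 'v mps" where
  "mscale c q = Abs_mps (\<lambda>\<alpha>. c \<alpha> * mcoeff q \<alpha>)"

lemma mcoeff_mscale [simp]: "mcoeff (mscale c q) \<alpha> = c \<alpha> * mcoeff q \<alpha>"
  by (simp add: mscale_def)

section \<open>Bidegrees, conjugation and the trace\<close>

lemma cvar_conj_conj [simp]: "cvar_conj (cvar_conj v) = v"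
  by (cases v) auto

lemma sum_cvar: "(\<Sum>w\<in>UNIV. F w) = (\<Sum>j\<in>UNIV. F (Z j)) + (\<Sum>j\<in>UNIV. F (Zbar j)) + (F (U :: 'n::finite cvar) :: 'a::comm_monoid_add)"
proof -
  have eq: "(UNIV :: 'n cvar set) = insert U (range Z \<union> range Zbar)"
    by (auto simp: image_iff) (metis cvar.exhaust)
  moreover have "(\<Sum>w\<in>range Z \<union> range Zbar. F w) = (\<Sum>w\<in>range Z. F w) + (\<Sum>w\<in>range Zbar. F w)"
    by (rule sum.union_disjoint) auto
  moreover have "(\<Sum>w\<in>range Z. F w) = (\<Sum>j\<in>UNIV. F (Z j))" "(\<Sum>w\<in>range Zbar. F w) = (\<Sum>j\<in>UNIV. F (Zbar j))"
    by (simp_all add: sum.reindex inj_on_def)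
  moreover have "sum F UNIV = F U + (\<Sum>w\<in>range Z \<union> range Zbar. F w)"
    unfolding eq by (rule sum.insert) auto
  ultimately show ?thesis by (simp only: add.commute)
qed

primrec wt :: "'n cvar \<Rightarrow> nat" where
  "wt (Z j) = 1" | "wt (Zbar j) = 1" | "wt U = 2"

primrec zwt :: "'n cvar \<Rightarrow> nat" where
  "zwt (Z j) = 1" | "zwt (Zbar j) = 0" | "zwt U = 0"

primrec zbwt :: "'n cvar \<Rightarrow> nat" where
  "zbwt (Z j) = 0" | "zbwt (Zbar j) = 1" | "zbwt U = 0"

abbreviation zdeg :: "('n::finite cvar \<Rightarrow> nat) \<Rightarrow> nat" where "zdeg \<equiv> wdeg zwt"
abbreviation zbdeg :: "('n::finite cvar \<Rightarrow> nat) \<Rightarrow> nat" where "zbdeg \<equiv> wdeg zbwt"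

lemma zdeg_eq: "zdeg \<alpha> = (\<Sum>j\<in>UNIV. \<alpha> (Z j))"
  by (simp add: wdeg_def sum_cvar)

lemma zbdeg_eq: "zbdeg \<alpha> = (\<Sum>j\<in>UNIV. \<alpha> (Zbar j))"
  by (simp add: wdeg_def sum_cvar)

lemma wdeg_wt: "wdeg wt \<alpha> = zdeg \<alpha> + zbdeg \<alpha> + 2 * \<alpha> U"
  by (simp add: wdeg_def sum_cvar)

lemma edeg_cvar: "edeg \<alpha> = zdeg \<alpha> + zbdeg \<alpha> + \<alpha> U"
  by (simp add: edeg_def wdeg_def sum_cvar)

subsection \<open>Conjugation\<close>

lemma comp_conj_upd: "(\<alpha>(cvar_conj v := n)) \<circ> cvar_conj = (\<alpha> \<circ> cvar_conj)(v := n)"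
  by (rule ext) (metis comp_apply cvar_conj_conj fun_upd_apply)

lemma comp_conj_conj [simp]: "\<alpha> \<circ> cvar_conj \<circ> cvar_conj = \<alpha>"
  by (rule ext) simp

lemma comp_conj_eq_0 [simp]: "\<alpha> \<circ> cvar_conj = (\<lambda>_. 0) \<longleftrightarrow> \<alpha> = (\<lambda>_. 0 :: nat)"
proof
  assume "\<alpha> \<circ> cvar_conj = (\<lambda>_. 0)"
  then have "\<alpha> \<circ> cvar_conj \<circ> cvar_conj = (\<lambda>_. 0) \<circ> cvar_conj" by simp
  then show "\<alpha> = (\<lambda>_. 0)" by (simp only: comp_conj_conj) (simp add: comp_def)
qed (simp add: comp_def)

lemma if_01_mult:
  "(if P then 1 else 0) * x = (if P then x else (0 :: 'a::comm_semiring_1))"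
  "x * (if P then 1 else 0) = (if P then x else (0 :: 'a::comm_semiring_1))"
  "x * (if P then y else 0) = (if P then x * y else (0 :: 'a::comm_semiring_1))"
  by auto

lemma wdeg_comp_conj: "wdeg \<omega> (\<alpha> \<circ> cvar_conj) = wdeg (\<omega> \<circ> cvar_conj) \<alpha>"
  by (simp add: wdeg_def sum_cvar add_ac)

lemma wt_conj [simp]: "wt \<circ> cvar_conj = wt"
proof
  show "(wt \<circ> cvar_conj) v = wt v" for v :: "'a cvar" by (cases v) auto
qed

lemma zwt_conj [simp]: "zwt \<circ> cvar_conj = zbwt"
proof
  show "(zwt \<circ> cvar_conj) v = zbwt v" for v :: "'a cvar" by (cases v) auto
qed

lemma zbwt_conj [simp]: "zbwt \<circ> cvar_conj = zwt"
proof
  show "(zbwt \<circ> cvar_conj) v = zwt v" for v :: "'a cvar" by (cases v) auto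
qed

lemma mcoeff_ser_conj [simp]: "mcoeff (ser_conj q) \<alpha> = cnj (mcoeff q (\<alpha> \<circ> cvar_conj))"
  by (simp add: ser_conj_def)

lemma ser_conj_ser_conj [simp]: "ser_conj (ser_conj q) = q"
  by (rule mps_eqI) simp

lemma ser_conj_add: "ser_conj (p + q :: 'n::finite ser) = ser_conj p + ser_conj q"
  by (rule mps_eqI) simp

lemma ser_conj_diff: "ser_conj (p - q :: 'n::finite ser) = ser_conj p - ser_conj q"
  by (rule mps_eqI) simp

lemma ser_conj_minus: "ser_conj (- q :: 'n::finite ser) = - ser_conj q"
  by (rule mps_eqI) simp

lemma ser_conj_0 [simp]: "ser_conj (0 :: 'n::finite ser) = 0"
  by (rule mps_eqI) simp

lemma ser_conj_sum: "ser_conj (\<Sum>i\<in>A. f i :: 'n::finite ser) = (\<Sum>i\<in>A. ser_conj (f i))"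
  by (induction A rule: infinite_finite_induct) (auto simp: ser_conj_add)

lemma ser_conj_mconst [simp]: "ser_conj (mconst c) = mconst (cnj c)"
  by (rule mps_eqI) (simp add: mcoeff_mconst)

lemma ser_conj_mvar_times: "ser_conj (mvar v * q :: 'n::finite ser) = mvar (cvar_conj v) * ser_conj q"
  by (rule mps_eqI) (simp add: mcoeff_mvar_times comp_conj_upd)

lemma ser_conj_mconst_times: "ser_conj (mconst c * q :: 'n::finite ser) = mconst (cnj c) * ser_conj q"
  by (rule mps_eqI) simp

lemma van_ser_conj: "van (\<omega> \<circ> cvar_conj) k q \<Longrightarrow> van \<omega> k (ser_conj q)"
  unfolding van_def mcoeff_ser_conj using wdeg_comp_conj[of "\<omega> \<circ> cvar_conj"] by (metis comp_conj_conj complex_cnj_zero)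

lemma van_wt_ser_conj: "van wt k q \<Longrightarrow> van wt k (ser_conj q)"
  by (rule van_ser_conj) simp

lemma van_ord_ser_conj: "van (\<lambda>_. 1) k q \<Longrightarrow> van (\<lambda>_. 1) k (ser_conj q)"
  by (rule van_ser_conj) (simp add: comp_def)

lemma ser_conj_mult: "ser_conj (p * q :: 'n::finite ser) = ser_conj p * ser_conj q"
proof -
  have "ser_conj (p * q) - ser_conj p * ser_conj q = 0"
  proof (rule mps_density[where N = 0 and \<Delta> = "\<lambda>p. ser_conj (p * q) - ser_conj p * ser_conj q"])
    show "van (\<lambda>_. 1) k (ser_conj (p * q) - ser_conj p * ser_conj q)"
      if "van (\<lambda>_. 1) (k + 0) p" for k and p :: "'n ser"
      using that by (intro van_diff van_ord_ser_conj van_mult'[where j = k and k = 0]) auto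
    show "ser_conj (mvar v * p * q) - ser_conj (mvar v * p) * ser_conj q = 0"
      if "ser_conj (p * q) - ser_conj p * ser_conj q = 0" for v and p :: "'n ser"
      using that unfolding mult.assoc ser_conj_mvar_times by (simp only: right_minus_eq mult.assoc)
  qed (auto simp: distrib_right ser_conj_add ser_conj_mconst_times)
  then show ?thesis by simp
qed

lemma ser_conj_mvar [simp]: "ser_conj (mvar v) = (mvar (cvar_conj v) :: 'n::finite ser)"
proof -
  have "ser_conj (1 :: 'n ser) = 1" by (rule mps_eqI) (simp add: mcoeff_one)
  then show ?thesis using ser_conj_mvar_times[of v 1] by simp
qed

lemma ser_conj_mderiv: "ser_conj (mderiv v q) = mderiv (cvar_conj v) (ser_conj q)"
  by (rule mps_eqI) (simp add: comp_conj_upd)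

lemma ser_conj_msubst:
  fixes \<sigma> :: "'n::finite cvar \<Rightarrow> 'n ser"
  assumes \<sigma>: "\<And>v. van (\<lambda>_. 1) 1 (\<sigma> v)" and c: "\<And>v. ser_conj (\<sigma> v) = \<sigma> (cvar_conj v)"
  shows "ser_conj (msubst q \<sigma>) = msubst (ser_conj q) \<sigma>"
proof -
  have "ser_conj (msubst q \<sigma>) - msubst (ser_conj q) \<sigma> = 0"
  proof (rule mps_density[where N = 0 and \<Delta> = "\<lambda>q. ser_conj (msubst q \<sigma>) - msubst (ser_conj q) \<sigma>"])
    show "van (\<lambda>_. 1) k (ser_conj (msubst p \<sigma>) - msubst (ser_conj p) \<sigma>)"
      if "van (\<lambda>_. 1) (k + 0) p" for k and p :: "'n ser"
      using that by (intro van_diff van_ord_ser_conj van_order_msubst \<sigma>) auto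
    show "ser_conj (msubst (mvar v * p) \<sigma>) - msubst (ser_conj (mvar v * p)) \<sigma> = 0"
      if "ser_conj (msubst p \<sigma>) - msubst (ser_conj p) \<sigma> = 0" for v and p :: "'n ser"
      using that unfolding ser_conj_mvar_times msubst_mvar_times[where \<sigma> = \<sigma>, OF \<sigma>] right_minus_eq
      by (simp only: ser_conj_mult c)
  qed (auto simp: ser_conj_add msubst_add)
  then show ?thesis by simp
qed

subsection \<open>Bihomogeneous components\<close>

definition bh :: "nat \<Rightarrow> nat \<Rightarrow> 'n::finite ser \<Rightarrow> 'n ser" where
  "bh a b q = mscale (\<lambda>\<alpha>. if zdeg \<alpha> = a \<and> zbdeg \<alpha> = b then 1 else 0) q"

lemma mcoeff_bh [simp]: "mcoeff (bh a b q) \<alpha> = (if zdeg \<alpha> = a \<and> zbdeg \<alpha> = b then mcoeff q \<alpha> else 0)"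
  by (simp add: bh_def)

lemma eq_bhI: "(\<And>a b. bh a b p = bh a b q) \<Longrightarrow> p = q"
proof (rule mps_eqI)
  fix \<alpha> assume "\<And>a b. bh a b p = bh a b q"
  then have "mcoeff (bh (zdeg \<alpha>) (zbdeg \<alpha>) p) \<alpha> = mcoeff (bh (zdeg \<alpha>) (zbdeg \<alpha>) q) \<alpha>" by metis
  then show "mcoeff p \<alpha> = mcoeff q \<alpha>" by simp
qed

lemma van_bh: "van \<omega> k q \<Longrightarrow> van \<omega> k (bh a b q)"
  by (auto simp: van_def)

lemma van_bhI: "(\<And>a b. van \<omega> k (bh a b q)) \<Longrightarrow> van \<omega> k q"
  unfolding van_def mcoeff_bh by metis

lemma bh_add: "bh a b (p + q) = bh a b p + bh a b q"
  by (rule mps_eqI) simp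

lemma bh_diff: "bh a b (p - q) = bh a b p - bh a b q"
  by (rule mps_eqI) simp

lemma bh_minus: "bh a b (- q) = - bh a b q"
  by (rule mps_eqI) simp

lemma bh_0 [simp]: "bh a b 0 = 0"
  by (rule mps_eqI) simp

lemma bh_sum: "bh a b (\<Sum>i\<in>A. f i) = (\<Sum>i\<in>A. bh a b (f i))"
  by (induction A rule: infinite_finite_induct) (auto simp: bh_add)

lemma bh_mconst_times: "bh a b (mconst c * q) = mconst c * bh a b q"
  by (rule mps_eqI) simp

lemma bh_bh [simp]: "bh a b (bh a' b' q) = (if a = a' \<and> b = b' then bh a b q else 0)"
  by (rule mps_eqI) auto

lemma bh_ser_conj: "bh a b (ser_conj q) = ser_conj (bh b a q)"
  by (rule mps_eqI) (auto simp: wdeg_comp_conj)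

lemma ser_conj_bh: "ser_conj (bh a b q) = bh b a (ser_conj q)"
  by (simp add: bh_ser_conj)

lemma bh_Z_Suc: "bh (Suc a) b (mvar (Z j) * q) = mvar (Z j) * bh a b q"
proof (rule mps_eqI)
  fix \<alpha>
  show "mcoeff (bh (Suc a) b (mvar (Z j) * q)) \<alpha> = mcoeff (mvar (Z j) * bh a b q) \<alpha>"
    using wdeg_upd_pred[of \<alpha> "Z j" zwt] wdeg_upd_pred[of \<alpha> "Z j" zbwt] by (auto simp: mcoeff_mvar_times)
qed

lemma bh_Zbar_Suc: "bh a (Suc b) (mvar (Zbar j) * q) = mvar (Zbar j) * bh a b q"
proof (rule mps_eqI)
  fix \<alpha>
  show "mcoeff (bh a (Suc b) (mvar (Zbar j) * q)) \<alpha> = mcoeff (mvar (Zbar j) * bh a b q) \<alpha>"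
    using wdeg_upd_pred[of \<alpha> "Zbar j" zwt] wdeg_upd_pred[of \<alpha> "Zbar j" zbwt] by (auto simp: mcoeff_mvar_times)
qed

lemma bh_Z_0: "bh 0 b (mvar (Z j) * q) = 0"
proof (rule mps_eqI)
  fix \<alpha>
  show "mcoeff (bh 0 b (mvar (Z j) * q)) \<alpha> = mcoeff 0 \<alpha>"
    using wdeg_upd_pred[of \<alpha> "Z j" zwt] by (auto simp: mcoeff_mvar_times)
qed

lemma bh_Zbar_0: "bh a 0 (mvar (Zbar j) * q) = 0"
proof (rule mps_eqI)
  fix \<alpha>
  show "mcoeff (bh a 0 (mvar (Zbar j) * q)) \<alpha> = mcoeff 0 \<alpha>"
    using wdeg_upd_pred[of \<alpha> "Zbar j" zbwt] by (auto simp: mcoeff_mvar_times)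
qed

lemma bh_mderiv_U: "bh a b (mderiv U q) = mderiv U (bh a b q)"
  by (rule mps_eqI) (auto simp: wdeg_upd_Suc)

lemma bh_mderiv_Z: "bh a b (mderiv (Z j) q) = mderiv (Z j) (bh (Suc a) b q)"
  by (rule mps_eqI) (auto simp: wdeg_upd_Suc)

lemma bh_mderiv_Zbar: "bh a b (mderiv (Zbar j) q) = mderiv (Zbar j) (bh a (Suc b) q)"
  by (rule mps_eqI) (auto simp: wdeg_upd_Suc)

lemma mderiv_Z_bh_0: "mderiv (Z j) (bh 0 b q) = 0"
  by (rule mps_eqI) (auto simp: wdeg_upd_Suc)

lemma mderiv_Zbar_bh_0: "mderiv (Zbar j) (bh a 0 q) = 0"
  by (rule mps_eqI) (auto simp: wdeg_upd_Suc)

text \<open>Only the part of \<open>F a b\<close> of bidegree \<open>(a, b)\<close> is read off, so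
  any family of series prescribes the bihomogeneous components of one series.\<close>

definition glue :: "(nat \<Rightarrow> nat \<Rightarrow> 'n::finite ser) \<Rightarrow> 'n ser" where
  "glue F = Abs_mps (\<lambda>\<alpha>. mcoeff (F (zdeg \<alpha>) (zbdeg \<alpha>)) \<alpha>)"

lemma bh_glue: "bh a b (glue F) = bh a b (F a b)"
  by (rule mps_eqI) (auto simp: glue_def)

subsection \<open>Euler fields and integration in \<open>u\<close>\<close>

definition Ez :: "'n::finite ser \<Rightarrow> 'n ser" where "Ez q = mscale (\<lambda>\<alpha>. of_nat (zdeg \<alpha>)) q"
definition Eb :: "'n::finite ser \<Rightarrow> 'n ser" where "Eb q = mscale (\<lambda>\<alpha>. of_nat (zbdeg \<alpha>)) q"

lemma mcoeff_Ez [simp]: "mcoeff (Ez q) \<alpha> = of_nat (zdeg \<alpha>) * mcoeff q \<alpha>" by (simp add: Ez_def)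
lemma mcoeff_Eb [simp]: "mcoeff (Eb q) \<alpha> = of_nat (zbdeg \<alpha>) * mcoeff q \<alpha>" by (simp add: Eb_def)

lemma Ez_eq: "Ez q = (\<Sum>j\<in>UNIV. mvar (Z j) * mderiv (Z j) q)"
proof (rule mps_eqI)
  fix \<alpha>
  have "mcoeff (mvar (Z j) * mderiv (Z j) q) \<alpha> = of_nat (\<alpha> (Z j)) * mcoeff q \<alpha>" for j
    by (auto simp: mcoeff_mvar_times)
  then show "mcoeff (Ez q) \<alpha> = mcoeff (\<Sum>j\<in>UNIV. mvar (Z j) * mderiv (Z j) q) \<alpha>"
    by (simp add: mcoeff_sum zdeg_eq sum_distrib_right)
qed

lemma Eb_eq: "Eb q = (\<Sum>j\<in>UNIV. mvar (Zbar j) * mderiv (Zbar j) q)"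
proof (rule mps_eqI)
  fix \<alpha>
  have "mcoeff (mvar (Zbar j) * mderiv (Zbar j) q) \<alpha> = of_nat (\<alpha> (Zbar j)) * mcoeff q \<alpha>" for j
    by (auto simp: mcoeff_mvar_times)
  then show "mcoeff (Eb q) \<alpha> = mcoeff (\<Sum>j\<in>UNIV. mvar (Zbar j) * mderiv (Zbar j) q) \<alpha>"
    by (simp add: mcoeff_sum zbdeg_eq sum_distrib_right)
qed

lemma Ez_add: "Ez (p + q) = Ez p + Ez q" by (rule mps_eqI) (simp add: algebra_simps)
lemma Eb_add: "Eb (p + q) = Eb p + Eb q" by (rule mps_eqI) (simp add: algebra_simps)
lemma Ez_diff: "Ez (p - q) = Ez p - Ez q" by (rule mps_eqI) (simp add: algebra_simps)
lemma Eb_diff: "Eb (p - q) = Eb p - Eb q" by (rule mps_eqI) (simp add: algebra_simps)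

lemma Ez_sum: "Ez (\<Sum>i\<in>A. f i) = (\<Sum>i\<in>A. Ez (f i))"
  by (rule mps_eqI) (simp add: mcoeff_sum sum_distrib_left)

lemma Eb_sum: "Eb (\<Sum>i\<in>A. f i) = (\<Sum>i\<in>A. Eb (f i))"
  by (rule mps_eqI) (simp add: mcoeff_sum sum_distrib_left)

lemma Ez_mult: "Ez (p * q) = Ez p * q + p * Ez q"
  by (simp add: Ez_eq mderiv_mult algebra_simps sum.distrib sum_distrib_left)

lemma Eb_mult: "Eb (p * q) = Eb p * q + p * Eb q"
  by (simp add: Eb_eq mderiv_mult algebra_simps sum.distrib sum_distrib_left)

lemma Ez_mconst [simp]: "Ez (mconst c) = 0" by (simp add: Ez_eq)
lemma Eb_mconst [simp]: "Eb (mconst c) = 0" by (simp add: Eb_eq)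

lemma Ez_mvar: "Ez (mvar v) = mconst (of_nat (zwt v)) * mvar v"
  by (rule mps_eqI) (auto simp: mcoeff_mvar)

lemma Eb_mvar: "Eb (mvar v) = mconst (of_nat (zbwt v)) * mvar v"
  by (rule mps_eqI) (auto simp: mcoeff_mvar)

lemma bh_Ez: "bh a b (Ez q) = mconst (of_nat a) * bh a b q" by (rule mps_eqI) simp
lemma bh_Eb: "bh a b (Eb q) = mconst (of_nat b) * bh a b q" by (rule mps_eqI) simp
lemma Ez_bh: "Ez (bh a b q) = mconst (of_nat a) * bh a b q" by (rule mps_eqI) simp
lemma Eb_bh: "Eb (bh a b q) = mconst (of_nat b) * bh a b q" by (rule mps_eqI) simp

lemma ser_conj_Ez: "ser_conj (Ez q) = Eb (ser_conj q)"
  by (rule mps_eqI) (simp add: wdeg_comp_conj)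

lemma ser_conj_Eb: "ser_conj (Eb q) = Ez (ser_conj q)"
  by (rule mps_eqI) (simp add: wdeg_comp_conj)

lemma van_Ez: "van \<omega> k q \<Longrightarrow> van \<omega> k (Ez q)" by (auto simp: van_def)
lemma van_mscale: "van \<omega> k q \<Longrightarrow> van \<omega> k (mscale c q)" by (auto simp: van_def)
lemma van_mconst_times: "van \<omega> k q \<Longrightarrow> van \<omega> k (mconst c * q)" by (auto simp: van_def)

lemma van_mderiv': "van \<omega> k q \<Longrightarrow> van \<omega> (k - \<omega> v) (mderiv v q)"
  by (auto simp: van_def wdeg_upd_Suc)

text \<open>The primitive in \<open>u\<close> without \<open>u\<close>-free part. It gains the
  weight 2 that \<open>mderiv U\<close> loses.\<close>

definition mint :: "'n::finite ser \<Rightarrow> 'n ser" where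
  "mint q = Abs_mps (\<lambda>\<alpha>. if \<alpha> U = 0 then 0 else mcoeff q (\<alpha>(U := \<alpha> U - 1)) / of_nat (\<alpha> U))"

lemma mcoeff_mint: "mcoeff (mint q) \<alpha> = (if \<alpha> U = 0 then 0 else mcoeff q (\<alpha>(U := \<alpha> U - 1)) / of_nat (\<alpha> U))"
  by (simp add: mint_def)

lemma of_nat_Suc_neq_0: "(1 + of_nat n :: complex) \<noteq> 0"
  by (metis nat.distinct(1) of_nat_0_eq_iff of_nat_Suc)

lemma mderiv_mint [simp]: "mderiv U (mint q) = q"
  by (rule mps_eqI) (simp add: mcoeff_mint of_nat_Suc_neq_0)

lemma mint_mderiv: "(\<And>\<alpha>. \<alpha> U = 0 \<Longrightarrow> mcoeff q \<alpha> = 0) \<Longrightarrow> mint (mderiv U q) = q"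
  by (rule mps_eqI) (simp add: mcoeff_mint)

lemma van_mint: "van wt k q \<Longrightarrow> van wt (k + 2) (mint q)"
  unfolding van_def mcoeff_mint
proof (intro allI impI)
  fix \<alpha> :: "'a cvar \<Rightarrow> nat"
  assume q: "\<forall>\<alpha>. wdeg wt \<alpha> < k \<longrightarrow> mcoeff q \<alpha> = 0" and a: "wdeg wt \<alpha> < k + 2"
  have "\<alpha> U \<noteq> 0 \<Longrightarrow> wdeg wt (\<alpha>(U := \<alpha> U - 1)) < k"
    using wdeg_upd_pred[of \<alpha> U wt] a by simp
  then show "(if \<alpha> U = 0 then 0 else mcoeff q (\<alpha>(U := \<alpha> U - 1)) / of_nat (\<alpha> U)) = 0"
    using q by (cases "\<alpha> U = 0") auto
qed

lemma van_wt_mderiv_U: "van wt k q \<Longrightarrow> van wt (k - 2) (mderiv U q)"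
  using van_mderiv'[of wt k q U] by simp

lemma bh_mint: "bh a b (mint q) = mint (bh a b q)"
proof (rule mps_eqI)
  fix \<alpha>
  show "mcoeff (bh a b (mint q)) \<alpha> = mcoeff (mint (bh a b q)) \<alpha>"
    using wdeg_upd_pred[of \<alpha> U zwt] wdeg_upd_pred[of \<alpha> U zbwt] by (auto simp: mcoeff_mint)
qed

lemma ser_conj_mint: "ser_conj (mint q) = mint (ser_conj q)"
proof (rule mps_eqI)
  fix \<alpha> :: "'a cvar \<Rightarrow> nat"
  show "mcoeff (ser_conj (mint q)) \<alpha> = mcoeff (mint (ser_conj q)) \<alpha>"
    using comp_conj_upd[of \<alpha> U "\<alpha> U - 1"] by (simp add: mcoeff_mint)
qed

subsection \<open>The Levi polynomial and the trace\<close>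

definition qf :: "('n::finite \<Rightarrow> 'n \<Rightarrow> complex) \<Rightarrow> 'n ser" where
  "qf c = (\<Sum>j\<in>UNIV. \<Sum>k\<in>UNIV. mconst (c j k) * (mvar (Zbar j) * mvar (Z k)))"

definition ltrace :: "('n::finite \<Rightarrow> 'n \<Rightarrow> complex) \<Rightarrow> 'n ser \<Rightarrow> 'n ser" where
  "ltrace ci q = (\<Sum>j\<in>UNIV. \<Sum>k\<in>UNIV. mconst (ci j k) * mderiv (Zbar j) (mderiv (Z k) q))"

lemma qf_times: "qf c * s = (\<Sum>j\<in>UNIV. \<Sum>k\<in>UNIV. mconst (c j k) * (mvar (Zbar j) * (mvar (Z k) * s)))"
  by (simp add: qf_def sum_distrib_right mult.assoc)

lemma bh_qf_Suc: "bh (Suc a) (Suc b) (qf c * s) = qf c * bh a b s"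
  by (simp add: qf_times bh_sum bh_mconst_times bh_Z_Suc bh_Zbar_Suc)

lemma bh_qf_0: "bh 0 b (qf c * s) = 0" 
  by (cases b) (simp_all add: qf_times bh_sum bh_mconst_times bh_Z_0 bh_Zbar_0 bh_Zbar_Suc)

lemma bh_qf_0': "bh a 0 (qf c * s) = 0" 
  by (simp add: qf_times bh_sum bh_mconst_times bh_Zbar_0)

lemma van_qf: "van wt 2 (qf c)"
  unfolding qf_def
  by (intro van_sum van_mconst_times van_mult'[where j = 1 and k = 1] van_mvar) auto

lemma van_qf_times: "van wt k s \<Longrightarrow> van wt (k + 2) (qf c * s)"
  by (rule van_mult'[OF van_qf]) auto

lemma mderiv_U_qf [simp]: "mderiv U (qf c) = 0"
  by (simp add: qf_def mderiv_sum mderiv_mult mderiv_mvar)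

lemma mderiv_U_qf_times: "mderiv U (qf c * s) = qf c * mderiv U s"
  by (simp add: mderiv_mult)

lemma mderiv_U_mconst_times: "mderiv U (mconst k * s :: 'n::finite ser) = mconst k * mderiv U s"
  by (simp add: mderiv_mult)

lemma mderiv_Z_qf: "mderiv (Z k) (qf c) = (\<Sum>j\<in>UNIV. mconst (c j k) * mvar (Zbar j))"
  by (simp add: qf_def mderiv_sum mderiv_mult mderiv_mvar if_01_mult)

lemma mderiv_Zbar_qf: "mderiv (Zbar j) (qf c) = (\<Sum>k\<in>UNIV. mconst (c j k) * mvar (Z k))"
  by (subst qf_def, subst sum.swap)
     (simp add: mderiv_sum mderiv_mult mderiv_mvar if_01_mult)

lemma ser_conj_qf: 
  assumes "\<And>j k. cnj (c j k) = c k j" shows "ser_conj (qf c) = qf c"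
proof -
  have "ser_conj (qf c) = (\<Sum>j\<in>UNIV. \<Sum>k\<in>UNIV. mconst (c k j) * (mvar (Z j) * mvar (Zbar k)))"
    by (simp add: qf_def ser_conj_sum ser_conj_mult assms)
  also have "\<dots> = qf c" unfolding qf_def by (subst sum.swap) (simp add: mult_ac)
  finally show ?thesis .
qed

lemma ltrace_add: "ltrace ci (p + q) = ltrace ci p + ltrace ci q"
  by (simp add: ltrace_def mderiv_add distrib_left sum.distrib)

lemma ltrace_diff: "ltrace ci (p - q) = ltrace ci p - ltrace ci q"
  by (simp add: ltrace_def mderiv_diff right_diff_distrib sum_subtractf)

lemma ltrace_0 [simp]: "ltrace ci 0 = 0"
  by (simp add: ltrace_def)

lemma ltrace_minus: "ltrace ci (- q) = - ltrace ci q"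
  using ltrace_diff[of ci 0 q] by simp

lemma ltrace_mconst_times: "ltrace ci (mconst k * s) = mconst k * ltrace ci s"
  by (simp add: ltrace_def mderiv_mult sum_distrib_left mult_ac)

lemma bh_ltrace: "bh a b (ltrace ci q) = ltrace ci (bh (Suc a) (Suc b) q)"
  by (simp add: ltrace_def bh_sum bh_mconst_times bh_mderiv_Z bh_mderiv_Zbar)

lemma van_ltrace: assumes "van wt k q" shows "van wt (k - 2) (ltrace ci q)"
  unfolding ltrace_def
proof (intro van_sum van_mconst_times)
  fix j l
  show "van wt (k - 2) (mderiv (Zbar j) (mderiv (Z l) q))"
    using van_mderiv'[OF van_mderiv'[OF assms, of "Z l"], of "Zbar j"] by (simp add: numeral_2_eq_2)
qed

lemma ser_conj_ltrace:
  assumes "\<And>j k. cnj (ci j k) = ci k j" shows "ser_conj (ltrace ci q) = ltrace ci (ser_conj q)"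
proof -
  have "ser_conj (ltrace ci q)
      = (\<Sum>j\<in>UNIV. \<Sum>k\<in>UNIV. mconst (ci k j) * mderiv (Z j) (mderiv (Zbar k) (ser_conj q)))"
    by (simp add: ltrace_def ser_conj_sum ser_conj_mult ser_conj_mderiv assms)
  also have "\<dots> = ltrace ci (ser_conj q)"
    unfolding ltrace_def by (subst sum.swap) (simp add: mderiv_commute)
  finally show ?thesis .
qed

lemma sum_mconst_delta:
  fixes f :: "'n::finite \<Rightarrow> 'v::finite mps"
  shows "(\<Sum>j\<in>UNIV. mconst (if j = l then 1 else 0) * f j) = f l"
    "(\<Sum>j\<in>UNIV. mconst (if l = j then 1 else 0) * f j) = f l"
proof -
  have "(\<Sum>j\<in>UNIV. mconst (if j = l then 1 else 0) * f j) = (\<Sum>j\<in>UNIV. if j = l then f j else 0)"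
    by (rule sum.cong) auto
  then show "(\<Sum>j\<in>UNIV. mconst (if j = l then 1 else 0) * f j) = f l" by simp
  then show "(\<Sum>j\<in>UNIV. mconst (if l = j then 1 else 0) * f j) = f l" by (simp add: eq_commute[of l])
qed

text \<open>The \<open>sl\<^sub>2\<close> relation behind all trace computations below.\<close>

lemma ltrace_qf_times:
  fixes c ci :: "'n::finite \<Rightarrow> 'n \<Rightarrow> complex"
  assumes ci1: "\<And>j l. (\<Sum>k\<in>UNIV. ci j k * c l k) = (if j = l then 1 else 0)"
    and ci2: "\<And>k l. (\<Sum>j\<in>UNIV. ci j k * c j l) = (if k = l then 1 else 0)"
  shows "ltrace ci (qf c * s) = qf c * ltrace ci s + mconst (of_nat CARD('n)) * s + Ez s + Eb s"
proof -
  have d: "mderiv (Zbar j) (mderiv (Z k) (qf c * s)) =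
      mconst (c j k) * s + mderiv (Z k) (qf c) * mderiv (Zbar j) s
      + mderiv (Zbar j) (qf c) * mderiv (Z k) s + qf c * mderiv (Zbar j) (mderiv (Z k) s)" for j k
    by (simp add: mderiv_mult mderiv_add mderiv_Z_qf mderiv_sum mderiv_mvar if_01_mult algebra_simps)
  have "(\<Sum>j\<in>UNIV. \<Sum>k\<in>UNIV. mconst (ci j k) * (mconst (c j k) * s))
      = (\<Sum>j\<in>UNIV. mconst (\<Sum>k\<in>UNIV. ci j k * c j k) * s)"
    by (simp add: mconst_sum mconst_mult sum_distrib_right mult.assoc)
  also have "\<dots> = mconst (of_nat CARD('n)) * s" by (simp add: ci1 mconst_of_nat)
  finally have 1: "(\<Sum>j\<in>UNIV. \<Sum>k\<in>UNIV. mconst (ci j k) * (mconst (c j k) * s)) = mconst (of_nat CARD('n)) * s" .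
  have "(\<Sum>j\<in>UNIV. \<Sum>k\<in>UNIV. mconst (ci j k) * (mderiv (Z k) (qf c) * mderiv (Zbar j) s))
      = (\<Sum>j\<in>UNIV. \<Sum>k\<in>UNIV. \<Sum>l\<in>UNIV. mconst (ci j k * c l k) * (mvar (Zbar l) * mderiv (Zbar j) s))"
    by (simp add: mderiv_Z_qf mconst_mult sum_distrib_left sum_distrib_right mult_ac)
  also have "\<dots> = (\<Sum>j\<in>UNIV. \<Sum>l\<in>UNIV. mconst (\<Sum>k\<in>UNIV. ci j k * c l k) * (mvar (Zbar l) * mderiv (Zbar j) s))"
    unfolding mconst_sum sum_distrib_right by (rule sum.cong[OF refl], rule sum.swap)
  also have "\<dots> = Eb s" by (simp add: ci1 Eb_eq sum_mconst_delta)
  finally have 2: "(\<Sum>j\<in>UNIV. \<Sum>k\<in>UNIV. mconst (ci j k) * (mderiv (Z k) (qf c) * mderiv (Zbar j) s)) = Eb s" .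
  have "(\<Sum>j\<in>UNIV. \<Sum>k\<in>UNIV. mconst (ci j k) * (mderiv (Zbar j) (qf c) * mderiv (Z k) s))
      = (\<Sum>k\<in>UNIV. \<Sum>j\<in>UNIV. \<Sum>l\<in>UNIV. mconst (ci j k * c j l) * (mvar (Z l) * mderiv (Z k) s))"
    by (subst sum.swap) (simp add: mderiv_Zbar_qf mconst_mult sum_distrib_left sum_distrib_right mult_ac)
  also have "\<dots> = (\<Sum>k\<in>UNIV. \<Sum>l\<in>UNIV. mconst (\<Sum>j\<in>UNIV. ci j k * c j l) * (mvar (Z l) * mderiv (Z k) s))"
    unfolding mconst_sum sum_distrib_right by (rule sum.cong[OF refl], rule sum.swap)
  also have "\<dots> = Ez s" by (simp add: ci2 Ez_eq sum_mconst_delta)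
  finally have 3: "(\<Sum>j\<in>UNIV. \<Sum>k\<in>UNIV. mconst (ci j k) * (mderiv (Zbar j) (qf c) * mderiv (Z k) s)) = Ez s" .
  have 4: "(\<Sum>j\<in>UNIV. \<Sum>k\<in>UNIV. mconst (ci j k) * (qf c * mderiv (Zbar j) (mderiv (Z k) s))) = qf c * ltrace ci s"
    by (simp add: ltrace_def sum_distrib_left mult_ac)
  show ?thesis
    unfolding ltrace_def[of ci "qf c * s"] d distrib_left sum.distrib 1 2 3 4 by (simp add: add_ac)
qed

section \<open>The homogeneous linearized equation\<close>

lemma mconst_cancel:
  fixes x y :: "'v::finite mps"
  assumes "mconst k * x = y" "k \<noteq> 0" shows "x = mconst (1 / k) * y"
proof -
  have "mconst (1 / k) * y = mconst (1 / k * k) * x" by (simp only: assms(1)[symmetric] mconst_mult mult.assoc)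
  then show ?thesis using assms(2) by simp
qed

lemma mconst_times_mconst: "mconst a * (mconst b * x) = mconst (a * b) * (x :: 'v::finite mps)"
  by (simp add: mconst_mult mult.assoc)

lemma qf_mconst: "qf c * (mconst k * x) = mconst k * (qf c * x)"
  by (rule mult.left_commute)

lemma bh_qf_nums:
  "bh 1 1 (qf c * s) = qf c * bh 0 0 s" "bh 2 1 (qf c * s) = qf c * bh 1 0 s"
  "bh 2 2 (qf c * s) = qf c * bh 1 1 s" "bh 3 2 (qf c * s) = qf c * bh 2 1 s"
  "bh 3 3 (qf c * s) = qf c * bh 2 2 s" "bh 1 2 (qf c * s) = qf c * bh 0 1 s"
  "bh 2 3 (qf c * s) = qf c * bh 1 2 s"
  using bh_qf_Suc[of 0 0 c s] bh_qf_Suc[of 1 0 c s] bh_qf_Suc[of 1 1 c s] bh_qf_Suc[of 2 1 c s]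
    bh_qf_Suc[of 2 2 c s] bh_qf_Suc[of 0 1 c s] bh_qf_Suc[of 1 2 c s]
  by (simp_all add: numeral_2_eq_2 numeral_3_eq_3)

lemmas mconst_nf = mconst_times_mconst qf_mconst mderiv_add mderiv_diff mderiv_minus mderiv_U_mconst_times
  mderiv_U_qf_times bh_add bh_diff bh_minus bh_mconst_times bh_mderiv_U ser_conj_add ser_conj_diff ser_conj_minus
  ser_conj_mconst_times ser_conj_mderiv distrib_left right_diff_distrib

lemmas mcoeff_lin = mcoeff_mconst_times plus_mps.rep_eq minus_mps.rep_eq uminus_mps.rep_eq

text \<open>The lowest weight part of the \<open>(1,0)\<close> field that projects to the Euler field.\<close>

definition Dz :: "('n::finite \<Rightarrow> 'n \<Rightarrow> complex) \<Rightarrow> 'n ser \<Rightarrow> 'n ser" where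
  "Dz c s = Ez s + mconst \<i> * (qf c * mderiv U s)"

text \<open>For a solution \<open>f\<close> of the homogeneous tangential equation, \<open>C\<close> and \<open>F\<close> stand for the
  pairings of \<open>f\<close> with \<open>z\<close> through the torsion and the Levi form; \<open>R\<close> is the contribution
  of \<open>(f, g)\<close> to the transversal equation.\<close>

locale hom_scalars =
  fixes c :: "'n::finite \<Rightarrow> 'n \<Rightarrow> complex" and C F g R :: "'n ser"
  assumes c_herm: "\<And>j k. cnj (c j k) = c k j"
    and C_eq: "Eb C = mconst \<i> * (qf c * mderiv U C)"
    and C_0: "\<And>b. bh 0 b C = 0"
    and F_eq: "Eb F = F + mconst \<i> * (qf c * mderiv U F)"
    and g_real: "ser_conj g = g"
    and R_def: "R = Dz c g - (Ez C + Eb C - mconst 2 * C) - (Ez F + Eb F - F) + ser_conj F"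
    and R_imag: "R + ser_conj R = 0"
begin

lemma conj_q [simp]: "ser_conj (qf c) = qf c"
  by (rule ser_conj_qf[OF c_herm])

lemma conj_q_times: "ser_conj (qf c * s) = qf c * ser_conj s"
  by (simp add: ser_conj_mult)

text \<open>The tangential equation links a bidegree only to its neighbour on the diagonal. Every
  component is thus a power of \<open>q\<close> times a \<open>u\<close>-derivative of the component
  where its diagonal starts.\<close>

lemma C_Suc: "mconst (of_nat (Suc b)) * bh (Suc a) (Suc b) C = mconst \<i> * (qf c * mderiv U (bh a b C))"
  using arg_cong[OF C_eq, of "bh (Suc a) (Suc b)"] by (simp only: bh_Eb bh_mconst_times bh_qf_Suc bh_mderiv_U)

text \<open>\<open>C\<close> carries a factor \<open>z\<close>, so the diagonals starting at
  \<open>(0, b)\<close> are empty. Hence the torsion does not enter at the bidegrees (1, 1), (2, 2)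
  and (3, 3).\<close>

lemma C_1: "bh 1 (Suc b) C = 0"
  using mconst_cancel[OF C_Suc[of b 0]] by (simp add: C_0 of_nat_Suc_neq_0)

lemma C_a1: "bh (Suc a) 1 C = mconst \<i> * (qf c * mderiv U (bh a 0 C))"
  using C_Suc[of 0 a] by simp

lemma C_vals:
  "bh 1 1 C = 0" "bh 1 2 C = 0" "bh 2 2 C = 0" "bh 2 3 C = 0" "bh 3 3 C = 0"
  "bh 2 1 C = mconst \<i> * (qf c * mderiv U (bh 1 0 C))"
  "bh 3 2 C = mconst (- 1 / 2) * (qf c * (qf c * mderiv U (mderiv U (bh 1 0 C))))"
proof -
  show 11: "bh 1 1 C = 0" and 12: "bh 1 2 C = 0" 
    using C_1[of 0] C_1[of 1] by (simp_all add: numeral_2_eq_2)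
  show 22: "bh 2 2 C = 0" using mconst_cancel[OF C_Suc[of 1 1]] 11 by (simp add: numeral_2_eq_2)
  show 23: "bh 2 3 C = 0" using mconst_cancel[OF C_Suc[of 2 1]] 12 by (simp add: numeral_2_eq_2 numeral_3_eq_3)
  show 33: "bh 3 3 C = 0" using mconst_cancel[OF C_Suc[of 2 2]] 22 by (simp add: numeral_2_eq_2 numeral_3_eq_3)
  show 21: "bh 2 1 C = mconst \<i> * (qf c * mderiv U (bh 1 0 C))"
    using C_a1[of 1] by (simp add: numeral_2_eq_2)
  have "bh 3 2 C = mconst (1 / of_nat (Suc 1)) * (mconst \<i> * (qf c * mderiv U (bh 2 1 C)))"
    using mconst_cancel[OF C_Suc[of 1 2]] by (simp add: numeral_2_eq_2 numeral_3_eq_3)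
  then show "bh 3 2 C = mconst (- 1 / 2) * (qf c * (qf c * mderiv U (mderiv U (bh 1 0 C))))"
    unfolding 21 by (simp add: mconst_nf)
qed

lemma F_a0: "bh a 0 F = 0"
  using arg_cong[OF F_eq, of "bh a 0"] by (simp add: bh_Eb bh_add bh_mconst_times bh_qf_0')

text \<open>Moving the summand \<open>F\<close> to the left lowers the factor \<open>b + 1\<close>
  to \<open>b\<close>. For \<open>b = 0\<close> the equation is void: the components of bidegree
  \<open>(a, 1)\<close> are the free data, and the diagonals of \<open>F\<close> start
  there.\<close>

lemma F_Suc: "mconst (of_nat b) * bh (Suc a) (Suc b) F = mconst \<i> * (qf c * mderiv U (bh a b F))"
proof -
  have "mconst (of_nat (Suc b)) * bh (Suc a) (Suc b) F
      = bh (Suc a) (Suc b) F + mconst \<i> * (qf c * mderiv U (bh a b F))"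
    using arg_cong[OF F_eq, of "bh (Suc a) (Suc b)"]
    by (simp only: bh_Eb bh_add bh_mconst_times bh_qf_Suc bh_mderiv_U)
  then show ?thesis by (simp add: mconst_add distrib_right)
qed

lemma F_0: "bh 0 (Suc (Suc b)) F = 0"
proof -
  have "mconst (of_nat (Suc (Suc b))) * bh 0 (Suc (Suc b)) F = bh 0 (Suc (Suc b)) F"
    using arg_cong[OF F_eq, of "bh 0 (Suc (Suc b))"]
    by (simp only: bh_Eb bh_add bh_mconst_times bh_qf_0) simp
  then have "mconst (of_nat (Suc (Suc b))) * bh 0 (Suc (Suc b)) F - bh 0 (Suc (Suc b)) F = 0" by simp
  then have "mconst (of_nat (Suc b)) * bh 0 (Suc (Suc b)) F = 0"
    unfolding of_nat_Suc[of "Suc b"] mconst_add by (simp add: distrib_right)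
  from mconst_cancel[OF this] show ?thesis by (simp add: of_nat_Suc_neq_0)
qed

lemma F_1: "bh 1 (Suc (Suc (Suc b))) F = 0"
  using mconst_cancel[OF F_Suc[of "Suc (Suc b)" 0]] F_0[of b]
  by (simp add: of_nat_Suc_neq_0 flip: of_nat_Suc del: of_nat_Suc)

lemma F_a2: "bh (Suc a) 2 F = mconst \<i> * (qf c * mderiv U (bh a 1 F))"
  using F_Suc[of 1 a] by (simp add: numeral_2_eq_2)

lemma F_vals:
  "bh 1 2 F = mconst \<i> * (qf c * mderiv U (bh 0 1 F))"
  "bh 2 2 F = mconst \<i> * (qf c * mderiv U (bh 1 1 F))"
  "bh 3 2 F = mconst \<i> * (qf c * mderiv U (bh 2 1 F))"
  "bh 2 3 F = mconst (- 1 / 2) * (qf c * (qf c * mderiv U (mderiv U (bh 0 1 F))))"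
  "bh 3 3 F = mconst (- 1 / 2) * (qf c * (qf c * mderiv U (mderiv U (bh 1 1 F))))"
proof -
  show 1: "bh 1 2 F = mconst \<i> * (qf c * mderiv U (bh 0 1 F))" using F_a2[of 0] by simp
  show 2: "bh 2 2 F = mconst \<i> * (qf c * mderiv U (bh 1 1 F))" using F_a2[of 1] by (simp add: numeral_2_eq_2)
  show "bh 3 2 F = mconst \<i> * (qf c * mderiv U (bh 2 1 F))" using F_a2[of 2] by (simp add: numeral_3_eq_3 numeral_2_eq_2)
  have "bh 2 3 F = mconst (1 / of_nat 2) * (mconst \<i> * (qf c * mderiv U (bh 1 2 F)))"
    using mconst_cancel[OF F_Suc[of 2 1]] by (simp add: numeral_2_eq_2 numeral_3_eq_3)
  then show "bh 2 3 F = mconst (- 1 / 2) * (qf c * (qf c * mderiv U (mderiv U (bh 0 1 F))))"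
    unfolding 1 by (simp add: mconst_nf)
  have "bh 3 3 F = mconst (1 / of_nat 2) * (mconst \<i> * (qf c * mderiv U (bh 2 2 F)))"
    using mconst_cancel[OF F_Suc[of 2 2]] by (simp add: numeral_2_eq_2 numeral_3_eq_3)
  then show "bh 3 3 F = mconst (- 1 / 2) * (qf c * (qf c * mderiv U (mderiv U (bh 1 1 F))))"
    unfolding 2 by (simp add: mconst_nf)
qed

definition "W = C + ser_conj C + F + ser_conj F"

lemma conj_Dz_g: "ser_conj (Dz c g) = Eb g - mconst \<i> * (qf c * mderiv U g)"
  unfolding Dz_def by (simp add: ser_conj_add ser_conj_Ez ser_conj_mconst_times conj_q_times
        ser_conj_mderiv g_real mconst_minus)

lemma conj_R: "ser_conj R = Eb g - mconst \<i> * (qf c * mderiv U g)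
    - (Eb (ser_conj C) + Ez (ser_conj C) - mconst 2 * ser_conj C)
    - (Eb (ser_conj F) + Ez (ser_conj F) - ser_conj F) + F"
  unfolding R_def ser_conj_add ser_conj_diff conj_Dz_g ser_conj_Ez ser_conj_Eb ser_conj_mconst_times by simp

text \<open>The terms \<open>\<i> q g\<^sub>u\<close> of \<open>Dz c g\<close> and its conjugate
  cancel. \<open>F\<close> occurs once with the factor of \<open>- F\<close> and once more as the
  conjugate of the last summand of \<open>R\<close>, which brings it to the same operator as
  \<open>C\<close>.\<close>

lemma g_eq: "Ez g + Eb g = Ez W + Eb W - mconst 2 * W"
  using R_imag unfolding conj_R unfolding R_def W_def Dz_def Ez_add Eb_add mconst_numeral
  by (simp add: algebra_simps)

lemma R_eq: "mconst 2 * R = Ez g - Eb g + mconst (2 * \<i>) * (qf c * mderiv U g)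
   - (Ez (C - ser_conj C) + Eb (C - ser_conj C) - mconst 2 * (C - ser_conj C))
   - (Ez (F - ser_conj F) + Eb (F - ser_conj F))"
proof -
  have R2: "mconst 2 * R = R - ser_conj R"
    using R_imag by (simp add: mconst_numeral eq_neg_iff_add_eq_0 flip: add_uminus_conv_diff)
  show ?thesis
    unfolding R2 conj_R unfolding R_def Dz_def Ez_diff Eb_diff mconst_mult mconst_numeral
    by (simp add: algebra_simps)
qed

text \<open>The factor \<open>a + b - 2\<close> makes \<open>bh 1 1 g\<close> vanish, and at (0, 0)
  the factor on the left is 0, so \<open>bh 0 0 g\<close> stays free.\<close>

lemma g_bh: "mconst (of_nat (a + b)) * bh a b g = mconst (of_nat (a + b) - 2) * 
    (bh a b C + ser_conj (bh b a C) + bh a b F + ser_conj (bh b a F))"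
  using arg_cong[OF g_eq, of "bh a b"] 
  unfolding W_def bh_add bh_diff bh_Ez bh_Eb bh_mconst_times bh_ser_conj
  by (simp add: mconst_diff mconst_add algebra_simps)

lemma R_bh: "bh a b R = mconst (1 / 2) * (mconst (of_nat a - of_nat b) * bh a b g
   + mconst (2 * \<i>) * bh a b (qf c * mderiv U g)
   - mconst (of_nat (a + b) - 2) * (bh a b C - ser_conj (bh b a C))
   - mconst (of_nat (a + b)) * (bh a b F - ser_conj (bh b a F)))"
proof (rule mconst_cancel)
  show "mconst 2 * bh a b R = mconst (of_nat a - of_nat b) * bh a b g
   + mconst (2 * \<i>) * bh a b (qf c * mderiv U g)
   - mconst (of_nat (a + b) - 2) * (bh a b C - ser_conj (bh b a C))
   - mconst (of_nat (a + b)) * (bh a b F - ser_conj (bh b a F))"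
    using arg_cong[OF R_eq, of "bh a b"] 
    unfolding bh_add bh_diff bh_Ez bh_Eb bh_mconst_times bh_ser_conj
    by (simp add: mconst_diff mconst_add algebra_simps)
qed simp

lemma g_vals:
  "bh 1 1 g = 0"
  "bh 1 0 g = - (bh 1 0 C + ser_conj (bh 0 1 F))"
  "bh 2 1 g = mconst (1 / 3) * (bh 2 1 C + bh 2 1 F + ser_conj (bh 1 2 F))"
  "bh 2 2 g = mconst (1 / 2) * (bh 2 2 F + ser_conj (bh 2 2 F))"
  "bh 3 2 g = mconst (3 / 5) * (bh 3 2 C + bh 3 2 F + ser_conj (bh 2 3 F))"
proof -
  show "bh 1 1 g = 0" using mconst_cancel[OF g_bh[of 1 1]] by simp
  show "bh 1 0 g = - (bh 1 0 C + ser_conj (bh 0 1 F))"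
    using mconst_cancel[OF g_bh[of 1 0]] C_0[of 1] F_a0[of 1] by (simp add: mconst_minus)
  show "bh 2 1 g = mconst (1 / 3) * (bh 2 1 C + bh 2 1 F + ser_conj (bh 1 2 F))"
    using mconst_cancel[OF g_bh[of 2 1]] C_vals(2) by (simp add: add.assoc)
  show "bh 2 2 g = mconst (1 / 2) * (bh 2 2 F + ser_conj (bh 2 2 F))"
    using mconst_cancel[OF g_bh[of 2 2]] C_vals(3) by (simp add: mconst_times_mconst)
  show "bh 3 2 g = mconst (3 / 5) * (bh 3 2 C + bh 3 2 F + ser_conj (bh 2 3 F))"
    using mconst_cancel[OF g_bh[of 3 2]] C_vals(4) by (simp add: mconst_times_mconst)
qed

abbreviation "\<gamma> \<equiv> bh 1 0 C"
abbreviation "chi a \<equiv> bh a 1 F"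
abbreviation "\<psi> \<equiv> bh 0 0 g"

text \<open>\<open>chi 1\<close> and its conjugate share the bidegree (1, 1). Only the difference of
  the two enters here and in \<open>R_33\<close>, only their sum in \<open>R_22\<close>; this
  decouples the three conditions on the diagonal.\<close>

lemma R_11: "bh 1 1 R = mconst \<i> * (qf c * mderiv U \<psi>) - (chi 1 - ser_conj (chi 1))"
  unfolding R_bh[of 1 1] bh_qf_nums bh_mderiv_U
  by (simp add: C_vals(1)[simplified] mconst_times_mconst right_diff_distrib)

lemma R_22: "bh 2 2 R = mconst (- 2 * \<i>) * (qf c * (mderiv U (chi 1 + ser_conj (chi 1))))"
  unfolding R_bh[of 2 2] bh_qf_nums bh_mderiv_U F_vals C_vals g_vals
  by (simp add: mconst_nf conj_q_times mconst_minus)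

lemma R_33: "bh 3 3 R = qf c * (qf c * mderiv U (mderiv U (chi 1 - ser_conj (chi 1))))"
proof -
  define X where "X = qf c * (qf c * mderiv U (mderiv U (chi 1)))"
  define Y where "Y = qf c * (qf c * mderiv U (mderiv U (ser_conj (chi 1))))"
  have "bh 3 3 R = mconst (1 / 2) * (mconst (2 * \<i>) * (mconst (1/2) * (mconst \<i> * X - mconst \<i> * Y))
      - mconst 6 * (mconst (- 1 / 2) * X - mconst (- 1 / 2) * Y))"
    unfolding R_bh[of 3 3] bh_qf_nums bh_mderiv_U F_vals C_vals g_vals X_def Y_def
    by (simp add: mconst_nf conj_q_times mconst_minus)
  also have "\<dots> = X - Y"
    by (rule mps_eqI, simp only: mcoeff_lin) (simp add: field_simps)
  finally show ?thesis by (simp add: X_def Y_def mconst_nf)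
qed

lemma R_21: "bh 2 1 R = mconst (- 4 / 3) * (chi 2 + mconst \<i> * (qf c * mderiv U \<gamma>)
   + mconst (2 * \<i>) * (qf c * mderiv U (ser_conj (chi 0))))"
proof -
  define X where "X = qf c * mderiv U \<gamma>"
  define Y where "Y = qf c * mderiv U (ser_conj (chi 0))"
  define T where "T = chi 2"
  have "bh 2 1 R = mconst (1 / 2) * (mconst (1 / 3) * (mconst \<i> * X + T + mconst (- \<i>) * Y)
      + mconst (2 * \<i>) * (- (X + Y)) - mconst \<i> * X - mconst 3 * (T - mconst (- \<i>) * Y))"
    unfolding R_bh[of 2 1] bh_qf_nums bh_mderiv_U F_vals C_vals g_vals X_def Y_def T_def
    by (simp add: mconst_nf conj_q_times mconst_minus)
  also have "\<dots> = mconst (- 4 / 3) * (T + mconst \<i> * X + mconst (2 * \<i>) * Y)"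
    by (rule mps_eqI, simp only: mcoeff_lin) (simp add: field_simps)
  finally show ?thesis by (simp add: X_def Y_def T_def)
qed

text \<open>The first summand, prescribed by the condition at (2, 1), absorbs \<open>chi 2\<close>.
  What remains involves only \<open>\<phi>\<^sub>0\<close>: since \<open>\<gamma>\<close> contains
  half the non-integrability tensor, doubling turns the factor 3 into the \<open>6 i\<close> of
  strong nondegeneracy.\<close>

lemma R_32: "bh 3 2 R = mconst (7 / 5 * \<i>) * (qf c * mderiv U (bh 2 1 R))
   - mconst (8 / 5) * (qf c * (qf c * mderiv U (mderiv U (\<gamma> + mconst 3 * ser_conj (chi 0)))))"
proof -
  define X where "X = qf c * (qf c * mderiv U (mderiv U \<gamma>))"
  define Y where "Y = qf c * (qf c * mderiv U (mderiv U (ser_conj (chi 0))))"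
  define T where "T = qf c * mderiv U (chi 2)"
  have "bh 3 2 R = mconst (1 / 2) * (mconst (3 / 5) * (mconst (- 1/2) * X + mconst \<i> * T + mconst (- 1/2) * Y)
      + mconst (2 * \<i>) * (mconst (1 / 3) * (mconst \<i> * X + T + mconst (- \<i>) * Y))
      - mconst 3 * (mconst (- 1/2) * X) - mconst 5 * (mconst \<i> * T - mconst (- 1/2) * Y))"
    unfolding R_bh[of 3 2] bh_qf_nums bh_mderiv_U F_vals C_vals g_vals X_def Y_def T_def
    by (simp add: mconst_nf conj_q_times mconst_minus)
  also have "\<dots> = mconst (7 / 5 * \<i>) * (mconst (- 4 / 3) * (T + mconst \<i> * X + mconst (2 * \<i>) * Y))
     - mconst (8 / 5) * (X + mconst 3 * Y)"
    by (rule mps_eqI, simp only: mcoeff_lin) (simp add: field_simps)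
  finally show ?thesis unfolding R_21 by (simp add: X_def Y_def T_def mconst_nf)
qed

text \<open>From degree 3 in \<open>z\<close> on the conjugate components that could enter all
  vanish, unlike at (2, 1). So \<open>chi (a + 3)\<close> stands with a nonzero factor next to a
  term known from \<open>\<phi>\<close> two steps below.\<close>

lemma R_a1: "bh (a + 3) 1 R = mconst (- 2 * of_nat (a + 3) / of_nat (a + 4)) * chi (a + 3)
   - mconst (4 * \<i> / (of_nat (a + 2) * of_nat (a + 4))) * (qf c * mderiv U (bh (a + 2) 0 C))"
proof -
  define X where "X = qf c * mderiv U (bh (a + 2) 0 C)"
  define T where "T = chi (a + 3)"
  have n: "(of_nat a + 2 :: complex) \<noteq> 0" "(of_nat a + 4 :: complex) \<noteq> 0"
    using of_nat_eq_0_iff[of "a + 2", where ?'a = complex] of_nat_eq_0_iff[of "a + 4", where ?'a = complex] by (auto simp: add.commute)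
  have C1: "bh 1 (a + 3) C = 0" "bh 0 (a + 2) C = 0" "bh 1 (a + 3) F = 0" "bh 0 (a + 2) F = 0" "bh (a + 2) 0 F = 0"
    using C_1[of "a + 2"] C_0 F_1[of a] F_0[of a] F_a0 by (simp_all add: eval_nat_numeral)
  have CX: "bh (a + 3) 1 C = mconst \<i> * X" using C_a1[of "a + 2"] by (simp add: X_def eval_nat_numeral)
  define x :: complex where "x = of_nat a"
  have s: "of_nat (a + 3 + 1) = x + 4" "of_nat (a + 4) = x + 4" "of_nat (a + 3) = x + 3"
     "of_nat (a + 2) = x + 2" "of_nat (a + 2 + 0) = x + 2" "of_nat 1 = (1 :: complex)" by (simp_all add: x_def)
  have n: "x + 2 \<noteq> 0" "x + 4 \<noteq> 0" using n by (simp_all add: x_def add.commute)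
  have G1: "bh (a + 3) 1 g = mconst ((x + 2) / (x + 4)) * (mconst \<i> * X + T)"
    using mconst_cancel[OF g_bh[of "a + 3" 1, unfolded s]] n(2)
    unfolding C1 CX T_def[symmetric] by (simp add: mconst_times_mconst add.commute)
  have G2: "bh (a + 2) 0 g = mconst (x / (x + 2)) * bh (a + 2) 0 C"
    using mconst_cancel[OF g_bh[of "a + 2" 0, unfolded s]] n(1)
    unfolding C1 by (simp add: mconst_times_mconst)
  have G3: "bh (a + 3) 1 (qf c * mderiv U g) = mconst (x / (x + 2)) * X"
    using bh_qf_Suc[of "a + 2" 0 c "mderiv U g"] unfolding bh_mderiv_U G2
    by (simp add: mderiv_U_mconst_times qf_mconst X_def eval_nat_numeral)
  have "bh (a + 3) 1 R = mconst (1 / 2) * (mconst (x + 3 - 1) * (mconst ((x + 2) / (x + 4)) * (mconst \<i> * X + T))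
      + mconst (2 * \<i>) * (mconst (x / (x + 2)) * X)
      - mconst (x + 4 - 2) * (mconst \<i> * X - 0) - mconst (x + 4) * (T - 0))"
    unfolding R_bh[of "a + 3" 1] s G1 G3 C1 CX T_def[symmetric] ser_conj_0 ..
  also have "\<dots> = mconst (- 2 * of_nat (a + 3) / of_nat (a + 4)) * T
   - mconst (4 * \<i> / (of_nat (a + 2) * of_nat (a + 4))) * X"
  proof -
    have "2 * (x + 4) \<noteq> 0" unfolding mult_eq_0_iff using n by simp
    then have n3: "x * 2 + 8 \<noteq> 0" by (simp add: algebra_simps)
    have e1: "- 2 * (x + 3) / (x + 4) = 1 / 2 * ((x + 3 - 1) * ((x + 2) / (x + 4)) - (x + 4))"
      using n by (simp add: divide_simps) (use n3 in \<open>simp add: algebra_simps\<close>)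
    have e2: "4 * \<i> / ((x + 2) * (x + 4)) = - \<i> / 2 * ((x + 3 - 1) * ((x + 2) / (x + 4)) + 2 * (x / (x + 2)) - (x + 4 - 2))"
      using n by (simp add: divide_simps) (simp add: algebra_simps)
    define A where "A = (x + 2) / (x + 4)"
    define B where "B = x / (x + 2)"
    show ?thesis
      unfolding s e1 e2 unfolding A_def[symmetric] B_def[symmetric]
      by (rule mps_eqI, simp only: mcoeff_lin) (simp add: algebra_simps)
  qed
  finally show ?thesis by (simp add: X_def T_def)
qed

end

section \<open>Solving the linearized problem\<close>

text \<open>\<open>aF a f + bF c f\<close> is the linear part of the reduced
  \<open>L\<^sup>w\<close> evaluated on \<open>f\<close>. The Levi form stands there with a factor
  \<open>\<i>\<close>, hence the factor in \<open>bF\<close>.\<close>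

definition aF :: "('n::finite \<Rightarrow> 'n \<Rightarrow> complex) \<Rightarrow> ('n \<Rightarrow> 'n ser) \<Rightarrow> 'n ser" where
  "aF a f = (\<Sum>j\<in>UNIV. \<Sum>k\<in>UNIV. mconst (a j k) * (mvar (Z j) * f k))"

definition bF :: "('n::finite \<Rightarrow> 'n \<Rightarrow> complex) \<Rightarrow> ('n \<Rightarrow> 'n ser) \<Rightarrow> 'n ser" where
  "bF c f = (\<Sum>j\<in>UNIV. \<Sum>k\<in>UNIV. mconst (\<i> * c j k) * (mvar (Zbar j) * f k))"

lemma aF_add: "aF a (\<lambda>k. f k + g k) = aF a f + aF a g"
  by (simp add: aF_def distrib_left sum.distrib)
lemma aF_diff: "aF a (\<lambda>k. f k - g k) = aF a f - aF a g"
  by (simp add: aF_def right_diff_distrib sum_subtractf)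
lemma aF_mconst: "aF a (\<lambda>k. mconst s * f k) = mconst s * aF a f"
  by (simp add: aF_def sum_distrib_left mult_ac)
lemma aF_qf: "aF a (\<lambda>k. qf c * f k) = qf c * aF a f"
  by (simp add: aF_def sum_distrib_left mult_ac)
lemma aF_mderiv_U: "aF a (\<lambda>k. mderiv U (f k)) = mderiv U (aF a f)"
  by (simp add: aF_def mderiv_sum mderiv_mult mderiv_mvar)
lemma bh_aF_Suc: "bh (Suc m) b (aF a f) = aF a (\<lambda>k. bh m b (f k))"
  by (simp add: aF_def bh_sum bh_mconst_times bh_Z_Suc)
lemma bh_aF_0: "bh 0 b (aF a f) = 0"
  by (simp add: aF_def bh_sum bh_mconst_times bh_Z_0)
lemma Ez_aF: "Ez (aF a f) = aF a f + aF a (\<lambda>k. Ez (f k))"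
  by (simp add: aF_def Ez_sum Ez_mult Ez_mvar distrib_left sum.distrib)
lemma Eb_aF: "Eb (aF a f) = aF a (\<lambda>k. Eb (f k))"
  by (simp add: aF_def Eb_sum Eb_mult Eb_mvar)
lemma van_aF: "(\<And>k. van wt m (f k)) \<Longrightarrow> van wt (m + 1) (aF a f)"
  unfolding aF_def by (intro van_sum van_mconst_times van_mult'[where j = 1 and k = m] van_mvar) auto

lemma bF_add: "bF c (\<lambda>k. f k + g k) = bF c f + bF c g"
  by (simp add: bF_def distrib_left sum.distrib)
lemma bF_diff: "bF c (\<lambda>k. f k - g k) = bF c f - bF c g"
  by (simp add: bF_def right_diff_distrib sum_subtractf)
lemma bF_mconst: "bF c (\<lambda>k. mconst s * f k) = mconst s * bF c f"
  by (simp add: bF_def sum_distrib_left mult_ac)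
lemma bF_qf: "bF c (\<lambda>k. qf c' * f k) = qf c' * bF c f"
  by (simp add: bF_def sum_distrib_left mult_ac)
lemma bF_mderiv_U: "bF c (\<lambda>k. mderiv U (f k)) = mderiv U (bF c f)"
  by (simp add: bF_def mderiv_sum mderiv_mult mderiv_mvar)
lemma bF_0 [simp]: "bF c (\<lambda>k. 0) = 0" by (simp add: bF_def)
lemma bh_bF_Suc: "bh m (Suc b) (bF c f) = bF c (\<lambda>k. bh m b (f k))"
  by (simp add: bF_def bh_sum bh_mconst_times bh_Zbar_Suc)
lemma bh_bF_0: "bh m 0 (bF c f) = 0"
  by (simp add: bF_def bh_sum bh_mconst_times bh_Zbar_0)
lemma Ez_bF: "Ez (bF c f) = bF c (\<lambda>k. Ez (f k))"
  by (simp add: bF_def Ez_sum Ez_mult Ez_mvar)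
lemma Eb_bF: "Eb (bF c f) = bF c f + bF c (\<lambda>k. Eb (f k))"
  by (simp add: bF_def Eb_sum Eb_mult Eb_mvar distrib_left sum.distrib)
lemma van_bF: "(\<And>k. van wt m (f k)) \<Longrightarrow> van wt (m + 1) (bF c f)"
  unfolding bF_def by (intro van_sum van_mconst_times van_mult'[where j = 1 and k = m] van_mvar) auto

lemma Dz_add: "Dz c (s + t) = Dz c s + Dz c t"
  by (simp add: Dz_def Ez_add mderiv_add distrib_left)
lemma Dz_diff: "Dz c (s - t) = Dz c s - Dz c t"
  by (simp add: Dz_def Ez_diff mderiv_diff right_diff_distrib)
lemma Dz_0 [simp]: "Dz c 0 = 0" using Dz_diff[of c 0 0] by simp
lemma bh_0_Dz: "bh 0 b (Dz c s) = 0"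
  by (simp add: Dz_def bh_add bh_Ez bh_mconst_times bh_qf_0)
lemma van_Dz: "van wt k s \<Longrightarrow> van wt k (Dz c s)"
  unfolding Dz_def
  by (intro van_add van_Ez van_mconst_times van_mono[OF van_qf_times[OF van_wt_mderiv_U]]) auto

text \<open>The lowest weight part of the contribution of \<open>(f, g)\<close> to the transversal component of the
  transformed structure along the Euler field.\<close>

definition Rlin :: "('n::finite \<Rightarrow> 'n \<Rightarrow> complex) \<Rightarrow> ('n \<Rightarrow> 'n \<Rightarrow> complex) \<Rightarrow> ('n \<Rightarrow> 'n ser) \<Rightarrow> 'n ser \<Rightarrow> 'n ser" where
  "Rlin a c f g = Dz c g - aF a (\<lambda>k. Dz c (f k) - f k) - bF c (\<lambda>k. Dz c (f k)) + ser_conj (bF c f)"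

lemma Rlin_add: "Rlin a c (\<lambda>k. f k + f' k) (g + g') = Rlin a c f g + Rlin a c f' g'"
  by (simp add: Rlin_def Dz_add aF_add bF_add aF_diff ser_conj_add)

lemma Rlin_diff: "Rlin a c (\<lambda>k. f k - f' k) (g - g') = Rlin a c f g - Rlin a c f' g'"
  by (simp add: Rlin_def Dz_diff aF_diff bF_diff ser_conj_diff)

lemma Rlin_g: "Rlin a c f g = Rlin a c f 0 + Dz c g"
  by (simp add: Rlin_def)

text \<open>\<open>Dz\<close> and \<open>aF\<close> produce nothing of degree 0 in \<open>z\<close>,
  and conjugation turns the factor \<open>zbar\<close> of \<open>bF\<close> into \<open>z\<close>.
  In particular no term of bidegree (0, 0) obstructs solving for \<open>g\<close>.\<close>

lemma bh_0_Rlin: "bh 0 b (Rlin a c f g) = 0"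
proof -
  have "bh 0 b (bF c (\<lambda>k. Dz c (f k))) = 0"
    by (cases b) (simp_all add: bh_bF_0 bh_bF_Suc bh_0_Dz)
  then show ?thesis 
    by (simp add: Rlin_def bh_add bh_diff bh_0_Dz bh_aF_0 bh_ser_conj bh_bF_0)
qed

lemma van_Rlin:
  assumes "\<And>k. van wt m (f k)" "van wt (m + 1) g" shows "van wt (m + 1) (Rlin a c f g)"
  unfolding Rlin_def using assms
  by (intro van_add van_diff van_Dz van_aF van_bF van_wt_ser_conj) auto

definition uexp :: "nat \<Rightarrow> 'n cvar \<Rightarrow> nat" where "uexp m = (\<lambda>_. 0)(U := m)"

lemma exp_eq_uexp: "zdeg \<alpha> = 0 \<Longrightarrow> zbdeg \<alpha> = 0 \<Longrightarrow> \<alpha> = uexp (\<alpha> U)"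
proof
  fix v assume "zdeg \<alpha> = 0" "zbdeg \<alpha> = 0"
  then show "\<alpha> v = uexp (\<alpha> U) v"
    by (cases v) (auto simp: zdeg_eq zbdeg_eq uexp_def)
qed

lemma uexp_simps [simp]: "zdeg (uexp m) = 0" "zbdeg (uexp m) = 0" "uexp m U = m"
   "wdeg wt (uexp m) = 2 * m" "wdeg (\<lambda>_. 1) (uexp m) = m"
  by (simp_all add: uexp_def)

text \<open>The transversal normalization for all \<open>c\<close> at once: a bihomogeneous
  component is a series in \<open>u\<close>, and a condition with \<open>c + 1\<close> in place of
  \<open>c\<close> becomes the vanishing of its \<open>u\<close>-derivative.\<close>

definition nrm :: "('n::finite \<Rightarrow> 'n \<Rightarrow> complex) \<Rightarrow> 'n ser \<Rightarrow> bool" where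
  "nrm ci R \<longleftrightarrow> R + ser_conj R = 0 \<and> mderiv U (bh 1 1 R) = 0 \<and> (\<forall>a. bh (a + 2) 1 R = 0) \<and>
    ltrace ci (bh 2 2 R) = 0 \<and> ltrace ci (ltrace ci (bh 3 2 R)) = 0 \<and>
    ltrace ci (ltrace ci (ltrace ci (bh 3 3 R))) = 0"

text \<open>The monomial \<open>u\<close> has weight 2, so the weight bound on \<open>f\<close>
  still admits it and it is excluded separately. The bound on \<open>g\<close> excludes
  \<open>u\<close> but not its square, whose coefficient is half of \<open>r\<close>.\<close>

definition lin_sol where
  "lin_sol c ci a p y r f g \<longleftrightarrow> (\<forall>k. Dz c (ser_conj (f k)) + p k = 0) \<and> nrm ci (y + Rlin a c f g) \<and>
     ser_conj g = g \<and> (\<forall>k. van wt 2 (f k) \<and> mcoeff (f k) (uexp 1) = 0) \<and> van wt 3 g \<and>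
     mcoeff g (uexp 2) = of_real r / 2"

subsection \<open>The tangential equation and the real part of the transversal one\<close>

text \<open>Bidegree by bidegree, the solution of \<open>Eb f = \<i> q f\<^sub>u + P\<close> whose components of bidegree
  \<open>(a, 0)\<close> are those of \<open>\<phi> a\<close>.\<close>

fun fcomp :: "('n::finite \<Rightarrow> 'n \<Rightarrow> complex) \<Rightarrow> (nat \<Rightarrow> 'n ser) \<Rightarrow> 'n ser \<Rightarrow> nat \<Rightarrow> nat \<Rightarrow> 'n ser" where
  "fcomp c \<phi> P a 0 = bh a 0 (\<phi> a)"
| "fcomp c \<phi> P 0 (Suc b) = mconst (1 / of_nat (Suc b)) * bh 0 (Suc b) P"
| "fcomp c \<phi> P (Suc a) (Suc b) = mconst (1 / of_nat (Suc b)) *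
     (mconst \<i> * (qf c * mderiv U (fcomp c \<phi> P a b)) + bh (Suc a) (Suc b) P)"

definition fsol :: "('n::finite \<Rightarrow> 'n \<Rightarrow> complex) \<Rightarrow> (nat \<Rightarrow> 'n ser) \<Rightarrow> 'n ser \<Rightarrow> 'n ser" where
  "fsol c \<phi> P = glue (fcomp c \<phi> P)"

lemma bh_fcomp: "bh a b (fcomp c \<phi> P a b) = fcomp c \<phi> P a b"
  by (induction c \<phi> P a b rule: fcomp.induct) (simp_all add: bh_mconst_times bh_add bh_qf_Suc bh_mderiv_U)

lemma bh_fsol: "bh a b (fsol c \<phi> P) = fcomp c \<phi> P a b"
  by (simp add: fsol_def bh_glue bh_fcomp)

lemma Eb_fsol:
  assumes "\<And>a. bh a 0 P = 0"
  shows "Eb (fsol c \<phi> P) = mconst \<i> * (qf c * mderiv U (fsol c \<phi> P)) + P"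
proof (rule eq_bhI)
  fix a b
  have n: "mconst (1 + of_nat d) * (mconst (1 / (1 + of_nat d)) * x) = x" for d and x :: "'a ser"
    by (simp add: mconst_times_mconst of_nat_Suc_neq_0)
  show "bh a b (Eb (fsol c \<phi> P)) = bh a b (mconst \<i> * (qf c * mderiv U (fsol c \<phi> P)) + P)"
  proof (cases b)
    case 0
    then show ?thesis by (simp add: bh_Eb bh_add bh_mconst_times bh_qf_0' assms)
  next
    case (Suc d)
    then show ?thesis
      by (cases a) (simp_all add: bh_Eb bh_add bh_mconst_times bh_qf_0 bh_qf_Suc bh_mderiv_U bh_fsol n)
  qed
qed

text \<open>Multiplication by \<open>q\<close> gains the weight 2 that the
  \<open>u\<close>-derivation loses, so no weight is lost along a diagonal.\<close>

lemma van_fsol: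
  assumes "\<And>a. van wt m (\<phi> a)" "van wt m P" shows "van wt m (fsol c \<phi> P)"
proof (rule van_bhI)
  fix a b
  have "van wt m (fcomp c \<phi> P a b)"
    using assms
  proof (induction c \<phi> P a b rule: fcomp.induct)
    case (3 c \<phi> P a b)
    then have "van wt m (fcomp c \<phi> P a b)" by simp
    then have "van wt m (qf c * mderiv U (fcomp c \<phi> P a b))"
      by (intro van_mono[OF van_qf_times[OF van_wt_mderiv_U]]) auto
    then show ?case using 3(3) by (simp only: fcomp.simps) (intro van_mconst_times van_add van_bh)
  qed (auto intro: van_mconst_times van_bh)
  then show "van wt m (bh a b (fsol c \<phi> P))" by (simp add: bh_fsol)
qed

lemma eq_fsol:
  assumes "Eb f = mconst \<i> * (qf c * mderiv U f) + P"
  shows "f = fsol c (\<lambda>a. bh a 0 f) P"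
proof (rule eq_bhI)
  fix a b
  show "bh a b f = bh a b (fsol c (\<lambda>a. bh a 0 f) P)"
  proof (induction b arbitrary: a)
    case (Suc b)
    have e: "mconst (of_nat (Suc b)) * bh a (Suc b) f = bh a (Suc b) (mconst \<i> * (qf c * mderiv U f)) + bh a (Suc b) P"
      using arg_cong[OF assms, of "bh a (Suc b)"] by (simp only: bh_Eb bh_add)
    have "bh a (Suc b) f = mconst (1 / of_nat (Suc b)) * (bh a (Suc b) (mconst \<i> * (qf c * mderiv U f)) + bh a (Suc b) P)"
      using mconst_cancel[OF e] of_nat_neq_0[of b] by blast
    then show ?case
      by (cases a) (simp_all add: bh_mconst_times bh_qf_0 bh_qf_Suc bh_mderiv_U bh_fsol Suc)
  qed (simp add: bh_fsol)
qed

text \<open>At bidegree \<open>(0, 0)\<close> the division by zero yields 0 and \<open>\<psi>\<close> is the value.\<close>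

definition gsol :: "'n::finite ser \<Rightarrow> 'n ser \<Rightarrow> 'n ser" where
  "gsol S \<psi> = mscale (\<lambda>\<alpha>. - 1 / of_nat (zdeg \<alpha> + zbdeg \<alpha>)) (S + ser_conj S) + \<psi>"

lemma ser_conj_gsol: "ser_conj \<psi> = \<psi> \<Longrightarrow> ser_conj (gsol S \<psi>) = gsol S \<psi>"
proof -
  assume \<psi>: "ser_conj \<psi> = \<psi>"
  have "ser_conj (mscale (\<lambda>\<alpha>. - 1 / of_nat (zdeg \<alpha> + zbdeg \<alpha>)) T)
      = mscale (\<lambda>\<alpha>. - 1 / of_nat (zdeg \<alpha> + zbdeg \<alpha>)) (ser_conj T)" for T :: "'a ser"
    by (rule mps_eqI) (simp add: wdeg_comp_conj add.commute)
  then show ?thesis by (simp add: gsol_def ser_conj_add \<psi> add.commute)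
qed

lemma E_gsol:
  assumes "bh 0 0 (S + ser_conj S) = 0" "bh 0 0 \<psi> = \<psi>"
  shows "Ez (gsol S \<psi>) + Eb (gsol S \<psi>) = - (S + ser_conj S)"
proof (rule mps_eqI)
  fix \<alpha>
  have 1: "mcoeff (S + ser_conj S) \<alpha> = 0" if "zdeg \<alpha> + zbdeg \<alpha> = 0"
    using arg_cong[OF assms(1), of "\<lambda>s. mcoeff s \<alpha>"] that by (simp del: plus_mps.rep_eq)
  have 2: "of_nat (zdeg \<alpha> + zbdeg \<alpha>) * mcoeff \<psi> \<alpha> = 0"
    using arg_cong[OF assms(2), of "\<lambda>s. mcoeff s \<alpha>"] by (auto split: if_splits)
  have E: "mcoeff (Ez s + Eb s) \<alpha> = of_nat (zdeg \<alpha> + zbdeg \<alpha>) * mcoeff s \<alpha>" for s :: "'a ser"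
    by (simp add: distrib_right)
  have "mcoeff (Ez (gsol S \<psi>) + Eb (gsol S \<psi>)) \<alpha>
      = of_nat (zdeg \<alpha> + zbdeg \<alpha>) * (- 1 / of_nat (zdeg \<alpha> + zbdeg \<alpha>) * mcoeff (S + ser_conj S) \<alpha>)
        + of_nat (zdeg \<alpha> + zbdeg \<alpha>) * mcoeff \<psi> \<alpha>"
    unfolding E unfolding gsol_def plus_mps.rep_eq[of "mscale _ _"] mcoeff_mscale distrib_left ..
  also have "\<dots> = - mcoeff (S + ser_conj S) \<alpha>"
    unfolding 2 using 1 by (cases "zdeg \<alpha> + zbdeg \<alpha> = 0") (simp_all del: plus_mps.rep_eq of_nat_add add_is_0)
  finally show "mcoeff (Ez (gsol S \<psi>) + Eb (gsol S \<psi>)) \<alpha> = mcoeff (- (S + ser_conj S)) \<alpha>" by simp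
qed

lemma bh_00_gsol: "bh 0 0 \<psi> = \<psi> \<Longrightarrow> bh 0 0 (gsol S \<psi>) = \<psi>"
  by (rule mps_eqI) (auto simp: gsol_def dest: arg_cong[of _ _ "\<lambda>s. mcoeff s _"] split: if_splits)

lemma van_gsol: "van wt k S \<Longrightarrow> van wt k \<psi> \<Longrightarrow> van wt k (gsol S \<psi>)"
  unfolding gsol_def by (intro van_add van_mscale van_wt_ser_conj)

text \<open>The eigenvalues of \<open>tr\<^sup>k q\<^sup>k\<close> on the series of bidegree \<open>(1, 0)\<close> for \<open>k = 2\<close> and \<open>(0, 0)\<close> for
  \<open>k = 3\<close>, in dimension \<open>m\<close>.\<close>

definition kap2 :: "complex \<Rightarrow> complex" where "kap2 m = (2 * m + 4) * (m + 1)"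
definition kap3 :: "complex \<Rightarrow> complex" where "kap3 m = (3 * m + 6) * (2 * m + 2) * m"

text \<open>The inverse of \<open>s \<mapsto> tr (q s)\<close> at bidegree \<open>(1, 1)\<close>.\<close>

definition inv_trace_q :: "('n::finite \<Rightarrow> 'n \<Rightarrow> complex) \<Rightarrow> ('n \<Rightarrow> 'n \<Rightarrow> complex) \<Rightarrow> 'n ser \<Rightarrow> 'n ser" where
  "inv_trace_q c ci s = mconst (1 / (of_nat CARD('n) + 2)) *
     (s - mconst (1 / (2 * of_nat CARD('n) + 2)) * (qf c * ltrace ci s))"

text \<open>In dimension \<open>nn\<close>: \<open>c\<close> is the Levi form, \<open>ci\<close> its inverse, \<open>2 a\<close> the transversal
  non-integrability tensor, and \<open>M1\<close>, \<open>M2\<close> describe the inverse \<open>v \<mapsto> M1 v + M2 vbar\<close> of the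
  real-linear operator in the second condition of strong nondegeneracy.\<close>

locale levi_data =
  fixes c ci a M1 M2 :: "'n::finite \<Rightarrow> 'n \<Rightarrow> complex" and nn :: complex
  assumes nn_def: "nn = of_nat CARD('n)"
    and c_herm: "\<And>j k. cnj (c j k) = c k j"
    and ci_herm: "\<And>j k. cnj (ci j k) = ci k j"
    and a_skew: "\<And>j k. a k j = - a j k"
    and ci1: "\<And>j l. (\<Sum>k\<in>UNIV. ci j k * c l k) = (if j = l then 1 else 0)"
    and ci2: "\<And>k l. (\<Sum>j\<in>UNIV. ci j k * c j l) = (if k = l then 1 else 0)"
    and M_left1: "\<And>j m. (\<Sum>k\<in>UNIV. M1 j k * a k m + M2 j k * (3 * \<i> * c k m)) = (if j = m then 1 else 0)"
    and M_left2: "\<And>j m. (\<Sum>k\<in>UNIV. M1 j k * (- 3 * \<i> * c m k) + M2 j k * cnj (a k m)) = 0"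
    and M_right1: "\<And>k m. (\<Sum>j\<in>UNIV. a k j * M1 j m - 3 * \<i> * c j k * cnj (M2 j m)) = (if k = m then 1 else 0)"
    and M_right2: "\<And>k m. (\<Sum>j\<in>UNIV. a k j * M2 j m - 3 * \<i> * c j k * cnj (M1 j m)) = 0"
begin

abbreviation "tr \<equiv> ltrace ci"
abbreviation "q \<equiv> qf c"

lemma conj_q [simp]: "ser_conj q = q"
  by (rule ser_conj_qf[OF c_herm])

lemma conj_q_times: "ser_conj (q * s) = q * ser_conj s"
  by (simp add: ser_conj_mult)

lemma conj_tr: "ser_conj (tr s) = tr (ser_conj s)"
  by (rule ser_conj_ltrace[OF ci_herm])

lemma Dz_conj: "Dz c g + ser_conj (Dz c g) = Ez g + Eb g" if "ser_conj g = g"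
  unfolding Dz_def using that by (simp add: ser_conj_add ser_conj_Ez ser_conj_mconst_times conj_q_times
        ser_conj_mderiv mconst_minus)

text \<open>In the real part \<open>g\<close> enters through \<open>Ez g + Eb g\<close> only, so
  dividing by the Euler degree solves for it. At (0, 0), where this degree is 0, there is nothing to
  solve, since neither \<open>y\<close> nor \<open>Rlin\<close> has a part of degree 0 in
  \<open>z\<close>.\<close>

lemma Rlin_gsol:
  fixes f :: "'n \<Rightarrow> 'n ser"
  assumes "\<And>b. bh 0 b y = 0" "ser_conj \<psi> = \<psi>" "bh 0 0 \<psi> = \<psi>"
  defines "R \<equiv> y + Rlin a c f (gsol (y + Rlin a c f 0) \<psi>)"
  shows "R + ser_conj R = 0"
proof -
  define S where "S = y + Rlin a c f 0"
  have "bh 0 0 (S + ser_conj S) = 0"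
    by (simp add: S_def bh_add bh_0_Rlin assms(1) bh_ser_conj)
  note E = E_gsol[OF this assms(3)]
  have "R = S + Dz c (gsol S \<psi>)" unfolding R_def S_def by (subst Rlin_g) (simp add: add.assoc)
  then have "R + ser_conj R = S + ser_conj S + (Dz c (gsol S \<psi>) + ser_conj (Dz c (gsol S \<psi>)))"
    by (simp add: ser_conj_add algebra_simps)
  then show ?thesis by (simp add: Dz_conj ser_conj_gsol assms(2) E)
qed

text \<open>Conjugation turns the equation for \<open>fbar\<close> along \<open>z\<close> into one
  for \<open>f\<close> along \<open>zbar\<close>, which is a recursion in the degree in
  \<open>zbar\<close>.\<close>

lemma tangential_iff:
  "Dz c (ser_conj s) + p = 0 \<longleftrightarrow> Eb s = mconst \<i> * (q * mderiv U s) + (- ser_conj p)"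
proof -
  have 1: "ser_conj (Dz c (ser_conj s) + p) = Eb s - mconst \<i> * (q * mderiv U s) + ser_conj p"
    unfolding Dz_def by (simp add: ser_conj_add ser_conj_Ez ser_conj_mconst_times conj_q_times ser_conj_mderiv mconst_minus)
  have "Dz c (ser_conj s) + p = 0 \<longleftrightarrow> ser_conj (Dz c (ser_conj s) + p) = 0"
    by (metis ser_conj_0 ser_conj_ser_conj)
  also have "\<dots> \<longleftrightarrow> Eb s = mconst \<i> * (q * mderiv U s) + (- ser_conj p)"
    unfolding 1 by (simp add: algebra_simps eq_diff_eq add_eq_0_iff)
  finally show ?thesis .
qed

subsection \<open>Traces\<close>

abbreviation "\<kappa>2 \<equiv> kap2 nn"
abbreviation "\<kappa>3 \<equiv> kap3 nn"

lemma nn_nz: "nn + 1 \<noteq> 0" "nn + 2 \<noteq> 0" "nn \<noteq> 0" "2 * nn + 2 \<noteq> 0" "\<kappa>2 \<noteq> 0" "\<kappa>3 \<noteq> 0"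
proof -
  have N: "CARD('n) > 0" by simp
  have eqs: "nn + 1 = of_nat (CARD('n) + 1)" "nn + 2 = of_nat (CARD('n) + 2)"
    "2 * nn + 2 = of_nat (2 * CARD('n) + 2)" "2 * nn + 4 = of_nat (2 * CARD('n) + 4)"
    "3 * nn + 6 = of_nat (3 * CARD('n) + 6)"
    by (simp_all add: nn_def)
  show "nn + 1 \<noteq> 0" "nn + 2 \<noteq> 0" "nn \<noteq> 0" "2 * nn + 2 \<noteq> 0" "\<kappa>2 \<noteq> 0" "\<kappa>3 \<noteq> 0"
    unfolding kap2_def kap3_def mult_eq_0_iff eqs unfolding nn_def of_nat_eq_0_iff using N by linarith+
qed

lemma tr_q: assumes "bh a' b' s = s" shows "tr (q * s) = q * tr s + mconst (nn + of_nat (a' + b')) * s"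
proof -
  have "Ez s = mconst (of_nat a') * s" "Eb s = mconst (of_nat b') * s"
    using Ez_bh[of a' b' s] Eb_bh[of a' b' s] assms by simp_all
  then show ?thesis
    by (simp add: ltrace_qf_times[OF ci1 ci2] mconst_add distrib_right add.assoc nn_def)
qed

lemma tr_00: "bh 0 b' s = s \<Longrightarrow> tr s = 0" "bh a' 0 s = s \<Longrightarrow> tr s = 0"
proof -
  show "tr s = 0" if "bh 0 b' s = s" 
    using mderiv_Z_bh_0[of _ b' s] that by (simp add: ltrace_def)
  show "tr s = 0" if "bh a' 0 s = s" 
    using mderiv_Zbar_bh_0[of _ a' s] that by (simp add: ltrace_def mderiv_commute)
qed

text \<open>The trace is commuted past one \<open>q\<close> at a time: it gives
  \<open>nn + 1\<close> on \<open>q s\<close>, and \<open>(nn + 1) + (nn + 3)\<close> on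
  \<open>q (q s)\<close>. The product of the two is \<open>\<kappa>2\<close>.\<close>

lemma tr2_qq: assumes "bh 1 0 s = s" shows "tr (tr (q * (q * s))) = mconst \<kappa>2 * s"
proof -
  have 0: "tr s = 0" using assms by (rule tr_00)
  have 1: "tr (q * s) = mconst (nn + 1) * s" using tr_q[OF assms] 0 by simp
  have "bh 2 1 (q * s) = q * s" using bh_qf_nums(2)[of c s] assms by simp
  from tr_q[OF this] have "tr (q * (q * s)) = q * (mconst (nn + 1) * s) + mconst (nn + 3) * (q * s)"
    unfolding 1 by simp
  also have "\<dots> = mconst (2 * nn + 4) * (q * s)" unfolding qf_mconst
    by (rule mps_eqI, simp only: mcoeff_lin) (simp add: algebra_simps)
  finally show ?thesis by (simp add: ltrace_mconst_times 1 mconst_times_mconst kap2_def)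
qed

text \<open>The successive factors are \<open>nn\<close>, \<open>nn + (nn + 2)\<close> and
  \<open>(2 * nn + 2) + (nn + 4)\<close>; their product is \<open>\<kappa>3\<close>.\<close>

lemma tr3_qqq: assumes "bh 0 0 s = s" shows "tr (tr (tr (q * (q * (q * s))))) = mconst \<kappa>3 * s"
proof -
  have 0: "tr s = 0" using assms by (rule tr_00)
  have 1: "tr (q * s) = mconst nn * s" using tr_q[OF assms] 0 by simp
  have b1: "bh 1 1 (q * s) = q * s" using bh_qf_nums(1)[of c s] assms by simp
  from tr_q[OF this] have "tr (q * (q * s)) = q * (mconst nn * s) + mconst (nn + 2) * (q * s)"
    unfolding 1 by simp
  also have "\<dots> = mconst (2 * nn + 2) * (q * s)" unfolding qf_mconst
    by (rule mps_eqI, simp only: mcoeff_lin) (simp add: algebra_simps)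
  finally have 2: "tr (q * (q * s)) = mconst (2 * nn + 2) * (q * s)" .
  have "bh 2 2 (q * (q * s)) = q * (q * s)" using bh_qf_nums(3)[of c "q * s"] b1 by simp
  from tr_q[OF this] have "tr (q * (q * (q * s))) = q * (mconst (2 * nn + 2) * (q * s)) + mconst (nn + 4) * (q * (q * s))"
    unfolding 2 by simp
  also have "\<dots> = mconst (3 * nn + 6) * (q * (q * s))" unfolding qf_mconst
    by (rule mps_eqI, simp only: mcoeff_lin) (simp add: algebra_simps)
  finally show ?thesis by (simp add: ltrace_mconst_times 1 2 mconst_times_mconst kap3_def)
qed

abbreviation "TI \<equiv> inv_trace_q c ci"

lemma TI_def: "TI s = mconst (1 / (nn + 2)) * (s - mconst (1 / (2 * nn + 2)) * (q * tr s))"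
  by (simp add: inv_trace_q_def nn_def)

lemma bh_tr_11: "bh 1 1 s = s \<Longrightarrow> bh 0 0 (tr s) = tr s"
  by (simp add: bh_ltrace)

lemma tr_q_tr: "bh 1 1 s = s \<Longrightarrow> tr (q * tr s) = mconst nn * tr s"
  using tr_q[OF bh_tr_11, of s] tr_00(1)[OF bh_tr_11, of s] by simp

text \<open>On bidegree (1, 1) the map \<open>s \<mapsto> tr (q * s)\<close> is
  \<open>nn + 2\<close> plus the map \<open>s \<mapsto> q * tr s\<close>, whose image consists of
  multiples of \<open>q\<close>, on which it is multiplication by \<open>nn\<close>. So the
  eigenvalues to be inverted are \<open>nn + 2\<close> and \<open>2 * nn + 2\<close>.\<close>

lemma TI_right: assumes "bh 1 1 s = s" shows "tr (q * TI s) = s"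
proof -
  have b: "bh 1 1 (TI s) = TI s"
    unfolding TI_def bh_mconst_times bh_diff bh_qf_nums bh_tr_11[OF assms] assms ..
  have t: "tr (TI s) = mconst (1 / (nn + 2)) * (tr s - mconst (1 / (2 * nn + 2)) * (mconst nn * tr s))"
    by (simp only: TI_def ltrace_mconst_times ltrace_diff tr_q_tr[OF assms])
  have "tr (q * TI s) = q * (mconst (1 / (nn + 2)) * (tr s - mconst (1 / (2 * nn + 2)) * (mconst nn * tr s)))
     + mconst (nn + of_nat (1 + 1)) * (mconst (1 / (nn + 2)) * (s - mconst (1 / (2 * nn + 2)) * (q * tr s)))"
    unfolding tr_q[OF b] t by (simp add: TI_def)
  also have "\<dots> = s"
    unfolding mconst_nf
    by (rule mps_eqI, simp only: mcoeff_lin) (use nn_nz in \<open>simp add: divide_simps\<close>, simp add: algebra_simps)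
  finally show ?thesis .
qed

lemma TI_left: assumes "bh 1 1 s = s" shows "TI (tr (q * s)) = s"
proof -
  have t: "tr (q * s) = q * tr s + mconst (nn + 2) * s" using tr_q[OF assms] by simp
  show ?thesis
    unfolding TI_def t ltrace_add ltrace_mconst_times tr_q_tr[OF assms] mconst_nf
    by (rule mps_eqI, simp only: mcoeff_lin) (use nn_nz in \<open>simp add: divide_simps\<close>, simp add: algebra_simps)
qed

lemma van_TI: "van wt k s \<Longrightarrow> van wt k (TI s)"
  unfolding TI_def
  by (intro van_mconst_times van_diff van_mono[OF van_qf_times[OF van_ltrace]]) auto

end

section \<open>Inverting the Levi pairing and the real-linear system for the component of bidegree
  (0, 0)\<close>

definition inv_levi :: "('n::finite \<Rightarrow> 'n \<Rightarrow> complex) \<Rightarrow> 'n ser \<Rightarrow> 'n \<Rightarrow> 'n ser" where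
  "inv_levi ci s k = mconst (- \<i>) * (\<Sum>j\<in>UNIV. mconst (ci j k) * mderiv (Zbar j) s)"

text \<open>The solution \<open>\<xi>\<close> of
  \<open>aF a \<xi> + 3 * ser_conj (bF c \<xi>) = l\<close> among series in \<open>u\<close>: the
  derivatives of \<open>l\<close> are its coefficients as a linear form in \<open>z\<close>, and
  \<open>M1\<close>, \<open>M2\<close> invert the operator.\<close>

definition msol :: "('n::finite \<Rightarrow> 'n \<Rightarrow> complex) \<Rightarrow> ('n \<Rightarrow> 'n \<Rightarrow> complex) \<Rightarrow> 'n ser \<Rightarrow> 'n \<Rightarrow> 'n ser" where
  "msol M1 M2 l j = (\<Sum>k\<in>UNIV. mconst (M1 j k) * mderiv (Z k) l) + (\<Sum>k\<in>UNIV. mconst (M2 j k) * ser_conj (mderiv (Z k) l))"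

lemma vanD: "van \<omega> k s \<Longrightarrow> wdeg \<omega> \<alpha> < k \<Longrightarrow> mcoeff s \<alpha> = 0"
  by (simp add: van_def)

lemma sum_matrix:
  "(\<Sum>k\<in>UNIV. mconst (A k) * (\<Sum>m\<in>UNIV. mconst (B k m) * x m)) =
   (\<Sum>m\<in>UNIV. mconst (\<Sum>k\<in>(UNIV :: 'k::finite set). A k * B k m) * (x (m :: 'm::finite) :: 'v::finite mps))"
  unfolding sum_distrib_left mconst_times_mconst
  by (subst sum.swap) (simp add: mconst_sum sum_distrib_right)

lemma aF_alt: "aF a f = (\<Sum>k\<in>UNIV. mvar (Z k) * (\<Sum>j\<in>UNIV. mconst (a k j) * f j))"
  by (simp add: aF_def sum_distrib_left mult_ac)

lemma bF_alt: "bF c f = (\<Sum>k\<in>UNIV. mvar (Zbar k) * (\<Sum>j\<in>UNIV. mconst (\<i> * c k j) * f j))"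
  by (simp add: bF_def sum_distrib_left mult_ac)

lemma mderiv_Zbar_bF:
  assumes "\<And>k. mderiv (Zbar l) (f k) = 0"
  shows "mderiv (Zbar l) (bF c f) = (\<Sum>k\<in>UNIV. mconst (\<i> * c l k) * f k)"
  by (simp add: bF_alt mderiv_sum mderiv_mult mderiv_mvar assms if_01_mult)

lemma mderiv_Z_aF:
  assumes "\<And>k. mderiv (Z l) (f k) = 0"
  shows "mderiv (Z l) (aF a f) = (\<Sum>k\<in>UNIV. mconst (a l k) * f k)"
  by (simp add: aF_alt mderiv_sum mderiv_mult mderiv_mvar assms if_01_mult)

lemma bh_inv_levi: "bh m 0 (inv_levi ci s k) = inv_levi ci (bh m 1 s) k"
  by (simp add: inv_levi_def bh_mconst_times bh_sum bh_mderiv_Zbar)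

lemma van_inv_levi: "van wt m s \<Longrightarrow> van wt (m - 1) (inv_levi ci s k)"
  unfolding inv_levi_def
  by (intro van_mconst_times van_sum van_mono[OF van_mderiv'[where \<omega> = wt and k = m]]) auto

lemma van_msol: assumes "van wt m l" shows "van wt (m - 1) (msol M1 M2 l j)"
proof -
  have "van wt (m - 1) (mderiv (Z k) l)" for k using van_mderiv'[OF assms, of "Z k"] by simp
  then show ?thesis unfolding msol_def
    by (intro van_add van_sum van_mconst_times van_wt_ser_conj)
qed

lemma mint3_mderiv3:
  assumes "\<And>\<alpha>. \<alpha> U < 3 \<Longrightarrow> mcoeff s \<alpha> = 0"
  shows "mint (mint (mint (mderiv U (mderiv U (mderiv U s))))) = s"
proof -
  have "mint (mderiv U (mderiv U (mderiv U s))) = mderiv U (mderiv U s)"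
    by (rule mint_mderiv) (simp add: assms)
  moreover have "mint (mderiv U (mderiv U s)) = mderiv U s"
    by (rule mint_mderiv) (simp add: assms)
  moreover have "mint (mderiv U s) = s"
    by (rule mint_mderiv) (simp add: assms)
  ultimately show ?thesis by simp
qed

lemma mint2_mderiv2:
  assumes "\<And>\<alpha>. \<alpha> U < 2 \<Longrightarrow> mcoeff s \<alpha> = 0"
  shows "mint (mint (mderiv U (mderiv U s))) = s"
proof -
  have "mint (mderiv U (mderiv U s)) = mderiv U s"
    by (rule mint_mderiv) (simp add: assms)
  moreover have "mint (mderiv U s) = s"
    by (rule mint_mderiv) (simp add: assms)
  ultimately show ?thesis by simp
qed

context levi_data
begin

lemma conj_bF: "ser_conj (bF c f) = (\<Sum>k\<in>UNIV. mvar (Z k) * (\<Sum>j\<in>UNIV. mconst (- \<i> * c j k) * ser_conj (f j)))"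
  by (simp add: bF_alt ser_conj_sum ser_conj_mult c_herm)

lemma mderiv_Z_conj_bF:
  assumes "\<And>k. mderiv (Zbar l) (f k) = 0"
  shows "mderiv (Z l) (ser_conj (bF c f)) = (\<Sum>k\<in>UNIV. mconst (- \<i> * c k l) * ser_conj (f k))"
proof -
  have "mderiv (Z l) (ser_conj (f k)) = 0" for k
    using arg_cong[OF assms, of ser_conj] by (simp add: ser_conj_mderiv)
  then show ?thesis
    by (simp add: conj_bF mderiv_sum mderiv_mult mderiv_mvar if_01_mult)
qed

lemma inv_levi_bF:
  assumes "\<And>k. bh m 0 (\<phi> k) = \<phi> k" shows "inv_levi ci (bF c \<phi>) k = \<phi> k"
proof -
  have "mderiv (Zbar l) (\<phi> k) = 0" for l k using mderiv_Zbar_bh_0[of l m "\<phi> k"] assms by simp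
  then have "inv_levi ci (bF c \<phi>) k = mconst (- \<i>) * (\<Sum>j\<in>UNIV. mconst (ci j k) * (\<Sum>l\<in>UNIV. mconst (\<i> * c j l) * \<phi> l))"
    by (simp add: inv_levi_def mderiv_Zbar_bF)
  also have "\<dots> = mconst (- \<i>) * (\<Sum>l\<in>UNIV. mconst \<i> * (mconst (\<Sum>j\<in>UNIV. ci j k * c j l) * \<phi> l))"
  proof -
    have "(\<Sum>j\<in>UNIV. ci j k * (\<i> * c j l)) = \<i> * (\<Sum>j\<in>UNIV. ci j k * c j l)" for l
      by (simp add: sum_distrib_left mult_ac)
    then show ?thesis unfolding sum_matrix by (simp only: mconst_times_mconst)
  qed
  also have "\<dots> = mconst (- \<i>) * (mconst \<i> * \<phi> k)"
    unfolding sum_distrib_left[symmetric] ci2 sum_mconst_delta ..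
  also have "\<dots> = \<phi> k" by (simp add: mconst_times_mconst)
  finally show ?thesis .
qed

lemma bF_inv_levi:
  assumes "bh m 1 s = s" shows "bF c (inv_levi ci s) = s"
proof -
  have "(\<Sum>j\<in>UNIV. mconst (\<i> * c k j) * inv_levi ci s j) = mderiv (Zbar k) s" for k
  proof -
    have "(\<Sum>j\<in>UNIV. mconst (\<i> * c k j) * inv_levi ci s j)
        = (\<Sum>j\<in>UNIV. mconst (c k j) * (\<Sum>l\<in>UNIV. mconst (ci l j) * mderiv (Zbar l) s))"
    proof (intro sum.cong refl)
      fix j
      have "\<i> * c k j * (- \<i>) = c k j" by (simp add: complex_eq_iff)
      then show "mconst (\<i> * c k j) * inv_levi ci s j = mconst (c k j) * (\<Sum>l\<in>UNIV. mconst (ci l j) * mderiv (Zbar l) s)"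
        unfolding inv_levi_def mconst_times_mconst by (simp only:)
    qed
    also have "\<dots> = (\<Sum>l\<in>UNIV. mconst (\<Sum>j\<in>UNIV. ci l j * c k j) * mderiv (Zbar l) s)"
      unfolding sum_matrix by (simp add: mult.commute)
    finally show ?thesis by (simp add: ci1 sum_mconst_delta)
  qed
  then have "bF c (inv_levi ci s) = Eb s" by (simp add: bF_alt Eb_eq)
  \<comment> \<open>Euler's identity: \<open>s\<close> is homogeneous of degree 1 in
    \<open>zbar\<close>.\<close>
  also have "\<dots> = s" using Eb_bh[of m 1 s] assms by simp
  finally show ?thesis .
qed

text \<open>The operator is only real-linear, so the coefficients of \<open>\<xi>\<close> and of its
  conjugate are collected separately; \<open>M_left1\<close> and \<open>M_left2\<close> evaluate the
  two collections.\<close>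

lemma msol_left:
  assumes \<xi>: "\<And>j. bh 0 0 (\<xi> j) = \<xi> j"
  shows "msol M1 M2 (aF a \<xi> + mconst 3 * ser_conj (bF c \<xi>)) j = \<xi> j"
proof -
  define l where "l = aF a \<xi> + mconst 3 * ser_conj (bF c \<xi>)"
  have d: "mderiv (Zbar k) (\<xi> j) = 0" "mderiv (Z k) (\<xi> j) = 0" for k j
    using mderiv_Zbar_bh_0[of k 0 "\<xi> j"] mderiv_Z_bh_0[of k 0 "\<xi> j"] \<xi> by simp_all
  have dl: "mderiv (Z k) l = (\<Sum>m\<in>UNIV. mconst (a k m) * \<xi> m) + (\<Sum>m\<in>UNIV. mconst (- 3 * \<i> * c m k) * ser_conj (\<xi> m))" for k
    unfolding l_def mderiv_add mderiv_mult mderiv_mconst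
    by (simp add: mderiv_Z_aF d mderiv_Z_conj_bF sum_distrib_left mconst_times_mconst mult.assoc)
  have dlc: "ser_conj (mderiv (Z k) l) = (\<Sum>m\<in>UNIV. mconst (cnj (a k m)) * ser_conj (\<xi> m)) + (\<Sum>m\<in>UNIV. mconst (3 * \<i> * c k m) * \<xi> m)" for k
    unfolding dl by (simp add: ser_conj_add ser_conj_sum ser_conj_mconst_times c_herm)
  have "msol M1 M2 l j = 
     ((\<Sum>m\<in>UNIV. mconst (\<Sum>k\<in>UNIV. M1 j k * a k m) * \<xi> m) + (\<Sum>m\<in>UNIV. mconst (\<Sum>k\<in>UNIV. M2 j k * (3 * \<i> * c k m)) * \<xi> m))
   + ((\<Sum>m\<in>UNIV. mconst (\<Sum>k\<in>UNIV. M1 j k * (- 3 * \<i> * c m k)) * ser_conj (\<xi> m)) + 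
      (\<Sum>m\<in>UNIV. mconst (\<Sum>k\<in>UNIV. M2 j k * cnj (a k m)) * ser_conj (\<xi> m)))"
    unfolding msol_def dlc unfolding dl distrib_left sum.distrib sum_matrix by (simp only: add_ac)
  also have "\<dots> = (\<Sum>m\<in>UNIV. mconst (\<Sum>k\<in>UNIV. M1 j k * a k m + M2 j k * (3 * \<i> * c k m)) * \<xi> m)
      + (\<Sum>m\<in>UNIV. mconst (\<Sum>k\<in>UNIV. M1 j k * (- 3 * \<i> * c m k) + M2 j k * cnj (a k m)) * ser_conj (\<xi> m))"
    by (simp only: sum.distrib mconst_add distrib_right)
  also have "\<dots> = \<xi> j" unfolding M_left1 M_left2 by (simp add: sum_mconst_delta)
  finally show ?thesis by (simp add: l_def)
qed

lemma msol_right: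
  assumes l: "bh 1 0 l = l"
  shows "aF a (msol M1 M2 l) + mconst 3 * ser_conj (bF c (msol M1 M2 l)) = l"
proof -
  define d where "d m = mderiv (Z m) l" for m
  have c: "ser_conj (msol M1 M2 l j) = (\<Sum>m\<in>UNIV. mconst (cnj (M1 j m)) * ser_conj (d m)) + (\<Sum>m\<in>UNIV. mconst (cnj (M2 j m)) * d m)" for j
    by (simp add: msol_def d_def ser_conj_add ser_conj_sum ser_conj_mconst_times)
  have s: "msol M1 M2 l j = (\<Sum>m\<in>UNIV. mconst (M1 j m) * d m) + (\<Sum>m\<in>UNIV. mconst (M2 j m) * ser_conj (d m))" for j
    by (simp add: msol_def d_def)
  have "(\<Sum>j\<in>UNIV. mconst (a k j) * msol M1 M2 l j) + (\<Sum>j\<in>UNIV. mconst (- (3 * \<i> * c j k)) * ser_conj (msol M1 M2 l j)) = d k" for k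
  proof -
    have "(\<Sum>j\<in>UNIV. mconst (a k j) * msol M1 M2 l j) + (\<Sum>j\<in>UNIV. mconst (- (3 * \<i> * c j k)) * ser_conj (msol M1 M2 l j))
        = ((\<Sum>m\<in>UNIV. mconst (\<Sum>j\<in>UNIV. a k j * M1 j m) * d m) + (\<Sum>m\<in>UNIV. mconst (\<Sum>j\<in>UNIV. - (3 * \<i> * c j k) * cnj (M2 j m)) * d m))
        + ((\<Sum>m\<in>UNIV. mconst (\<Sum>j\<in>UNIV. a k j * M2 j m) * ser_conj (d m)) + (\<Sum>m\<in>UNIV. mconst (\<Sum>j\<in>UNIV. - (3 * \<i> * c j k) * cnj (M1 j m)) * ser_conj (d m)))"
      unfolding c unfolding s distrib_left sum.distrib sum_matrix by (simp only: add_ac)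
    also have "\<dots> = (\<Sum>m\<in>UNIV. mconst (\<Sum>j\<in>UNIV. a k j * M1 j m - 3 * \<i> * c j k * cnj (M2 j m)) * d m)
       + (\<Sum>m\<in>UNIV. mconst (\<Sum>j\<in>UNIV. a k j * M2 j m - 3 * \<i> * c j k * cnj (M1 j m)) * ser_conj (d m))"
      by (simp only: sum.distrib mconst_add distrib_right diff_conv_add_uminus mult_minus_left)
    also have "\<dots> = d k" unfolding M_right1 M_right2 by (simp add: sum_mconst_delta)
    finally show ?thesis .
  qed
  moreover have "mconst 3 * ser_conj (bF c x) =
      (\<Sum>k\<in>UNIV. mvar (Z k) * (\<Sum>j\<in>UNIV. mconst (- (3 * \<i> * c j k)) * ser_conj (x j)))" for x
    unfolding conj_bF by (simp add: sum_distrib_left mult.left_commute[of "mconst 3" "mvar _"] mconst_times_mconst mult.assoc)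
  ultimately have "aF a (msol M1 M2 l) + mconst 3 * ser_conj (bF c (msol M1 M2 l)) = (\<Sum>k\<in>UNIV. mvar (Z k) * d k)"
    unfolding aF_alt by (simp only: sum.distrib[symmetric] distrib_left[symmetric])
  also have "\<dots> = Ez l" by (simp add: Ez_eq d_def)
  also have "\<dots> = l" using Ez_bh[of 1 0 l] l by simp
  finally show ?thesis .
qed

text \<open>On solutions of the homogeneous tangential equation \<open>Dz\<close> acts as
  \<open>Ez + Eb\<close>. Pairing with \<open>z\<close> or \<open>zbar\<close> raises the degree by
  one; correcting for this produces the summands \<open>- 2 C\<close> and \<open>- F\<close> in the
  assumption \<open>R_def\<close>.\<close>

lemma hom_interp:
  assumes tang: "\<And>k. Dz c (ser_conj (f k)) = 0" and g: "ser_conj g = g"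
    and R: "Rlin a c f g + ser_conj (Rlin a c f g) = 0"
  shows "hom_scalars c (aF a f) (bF c f) g (Rlin a c f g)"
proof
  have Ebf: "Eb (f k) = mconst \<i> * (q * mderiv U (f k))" for k
    using tangential_iff[of "f k" 0] tang by simp
  have Dzf: "Dz c (f k) = Ez (f k) + Eb (f k)" for k by (simp add: Dz_def Ebf)
  show EbC: "Eb (aF a f) = mconst \<i> * (q * mderiv U (aF a f))"
    by (simp add: Eb_aF Ebf aF_mconst aF_qf aF_mderiv_U)
  show EbF: "Eb (bF c f) = bF c f + mconst \<i> * (q * mderiv U (bF c f))"
    by (simp add: Eb_bF Ebf bF_mconst bF_qf bF_mderiv_U)
  show "Rlin a c f g = Dz c g - (Ez (aF a f) + Eb (aF a f) - mconst 2 * aF a f)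
      - (Ez (bF c f) + Eb (bF c f) - bF c f) + ser_conj (bF c f)"
    by (simp add: Rlin_def Dzf aF_diff aF_add bF_add Ez_aF Eb_aF Ez_bF Eb_bF mconst_numeral algebra_simps)
qed (use c_herm g R bh_aF_0 in auto)

text \<open>The formulas of \<open>hom_scalars\<close> are solved for the free data of an arbitrary
  solution while the weights are recorded. Since \<open>y\<close> may be zero, with \<open>m\<close>
  arbitrary, the uniqueness is included.\<close>

lemma hom_stable:
  assumes tang: "\<And>k. Dz c (ser_conj (f k)) = 0" and g: "ser_conj g = g"
    and y_imag: "y + ser_conj y = 0" and n: "nrm ci (y + Rlin a c f g)"
    and f2: "\<And>k. van wt 2 (f k)" "\<And>k. mcoeff (f k) (uexp 1) = 0"
    and g3: "van wt 3 g" "mcoeff g (uexp 2) = 0"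
    and y: "van wt (m + 1) y"
  shows "van wt m (f k)" "van wt (m + 1) g"
proof -
  define R where "R = Rlin a c f g"
  define C where "C = aF a f"
  define F where "F = bF c f"
  have R_im: "R + ser_conj R = 0"
  proof -
    have "(y + ser_conj y) + (R + ser_conj R) = 0"
      using n unfolding nrm_def R_def ser_conj_add by (simp add: algebra_simps)
    then show ?thesis by (simp add: y_imag)
  qed
  interpret h: hom_scalars c C F g R
    unfolding C_def F_def R_def by (rule hom_interp[OF tang g R_im[unfolded R_def]])
  define \<psi> where "\<psi> = bh 0 0 g"
  define \<chi>1 where "\<chi>1 = bh 1 1 F"
  define \<delta> where "\<delta> = \<chi>1 - ser_conj \<chi>1"
  define \<sigma> where "\<sigma> = \<chi>1 + ser_conj \<chi>1"
  define y11 where "y11 = bh 1 1 y"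
  have Y: "van wt (m + 1) (bh i j y)" for i j by (rule van_bh[OF y])
  have n11: "mderiv U y11 + mderiv U (bh 1 1 R) = 0"
    using n unfolding nrm_def bh_add mderiv_add R_def y11_def by blast
  have n22: "tr (bh 2 2 y) + tr (bh 2 2 R) = 0"
    using n unfolding nrm_def bh_add ltrace_add R_def by blast
  have n32: "tr (tr (bh 3 2 y)) + tr (tr (bh 3 2 R)) = 0"
    using n unfolding nrm_def bh_add ltrace_add R_def by blast
  have n33: "tr (tr (tr (bh 3 3 y))) + tr (tr (tr (bh 3 3 R))) = 0"
    using n unfolding nrm_def bh_add ltrace_add R_def by blast
  have na1: "bh (l + 2) 1 R = - bh (l + 2) 1 y" for l
    using n unfolding nrm_def bh_add R_def by (metis add.commute eq_neg_iff_add_eq_0)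
  have dR11: "mderiv U (bh 1 1 R) = mconst \<i> * (q * mderiv U (mderiv U \<psi>)) - mderiv U \<delta>"
    unfolding h.R_11 \<psi>_def \<delta>_def \<chi>1_def by (simp only: mderiv_diff mderiv_U_mconst_times mderiv_U_qf_times)
  then have d\<delta>: "mderiv U \<delta> = mconst \<i> * (q * mderiv U (mderiv U \<psi>)) + mderiv U y11"
    using n11 by (simp add: algebra_simps add_eq_0_iff)
  \<comment> \<open>The (1, 1)-condition eliminates \<open>\<delta>\<close>; left is
    \<open>q\<close> cubed times the third \<open>u\<close>-derivative of \<open>\<psi>\<close>, on
    which the triple trace acts as \<open>\<kappa>3\<close>.\<close>
  have R33: "bh 3 3 R = mconst \<i> * (q * (q * (q * mderiv U (mderiv U (mderiv U \<psi>))))) + q * (q * mderiv U (mderiv U y11))"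
    unfolding h.R_33 \<chi>1_def[symmetric] \<delta>_def[symmetric] d\<delta>
    by (simp add: mderiv_add mderiv_U_mconst_times mderiv_U_qf_times distrib_left qf_mconst)
  have b\<psi>: "bh 0 0 (mderiv U (mderiv U (mderiv U \<psi>))) = mderiv U (mderiv U (mderiv U \<psi>))"
    by (simp add: bh_mderiv_U \<psi>_def)
  have "mconst (\<i> * \<kappa>3) * mderiv U (mderiv U (mderiv U \<psi>)) = 
      - (tr (tr (tr (bh 3 3 y))) + tr (tr (tr (q * (q * mderiv U (mderiv U y11))))))"
    using n33 unfolding R33 ltrace_add ltrace_mconst_times tr3_qqq[OF b\<psi>] mconst_times_mconst eq_neg_iff_add_eq_0
    by (simp only: add_ac)
  then have "mderiv U (mderiv U (mderiv U \<psi>)) = mconst (1 / (\<i> * \<kappa>3)) * 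
      - (tr (tr (tr (bh 3 3 y))) + tr (tr (tr (q * (q * mderiv U (mderiv U y11))))))"
    by (rule mconst_cancel) (use nn_nz in simp)
  \<comment> \<open>Subtraction of naturals truncates at 0, so adding the lost weight back later
    gives at least \<open>m + 1\<close>.\<close>
  moreover have "van wt (m + 1 - 2 - 2 - 2) \<dots>"
    unfolding y11_def
    by (intro van_mconst_times van_minus van_add van_ltrace Y
      van_mono[OF van_qf_times[OF van_qf_times[OF van_wt_mderiv_U[OF van_wt_mderiv_U[OF Y]]]]]) auto
  ultimately have "van wt (m + 1 - 2 - 2 - 2) (mderiv U (mderiv U (mderiv U \<psi>)))" by simp
  then have "van wt (m + 1 - 2 - 2 - 2 + 2 + 2 + 2) (mint (mint (mint (mderiv U (mderiv U (mderiv U \<psi>))))))"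
    by (intro van_mint)
  \<comment> \<open>Three primitives recover \<open>\<psi>\<close>, because its coefficients of 1
    and \<open>u\<close> vanish by weight and that of the square of \<open>u\<close> by
    hypothesis.\<close>
  moreover have "mint (mint (mint (mderiv U (mderiv U (mderiv U \<psi>))))) = \<psi>"
  proof (rule mint3_mderiv3)
    fix \<alpha> :: "'n cvar \<Rightarrow> nat" assume a: "\<alpha> U < 3"
    show "mcoeff \<psi> \<alpha> = 0"
    proof (cases "zdeg \<alpha> = 0 \<and> zbdeg \<alpha> = 0")
      case True
      then have u: "\<alpha> = uexp (\<alpha> U)" by (intro exp_eq_uexp) auto
      have "mcoeff g (uexp 0) = 0" "mcoeff g (uexp 1) = 0"
        using vanD[OF g3(1), of "uexp 0"] vanD[OF g3(1), of "uexp 1"] by simp_all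
      moreover have "\<alpha> U = 0 \<or> \<alpha> U = 1 \<or> \<alpha> U = 2" using a by linarith
      ultimately have "mcoeff g (uexp (\<alpha> U)) = 0" using g3(2) by auto
      then show ?thesis using u by (simp add: \<psi>_def)
    qed (auto simp: \<psi>_def)
  qed
  ultimately have "van wt (m + 1 - 2 - 2 - 2 + 2 + 2 + 2) \<psi>" by metis
  then have V\<psi>: "van wt (m + 1) \<psi>" by (rule van_mono) arith
  have Vd\<delta>: "van wt (m + 1 - 2) (mderiv U \<delta>)"
    unfolding d\<delta> y11_def
    by (intro van_add van_mconst_times van_wt_mderiv_U Y
        van_mono[OF van_qf_times[OF van_wt_mderiv_U[OF van_wt_mderiv_U[OF V\<psi>]]]]) auto
  have \<chi>11: "bh 1 1 \<chi>1 = \<chi>1" by (simp add: \<chi>1_def)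
  have \<sigma>11: "bh 1 1 (mderiv U \<sigma>) = mderiv U \<sigma>"
    by (simp only: bh_mderiv_U \<sigma>_def bh_add bh_ser_conj \<chi>11)
  have "mconst (2 * \<i>) * tr (q * mderiv U \<sigma>) = tr (bh 2 2 y)"
    using n22 unfolding h.R_22 \<chi>1_def[symmetric] \<sigma>_def[symmetric] ltrace_mconst_times
    by (simp add: mconst_minus)
  then have tq\<sigma>: "tr (q * mderiv U \<sigma>) = mconst (1 / (2 * \<i>)) * tr (bh 2 2 y)"
    by (rule mconst_cancel) simp
  have "mderiv U \<sigma> = TI (tr (q * mderiv U \<sigma>))" by (rule TI_left[OF \<sigma>11, symmetric])
  moreover have "van wt (m + 1 - 2) (TI (tr (q * mderiv U \<sigma>)))"
    unfolding tq\<sigma> by (intro van_TI van_mconst_times van_ltrace Y)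
  ultimately have Vd\<sigma>: "van wt (m + 1 - 2) (mderiv U \<sigma>)" by simp
  have "mderiv U \<chi>1 = mconst (1 / 2) * (mderiv U \<delta> + mderiv U \<sigma>)"
    by (rule mconst_cancel) (simp_all add: \<delta>_def \<sigma>_def mderiv_add mderiv_diff mconst_numeral algebra_simps)
  then have "van wt (m + 1 - 2) (mderiv U \<chi>1)"
    using Vd\<delta> Vd\<sigma> by (simp only:) (intro van_mconst_times van_add)
  then have "van wt (m + 1 - 2 + 2) (mint (mderiv U \<chi>1))" by (rule van_mint)
  moreover have "mint (mderiv U \<chi>1) = \<chi>1"
  proof (rule mint_mderiv)
    fix \<alpha> :: "'n cvar \<Rightarrow> nat" assume "\<alpha> U = 0"
    \<comment> \<open>A term of bidegree (1, 1) without \<open>u\<close> has weight 2, whereas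
      \<open>F\<close> starts at weight 3.\<close>
    moreover have "van wt (2 + 1) F" unfolding F_def by (rule van_bF) (rule f2)
    ultimately show "mcoeff \<chi>1 \<alpha> = 0" by (auto simp: \<chi>1_def van_def wdeg_wt)
  qed
  ultimately have "van wt (m + 1 - 2 + 2) \<chi>1" by metis
  then have V\<chi>1: "van wt (m + 1) \<chi>1" by (rule van_mono) arith

  define \<phi> where "\<phi> l = (\<lambda>k. bh l 0 (f k))" for l
  have b\<phi>: "bh l 0 (\<phi> l k) = \<phi> l k" for l k by (simp add: \<phi>_def)
  have \<chi>\<phi>: "bh l 1 F = bF c (\<phi> l)" for l
    using bh_bF_Suc[of l 0 c f] by (simp add: F_def \<phi>_def)
  have \<gamma>\<phi>: "bh (Suc l) 0 C = aF a (\<phi> l)" for l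
    using bh_aF_Suc[of l 0 a f] by (simp add: C_def \<phi>_def)
  have \<phi>\<chi>: "\<phi> l k = inv_levi ci (bh l 1 F) k" for l k
    unfolding \<chi>\<phi> using inv_levi_bF[of l "\<phi> l"] b\<phi> by simp
  have V\<phi>\<chi>: "van wt m (\<phi> l k)" if "van wt (m + 1) (bh l 1 F)" for l k
    unfolding \<phi>\<chi> using van_inv_levi[OF that, of ci k] by simp
  have V\<phi>1: "van wt m (\<phi> 1 k)" for k
    using V\<phi>\<chi>[of 1 k] V\<chi>1 by (simp add: \<chi>1_def)

  define \<xi> where "\<xi> k = mderiv U (mderiv U (\<phi> 0 k))" for k
  define l where "l = aF a \<xi> + mconst 3 * ser_conj (bF c \<xi>)"
  have l_eq: "l = mderiv U (mderiv U (bh 1 0 C + mconst 3 * ser_conj (bh 0 1 F)))"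
    unfolding l_def \<xi>_def aF_mderiv_U bF_mderiv_U \<chi>\<phi> \<gamma>\<phi>[of 0, folded One_nat_def]
    by (simp add: mderiv_add mderiv_U_mconst_times ser_conj_mderiv)
  have bl: "bh 1 0 l = l"
    unfolding l_eq bh_mderiv_U bh_add bh_mconst_times bh_ser_conj by simp
  \<comment> \<open>Through this condition the unknown \<open>chi 2\<close> disappears from
    \<open>R_32\<close>, so \<open>\<phi> 0\<close> can be found before
    \<open>\<phi> 2\<close>.\<close>
  have R21: "bh 2 1 R = - bh 2 1 y" using na1[of 0] by (simp add: numeral_2_eq_2)
  have "mconst (8 / 5 * \<kappa>2) * l = tr (tr (bh 3 2 y)) + tr (tr (mconst (7 / 5 * \<i>) * (q * mderiv U (bh 2 1 R))))"
  proof -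
    have e: "tr (tr (bh 3 2 R)) = tr (tr (mconst (7 / 5 * \<i>) * (q * mderiv U (bh 2 1 R)))) - mconst (8 / 5 * \<kappa>2) * l"
      unfolding h.R_32 l_eq[symmetric] ltrace_diff
      by (simp only: ltrace_mconst_times tr2_qq[OF bl] mconst_times_mconst)
    have "tr (tr (bh 3 2 y)) = - tr (tr (bh 3 2 R))" using n32 by (simp only: eq_neg_iff_add_eq_0)
    then show ?thesis unfolding e by simp
  qed
  then have l_sol: "l = mconst (1 / (8 / 5 * \<kappa>2)) * (tr (tr (bh 3 2 y)) + tr (tr (mconst (7 / 5 * \<i>) * (q * mderiv U (bh 2 1 R)))))"
    by (rule mconst_cancel) (use nn_nz in simp)
  have "van wt (m + 1 - 2 - 2) l"
    unfolding l_sol R21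
    by (intro van_mconst_times van_add van_ltrace Y 
        van_mono[OF van_qf_times[OF van_wt_mderiv_U[OF van_minus[OF Y]]]]) auto
  then have "van wt (m + 1 - 2 - 2 - 1) (msol M1 M2 l k)" for k by (rule van_msol)
  moreover have "msol M1 M2 l k = \<xi> k" for k
    unfolding l_def by (rule msol_left) (simp add: \<xi>_def bh_mderiv_U \<phi>_def)
  ultimately have "van wt (m + 1 - 2 - 2 - 1) (\<xi> k)" for k by simp
  then have "van wt (m + 1 - 2 - 2 - 1 + 2 + 2) (mint (mint (\<xi> k)))" for k by (intro van_mint)
  moreover have "mint (mint (\<xi> k)) = \<phi> 0 k" for k
    unfolding \<xi>_def
  proof (rule mint2_mderiv2)
    fix \<alpha> :: "'n cvar \<Rightarrow> nat" assume a: "\<alpha> U < 2"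
    show "mcoeff (\<phi> 0 k) \<alpha> = 0"
    proof (cases "zdeg \<alpha> = 0 \<and> zbdeg \<alpha> = 0")
      case True
      then have u: "\<alpha> = uexp (\<alpha> U)" by (intro exp_eq_uexp) auto
      have "mcoeff (f k) (uexp 0) = 0"
        using vanD[OF f2(1)[of k], of "uexp 0"] by simp
      moreover have "\<alpha> U = 0 \<or> \<alpha> U = 1" using a by linarith
      ultimately have "mcoeff (f k) (uexp (\<alpha> U)) = 0" using f2(2) by auto
      then show ?thesis using u by (simp add: \<phi>_def)
    qed (auto simp: \<phi>_def)
  qed
  ultimately have "van wt (m + 1 - 2 - 2 - 1 + 2 + 2) (\<phi> 0 k)" for k by metis
  then have V\<phi>0: "van wt m (\<phi> 0 k)" for k by (rule van_mono) arith

  have \<chi>2: "bh 2 1 F = mconst (3 / 4) * bh 2 1 y - (mconst \<i> * (q * mderiv U (bh 1 0 C))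
      + mconst (2 * \<i>) * (q * mderiv U (ser_conj (bh 0 1 F))))"
    using mconst_cancel[OF h.R_21[unfolded R21, symmetric]]
    by (simp add: algebra_simps mconst_minus)
  have V\<gamma>: "van wt (m + 1) (bh 1 0 C)"
    unfolding \<gamma>\<phi>[of 0, folded One_nat_def] by (rule van_aF[OF V\<phi>0])
  have V\<chi>0: "van wt (m + 1) (ser_conj (bh 0 1 F))"
    unfolding \<chi>\<phi> by (intro van_wt_ser_conj van_bF V\<phi>0)
  have Vq: "van wt (m + 1) (q * mderiv U s)" if "van wt (m + 1) s" for s
    by (rule van_mono[OF van_qf_times[OF van_wt_mderiv_U[OF that]]]) simp
  have "van wt (m + 1) (bh 2 1 F)"
    unfolding \<chi>2 by (intro van_diff van_add van_mconst_times Vq Y V\<gamma> V\<chi>0)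
  then have V\<phi>2: "van wt m (\<phi> 2 k)" for k by (rule V\<phi>\<chi>)
  have V\<phi>: "\<forall>k. van wt m (\<phi> l k)" for l
  proof (induction l rule: less_induct)
    case (less l)
    consider "l = 0" | "l = 1" | "l = 2" | "l \<ge> 3" by linarith
    then show ?case
    proof cases
      case l: 4
      define i where "i = l - 3"
      have 4: "l = i + 3" using l by (simp add: i_def)
      have "mconst (- 2 * of_nat (i + 3) / of_nat (i + 4)) * bh (i + 3) 1 F = 
          - bh (i + 3) 1 y + mconst (4 * \<i> / (of_nat (i + 2) * of_nat (i + 4))) * (q * mderiv U (bh (i + 2) 0 C))"
        using h.R_a1[of i] na1[of "i + 1"] by (simp add: algebra_simps numeral_3_eq_3 numeral_2_eq_2)
      from mconst_cancel[OF this] have e: "bh (i + 3) 1 F = mconst (1 / (- 2 * of_nat (i + 3) / of_nat (i + 4))) *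
          (- bh (i + 3) 1 y + mconst (4 * \<i> / (of_nat (i + 2) * of_nat (i + 4))) * (q * mderiv U (bh (i + 2) 0 C)))"
        using of_nat_eq_0_iff[of "i + 3", where ?'a = complex] of_nat_eq_0_iff[of "i + 4", where ?'a = complex]
        by (simp del: of_nat_add)
      have "van wt m (\<phi> (i + 1) k)" for k using less[of "i + 1"] 4 by simp
      then have "van wt (m + 1) (aF a (\<phi> (i + 1)))" by (rule van_aF)
      then have "van wt (m + 1) (bh (i + 2) 0 C)"
        using \<gamma>\<phi>[of "i + 1"] by simp
      then have "van wt (m + 1) (bh (i + 3) 1 F)"
        unfolding e by (intro van_mconst_times van_add van_minus Vq Y)
      then show ?thesis using V\<phi>\<chi> 4 by blast
    qed (use V\<phi>0 V\<phi>1 V\<phi>2 in auto)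
  qed
  have Vf: "van wt m (f k)" for k
  proof -
    have "Eb (f k) = mconst \<i> * (q * mderiv U (f k)) + 0"
      using tangential_iff[of "f k" 0] tang by simp
    from eq_fsol[OF this] have e: "f k = fsol c (\<lambda>l. bh l 0 (f k)) 0" .
    have "van wt m (bh l 0 (f k))" for l using V\<phi>[of l] by (simp add: \<phi>_def)
    then have "van wt m (fsol c (\<lambda>l. bh l 0 (f k)) 0)" by (intro van_fsol) auto
    then show ?thesis by (simp only: e[symmetric])
  qed
  then show "van wt m (f k)" .
  define S where "S = Rlin a c f 0"
  have VS: "van wt (m + 1) S" unfolding S_def by (rule van_Rlin) (use Vf in auto)
  have "R = S + Dz c g" unfolding R_def S_def by (rule Rlin_g)
  then have "(Ez g + Eb g) + (S + ser_conj S) = R + ser_conj R"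
    unfolding Dz_conj[OF g, symmetric] by (simp add: ser_conj_add add_ac)
  then have E: "Ez g + Eb g = - (S + ser_conj S)"
    unfolding R_im by (simp only: eq_neg_iff_add_eq_0)
  show "van wt (m + 1) g"
    unfolding van_def
  proof (intro allI impI)
    fix \<alpha> :: "'n cvar \<Rightarrow> nat" assume a: "wdeg wt \<alpha> < m + 1"
    show "mcoeff g \<alpha> = 0"
    proof (cases "zdeg \<alpha> + zbdeg \<alpha> = 0")
      case True
      then have "mcoeff g \<alpha> = mcoeff \<psi> \<alpha>" by (simp add: \<psi>_def)
      then show ?thesis using V\<psi> a by (simp add: van_def)
    next
      case False
      have "of_nat (zdeg \<alpha> + zbdeg \<alpha>) * mcoeff g \<alpha> = - mcoeff (S + ser_conj S) \<alpha>"
        using arg_cong[OF E, of "\<lambda>s. mcoeff s \<alpha>"] by (simp add: distrib_right)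
      also have "mcoeff (S + ser_conj S) \<alpha> = 0"
        using van_add[OF VS van_wt_ser_conj[OF VS]] a by (simp add: van_def del: plus_mps.rep_eq)
      finally have "(of_nat (zdeg \<alpha> + zbdeg \<alpha>) :: complex) = 0 \<or> mcoeff g \<alpha> = 0"
        by (simp only: minus_zero mult_eq_0_iff)
      then show ?thesis using False by (simp only: of_nat_eq_0_iff simp_thms)
    qed
  qed
qed

end

subsection \<open>Existence\<close>

text \<open>The unknowns \<open>\<psi>\<close>, \<open>\<phi>\<^sub>a\<close> are obtained by solving \<open>R_33\<close>, \<open>R_22\<close>, \<open>R_11\<close>, \<open>R_32\<close>, \<open>R_21\<close> and \<open>R_a1\<close>
  in turn, starting from the inhomogeneity \<open>y\<close>.\<close>

definition psi_sol :: "('n::finite \<Rightarrow> 'n \<Rightarrow> complex) \<Rightarrow> ('n \<Rightarrow> 'n \<Rightarrow> complex) \<Rightarrow> complex \<Rightarrow> 'n ser \<Rightarrow> 'n ser" where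
  "psi_sol c ci r y = mconst (r / 2) * (mvar U * mvar U) +
     mint (mint (mint (mconst (\<i> / kap3 (of_nat CARD('n))) *
       (ltrace ci (ltrace ci (ltrace ci (bh 3 3 y))) +
        ltrace ci (ltrace ci (ltrace ci (qf c * (qf c * mderiv U (mderiv U (bh 1 1 y))))))))))"

text \<open>Half the sum of two derivatives: that of \<open>\<chi>1\<close> minus its conjugate,
  given by the (1, 1)-condition, and that of \<open>\<chi>1\<close> plus its conjugate, given by the
  (2, 2)-condition. The initial value is 0 since \<open>f\<close> has no linear terms.\<close>

definition chi1_sol :: "('n::finite \<Rightarrow> 'n \<Rightarrow> complex) \<Rightarrow> ('n \<Rightarrow> 'n \<Rightarrow> complex) \<Rightarrow> complex \<Rightarrow> 'n ser \<Rightarrow> 'n ser" where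
  "chi1_sol c ci r y = mint (mconst (1 / 2) * (mconst \<i> * (qf c * mderiv U (mderiv U (psi_sol c ci r y)))
     + mderiv U (bh 1 1 y) + mconst (- \<i> / 2) * inv_trace_q c ci (ltrace ci (bh 2 2 y))))"

text \<open>The linear form in \<open>z\<close> that the second derivative of
  \<open>\<phi>\<^sub>0\<close> has to produce: the (3, 2)-condition divided by \<open>8/5\<close>
  times \<open>kap2\<close>, with \<open>bh 2 1 R\<close> replaced by
  \<open>- bh 2 1 y\<close>.\<close>

definition l_sol :: "('n::finite \<Rightarrow> 'n \<Rightarrow> complex) \<Rightarrow> ('n \<Rightarrow> 'n \<Rightarrow> complex) \<Rightarrow> 'n ser \<Rightarrow> 'n ser" where
  "l_sol c ci y = mconst (5 / (8 * kap2 (of_nat CARD('n)))) * (ltrace ci (ltrace ci (bh 3 2 y))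
     - mconst (7 / 5 * \<i>) * ltrace ci (ltrace ci (qf c * mderiv U (bh 2 1 y))))"

definition phi0_sol where
  "phi0_sol c ci M1 M2 y k = mint (mint (msol M1 M2 (l_sol c ci y) k))"

fun phi_sol :: "('n::finite \<Rightarrow> 'n \<Rightarrow> complex) \<Rightarrow> ('n \<Rightarrow> 'n \<Rightarrow> complex) \<Rightarrow> ('n \<Rightarrow> 'n \<Rightarrow> complex) \<Rightarrow>
    ('n \<Rightarrow> 'n \<Rightarrow> complex) \<Rightarrow> ('n \<Rightarrow> 'n \<Rightarrow> complex) \<Rightarrow> complex \<Rightarrow> 'n ser \<Rightarrow> nat \<Rightarrow> 'n \<Rightarrow> 'n ser" where
  "phi_sol c ci a M1 M2 r y 0 = phi0_sol c ci M1 M2 y"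
| "phi_sol c ci a M1 M2 r y (Suc 0) = inv_levi ci (chi1_sol c ci r y)"
| "phi_sol c ci a M1 M2 r y (Suc (Suc 0)) = inv_levi ci (mconst (3 / 4) * bh 2 1 y
     - (mconst \<i> * (qf c * mderiv U (aF a (phi0_sol c ci M1 M2 y)))
        + mconst (2 * \<i>) * (qf c * mderiv U (ser_conj (bF c (phi0_sol c ci M1 M2 y))))))"
| "phi_sol c ci a M1 M2 r y (Suc (Suc (Suc m))) = inv_levi ci (mconst (of_nat (m + 4) / (2 * of_nat (m + 3))) *
     (bh (m + 3) 1 y - mconst (4 * \<i> / (of_nat (m + 2) * of_nat (m + 4))) *
       (qf c * mderiv U (aF a (phi_sol c ci a M1 M2 r y (Suc m))))))"

definition f0_sol where "f0_sol c ci a M1 M2 r y k = fsol c (\<lambda>m. phi_sol c ci a M1 M2 r y m k) 0"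
definition g0_sol where "g0_sol c ci a M1 M2 r y = gsol (Rlin a c (f0_sol c ci a M1 M2 r y) 0) (psi_sol c ci r y)"

lemma mderiv_numeral [simp]: "mderiv v (numeral m) = (0 :: 'v::finite mps)"
  using mderiv_mconst[of v "numeral m"] by (simp only: mconst_numeral)

lemma bh_mvar_U: "bh a b (mvar U * s) = mvar U * bh a b s"
proof (rule mps_eqI)
  fix \<alpha>
  show "mcoeff (bh a b (mvar U * s)) \<alpha> = mcoeff (mvar U * bh a b s) \<alpha>"
    using wdeg_upd_pred[of \<alpha> U zwt] wdeg_upd_pred[of \<alpha> U zbwt] by (simp add: mcoeff_mvar_times)
qed

lemma bh_00_1: "bh 0 0 1 = 1"
  by (rule mps_eqI) (simp add: mcoeff_one)

lemma bh_uu: "bh 0 0 (mvar U * mvar U) = mvar U * mvar U"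
proof -
  have "bh 0 0 (mvar U * (mvar U * 1)) = mvar U * (mvar U * 1)" unfolding bh_mvar_U bh_00_1 ..
  then show ?thesis by simp
qed

lemma mcoeff_uu: "mcoeff (mvar U * mvar U :: 'n::finite ser) (uexp 2) = 1"
  by (simp add: mcoeff_mvar_times mcoeff_mvar uexp_def)

lemma mderiv_uu: "mderiv U (mderiv U (mderiv U (mconst k * (mvar U * mvar U)))) = (0 :: 'n::finite ser)"
  by (simp add: mderiv_mult mderiv_add mderiv_mvar)

lemma ser_conj_uu: "ser_conj (mvar U * mvar U) = (mvar U * mvar U :: 'n::finite ser)"
  by (simp add: ser_conj_mult)

context levi_data
begin

context
  fixes r :: real and y :: "'n ser"
  assumes y_imag: "y + ser_conj y = 0" and y_0: "\<And>b. bh 0 b y = 0" and y_3: "van wt 3 y"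
begin

abbreviation "\<psi> \<equiv> psi_sol c ci r y"
abbreviation "\<chi>1 \<equiv> chi1_sol c ci r y"
abbreviation "l \<equiv> l_sol c ci y"
abbreviation "\<phi> \<equiv> phi_sol c ci a M1 M2 r y"
abbreviation "f0 \<equiv> f0_sol c ci a M1 M2 r y"
abbreviation "g0 \<equiv> g0_sol c ci a M1 M2 r y"

lemma conj_y: "ser_conj y = - y"
  using y_imag by (simp add: eq_neg_iff_add_eq_0 add.commute)

lemma conj_bh_y: "ser_conj (bh i j y) = - bh j i y"
  by (simp add: ser_conj_bh conj_y bh_minus)

lemma psi3: "mderiv U (mderiv U (mderiv U \<psi>)) = mconst (\<i> / \<kappa>3) *
       (tr (tr (tr (bh 3 3 y))) + tr (tr (tr (q * (q * mderiv U (mderiv U (bh 1 1 y)))))))"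
  unfolding psi_sol_def by (simp only: mderiv_add mderiv_uu mderiv_mint nn_def add_0_left)

lemma bh_psi: "bh 0 0 \<psi> = \<psi>"
  unfolding psi_sol_def bh_add bh_mint bh_mconst_times bh_uu bh_ltrace
  by (simp add: bh_qf_Suc bh_mderiv_U numeral_3_eq_3)

text \<open>\<open>y\<close> is imaginary, while the trace, \<open>q\<close> and the
  \<open>u\<close>-derivation commute with conjugation; the factor \<open>\<i>\<close> makes the
  right-hand side real.\<close>

lemma conj_psi: "ser_conj \<psi> = \<psi>"
proof -
  have k: "cnj \<kappa>3 = \<kappa>3" by (simp add: kap3_def nn_def)
  have "ser_conj (mconst (\<i> / \<kappa>3) * (tr (tr (tr (bh 3 3 y))) + tr (tr (tr (q * (q * mderiv U (mderiv U (bh 1 1 y))))))))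
      = mconst (\<i> / \<kappa>3) * (tr (tr (tr (bh 3 3 y))) + tr (tr (tr (q * (q * mderiv U (mderiv U (bh 1 1 y)))))))"
    by (simp add: ser_conj_mconst_times ser_conj_add conj_tr conj_q_times ser_conj_mderiv conj_bh_y k
        mderiv_minus ltrace_minus mconst_minus distrib_left right_diff_distrib)
  then show ?thesis
    unfolding psi_sol_def nn_def ser_conj_add ser_conj_mint ser_conj_uu ser_conj_mconst_times by simp
qed

lemma van_psi: "van wt 4 \<psi>"
proof -
  have "van wt 4 (mvar U * mvar U :: 'n ser)" 
    by (rule van_mult'[where j = 2 and k = 2]) (auto intro: van_mvar)
  moreover have "van wt 4 (mint (mint (mint s)))" for s :: "'n ser"
  proof -
    have "van wt (0 + 2 + 2 + 2) (mint (mint (mint s)))" by (intro van_mint) simp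
    then show ?thesis by (rule van_mono) simp
  qed
  ultimately show ?thesis unfolding psi_sol_def by (intro van_add van_mconst_times)
qed

text \<open>The derivative of \<open>\<chi>1\<close> is \<open>(A + B) / 2\<close> with
  \<open>A\<close> imaginary and \<open>B\<close> real, so the two parts can be read off.\<close>

lemma chi1_conj:
  "mderiv U (\<chi>1 - ser_conj \<chi>1) = mconst \<i> * (q * mderiv U (mderiv U \<psi>)) + mderiv U (bh 1 1 y)"
  "mderiv U (\<chi>1 + ser_conj \<chi>1) = mconst (- \<i> / 2) * TI (tr (bh 2 2 y))"
proof -
  define A where "A = mconst \<i> * (q * mderiv U (mderiv U \<psi>)) + mderiv U (bh 1 1 y)"
  define B where "B = mconst (- \<i> / 2) * TI (tr (bh 2 2 y))"
  have A: "ser_conj A = - A"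
    by (simp add: A_def ser_conj_add ser_conj_mconst_times conj_q_times ser_conj_mderiv conj_psi conj_bh_y mderiv_minus mconst_minus)
  have N: "cnj nn = nn" by (simp add: nn_def)
  have B: "ser_conj B = B"
    unfolding B_def TI_def
    by (simp add: ser_conj_diff ser_conj_mconst_times conj_q_times conj_tr conj_bh_y ltrace_minus N mconst_minus algebra_simps)
  have d: "mderiv U \<chi>1 = mconst (1 / 2) * (A + B)"
    by (simp add: chi1_sol_def A_def B_def add.assoc)
  have dc: "mderiv U (ser_conj \<chi>1) = mconst (1 / 2) * (B - A)"
    using arg_cong[OF d, of ser_conj] by (simp add: ser_conj_mderiv ser_conj_mconst_times ser_conj_add A B)
  show "mderiv U (\<chi>1 - ser_conj \<chi>1) = mconst \<i> * (q * mderiv U (mderiv U \<psi>)) + mderiv U (bh 1 1 y)"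
    unfolding mderiv_diff d dc A_def[symmetric] by (rule mps_eqI, simp only: mcoeff_lin) (simp add: field_simps)
  show "mderiv U (\<chi>1 + ser_conj \<chi>1) = mconst (- \<i> / 2) * TI (tr (bh 2 2 y))"
    unfolding mderiv_add d dc B_def[symmetric] by (rule mps_eqI, simp only: mcoeff_lin) (simp add: field_simps)
qed

lemma bh_TI: "bh 1 1 s = s \<Longrightarrow> bh 1 1 (TI s) = TI s"
  unfolding TI_def bh_mconst_times bh_diff bh_qf_nums using bh_tr_11[of s] by simp

lemma tr_22: "bh 1 1 (tr (bh 2 2 y)) = tr (bh 2 2 y)"
  by (simp add: bh_ltrace numeral_2_eq_2)

lemma bh_chi1: "bh 1 1 \<chi>1 = \<chi>1"
  unfolding chi1_sol_def bh_mint bh_mconst_times bh_add bh_qf_nums bh_mderiv_U bh_psi bh_TI[OF tr_22]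
  by simp

lemma bh_l: "bh 1 0 l = l"
proof -
  have "bh 1 0 (tr (tr (bh 3 2 y))) = tr (tr (bh 3 2 y))"
    by (simp add: bh_ltrace numeral_2_eq_2 numeral_3_eq_3)
  moreover have "bh 1 0 (tr (tr (q * mderiv U (bh 2 1 y)))) = tr (tr (q * mderiv U (bh 2 1 y)))"
    using bh_qf_nums(4)[of c "mderiv U (bh 2 1 y)"]
    by (simp add: bh_ltrace numeral_2_eq_2 numeral_3_eq_3 bh_mderiv_U)
  ultimately show ?thesis by (simp only: l_sol_def bh_mconst_times bh_diff)
qed

lemma bh_msol: "bh 1 0 s = s \<Longrightarrow> bh 0 0 (msol M1 M2 s j) = msol M1 M2 s j"
  by (simp add: msol_def bh_add bh_sum bh_mconst_times bh_ser_conj bh_mderiv_Z)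

lemma bh_phi: "bh m 0 (\<phi> m k) = \<phi> m k"
proof -
  have I: "bh m 0 (inv_levi ci s k) = inv_levi ci s k" if "bh m 1 s = s" for m s k
    using that by (simp add: bh_inv_levi)
  have q: "bh (Suc (Suc m)) (Suc 0) (q * mderiv U (aF a f)) = q * mderiv U (aF a (\<lambda>k. bh m 0 (f k)))" for m f
    by (simp add: bh_qf_Suc bh_mderiv_U bh_aF_Suc)
  have q': "bh (Suc (Suc 0)) (Suc 0) (q * mderiv U (ser_conj (bF c f))) = q * mderiv U (ser_conj (bF c (\<lambda>k. bh 0 0 (f k))))" for f
    by (simp add: bh_qf_Suc bh_mderiv_U bh_bF_Suc bh_ser_conj)
  have p0: "bh 0 0 (phi0_sol c ci M1 M2 y k) = phi0_sol c ci M1 M2 y k" for k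
    by (simp add: phi0_sol_def bh_mint bh_msol[OF bh_l])
  show ?thesis
  proof (induction m arbitrary: k rule: less_induct)
    case (less m)
    consider "m = 0" | "m = 1" | "m = 2" | "m \<ge> 3" by linarith
    then show ?case
    proof cases
      case 1
      then show ?thesis using p0 by simp
    next
      case 2
      then show ?thesis using I[OF bh_chi1] by simp
    next
      case 3
      then have m: "m = Suc (Suc 0)" by simp
      show ?thesis unfolding m phi_sol.simps
        by (rule I) (simp add: bh_diff bh_add bh_mconst_times q q' p0 numeral_2_eq_2)
    next
      case 4
      define i where "i = m - 3"
      have m: "m = Suc (Suc (Suc i))" using 4 by (simp add: i_def)
      have IH: "bh (Suc i) 0 (\<phi> (Suc i) k) = \<phi> (Suc i) k" for k using less[of "Suc i"] m by simp
      show ?thesis unfolding m phi_sol.simps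
        by (rule I) (simp add: bh_diff bh_add bh_mconst_times q IH numeral_3_eq_3 del: phi_sol.simps)
    qed
  qed
qed

lemma van_chi1: "van wt 3 \<chi>1"
proof -
  have "van wt 1 (q * mderiv U (mderiv U \<psi>))"
    by (rule van_mono[OF van_qf_times[OF van_wt_mderiv_U[OF van_wt_mderiv_U[OF van_psi]]]]) simp
  moreover have "van wt 1 (mderiv U (bh 1 1 y))"
    by (rule van_mono[OF van_wt_mderiv_U[OF van_bh[OF y_3]]]) simp
  moreover have "van wt 1 (TI (tr (bh 2 2 y)))"
    by (rule van_mono[OF van_TI[OF van_ltrace[OF van_bh[OF y_3]]]]) simp
  ultimately have "van wt (1 + 2) \<chi>1"
    unfolding chi1_sol_def by (intro van_mint van_mconst_times van_add)
  then show ?thesis by (simp add: numeral_3_eq_3)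
qed

lemma van_phi: "van wt 2 (\<phi> m k)"
proof -
  have I: "van wt 2 (inv_levi ci s k)" if "van wt 3 s" for s k
    using van_inv_levi[OF that, of ci k] by simp
  have V: "van wt 3 (q * mderiv U s)" if "van wt 3 s" for s
    by (rule van_mono[OF van_qf_times[OF van_wt_mderiv_U[OF that]]]) simp
  have a: "van wt 3 (aF a f)" if "\<And>k. van wt 2 (f k)" for f
    using van_aF[of 2 f a] that by simp
  have p0: "van wt 2 (phi0_sol c ci M1 M2 y k)" for k
  proof -
    have "van wt (0 + 2 + 2) (phi0_sol c ci M1 M2 y k)" unfolding phi0_sol_def by (intro van_mint) simp
    then show ?thesis by (rule van_mono) simp
  qed
  have b: "van wt 3 (ser_conj (bF c (phi0_sol c ci M1 M2 y)))"
    using van_wt_ser_conj[OF van_bF[of 2 "phi0_sol c ci M1 M2 y" c]] p0 by simp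
  show ?thesis
  proof (induction m arbitrary: k rule: less_induct)
    case (less m)
    consider "m = 0" | "m = 1" | "m = 2" | "m \<ge> 3" by linarith
    then show ?case
    proof cases
      case 1
      then show ?thesis using p0 by simp
    next
      case 2
      then show ?thesis using I[OF van_chi1] by simp
    next
      case 3
      then have m: "m = Suc (Suc 0)" by simp
      show ?thesis unfolding m phi_sol.simps
        by (intro I van_diff van_add van_mconst_times V a b p0 van_bh y_3)
    next
      case 4
      define i where "i = m - 3"
      have m: "m = Suc (Suc (Suc i))" using 4 by (simp add: i_def)
      have IH: "van wt 2 (\<phi> (Suc i) k)" for k using less[of "Suc i"] m by simp
      show ?thesis unfolding m phi_sol.simps
        by (intro I van_diff van_add van_mconst_times V a IH van_bh y_3)
    qed
  qed
qed

text \<open>The formulas of \<open>hom_scalars\<close> are read backwards. For this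
  \<open>inv_levi\<close>, \<open>TI\<close> and \<open>msol\<close> have to be right inverses,
  whereas the stability estimate uses that they are left inverses.\<close>

lemma hom_exists: "lin_sol c ci a (\<lambda>_. 0) y r f0 g0"
proof -
  define R where "R = Rlin a c f0 g0"
  define C where "C = aF a f0"
  define F where "F = bF c f0"
  have tang: "Dz c (ser_conj (f0 k)) = 0" for k
    using tangential_iff[of "f0 k" 0] Eb_fsol[of 0 c "\<lambda>m. \<phi> m k"] by (simp add: f0_sol_def)
  have g: "ser_conj g0 = g0" unfolding g0_sol_def by (rule ser_conj_gsol[OF conj_psi])
  have R_im: "R + ser_conj R = 0"
    using Rlin_gsol[of 0 \<psi> f0] conj_psi bh_psi unfolding R_def g0_sol_def by simp
  interpret h: hom_scalars c C F g0 R
    unfolding C_def F_def R_def by (rule hom_interp[OF tang g R_im[unfolded R_def]])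
  have bf: "bh m 0 (f0 k) = \<phi> m k" for m k
    by (simp add: f0_sol_def bh_fsol bh_phi)
  have \<chi>\<phi>: "bh m 1 F = bF c (\<phi> m)" for m
    using bh_bF_Suc[of m 0 c f0] by (simp add: F_def bf)
  have \<gamma>\<phi>: "bh (Suc m) 0 C = aF a (\<phi> m)" for m
    using bh_aF_Suc[of m 0 a f0] by (simp add: C_def bf)
  have \<psi>: "bh 0 0 g0 = \<psi>" unfolding g0_sol_def by (rule bh_00_gsol[OF bh_psi])
  have \<chi>1: "bh 1 1 F = \<chi>1"
    unfolding \<chi>\<phi> using bF_inv_levi[OF bh_chi1] by simp
  have "mderiv U (bh 1 1 R) = - mderiv U (bh 1 1 y)"
    unfolding h.R_11 \<psi> \<chi>1 mderiv_diff[of U _ "\<chi>1 - ser_conj \<chi>1"] chi1_conj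
    by (simp add: mderiv_U_mconst_times mderiv_U_qf_times)
  then have c11: "mderiv U (bh 1 1 (y + R)) = 0" by (simp add: bh_add mderiv_add)
  have "tr (bh 2 2 R) = mconst (- 2 * \<i>) * tr (q * (mconst (- \<i> / 2) * TI (tr (bh 2 2 y))))"
    unfolding h.R_22 \<chi>1 chi1_conj ltrace_mconst_times ..
  also have "\<dots> = mconst (- 1) * tr (bh 2 2 y)"
    unfolding qf_mconst ltrace_mconst_times TI_right[OF tr_22] mconst_times_mconst by simp
  finally have c22: "tr (bh 2 2 (y + R)) = 0" by (simp add: bh_add ltrace_add mconst_minus)
  have b3: "bh 0 0 (mderiv U (mderiv U (mderiv U \<psi>))) = mderiv U (mderiv U (mderiv U \<psi>))"
    by (simp add: bh_mderiv_U bh_psi)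
  have "bh 3 3 R = mconst \<i> * (q * (q * (q * mderiv U (mderiv U (mderiv U \<psi>))))) + q * (q * mderiv U (mderiv U (bh 1 1 y)))"
    unfolding h.R_33 \<chi>1 chi1_conj
    by (simp add: mderiv_add mderiv_U_mconst_times mderiv_U_qf_times distrib_left qf_mconst)
  then have "tr (tr (tr (bh 3 3 R))) = mconst \<i> * (mconst \<kappa>3 * mderiv U (mderiv U (mderiv U \<psi>)))
     + tr (tr (tr (q * (q * mderiv U (mderiv U (bh 1 1 y))))))"
    by (simp add: ltrace_add ltrace_mconst_times tr3_qqq[OF b3])
  also have "\<dots> = - tr (tr (tr (bh 3 3 y)))"
    unfolding psi3 mconst_times_mconst using nn_nz by (simp add: mconst_minus)
  finally have c33: "tr (tr (tr (bh 3 3 (y + R)))) = 0" by (simp add: bh_add ltrace_add)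
  have "bh 2 1 F = mconst (3 / 4) * bh 2 1 y
     - (mconst \<i> * (q * mderiv U (bh 1 0 C)) + mconst (2 * \<i>) * (q * mderiv U (ser_conj (bh 0 1 F))))"
  proof -
    have two: "(2::nat) = Suc (Suc 0)" by simp
    define s where "s = mconst (3 / 4) * bh 2 1 y
     - (mconst \<i> * (q * mderiv U (aF a (\<phi> 0))) + mconst (2 * \<i>) * (q * mderiv U (ser_conj (bF c (\<phi> 0)))))"
    have b: "bh 2 1 s = s"
      unfolding s_def bh_diff bh_add bh_mconst_times bh_qf_nums bh_mderiv_U bh_ser_conj 
      using bh_aF_Suc[of 0 0 a "\<phi> 0"] bh_bF_Suc[of 0 0 c "\<phi> 0"] by (simp add: bh_phi del: phi_sol.simps)
    have "\<phi> 2 = inv_levi ci s" unfolding two phi_sol.simps s_def ..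
    then have "bh 2 1 F = s" unfolding \<chi>\<phi> using bF_inv_levi[OF b] by simp
    then show ?thesis unfolding s_def \<gamma>\<phi>[of 0, folded One_nat_def] \<chi>\<phi>[of 0] .
  qed
  then have "bh 2 1 R = mconst (- 4 / 3) * (mconst (3 / 4) * bh 2 1 y)"
    unfolding h.R_21 by simp
  then have R21: "bh 2 1 R = - bh 2 1 y" by (simp add: mconst_times_mconst mconst_minus)
  have l: "l = mderiv U (mderiv U (bh 1 0 C + mconst 3 * ser_conj (bh 0 1 F)))"
  proof -
    have "\<phi> 0 = (\<lambda>k. mint (mint (msol M1 M2 l k)))" by (rule ext) (simp add: phi0_sol_def)
    then have d: "mderiv U (mderiv U (aF a (\<phi> 0))) = aF a (msol M1 M2 l)"
        "mderiv U (mderiv U (bF c (\<phi> 0))) = bF c (msol M1 M2 l)"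
      by (simp_all flip: aF_mderiv_U bF_mderiv_U)
    have "mderiv U (mderiv U (bh 1 0 C + mconst 3 * ser_conj (bh 0 1 F)))
       = aF a (msol M1 M2 l) + mconst 3 * ser_conj (bF c (msol M1 M2 l))"
      unfolding \<chi>\<phi> \<gamma>\<phi>[of 0, folded One_nat_def] mderiv_add mderiv_U_mconst_times d(1)
      using arg_cong[OF d(2), of ser_conj] by (simp add: ser_conj_mderiv)
    then show ?thesis using msol_right[OF bh_l] by simp
  qed
  have "tr (tr (bh 3 2 R)) = mconst (7 / 5 * \<i>) * tr (tr (q * mderiv U (bh 2 1 R))) - mconst (8 / 5) * (mconst \<kappa>2 * l)"
    unfolding h.R_32 l[symmetric] ltrace_diff ltrace_mconst_times tr2_qq[OF bh_l] ..
  also have "\<dots> = - tr (tr (bh 3 2 y))"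
    unfolding R21 using nn_nz
    by (simp add: l_sol_def nn_def[symmetric] mderiv_minus ltrace_minus mconst_times_mconst)
  finally have c32: "tr (tr (bh 3 2 (y + R))) = 0" by (simp add: bh_add ltrace_add)
  have "bh (m + 3) 1 (y + R) = 0" for m
  proof -
    define k1 where "k1 = of_nat (m + 4) / (2 * of_nat (m + 3) :: complex)"
    define k2 where "k2 = 4 * \<i> / (of_nat (m + 2) * of_nat (m + 4))"
    define s where "s = mconst k1 * (bh (m + 3) 1 y - mconst k2 * (q * mderiv U (aF a (\<phi> (Suc m)))))"
    have "bh (m + 3) 1 (q * mderiv U (aF a (\<phi> (Suc m)))) = q * mderiv U (aF a (\<phi> (Suc m)))"
      using bh_qf_Suc[of "m + 2" 0 c "mderiv U (aF a (\<phi> (Suc m)))"] bh_aF_Suc[of "m + 1" 0 a "\<phi> (Suc m)"]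
      by (simp add: bh_phi bh_mderiv_U numeral_3_eq_3 del: phi_sol.simps)
    then have b: "bh (m + 3) 1 s = s" by (simp add: s_def bh_diff bh_mconst_times)
    have m3: "m + 3 = Suc (Suc (Suc m))" by simp
    have "\<phi> (m + 3) = inv_levi ci s" unfolding m3 phi_sol.simps s_def k1_def k2_def by (simp add: numeral_3_eq_3)
    then have F: "bh (m + 3) 1 F = s" unfolding \<chi>\<phi> using bF_inv_levi[OF b] by simp
    have C: "bh (m + 2) 0 C = aF a (\<phi> (Suc m))" using \<gamma>\<phi>[of "Suc m"] by simp
    have k: "(- 2 * of_nat (m + 3) / of_nat (m + 4)) * k1 = -1"
      using of_nat_eq_0_iff[of "m + 3", where ?'a = complex] of_nat_eq_0_iff[of "m + 4", where ?'a = complex]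
      by (simp add: k1_def del: of_nat_add)
    have "bh (m + 3) 1 R = mconst (- 1) * (bh (m + 3) 1 y - mconst k2 * (q * mderiv U (aF a (\<phi> (Suc m))))) 
        - mconst k2 * (q * mderiv U (aF a (\<phi> (Suc m))))"
      unfolding h.R_a1 F C s_def mconst_times_mconst k k2_def[symmetric] ..
    then show ?thesis by (simp add: bh_add mconst_minus)
  qed
  moreover have "bh 2 1 (y + R) = 0" unfolding bh_add R21 by simp
  ultimately have ca1: "bh (m + 2) 1 (y + R) = 0" for m
    by (cases m) (simp_all add: numeral_3_eq_3 numeral_2_eq_2)
  have "(y + R) + ser_conj (y + R) = (y + ser_conj y) + (R + ser_conj R)"
    by (simp only: ser_conj_add add_ac)
  then have c0: "(y + R) + ser_conj (y + R) = 0" by (simp only: y_imag R_im add_0)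
  have n: "nrm ci (y + Rlin a c f0 g0)"
    using c0 c11 ca1 c22 c32 c33 unfolding nrm_def R_def by blast
  have f2: "van wt 2 (f0 k)" for k unfolding f0_sol_def by (intro van_fsol van_phi) simp
  have "mcoeff (f0 k) (uexp 1) = mcoeff (bh 0 0 (f0 k)) (uexp 1)" for k by simp
  then have fu: "mcoeff (f0 k) (uexp 1) = 0" for k unfolding bf by (simp add: phi0_sol_def mcoeff_mint)
  have g3: "van wt 3 g0"
    unfolding g0_sol_def by (intro van_gsol) (use van_Rlin[of 2 f0 0 a c] f2 van_psi in \<open>auto intro: van_mono\<close>)
  have "mcoeff g0 (uexp 2) = mcoeff (bh 0 0 g0) (uexp 2)" by simp
  also have "\<dots> = of_real r / 2"
    unfolding \<psi> psi_sol_def by (simp add: mcoeff_uu mcoeff_mint)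
  finally show ?thesis
    unfolding lin_sol_def using tang n g f2 fu g3 by simp
qed

end

end

subsection \<open>The solution operator\<close>

text \<open>A particular solution with all free data zero: \<open>fp_sol\<close> takes care of the
  tangential equation, \<open>gp_sol\<close> of the real part of the transversal one. The remaining
  inhomogeneity \<open>yp_sol\<close> is imaginary, as the homogeneous problem requires.\<close>

definition fp_sol where "fp_sol c p k = fsol c (\<lambda>_. 0) (- ser_conj (p k))"
definition gp_sol where "gp_sol c a p y = gsol (y + Rlin a c (fp_sol c p) 0) 0"
definition yp_sol where "yp_sol c a p y = y + Rlin a c (fp_sol c p) (gp_sol c a p y)"
definition f_sol where "f_sol c ci a M1 M2 r p y k = fp_sol c p k + f0_sol c ci a M1 M2 r (yp_sol c a p y) k"
definition g_sol where "g_sol c ci a M1 M2 r p y = gp_sol c a p y + g0_sol c ci a M1 M2 r (yp_sol c a p y)"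

text \<open>The compatibility conditions on the data. Equations evaluated along the Euler field have
  no part of degree 0 in \<open>z\<close>, and the weights 2 and 3 are those of \<open>f\<close> and
  \<open>g\<close>.\<close>

definition lin_data :: "('n::finite \<Rightarrow> 'n ser) \<Rightarrow> 'n ser \<Rightarrow> bool" where
  "lin_data p y \<longleftrightarrow> (\<forall>k b. bh 0 b (p k) = 0) \<and> (\<forall>k. van wt 2 (p k)) \<and> (\<forall>b. bh 0 b y = 0) \<and> van wt 3 y"

lemma nrm_diff: "nrm ci R \<Longrightarrow> nrm ci R' \<Longrightarrow> nrm ci (R - R')"
proof -
  assume "nrm ci R" "nrm ci R'"
  moreover have "R - R' + ser_conj (R - R') = (R + ser_conj R) - (R' + ser_conj R')"
    by (simp add: ser_conj_diff)
  ultimately show ?thesis unfolding nrm_def bh_diff mderiv_diff ltrace_diff by simp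
qed

context levi_data
begin

context
  fixes p :: "'n \<Rightarrow> 'n ser" and y :: "'n ser"
  assumes data: "lin_data p y"
begin

lemma fp_tang: "Dz c (ser_conj (fp_sol c p k)) + p k = 0"
proof -
  have "bh a' 0 (- ser_conj (p k)) = 0" for a'
    using data by (simp add: bh_minus bh_ser_conj lin_data_def)
  then show ?thesis using Eb_fsol[of "- ser_conj (p k)" c "\<lambda>_. 0"] tangential_iff by (simp add: fp_sol_def)
qed

lemma van_fp: "(\<And>k. van wt m (p k)) \<Longrightarrow> van wt m (fp_sol c p k)"
  unfolding fp_sol_def by (intro van_fsol van_minus van_wt_ser_conj) auto

lemma fp_2: "van wt 2 (fp_sol c p k)" "mcoeff (fp_sol c p k) (uexp 1) = 0"
proof -
  show "van wt 2 (fp_sol c p k)" using data by (intro van_fp) (simp add: lin_data_def)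
  have "mcoeff (fp_sol c p k) (uexp 1) = mcoeff (bh 0 0 (fp_sol c p k)) (uexp 1)" by simp
  then show "mcoeff (fp_sol c p k) (uexp 1) = 0" unfolding fp_sol_def bh_fsol by simp
qed

lemma van_gp: "(\<And>k. van wt m (p k)) \<Longrightarrow> van wt (m + 1) y \<Longrightarrow> van wt (m + 1) (gp_sol c a p y)"
  unfolding gp_sol_def by (intro van_gsol van_add van_Rlin van_fp) auto

lemma gp_3: "van wt 3 (gp_sol c a p y)" "mcoeff (gp_sol c a p y) (uexp 2) = 0"
  "ser_conj (gp_sol c a p y) = gp_sol c a p y"
proof -
  show "van wt 3 (gp_sol c a p y)" using van_gp[of 2] data by (simp add: lin_data_def)
  have "mcoeff (gp_sol c a p y) (uexp 2) = mcoeff (bh 0 0 (gp_sol c a p y)) (uexp 2)" by simp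
  also have "bh 0 0 (gp_sol c a p y) = 0" unfolding gp_sol_def by (rule bh_00_gsol) simp
  finally show "mcoeff (gp_sol c a p y) (uexp 2) = 0" by simp
  show "ser_conj (gp_sol c a p y) = gp_sol c a p y"
    unfolding gp_sol_def by (rule ser_conj_gsol) simp
qed

lemma yp_imag: "yp_sol c a p y + ser_conj (yp_sol c a p y) = 0"
  using Rlin_gsol[of y 0 "fp_sol c p"] data by (simp add: yp_sol_def gp_sol_def lin_data_def)

lemma yp_0: "bh 0 b (yp_sol c a p y) = 0"
  using data by (simp add: yp_sol_def bh_add bh_0_Rlin lin_data_def)

lemma van_yp: "(\<And>k. van wt m (p k)) \<Longrightarrow> van wt (m + 1) y \<Longrightarrow> van wt (m + 1) (yp_sol c a p y)"
  unfolding yp_sol_def by (intro van_add van_Rlin van_fp van_gp) auto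

lemma yp_3: "van wt 3 (yp_sol c a p y)"
  using van_yp[of 2] data by (simp add: lin_data_def)

lemma lin_exists: 
  fixes r :: real
  shows "lin_sol c ci a p y r (f_sol c ci a M1 M2 r p y) (g_sol c ci a M1 M2 r p y)"
proof -
  let ?y = "yp_sol c a p y"
  let ?f = "f0_sol c ci a M1 M2 r ?y" and ?g = "g0_sol c ci a M1 M2 r ?y"
  have h: "lin_sol c ci a (\<lambda>_. 0) ?y r ?f ?g"
    by (rule hom_exists[OF yp_imag yp_0 yp_3])
  have f: "f_sol c ci a M1 M2 r p y = (\<lambda>k. fp_sol c p k + ?f k)"
    by (rule ext) (simp add: f_sol_def)
  have g: "g_sol c ci a M1 M2 r p y = gp_sol c a p y + ?g" by (simp add: g_sol_def)
  have R: "y + Rlin a c (\<lambda>k. fp_sol c p k + ?f k) (gp_sol c a p y + ?g) = ?y + Rlin a c ?f ?g"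
    unfolding Rlin_add yp_sol_def by (simp add: add.assoc)
  have "Dz c (ser_conj (fp_sol c p k + ?f k)) + p k =
     (Dz c (ser_conj (fp_sol c p k)) + p k) + Dz c (ser_conj (?f k))" for k
    by (simp add: ser_conj_add Dz_add)
  then have t: "Dz c (ser_conj (fp_sol c p k + ?f k)) + p k = 0" for k
    using h fp_tang by (simp add: lin_sol_def)
  show ?thesis
    unfolding f g lin_sol_def R using h t gp_3 fp_2
    by (auto simp: lin_sol_def ser_conj_add intro: van_add)
qed

end

text \<open>The difference of the solutions, corrected by the particular solution for the difference
  of the data, solves a homogeneous problem with \<open>r = 0\<close>. The solution thus depends on
  the data without loss of weight; equal data give equal solutions.\<close>

lemma lin_stable:
  assumes s: "lin_sol c ci a p y r f g" and s': "lin_sol c ci a p' y' r f' g'"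
    and d: "lin_data p y" and d': "lin_data p' y'"
    and p: "\<And>k. van wt m (p k - p' k)" and y: "van wt (m + 1) (y - y')"
  shows "van wt m (f k - f' k)" "van wt (m + 1) (g - g')"
proof -
  let ?p = "\<lambda>k. p k - p' k" and ?y = "y - y'"
  let ?fp = "fp_sol c ?p" and ?gp = "gp_sol c a ?p ?y"
  have D: "lin_data ?p ?y"
    using d d' by (auto simp: lin_data_def bh_diff intro: van_diff)
  define F where "F k = (f k - f' k) - ?fp k" for k
  define G where "G = (g - g') - ?gp"
  have R: "yp_sol c a ?p ?y + Rlin a c F G = (y + Rlin a c f g) - (y' + Rlin a c f' g')"
    unfolding F_def G_def Rlin_diff yp_sol_def by simp
  have tang: "Dz c (ser_conj (F k)) = 0" for k
  proof -
    have "Dz c (ser_conj (F k)) = (Dz c (ser_conj (f k)) + p k) - (Dz c (ser_conj (f' k)) + p' k)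
        - (Dz c (ser_conj (?fp k)) + ?p k)"
      by (simp add: F_def ser_conj_diff Dz_diff)
    also have "\<dots> = 0" using s s' fp_tang[OF D, of k] by (simp add: lin_sol_def)
    finally show ?thesis .
  qed
  have n: "nrm ci (yp_sol c a ?p ?y + Rlin a c F G)"
    unfolding R using s s' by (intro nrm_diff) (auto simp: lin_sol_def)
  have G: "ser_conj G = G" using s s' gp_3(3)[OF D] by (simp add: G_def ser_conj_diff lin_sol_def)
  have F2: "van wt 2 (F k)" "mcoeff (F k) (uexp 1) = 0" for k
    using s s' fp_2[OF D, of k] by (auto simp: F_def lin_sol_def intro!: van_diff)
  have "mcoeff g (uexp 2) = mcoeff g' (uexp 2)" using s s' unfolding lin_sol_def by metis
  then have G3: "van wt 3 G" "mcoeff G (uexp 2) = 0"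
    using s s' gp_3[OF D] by (auto simp: G_def lin_sol_def intro!: van_diff)
  have Y: "van wt (m + 1) (yp_sol c a ?p ?y)" by (rule van_yp[OF D p y])
  note st = hom_stable[OF tang G yp_imag[OF D] n F2 G3 Y]
  have "van wt m (F k + ?fp k)" by (rule van_add[OF st(1) van_fp[OF D p]])
  then show "van wt m (f k - f' k)" by (simp add: F_def)
  have "van wt (m + 1) (G + ?gp)" by (rule van_add[OF st(2) van_gp[OF D p y]])
  then show "van wt (m + 1) (g - g')" by (simp add: G_def)
qed

end

section \<open>Families of series with coefficients in a ring of functions\<close>

text \<open>No inverses are asked for: the divisions in the solution formulas are by constants
  depending on the dimension and on degrees, and the inverse matrices enter as parameters with
  entries in \<open>S\<close>.\<close>

locale coeff_ring =
  fixes S :: "('p \<Rightarrow> complex) set"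
  assumes S_const: "(\<lambda>x. k) \<in> S"
    and S_add: "u \<in> S \<Longrightarrow> v \<in> S \<Longrightarrow> (\<lambda>x. u x + v x) \<in> S"
    and S_mult: "u \<in> S \<Longrightarrow> v \<in> S \<Longrightarrow> (\<lambda>x. u x * v x) \<in> S"
    and S_cnj: "u \<in> S \<Longrightarrow> (\<lambda>x. cnj (u x)) \<in> S"
begin

lemma S_minus: "u \<in> S \<Longrightarrow> (\<lambda>x. - u x) \<in> S"
  using S_mult[OF S_const[of "-1"]] by simp

lemma S_diff: "u \<in> S \<Longrightarrow> v \<in> S \<Longrightarrow> (\<lambda>x. u x - v x) \<in> S"
  using S_add[OF _ S_minus] by simp

lemma S_sum: "(\<And>i. i \<in> A \<Longrightarrow> u i \<in> S) \<Longrightarrow> (\<lambda>x. \<Sum>i\<in>A. u i x) \<in> S"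
  by (induction A rule: infinite_finite_induct) (auto intro: S_const S_add)

lemma S_prod: "(\<And>i. i \<in> A \<Longrightarrow> u i \<in> S) \<Longrightarrow> (\<lambda>x. \<Prod>i\<in>A. u i x) \<in> S"
  by (induction A rule: infinite_finite_induct) (auto intro: S_const S_mult)

lemma S_divide: "u \<in> S \<Longrightarrow> (\<lambda>x. u x / k) \<in> S"
  using S_mult[OF _ S_const[of "1 / k"]] by simp

definition fam :: "('p \<Rightarrow> 'v::finite mps) \<Rightarrow> bool" where
  "fam s \<longleftrightarrow> (\<forall>\<alpha>. (\<lambda>x. mcoeff (s x) \<alpha>) \<in> S)"

lemma famD: "fam s \<Longrightarrow> (\<lambda>x. mcoeff (s x) \<alpha>) \<in> S" by (simp add: fam_def)

lemma fam_const: "fam (\<lambda>x. s)" by (simp add: fam_def S_const)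
lemma fam_add: "fam s \<Longrightarrow> fam t \<Longrightarrow> fam (\<lambda>x. s x + t x)" by (simp add: fam_def S_add)
lemma fam_diff: "fam s \<Longrightarrow> fam t \<Longrightarrow> fam (\<lambda>x. s x - t x)" by (simp add: fam_def S_diff)
lemma fam_minus: "fam s \<Longrightarrow> fam (\<lambda>x. - s x)" by (simp add: fam_def S_minus)
lemma fam_sum: "(\<And>i. i \<in> A \<Longrightarrow> fam (s i)) \<Longrightarrow> fam (\<lambda>x. \<Sum>i\<in>A. s i x)"
  by (induction A rule: infinite_finite_induct) (auto intro: fam_const fam_add)
lemma fam_mult: "fam s \<Longrightarrow> fam t \<Longrightarrow> fam (\<lambda>x. s x * t x)"
  unfolding fam_def mcoeff_times by (intro allI S_sum S_mult) auto
lemma fam_prod: "(\<And>i. i \<in> A \<Longrightarrow> fam (s i)) \<Longrightarrow> fam (\<lambda>x. \<Prod>i\<in>A. s i x)"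
  by (induction A rule: infinite_finite_induct) (auto intro: fam_const fam_mult)
lemma fam_pow: "fam s \<Longrightarrow> fam (\<lambda>x. s x ^ m)"
  by (induction m) (auto intro: fam_const fam_mult)
lemma fam_mconst: "u \<in> S \<Longrightarrow> fam (\<lambda>x. mconst (u x))"
  unfolding fam_def mcoeff_mconst
proof
  fix \<alpha> :: "'c \<Rightarrow> nat" assume "u \<in> S"
  then show "(\<lambda>x. if \<alpha> = (\<lambda>v. 0) then u x else 0) \<in> S" by (cases "\<alpha> = (\<lambda>v. 0)") (auto intro: S_const)
qed
lemma fam_mconst_const: "fam s \<Longrightarrow> fam (\<lambda>x. mconst k * s x)"
  by (intro fam_mult fam_const)
lemma fam_mscale: "fam s \<Longrightarrow> fam (\<lambda>x. mscale m (s x))"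
  by (simp add: fam_def S_mult S_const)
lemma fam_mderiv: "fam s \<Longrightarrow> fam (\<lambda>x. mderiv v (s x))"
  unfolding fam_def mcoeff_mderiv by (intro allI S_mult S_const) auto
lemma fam_ser_conj: "fam s \<Longrightarrow> fam (\<lambda>x. ser_conj (s x))"
  by (simp add: fam_def S_cnj)
lemma fam_bh: "fam s \<Longrightarrow> fam (\<lambda>x. bh i j (s x))"
  unfolding bh_def by (rule fam_mscale)
lemma fam_Ez: "fam s \<Longrightarrow> fam (\<lambda>x. Ez (s x))" unfolding Ez_def by (rule fam_mscale)
lemma fam_mint: "fam s \<Longrightarrow> fam (\<lambda>x. mint (s x))"
  unfolding fam_def
proof
  fix \<alpha> assume "\<forall>\<alpha>. (\<lambda>x. mcoeff (s x) \<alpha>) \<in> S"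
  then show "(\<lambda>x. mcoeff (mint (s x)) \<alpha>) \<in> S"
    by (cases "\<alpha> U = 0") (auto simp: mcoeff_mint intro: S_const S_divide)
qed
lemma fam_glue: "(\<And>i j. fam (\<lambda>x. s x i j)) \<Longrightarrow> fam (\<lambda>x. glue (s x))"
  by (simp add: fam_def glue_def)
lemma fam_msubst: "fam s \<Longrightarrow> (\<And>v. fam (\<lambda>x. \<sigma> x v)) \<Longrightarrow> fam (\<lambda>x. msubst (s x) (\<sigma> x))"
  unfolding fam_def[of "\<lambda>x. msubst (s x) (\<sigma> x)"] mcoeff_msubst spow_def
  by (intro allI S_sum S_mult) (auto intro!: famD fam_prod fam_pow)

definition cfam :: "('p \<Rightarrow> 'i \<Rightarrow> 'j \<Rightarrow> complex) \<Rightarrow> bool" where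
  "cfam c \<longleftrightarrow> (\<forall>j k. (\<lambda>x. c x j k) \<in> S)"

lemma cfamD: "cfam c \<Longrightarrow> (\<lambda>x. c x j k) \<in> S" by (simp add: cfam_def)

lemma fam_qf: "cfam c \<Longrightarrow> fam (\<lambda>x. qf (c x))"
  unfolding qf_def by (intro fam_sum fam_mult fam_mconst fam_const) (simp add: cfam_def)
lemma fam_ltrace: "cfam ci \<Longrightarrow> fam s \<Longrightarrow> fam (\<lambda>x. ltrace (ci x) (s x))"
  unfolding ltrace_def by (intro fam_sum fam_mult fam_mconst fam_mderiv) (simp_all add: cfam_def)
lemma fam_aF: "cfam a \<Longrightarrow> (\<And>k. fam (\<lambda>x. f x k)) \<Longrightarrow> fam (\<lambda>x. aF (a x) (f x))"
  unfolding aF_def by (intro fam_sum fam_mult fam_mconst fam_const) (simp_all add: cfam_def)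
lemma fam_bF: "cfam c \<Longrightarrow> (\<And>k. fam (\<lambda>x. f x k)) \<Longrightarrow> fam (\<lambda>x. bF (c x) (f x))"
  unfolding bF_def by (intro fam_sum fam_mult fam_mconst fam_const S_mult S_const) (simp_all add: cfam_def)
lemma fam_Dz: "cfam c \<Longrightarrow> fam s \<Longrightarrow> fam (\<lambda>x. Dz (c x) (s x))"
  unfolding Dz_def by (intro fam_add fam_Ez fam_mconst_const fam_mult fam_qf fam_mderiv)
lemma fam_Rlin: "cfam a \<Longrightarrow> cfam c \<Longrightarrow> (\<And>k. fam (\<lambda>x. f x k)) \<Longrightarrow> fam g \<Longrightarrow> fam (\<lambda>x. Rlin (a x) (c x) (f x) (g x))"
  unfolding Rlin_def by (intro fam_add fam_diff fam_Dz fam_aF fam_bF fam_ser_conj)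
lemma fam_gsol: "fam s \<Longrightarrow> fam t \<Longrightarrow> fam (\<lambda>x. gsol (s x) (t x))"
  unfolding gsol_def by (intro fam_add fam_mscale fam_ser_conj)
lemma fam_fcomp: 
  assumes c: "cfam c" and f: "\<And>m. fam (\<lambda>x. \<phi> x m)" and P: "fam P"
  shows "fam (\<lambda>x. fcomp (c x) (\<phi> x) (P x) i j)"
proof (induction j arbitrary: i)
  case 0
  then show ?case using fam_bh[OF f[of i]] by simp
next
  case (Suc j)
  show ?case
  proof (cases i)
    case 0
    then show ?thesis using fam_mconst_const[OF fam_bh[OF P]] by simp
  next
    case (Suc i')
    show ?thesis unfolding Suc fcomp.simps
      by (intro fam_mconst_const fam_add fam_mult fam_qf fam_mderiv fam_bh c P Suc.IH)
  qed
qed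
lemma fam_fsol: "cfam c \<Longrightarrow> (\<And>m. fam (\<lambda>x. \<phi> x m)) \<Longrightarrow> fam P \<Longrightarrow> fam (\<lambda>x. fsol (c x) (\<phi> x) (P x))"
  unfolding fsol_def by (intro fam_glue fam_fcomp)
lemma fam_inv_levi: "cfam ci \<Longrightarrow> fam s \<Longrightarrow> fam (\<lambda>x. inv_levi (ci x) (s x) k)"
  unfolding inv_levi_def by (intro fam_mconst_const fam_sum fam_mult fam_mconst fam_mderiv) (simp_all add: cfam_def)
lemma fam_msol: "cfam M1 \<Longrightarrow> cfam M2 \<Longrightarrow> fam s \<Longrightarrow> fam (\<lambda>x. msol (M1 x) (M2 x) (s x) k)"
  unfolding msol_def by (intro fam_add fam_sum fam_mult fam_mconst fam_mderiv fam_ser_conj) (simp_all add: cfam_def)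
lemma fam_inv_trace_q: "cfam c \<Longrightarrow> cfam ci \<Longrightarrow> fam s \<Longrightarrow> fam (\<lambda>x. inv_trace_q (c x) (ci x) (s x))"
  unfolding inv_trace_q_def by (intro fam_mconst_const fam_diff fam_mult fam_qf fam_ltrace)

lemmas fam_intros = fam_mconst_const fam_add fam_diff fam_minus fam_bh fam_mderiv fam_mint fam_ser_conj
  fam_ltrace fam_aF fam_bF fam_inv_levi fam_msol fam_inv_trace_q fam_mult fam_qf

context
  fixes c ci a M1 M2 :: "'p \<Rightarrow> 'n::finite \<Rightarrow> 'n \<Rightarrow> complex" and r :: "'p \<Rightarrow> complex"
  assumes cc: "cfam c" "cfam ci" "cfam a" "cfam M1" "cfam M2" and rr: "r \<in> S"
begin

lemma fam_psi_sol: "fam y \<Longrightarrow> fam (\<lambda>x. psi_sol (c x) (ci x) (r x) (y x))"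
  unfolding psi_sol_def by (intro fam_intros cc fam_mconst fam_const S_divide rr)

lemma fam_chi1_sol: "fam y \<Longrightarrow> fam (\<lambda>x. chi1_sol (c x) (ci x) (r x) (y x))"
  unfolding chi1_sol_def by (intro fam_intros cc fam_psi_sol)

lemma fam_phi0_sol: "fam y \<Longrightarrow> fam (\<lambda>x. phi0_sol (c x) (ci x) (M1 x) (M2 x) (y x) k)"
  unfolding phi0_sol_def l_sol_def by (intro fam_intros cc)

lemma fam_phi_sol: 
  assumes y: "fam y" shows "fam (\<lambda>x. phi_sol (c x) (ci x) (a x) (M1 x) (M2 x) (r x) (y x) m k)"
proof (induction m arbitrary: k rule: less_induct)
  case (less m)
  consider "m = 0" | "m = 1" | "m = 2" | "m \<ge> 3" by linarith
  then show ?case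
  proof cases
    case 1
    then show ?thesis using fam_phi0_sol[OF y] by simp
  next
    case 2
    then show ?thesis using fam_inv_levi[OF cc(2) fam_chi1_sol[OF y]] by simp
  next
    case 3
    then have m: "m = Suc (Suc 0)" by simp
    show ?thesis unfolding m phi_sol.simps by (intro fam_intros fam_phi0_sol cc y)
  next
    case 4
    define i where "i = m - 3"
    have m: "m = Suc (Suc (Suc i))" using 4 by (simp add: i_def)
    have IH: "fam (\<lambda>x. phi_sol (c x) (ci x) (a x) (M1 x) (M2 x) (r x) (y x) (Suc i) k)" for k 
      using less[of "Suc i"] m by simp
    show ?thesis unfolding m phi_sol.simps by (intro fam_intros IH cc y)
  qed
qed

lemma fam_f0_sol: "fam y \<Longrightarrow> fam (\<lambda>x. f0_sol (c x) (ci x) (a x) (M1 x) (M2 x) (r x) (y x) k)"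
  unfolding f0_sol_def by (intro fam_fsol fam_phi_sol fam_const cc)

lemma fam_g0_sol: "fam y \<Longrightarrow> fam (\<lambda>x. g0_sol (c x) (ci x) (a x) (M1 x) (M2 x) (r x) (y x))"
  unfolding g0_sol_def by (intro fam_gsol fam_Rlin fam_f0_sol fam_psi_sol fam_const cc)

lemma fam_sol:
  assumes p: "\<And>k. fam (\<lambda>x. p x k)" and y: "fam y"
  shows "fam (\<lambda>x. f_sol (c x) (ci x) (a x) (M1 x) (M2 x) (r x) (p x) (y x) k)"
    "fam (\<lambda>x. g_sol (c x) (ci x) (a x) (M1 x) (M2 x) (r x) (p x) (y x))"
proof -
  have fp: "fam (\<lambda>x. fp_sol (c x) (p x) k)" for k
    unfolding fp_sol_def by (intro fam_fsol fam_const fam_minus fam_ser_conj cc p)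
  have gp: "fam (\<lambda>x. gp_sol (c x) (a x) (p x) (y x))"
    unfolding gp_sol_def by (intro fam_gsol fam_add fam_Rlin fam_const cc y fp)
  have yp: "fam (\<lambda>x. yp_sol (c x) (a x) (p x) (y x))"
    unfolding yp_sol_def by (intro fam_add fam_Rlin cc y fp gp)
  show "fam (\<lambda>x. f_sol (c x) (ci x) (a x) (M1 x) (M2 x) (r x) (p x) (y x) k)"
    unfolding f_sol_def by (intro fam_add fp fam_f0_sol yp)
  show "fam (\<lambda>x. g_sol (c x) (ci x) (a x) (M1 x) (M2 x) (r x) (p x) (y x))"
    unfolding g_sol_def by (intro fam_add gp fam_g0_sol yp)
qed

end

end

section \<open>The nonlinear equation as a fixed point problem\<close>

text \<open>The unknowns: the components of \<open>f\<close>, the series \<open>g\<close>, and the entries of the transformed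
  structure.\<close>

datatype 'n slot = SF 'n | SG | SZ 'n 'n | SW 'n

definition cmap :: "('n slot \<Rightarrow> 'n::finite ser) \<Rightarrow> 'n cvar \<Rightarrow> 'n ser" where
  "cmap x v = mvar v + (case v of Z i \<Rightarrow> x (SF i) | Zbar i \<Rightarrow> ser_conj (x (SF i)) | U \<Rightarrow> x SG)"

text \<open>The coefficients of the frame field \<open>X\<^sub>k\<close>, so that
  \<open>vfield (crf lz lw k)\<close> is the derivation along it.\<close>

definition crf :: "('n::finite \<Rightarrow> 'n \<Rightarrow> 'n ser) \<Rightarrow> ('n \<Rightarrow> 'n ser) \<Rightarrow> 'n \<Rightarrow> 'n cvar \<Rightarrow> 'n ser" where
  "crf lz lw k v = (case v of Z j \<Rightarrow> if j = k then 1 else 0 | Zbar j \<Rightarrow> lz j k | U \<Rightarrow> lw k)"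

text \<open>The transformation rule is equivalent to \<open>Mw = x \<circ> SW\<close>, \<open>Mz = x \<circ> SZ\<close>; the last summands
  isolate the value of the transformed structure at the unshifted point.\<close>

definition Mw where
  "Mw lz lw x k = lw k + vfield (crf lz lw k) (x SG)
     - (\<Sum>i\<in>UNIV. msubst (x (SW i)) (cmap x) * vfield (crf lz lw k) (x (SF i)))
     - (msubst (x (SW k)) (cmap x) - x (SW k))"

definition Mz where
  "Mz lz lw x i k = lz i k + vfield (crf lz lw k) (ser_conj (x (SF i)))
     - (\<Sum>j\<in>UNIV. msubst (x (SZ i j)) (cmap x) * vfield (crf lz lw k) (x (SF j)))
     - (msubst (x (SZ i k)) (cmap x) - x (SZ i k))"

text \<open>\<open>p_of\<close> and \<open>y_of\<close> are what is left along the Euler field after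
  removal of the linearized operator. If \<open>Mz\<close> and \<open>Mw\<close> reproduce the
  structure, the linear problem with these data is the normalization of the structure; the Levi
  polynomial subtracted in \<open>y_of\<close> is invisible to \<open>nrm\<close>.\<close>

definition p_of where
  "p_of c lz lw x i = (\<Sum>k\<in>UNIV. mvar (Z k) * Mz lz lw x i k) - Dz c (ser_conj (x (SF i)))"

definition y_of where
  "y_of c a lz lw x = (\<Sum>k\<in>UNIV. mvar (Z k) * Mw lz lw x k) - Rlin a c (\<lambda>i. x (SF i)) (x SG) - mconst \<i> * qf c"

definition upd_map :: "('n slot \<Rightarrow> 'n ser) \<Rightarrow> ('n \<Rightarrow> 'n ser) \<Rightarrow> 'n ser \<Rightarrow> 'n slot \<Rightarrow> 'n ser" where
  "upd_map x f g s = (case s of SF i \<Rightarrow> f i | SG \<Rightarrow> g | _ \<Rightarrow> x s)"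

definition upd_str :: "('n::finite \<Rightarrow> 'n \<Rightarrow> 'n ser) \<Rightarrow> ('n \<Rightarrow> 'n ser) \<Rightarrow> ('n slot \<Rightarrow> 'n ser) \<Rightarrow> 'n slot \<Rightarrow> 'n ser" where
  "upd_str lz lw x s = (case s of SZ i k \<Rightarrow> Mz lz lw x i k | SW k \<Rightarrow> Mw lz lw x k | _ \<Rightarrow> x s)"

text \<open>The structure is recomputed with the map already updated. As \<open>X\<^sub>k\<close>
  loses one weight, the old map would not improve the guaranteed accuracy of the structure.\<close>

definition step where
  "step c ci a M1 M2 r lz lw x = upd_str lz lw (upd_map x
     (f_sol c ci a M1 M2 r (p_of c lz lw x) (y_of c a lz lw x))
     (g_sol c ci a M1 M2 r (p_of c lz lw x) (y_of c a lz lw x)))"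

definition ell :: "('n::finite \<Rightarrow> 'n \<Rightarrow> complex) \<Rightarrow> ('n \<Rightarrow> 'n \<Rightarrow> complex) \<Rightarrow> 'n \<Rightarrow> 'n ser" where
  "ell a c k = (\<Sum>j\<in>UNIV. mconst (a j k) * mvar (Z j) + mconst (\<i> * c j k) * mvar (Zbar j))"

definition start :: "('n::finite \<Rightarrow> 'n \<Rightarrow> complex) \<Rightarrow> ('n \<Rightarrow> 'n \<Rightarrow> complex) \<Rightarrow> 'n slot \<Rightarrow> 'n ser" where
  "start a c s = (case s of SW k \<Rightarrow> ell a c k | _ \<Rightarrow> 0)"

text \<open>The coefficients of weight \<open>w\<close> are stationary from the iterate \<open>w + 3\<close> on.\<close>

definition slot_limit :: "(('n::finite slot \<Rightarrow> 'n ser) \<Rightarrow> ('n slot \<Rightarrow> 'n ser)) \<Rightarrow> ('n slot \<Rightarrow> 'n ser) \<Rightarrow> 'n slot \<Rightarrow> 'n ser" where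
  "slot_limit T x s = Abs_mps (\<lambda>\<alpha>. mcoeff ((T ^^ (wdeg wt \<alpha> + 3)) x s) \<alpha>)"

text \<open>The relative accuracy of the unknowns: \<open>f\<close> and \<open>L\<^sup>w\<close> are
  known to one weight more than the tangential component, \<open>g\<close> to two. With these
  offsets all of them gain one weight per iteration.\<close>

primrec shift :: "'n slot \<Rightarrow> nat" where
  "shift (SF i) = 1" | "shift SG = 2" | "shift (SZ i k) = 0" | "shift (SW k) = 1"

definition close :: "nat \<Rightarrow> ('n::finite slot \<Rightarrow> 'n ser) \<Rightarrow> ('n slot \<Rightarrow> 'n ser) \<Rightarrow> bool" where
  "close m x x' \<longleftrightarrow> (\<forall>s. van wt (m + shift s) (x s - x' s))"

text \<open>The sizes of \<open>f\<close> and \<open>g\<close> make \<open>id + (f, g)\<close> tangent to the identity in the weighted sense.\<close>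

definition tame :: "('n::finite slot \<Rightarrow> 'n ser) \<Rightarrow> bool" where
  "tame x \<longleftrightarrow> (\<forall>i. van wt 2 (x (SF i))) \<and> van wt 3 (x SG)"

section \<open>Weight estimates for coordinate changes close to the identity\<close>

lemma van_ord_1: "van wt 1 s \<Longrightarrow> van (\<lambda>_. 1) 1 s"
proof -
  assume s: "van wt 1 s"
  show ?thesis
    unfolding van_def
  proof (intro allI impI)
    fix \<alpha> :: "'a cvar \<Rightarrow> nat" assume "wdeg (\<lambda>_. 1) \<alpha> < 1"
    then have "wdeg wt \<alpha> = 0" by (simp add: wdeg_def)
    then show "mcoeff s \<alpha> = 0" using s by (simp add: van_def)
  qed
qed

lemma wt_pos: "1 \<le> wt v" by (cases v) auto

lemma van_diff_mult:
  assumes "van \<omega> i (p - p')" "van \<omega> j q" "van \<omega> i' p'" "van \<omega> j' (q - q')" "t \<le> i + j" "t \<le> i' + j'"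
  shows "van \<omega> t (p * q - p' * q')"
proof -
  have "p * q - p' * q' = (p - p') * q + p' * (q - q')" by (simp add: algebra_simps)
  then show ?thesis using van_mult'[OF assms(1,2,5)] van_mult'[OF assms(3,4,6)] by (simp add: van_add)
qed

lemma van_sum_diff: "(\<And>i. i \<in> A \<Longrightarrow> van \<omega> t (f i - g i)) \<Longrightarrow> van \<omega> t ((\<Sum>i\<in>A. f i) - (\<Sum>i\<in>A. g i))"
  unfolding sum_subtractf[symmetric] by (rule van_sum)

lemma van_diff_diff: "van \<omega> t (p - p') \<Longrightarrow> van \<omega> t (q - q') \<Longrightarrow> van \<omega> t ((p - q) - (p' - q'))"
  using van_diff[of \<omega> t "p - p'" "q - q'"] by (simp add: algebra_simps)

lemma van_add_diff: "van \<omega> t (p - p') \<Longrightarrow> van \<omega> t (q - q') \<Longrightarrow> van \<omega> t ((p + q) - (p' + q'))"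
  using van_add[of \<omega> t "p - p'" "q - q'"] by (simp add: algebra_simps)

lemma van_Z_times: "van wt t s \<Longrightarrow> van wt (t + 1) (mvar (Z k) * s)"
  by (rule van_mult'[where j = 1 and k = t]) (auto intro: van_mvar)

context
  fixes x :: "'n::finite slot \<Rightarrow> 'n ser"
  assumes x: "tame x"
begin

lemma cmap_diff: "van wt (wt v + 1) (cmap x v - mvar v)"
proof -
  have "van wt (1 + 1) (x (SF i))" "van wt (1 + 1) (ser_conj (x (SF i)))" "van wt (2 + 1) (x SG)" for i
    using x van_wt_ser_conj by (auto simp: tame_def numeral_2_eq_2 numeral_3_eq_3)
  then show ?thesis by (cases v) (simp_all add: cmap_def)
qed

lemma van_cmap: "van wt (wt v) (cmap x v)"
proof -
  have "van wt (wt v) (mvar v)" by (rule van_mvar) simp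
  moreover have "van wt (wt v) (cmap x v - mvar v)" by (rule van_mono[OF cmap_diff]) simp
  ultimately show ?thesis using van_add by fastforce
qed

lemma ord_cmap: "van (\<lambda>_. 1) 1 (cmap x v)"
  by (rule van_ord_1[OF van_mono[OF van_cmap wt_pos]])

lemma van_subst: "van wt t s \<Longrightarrow> van wt t (msubst s (cmap x))"
  by (rule van_msubst[OF _ van_cmap])

lemma van_subst_diff: "van wt t s \<Longrightarrow> van wt (t + 1) (msubst s (cmap x) - s)"
proof -
  assume "van wt t s"
  then have "van wt (t + 1) (msubst s (cmap x) - msubst s mvar)"
    by (rule van_msubst_diff[OF _ van_cmap van_mvar cmap_diff]) simp
  then show ?thesis by (simp add: msubst_mvar_id)
qed

end

lemma cmap_cmap_diff:
  assumes "\<And>i. van wt (d + 1) (x (SF i) - x' (SF i))" "van wt (d + 2) (x SG - x' SG)"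
  shows "van wt (wt v + d) (cmap x v - cmap x' v)"
proof (cases v)
  case (Zbar i)
  have "van wt (d + 1) (ser_conj (x (SF i) - x' (SF i)))" by (intro van_wt_ser_conj assms)
  then show ?thesis using Zbar by (simp add: cmap_def ser_conj_diff add.commute)
qed (use assms in \<open>simp_all add: cmap_def add.commute\<close>)

text \<open>Subtracting the unshifted value gains one weight on \<open>s - s'\<close>, because a
  tame substitution changes a series only in higher weight. This gain keeps the last summands of
  \<open>Mw\<close> and \<open>Mz\<close> from spoiling the contraction.\<close>

lemma van_subst_subst:
  assumes x: "tame x" "tame x'" and s: "van wt u (s - s')" "van wt w s'"
    and d: "\<And>i. van wt (d + 1) (x (SF i) - x' (SF i))" "van wt (d + 2) (x SG - x' SG)"
  shows "t \<le> u \<Longrightarrow> t \<le> w + d \<Longrightarrow> van wt t (msubst s (cmap x) - msubst s' (cmap x'))"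
    and "t \<le> u + 1 \<Longrightarrow> t \<le> w + d \<Longrightarrow> van wt t ((msubst s (cmap x) - s) - (msubst s' (cmap x') - s'))"
proof -
  have 1: "van wt (w + d) (msubst s' (cmap x) - msubst s' (cmap x'))"
    by (rule van_msubst_diff[OF s(2)]) (auto intro: van_cmap x cmap_cmap_diff d)
  have e: "msubst s (cmap x) - msubst s' (cmap x') = msubst (s - s') (cmap x) + (msubst s' (cmap x) - msubst s' (cmap x'))"
    by (simp add: msubst_diff)
  show "van wt t (msubst s (cmap x) - msubst s' (cmap x'))" if "t \<le> u" "t \<le> w + d"
    unfolding e using that by (intro van_add van_mono[OF 1] van_mono[OF van_subst[OF x(1) s(1)]])
  have e: "(msubst s (cmap x) - s) - (msubst s' (cmap x') - s')
      = (msubst (s - s') (cmap x) - (s - s')) + (msubst s' (cmap x) - msubst s' (cmap x'))"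
    by (simp add: msubst_diff)
  show "van wt t ((msubst s (cmap x) - s) - (msubst s' (cmap x') - s'))" if "t \<le> u + 1" "t \<le> w + d"
    unfolding e using that by (intro van_add van_mono[OF 1] van_mono[OF van_subst_diff[OF x(1) s(1)]])
qed

text \<open>The linear part of \<open>lw\<close> in \<open>z\<close>, \<open>zbar\<close> consists
  of a skew form and the Levi form only. A general \<open>L\<close> is brought to this form by the
  shear defined with \<open>quad\<close>.\<close>

locale reduced = levi_data +
  fixes lz :: "'a::finite \<Rightarrow> 'a \<Rightarrow> 'a ser" and lw :: "'a \<Rightarrow> 'a ser" and r :: real
  assumes Lz_1: "\<And>i k. van wt 1 (lz i k)" and Lw_2: "\<And>k. van wt 2 (lw k - ell a c k)"
begin

abbreviation "X k \<equiv> vfield (crf lz lw k)"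
abbreviation "el k \<equiv> ell a c k"

definition good :: "('a slot \<Rightarrow> 'a ser) \<Rightarrow> bool" where
  "good x \<longleftrightarrow> tame x \<and> (\<forall>i k. van wt 1 (x (SZ i k))) \<and> (\<forall>k. van wt 2 (x (SW k) - el k))"

lemma van_l: "van wt 1 (el k)"
  unfolding ell_def by (intro van_sum van_add van_mconst_times van_mvar) auto

lemma van_from_l: "van wt 2 (s - el k) \<Longrightarrow> van wt 1 s"
  using van_add[OF van_mono[of wt 2 "s - el k" 1] van_l[of k]] by simp

text \<open>The loss is one: from the \<open>z\<close>-derivative, whose coefficient is constant,
  and from the \<open>u\<close>-derivative, which loses 2 while its coefficient has weight
  1.\<close>

lemma van_X: "van wt (t + 1) s \<Longrightarrow> van wt t (X k s)"
proof (rule van_vfield[where a = "\<lambda>v. if v \<in> range Z then 0 else 1"])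
  fix w :: "'a cvar"
  show "van wt (if w \<in> range Z then 0 else 1) (crf lz lw k w)"
    using Lz_1 van_from_l[OF Lw_2] by (cases w) (auto simp: crf_def)
  show "t + wt w \<le> t + 1 + (if w \<in> range Z then 0 else 1)"
    by (cases w) auto
qed

text \<open>The difference between the field \<open>\<Sum>k. z\<^sub>k X\<^sub>k\<close> and its
  model \<open>Dz c\<close>. Its coefficients have one weight more than the variables they belong
  to, so this derivation raises the weight.\<close>

definition eta :: "'a cvar \<Rightarrow> 'a ser" where
  "eta v = (case v of Z j \<Rightarrow> 0 | Zbar j \<Rightarrow> \<Sum>k\<in>UNIV. mvar (Z k) * lz j k
     | U \<Rightarrow> (\<Sum>k\<in>UNIV. mvar (Z k) * lw k) - mconst \<i> * q)"

abbreviation "D s \<equiv> Dz c s + vfield eta s"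

lemma D_eq: "(\<Sum>k\<in>UNIV. mvar (Z k) * X k s) = D s"
proof -
  have "(\<Sum>k\<in>UNIV. mvar (Z k) * X k s) = (\<Sum>w\<in>UNIV. (\<Sum>k\<in>UNIV. mvar (Z k) * crf lz lw k w) * mderiv w s)"
    unfolding vfield_def sum_distrib_left sum_distrib_right by (subst sum.swap) (simp add: mult.assoc)
  also have "\<dots> = (\<Sum>j\<in>UNIV. mvar (Z j) * mderiv (Z j) s) +
      (\<Sum>j\<in>UNIV. (\<Sum>k\<in>UNIV. mvar (Z k) * lz j k) * mderiv (Zbar j) s) + (\<Sum>k\<in>UNIV. mvar (Z k) * lw k) * mderiv U s"
    unfolding sum_cvar by (simp add: crf_def if_01_mult)
  also have "\<dots> = D s"
    unfolding vfield_def sum_cvar by (simp add: eta_def Dz_def Ez_eq left_diff_distrib mult.assoc)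
  finally show ?thesis .
qed

lemma l_times: "(\<Sum>k\<in>UNIV. el k * f k) = aF a f + bF c f"
proof -
  have "(\<Sum>k\<in>UNIV. el k * f k) = (\<Sum>k\<in>UNIV. \<Sum>j\<in>UNIV. mconst (a j k) * (mvar (Z j) * f k) + mconst (\<i> * c j k) * (mvar (Zbar j) * f k))"
    by (simp only: ell_def sum_distrib_right distrib_right mult.assoc)
  also have "\<dots> = aF a f + bF c f"
    unfolding aF_def bF_def by (subst sum.swap) (simp only: sum.distrib)
  finally show ?thesis .
qed

lemma skew: "mconst (a k j) = (- mconst (a j k) :: 'a ser)"
  by (simp add: a_skew[of j k] mconst_minus)

lemma Z_times_l: "(\<Sum>k\<in>UNIV. mvar (Z k) * el k) = mconst \<i> * q"
proof -
  have "aF a (\<lambda>k. mvar (Z k)) = (\<Sum>j\<in>UNIV. \<Sum>k\<in>UNIV. mconst (a k j) * (mvar (Z k) * mvar (Z j)))"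
    unfolding aF_def by (rule sum.swap)
  also have "\<dots> = (\<Sum>j\<in>UNIV. \<Sum>k\<in>UNIV. - (mconst (a j k) * (mvar (Z j) * mvar (Z k))))"
  proof (intro sum.cong refl)
    fix j k
    show "mconst (a k j) * (mvar (Z k) * mvar (Z j)) = - (mconst (a j k) * (mvar (Z j) * mvar (Z k)))"
      by (simp add: skew[of k j] mult.commute)
  qed
  also have "\<dots> = - aF a (\<lambda>k. mvar (Z k))"
    by (simp add: aF_def sum_negf)
  finally have "mconst 2 * aF a (\<lambda>k. mvar (Z k)) = 0" by (simp add: mconst_numeral eq_neg_iff_add_eq_0)
  from mconst_cancel[OF this] have "aF a (\<lambda>k. mvar (Z k)) = 0" by simp
  moreover have "bF c (\<lambda>k. mvar (Z k)) = mconst \<i> * q"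
    by (simp add: bF_def qf_def sum_distrib_left mconst_times_mconst)
  ultimately show ?thesis using l_times[of "\<lambda>k. mvar (Z k)"] by (simp add: mult.commute)
qed

lemma eta_U: "eta U = (\<Sum>k\<in>UNIV. mvar (Z k) * (lw k - el k))"
  by (simp add: eta_def right_diff_distrib sum_subtractf Z_times_l)

lemma van_eta: "van wt t s \<Longrightarrow> van wt (t + 1) (vfield eta s)"
proof (rule van_vfield[where a = "\<lambda>v. wt v + 1"])
  fix w :: "'a cvar"
  show "van wt (wt w + 1) (eta w)"
  proof (cases w)
    case (Zbar j)
    have "van wt (1 + 1) (mvar (Z k) * lz j k)" for k by (rule van_Z_times[OF Lz_1])
    then show ?thesis using Zbar by (simp add: eta_def van_sum)
  next
    case U
    have "van wt (2 + 1) (eta U)" unfolding eta_U by (intro van_sum van_Z_times Lw_2)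
    then show ?thesis using U by simp
  qed (simp add: eta_def)
qed auto

lemma van_D: "van wt t s \<Longrightarrow> van wt t (D s)"
  by (intro van_add van_Dz van_mono[OF van_eta]) auto

lemma D_diff: "D s - D s' = D (s - s')"
  by (simp add: Dz_diff vfield_diff)

definition l' :: "('a slot \<Rightarrow> 'a ser) \<Rightarrow> 'a \<Rightarrow> 'a ser" where
  "l' x k = (\<Sum>j\<in>UNIV. mconst (a j k) * x (SF j) + mconst (\<i> * c j k) * ser_conj (x (SF j)))"

lemma msubst_l: "tame x \<Longrightarrow> msubst (el k) (cmap x) = el k + l' x k"
proof -
  assume x: "tame x"
  have "msubst (mvar v) (cmap x) = cmap x v" for v
    by (rule msubst_mvar) (rule ord_cmap[OF x])
  then show ?thesis
    by (simp add: ell_def l'_def msubst_sum msubst_add msubst_mconst_times cmap_def distrib_left sum.distrib)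
qed

text \<open>The change of the linear part of \<open>L\<^sup>w\<close> under the shift supplies the
  summands of \<open>Rlin\<close> in which \<open>f\<close> is not differentiated. The signs come
  from skewness of \<open>a\<close> and hermitian symmetry of \<open>c\<close>.\<close>

lemma Z_times_l': "(\<Sum>k\<in>UNIV. mvar (Z k) * l' x k) = - aF a (\<lambda>i. x (SF i)) - ser_conj (bF c (\<lambda>i. x (SF i)))"
proof -
  have "(\<Sum>j\<in>UNIV. mconst (a k j) * x (SF j)) = - (\<Sum>j\<in>UNIV. mconst (a j k) * x (SF j))" for k
    unfolding sum_negf[symmetric] by (intro sum.cong refl) (metis skew minus_mult_left)
  moreover have "(\<Sum>j\<in>UNIV. mconst (- \<i> * c j k) * ser_conj (x (SF j))) = - (\<Sum>j\<in>UNIV. mconst (\<i> * c j k) * ser_conj (x (SF j)))" for k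
    by (simp add: mconst_minus sum_negf)
  ultimately show ?thesis
    unfolding aF_alt conj_bF by (simp add: l'_def sum.distrib distrib_left sum_negf)
qed

lemma p_of_eq: "p_of c lz lw x i = (\<Sum>k\<in>UNIV. mvar (Z k) * lz i k) + vfield eta (ser_conj (x (SF i)))
   - (\<Sum>j\<in>UNIV. msubst (x (SZ i j)) (cmap x) * D (x (SF j)))
   - (\<Sum>k\<in>UNIV. mvar (Z k) * (msubst (x (SZ i k)) (cmap x) - x (SZ i k)))"
proof -
  have "(\<Sum>k\<in>UNIV. mvar (Z k) * (\<Sum>j\<in>UNIV. msubst (x (SZ i j)) (cmap x) * X k (x (SF j))))
      = (\<Sum>j\<in>UNIV. msubst (x (SZ i j)) (cmap x) * (\<Sum>k\<in>UNIV. mvar (Z k) * X k (x (SF j))))"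
    unfolding sum_distrib_left by (subst sum.swap) (simp add: mult.left_commute)
  then have "(\<Sum>k\<in>UNIV. mvar (Z k) * Mz lz lw x i k) = (\<Sum>k\<in>UNIV. mvar (Z k) * lz i k) + D (ser_conj (x (SF i)))
   - (\<Sum>j\<in>UNIV. msubst (x (SZ i j)) (cmap x) * D (x (SF j)))
   - (\<Sum>k\<in>UNIV. mvar (Z k) * (msubst (x (SZ i k)) (cmap x) - x (SZ i k)))"
    unfolding Mz_def by (simp only: distrib_left right_diff_distrib sum.distrib sum_subtractf D_eq)
  then show ?thesis by (simp add: p_of_def)
qed

text \<open>With \<open>Rlin\<close> cancelled, each remaining term contains \<open>eta\<close>, the
  deviation of the transformed \<open>L\<^sup>w\<close> from its linear part, or the effect of a
  substitution on such a deviation; all of these raise the weight.\<close>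

lemma y_of_eq:
  assumes x: "tame x"
  shows "y_of c a lz lw x = eta U + vfield eta (x SG)
   - (\<Sum>i\<in>UNIV. (msubst (x (SW i)) (cmap x) - el i) * D (x (SF i)))
   - (\<Sum>i\<in>UNIV. el i * vfield eta (x (SF i)))
   - (\<Sum>k\<in>UNIV. mvar (Z k) * (msubst (x (SW k) - el k) (cmap x) - (x (SW k) - el k)))"
proof -
  let ?W = "\<lambda>i. msubst (x (SW i)) (cmap x)"
  have "(\<Sum>k\<in>UNIV. mvar (Z k) * (\<Sum>j\<in>UNIV. ?W j * X k (x (SF j))))
      = (\<Sum>j\<in>UNIV. ?W j * (\<Sum>k\<in>UNIV. mvar (Z k) * X k (x (SF j))))"
    unfolding sum_distrib_left by (subst sum.swap) (simp add: mult.left_commute)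
  then have 1: "(\<Sum>k\<in>UNIV. mvar (Z k) * Mw lz lw x k) = (\<Sum>k\<in>UNIV. mvar (Z k) * lw k) + D (x SG)
   - (\<Sum>j\<in>UNIV. ?W j * D (x (SF j))) - (\<Sum>k\<in>UNIV. mvar (Z k) * (?W k - x (SW k)))"
    unfolding Mw_def by (simp only: distrib_left right_diff_distrib sum.distrib sum_subtractf D_eq)
  have 2: "(\<Sum>j\<in>UNIV. ?W j * D (x (SF j))) = (\<Sum>i\<in>UNIV. (?W i - el i) * D (x (SF i))) 
     + (\<Sum>i\<in>UNIV. el i * vfield eta (x (SF i))) + (\<Sum>i\<in>UNIV. el i * Dz c (x (SF i)))"
    unfolding sum.distrib[symmetric] by (rule sum.cong) (simp_all add: algebra_simps)
  have 3: "(\<Sum>k\<in>UNIV. mvar (Z k) * (?W k - x (SW k))) =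
      (\<Sum>k\<in>UNIV. mvar (Z k) * (msubst (x (SW k) - el k) (cmap x) - (x (SW k) - el k))) + (\<Sum>k\<in>UNIV. mvar (Z k) * l' x k)"
    unfolding sum.distrib[symmetric] by (rule sum.cong) (simp_all add: algebra_simps msubst_diff msubst_l[OF x])
  have "Rlin a c (\<lambda>i. x (SF i)) (x SG) = Dz c (x SG) - (\<Sum>i\<in>UNIV. el i * Dz c (x (SF i))) - (\<Sum>k\<in>UNIV. mvar (Z k) * l' x k)"
    unfolding l_times Z_times_l' Rlin_def aF_diff by simp
  then show ?thesis unfolding y_of_def 1 2 3 by (simp add: eta_def)
qed

lemma bh_0_Z_sum: "bh 0 b (\<Sum>k\<in>UNIV. mvar (Z k) * s k) = 0"
  by (simp add: bh_sum bh_Z_0)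

lemma lin_data_of:
  assumes x: "good x" shows "lin_data (p_of c lz lw x) (y_of c a lz lw x)"
proof -
  have t: "tame x" and z: "van wt 1 (x (SZ i k))" and w: "van wt 2 (x (SW k) - el k)" for i k
    using x by (auto simp: good_def)
  have f: "van wt 2 (x (SF i))" "van wt 2 (ser_conj (x (SF i)))" and g: "van wt 3 (x SG)" for i
    using t van_wt_ser_conj by (auto simp: tame_def)
  have "van wt 2 (p_of c lz lw x i)" for i
  proof -
    have "van wt (1 + 1) (\<Sum>k\<in>UNIV. mvar (Z k) * lz i k)" by (intro van_sum van_Z_times Lz_1)
    then have "van wt 2 (\<Sum>k\<in>UNIV. mvar (Z k) * lz i k)" by (rule van_mono) simp
    moreover have "van wt 2 (vfield eta (ser_conj (x (SF i))))" by (rule van_mono[OF van_eta[OF f(2)]]) simp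
    moreover have "van wt 2 (msubst (x (SZ i j)) (cmap x) * D (x (SF j)))" for j
      by (rule van_mult'[OF van_subst[OF t z] van_D[OF f(1)]]) simp
    moreover have "van wt 2 (mvar (Z k) * (msubst (x (SZ i k)) (cmap x) - x (SZ i k)))" for k
      by (rule van_mono[OF van_Z_times[OF van_subst_diff[OF t z]]]) simp
    ultimately show ?thesis unfolding p_of_eq by (rule van_diff[OF van_diff[OF van_add van_sum] van_sum])
  qed
  moreover have "van wt 3 (y_of c a lz lw x)"
  proof -
    have "van wt (2 + 1) (eta U)" unfolding eta_U by (intro van_sum van_Z_times Lw_2)
    then have "van wt 3 (eta U)" by simp
    moreover have "van wt 3 (vfield eta (x SG))" by (rule van_mono[OF van_eta[OF g]]) simp
    moreover have "van wt 3 ((msubst (x (SW i)) (cmap x) - el i) * D (x (SF i)))" for i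
    proof -
      have "msubst (x (SW i)) (cmap x) - el i = msubst (x (SW i) - el i) (cmap x) + (msubst (el i) (cmap x) - el i)"
        by (simp add: msubst_diff)
      moreover have "van wt 1 \<dots>"
        by (intro van_add van_mono[OF van_subst[OF t w]] van_mono[OF van_subst_diff[OF t van_l]]) auto
      ultimately have "van wt 1 (msubst (x (SW i)) (cmap x) - el i)" by (simp only:)
      then show ?thesis by (rule van_mult'[OF _ van_D[OF f(1)]]) simp
    qed
    moreover have "van wt 3 (el i * vfield eta (x (SF i)))" for i
      by (rule van_mult'[OF van_l van_eta[OF f(1)]]) simp
    moreover have "van wt 3 (mvar (Z k) * (msubst (x (SW k) - el k) (cmap x) - (x (SW k) - el k)))" for k
      by (rule van_mono[OF van_Z_times[OF van_subst_diff[OF t w]]]) simp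
    ultimately show ?thesis unfolding y_of_eq[OF t] by (intro van_add van_diff van_sum)
  qed
  moreover have "bh 0 b (p_of c lz lw x i) = 0" for b i
    by (simp add: p_of_def bh_diff bh_0_Z_sum bh_0_Dz)
  moreover have "bh 0 b (y_of c a lz lw x) = 0" for b
    using bh_qf_0[of b c 1] by (simp add: y_of_def bh_diff bh_0_Z_sum bh_0_Rlin bh_mconst_times)
  ultimately show ?thesis by (simp add: lin_data_def)
qed

context
  fixes x x' :: "'a slot \<Rightarrow> 'a ser" and m :: nat
  assumes x: "good x" and x': "good x'"
begin

lemma good_facts:
  "tame x" "tame x'" "van wt 1 (x (SZ i k))" "van wt 1 (x' (SZ i k))" "van wt 2 (x (SW k) - el k)" "van wt 2 (x' (SW k) - el k)"
  "van wt 1 (x (SW k))" "van wt 1 (x' (SW k))" "van wt 2 (x (SF i))" "van wt 2 (x' (SF i))" "van wt 3 (x SG)" "van wt 3 (x' SG)"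
  using x x' van_from_l[of "x (SW k)" k] van_from_l[of "x' (SW k)" k] by (auto simp: good_def tame_def)

text \<open>The gain of one weight: states that are \<open>close m\<close> agree in \<open>f\<close>
  up to weight \<open>m + 1\<close>, but in the data for \<open>f\<close> up to
  \<open>m + 2\<close>. The same gain occurs for \<open>g\<close> in \<open>close_y\<close>.\<close>

lemma close_p:
  assumes "close m x x'" shows "van wt (m + 2) (p_of c lz lw x i - p_of c lz lw x' i)"
proof -
  note gf = good_facts
  have f: "van wt (m + 1) (x (SF i) - x' (SF i))" and g: "van wt (m + 2) (x SG - x' SG)" 
    and z: "van wt m (x (SZ i k) - x' (SZ i k))" for i k
    using assms unfolding close_def by (metis shift.simps add_0_right)+
  have "van wt (m + 1) (ser_conj (x (SF i) - x' (SF i)))" by (intro van_wt_ser_conj f)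
  then have 1: "van wt (m + 2) (vfield eta (ser_conj (x (SF i))) - vfield eta (ser_conj (x' (SF i))))"
    unfolding vfield_diff[symmetric] ser_conj_diff[symmetric] by (intro van_mono[OF van_eta]) auto
  have 2: "van wt (m + 2) (msubst (x (SZ i j)) (cmap x) * D (x (SF j)) - msubst (x' (SZ i j)) (cmap x') * D (x' (SF j)))" for j
  proof (rule van_diff_mult)
    show "van wt m (msubst (x (SZ i j)) (cmap x) - msubst (x' (SZ i j)) (cmap x'))"
      by (rule van_subst_subst(1)[OF gf(1,2) z gf(4) f g]) auto
    show "van wt (m + 1) (D (x (SF j)) - D (x' (SF j)))" unfolding D_diff by (intro van_D f)
  qed (auto intro: van_D gf van_subst)
  have 3: "van wt (m + 2) (mvar (Z k) * (msubst (x (SZ i k)) (cmap x) - x (SZ i k)) - mvar (Z k) * (msubst (x' (SZ i k)) (cmap x') - x' (SZ i k)))" for k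
  proof -
    have "van wt (m + 1) ((msubst (x (SZ i k)) (cmap x) - x (SZ i k)) - (msubst (x' (SZ i k)) (cmap x') - x' (SZ i k)))"
      by (rule van_subst_subst(2)[OF gf(1,2) z gf(4) f g]) auto
    then show ?thesis unfolding right_diff_distrib[symmetric] by (rule van_mono[OF van_Z_times]) simp
  qed
  show ?thesis
    unfolding p_of_eq by (intro van_diff_diff van_add_diff van_sum_diff 1 2 3) simp
qed

lemma close_y:
  assumes "close m x x'" shows "van wt (m + 3) (y_of c a lz lw x - y_of c a lz lw x')"
proof -
  note gf = good_facts
  have f: "van wt (m + 1) (x (SF i) - x' (SF i))" and g: "van wt (m + 2) (x SG - x' SG)" 
    and w: "van wt (m + 1) (x (SW k) - x' (SW k))" for i k
    using assms unfolding close_def by (metis shift.simps)+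
  have 1: "van wt (m + 3) (vfield eta (x SG) - vfield eta (x' SG))"
    unfolding vfield_diff[symmetric] by (rule van_mono[OF van_eta[OF g]]) simp
  have l2: "van wt 2 (msubst (x' (SW i)) (cmap x') - el i)" for i
  proof -
    have "msubst (x' (SW i)) (cmap x') - el i = msubst (x' (SW i) - el i) (cmap x') + (msubst (el i) (cmap x') - el i)"
      by (simp add: msubst_diff)
    moreover have "van wt 2 \<dots>"
      by (intro van_add van_subst gf van_mono[OF van_subst_diff[OF _ van_l]]) auto
    ultimately show ?thesis by (simp only:)
  qed
  have 2: "van wt (m + 3) ((msubst (x (SW i)) (cmap x) - el i) * D (x (SF i)) - (msubst (x' (SW i)) (cmap x') - el i) * D (x' (SF i)))" for i
  proof (rule van_diff_mult)
    have "van wt (m + 1) (msubst (x (SW i)) (cmap x) - msubst (x' (SW i)) (cmap x'))"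
      by (rule van_subst_subst(1)[OF gf(1,2) w gf(8) f g]) auto
    then show "van wt (m + 1) ((msubst (x (SW i)) (cmap x) - el i) - (msubst (x' (SW i)) (cmap x') - el i))" by simp
    show "van wt (m + 1) (D (x (SF i)) - D (x' (SF i)))" unfolding D_diff by (intro van_D f)
  qed (auto intro: van_D gf l2)
  have 3: "van wt (m + 3) (el i * vfield eta (x (SF i)) - el i * vfield eta (x' (SF i)))" for i
    unfolding right_diff_distrib[symmetric] vfield_diff[symmetric] by (rule van_mult'[OF van_l van_eta[OF f]]) simp
  have 4: "van wt (m + 3) (mvar (Z k) * (msubst (x (SW k) - el k) (cmap x) - (x (SW k) - el k))
      - mvar (Z k) * (msubst (x' (SW k) - el k) (cmap x') - (x' (SW k) - el k)))" for k
  proof -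
    have "van wt (m + 1) ((x (SW k) - el k) - (x' (SW k) - el k))" using w[of k] by simp
    then have "van wt (m + 2) ((msubst (x (SW k) - el k) (cmap x) - (x (SW k) - el k)) - (msubst (x' (SW k) - el k) (cmap x') - (x' (SW k) - el k)))"
      by (rule van_subst_subst(2)[OF gf(1,2) _ gf(6) f g]) auto
    then show ?thesis unfolding right_diff_distrib[symmetric] by (rule van_mono[OF van_Z_times]) simp
  qed
  show ?thesis
    unfolding y_of_eq[OF gf(1)] y_of_eq[OF gf(2)]
    by (intro van_diff_diff van_add_diff van_sum_diff 1 2 3 4) simp
qed

text \<open>The derivation along \<open>X\<^sub>k\<close> costs one weight, so the accuracy assumed
  for \<open>f\<close> and \<open>g\<close> is already that of the next iterate, while the structure
  is still the old one.\<close>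

lemma close_M:
  assumes f: "\<And>i. van wt (m + 2) (x (SF i) - x' (SF i))" and g: "van wt (m + 3) (x SG - x' SG)"
    and z: "\<And>i k. van wt m (x (SZ i k) - x' (SZ i k))" and w: "\<And>k. van wt (m + 1) (x (SW k) - x' (SW k))"
  shows "van wt (m + 1) (Mz lz lw x i k - Mz lz lw x' i k)" "van wt (m + 2) (Mw lz lw x k - Mw lz lw x' k)"
proof -
  note gf = good_facts
  have f': "van wt ((m + 1) + 1) (x (SF i) - x' (SF i))" and g': "van wt ((m + 1) + 2) (x SG - x' SG)" for i
    using f g by (simp_all add: numeral_2_eq_2 numeral_3_eq_3)
  have Xf: "van wt 1 (X k (x (SF i)))" for i
    by (rule van_X) (use gf(9) in \<open>simp add: numeral_2_eq_2\<close>)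
  have dX: "van wt (m + 1) (X k (x (SF i)) - X k (x' (SF i)))" for i
    unfolding vfield_diff[symmetric] by (rule van_X[OF f'])
  have 1: "van wt (m + 1) (X k (ser_conj (x (SF i))) - X k (ser_conj (x' (SF i))))"
    unfolding vfield_diff[symmetric] ser_conj_diff[symmetric] by (rule van_X[OF van_wt_ser_conj[OF f']])
  have 2: "van wt (m + 1) (msubst (x (SZ i j)) (cmap x) * X k (x (SF j)) - msubst (x' (SZ i j)) (cmap x') * X k (x' (SF j)))" for j
  proof (rule van_diff_mult)
    show "van wt m (msubst (x (SZ i j)) (cmap x) - msubst (x' (SZ i j)) (cmap x'))"
      by (rule van_subst_subst(1)[OF gf(1,2) z gf(4) f' g']) auto
  qed (auto intro: Xf dX van_subst gf)
  have 3: "van wt (m + 1) ((msubst (x (SZ i k)) (cmap x) - x (SZ i k)) - (msubst (x' (SZ i k)) (cmap x') - x' (SZ i k)))"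
    by (rule van_subst_subst(2)[OF gf(1,2) z gf(4) f' g']) auto
  show "van wt (m + 1) (Mz lz lw x i k - Mz lz lw x' i k)"
    unfolding Mz_def by (intro van_diff_diff van_add_diff van_sum_diff 1 2 3[unfolded right_diff_distrib]) (simp_all add: 3)
  have 1: "van wt (m + 2) (X k (x SG) - X k (x' SG))"
    unfolding vfield_diff[symmetric] by (rule van_X) (use g in \<open>simp add: numeral_2_eq_2 numeral_3_eq_3\<close>)
  have 2: "van wt (m + 2) (msubst (x (SW j)) (cmap x) * X k (x (SF j)) - msubst (x' (SW j)) (cmap x') * X k (x' (SF j)))" for j
  proof (rule van_diff_mult)
    show "van wt (m + 1) (msubst (x (SW j)) (cmap x) - msubst (x' (SW j)) (cmap x'))"
      by (rule van_subst_subst(1)[OF gf(1,2) w gf(8) f' g']) auto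
  qed (auto intro: Xf dX van_subst gf)
  have 3: "van wt (m + 2) ((msubst (x (SW k)) (cmap x) - x (SW k)) - (msubst (x' (SW k)) (cmap x') - x' (SW k)))"
    by (rule van_subst_subst(2)[OF gf(1,2) w gf(8) f' g']) auto
  show "van wt (m + 2) (Mw lz lw x k - Mw lz lw x' k)"
    unfolding Mw_def by (rule van_diff_diff[OF van_diff_diff[OF van_add_diff[OF _ 1] van_sum_diff[OF 2]] 3]) simp
qed

end

lemma good_M:
  assumes x: "tame x" and z: "\<And>i k. van wt 1 (x (SZ i k))" and w: "\<And>k. van wt 1 (x (SW k))"
  shows "van wt 1 (Mz lz lw x i k)" "van wt 2 (Mw lz lw x k - el k)"
proof -
  have Xf: "van wt 1 (X k (x (SF i)))" for i
    by (rule van_X) (use x in \<open>simp add: tame_def numeral_2_eq_2\<close>)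
  have Xc: "van wt 1 (X k (ser_conj (x (SF i))))"
    by (rule van_X, rule van_wt_ser_conj) (use x in \<open>simp add: tame_def numeral_2_eq_2\<close>)
  have Xg: "van wt 2 (X k (x SG))"
    by (rule van_X) (use x in \<open>simp add: tame_def numeral_2_eq_2 numeral_3_eq_3\<close>)
  have "van wt 1 (msubst (x (SZ i j)) (cmap x) * X k (x (SF j)))" for j
    by (rule van_mult'[OF van_subst[OF x z] Xf]) simp
  moreover have "van wt 1 (msubst (x (SZ i k)) (cmap x) - x (SZ i k))"
    by (rule van_mono[OF van_subst_diff[OF x z]]) simp
  ultimately show "van wt 1 (Mz lz lw x i k)"
    unfolding Mz_def by (rule van_diff[OF van_diff[OF van_add[OF Lz_1 Xc] van_sum]])
  have "van wt 2 (msubst (x (SW j)) (cmap x) * X k (x (SF j)))" for j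
    by (rule van_mult'[OF van_subst[OF x w] Xf]) simp
  moreover have "van wt 2 (msubst (x (SW k)) (cmap x) - x (SW k))"
    by (rule van_mono[OF van_subst_diff[OF x w]]) simp
  moreover have "Mw lz lw x k - el k = (lw k - el k) + X k (x SG)
     - (\<Sum>i\<in>UNIV. msubst (x (SW i)) (cmap x) * X k (x (SF i))) - (msubst (x (SW k)) (cmap x) - x (SW k))"
    by (simp add: Mw_def)
  ultimately show "van wt 2 (Mw lz lw x k - el k)"
    by (simp only:) (rule van_diff[OF van_diff[OF van_add[OF Lw_2 Xg] van_sum]])
qed

section \<open>The contraction and its fixed point\<close>

abbreviation "stp \<equiv> step c ci a M1 M2 (of_real r) lz lw"
abbreviation "fs x \<equiv> f_sol c ci a M1 M2 (of_real r) (p_of c lz lw x) (y_of c a lz lw x)"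
abbreviation "gs x \<equiv> g_sol c ci a M1 M2 (of_real r) (p_of c lz lw x) (y_of c a lz lw x)"

lemma sol: "good x \<Longrightarrow> lin_sol c ci a (p_of c lz lw x) (y_of c a lz lw x) r (fs x) (gs x)"
  by (rule lin_exists[OF lin_data_of])

lemma good_upd: "good x \<Longrightarrow> good (upd_map x (fs x) (gs x))"
  using sol[of x] by (auto simp: good_def tame_def upd_map_def lin_sol_def)

lemma good_step: "good x \<Longrightarrow> good (stp x)"
proof -
  assume "good x"
  then have g: "good (upd_map x (fs x) (gs x))" by (rule good_upd)
  then have "tame (stp x)" by (simp add: step_def good_def tame_def upd_str_def)
  moreover have "van wt 1 (upd_map x (fs x) (gs x) (SZ i k))" "van wt 1 (upd_map x (fs x) (gs x) (SW k))" for i k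
    using good_facts[OF g g] by blast+
  then have "van wt 1 (Mz lz lw (upd_map x (fs x) (gs x)) i k)" "van wt 2 (Mw lz lw (upd_map x (fs x) (gs x)) k - el k)" for i k
    using good_M[of "upd_map x (fs x) (gs x)"] g unfolding good_def by blast+
  ultimately show ?thesis unfolding good_def by (simp add: step_def upd_str_def)
qed

text \<open>The data have gained one weight, \<open>lin_stable\<close> passes the gain on to
  \<open>f\<close> and \<open>g\<close>, and recomputing the structure from these passes it on to
  the remaining slots.\<close>

lemma close_step:
  assumes x: "good x" and x': "good x'" and c: "close m x x'"
  shows "close (Suc m) (stp x) (stp x')"
proof -
  let ?u = "upd_map x (fs x) (gs x)" and ?u' = "upd_map x' (fs x') (gs x')"
  have "van wt ((m + 2) + 1) (y_of c a lz lw x - y_of c a lz lw x')"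
    using close_y[OF x x' c] by (simp add: numeral_2_eq_2 numeral_3_eq_3)
  note st = lin_stable[OF sol[OF x] sol[OF x'] lin_data_of[OF x] lin_data_of[OF x'] close_p[OF x x' c] this]
  have z: "van wt m (x (SZ i k) - x' (SZ i k))" and w: "van wt (m + 1) (x (SW k) - x' (SW k))" for i k
    using c unfolding close_def by (metis shift.simps add_0_right)+
  have f: "van wt (m + 2) (?u (SF i) - ?u' (SF i))" for i using st(1) by (simp add: upd_map_def)
  have g: "van wt (m + 3) (?u SG - ?u' SG)" using st(2) by (simp add: upd_map_def numeral_2_eq_2 numeral_3_eq_3)
  note M = close_M[OF good_upd[OF x] good_upd[OF x'] f g]
  show ?thesis
    unfolding close_def
  proof
    fix s :: "'a slot"
    show "van wt (Suc m + shift s) (stp x s - stp x' s)"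
    proof (cases s)
      case (SF i)
      then show ?thesis using f[of i] by (simp add: step_def upd_str_def numeral_2_eq_2)
    next
      case SG
      then show ?thesis using g by (simp add: step_def upd_str_def numeral_2_eq_2 numeral_3_eq_3)
    next
      case (SZ i k)
      have "van wt (m + 1) (Mz lz lw ?u i k - Mz lz lw ?u' i k)"
        by (rule M(1)) (use z w in \<open>simp_all add: upd_map_def\<close>)
      then show ?thesis using SZ by (simp add: step_def upd_str_def)
    next
      case (SW k)
      have "van wt (m + 2) (Mw lz lw ?u k - Mw lz lw ?u' k)"
        by (rule M(2)) (use z w in \<open>simp_all add: upd_map_def\<close>)
      then show ?thesis using SW by (simp add: step_def upd_str_def numeral_2_eq_2)
    qed
  qed
qed

lemma good_close: "good x \<Longrightarrow> good x' \<Longrightarrow> close 1 x x'"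
  unfolding close_def
proof
  fix s assume x: "good x" "good x'"
  show "van wt (1 + shift s) (x s - x' s)"
  proof (cases s)
    case (SW k)
    have "x (SW k) - x' (SW k) = (x (SW k) - el k) - (x' (SW k) - el k)" by simp
    moreover have "van wt 2 \<dots>" by (rule van_diff) (use x in \<open>simp_all add: good_def\<close>)
    ultimately show ?thesis using SW by (simp add: numeral_2_eq_2)
  qed (use x in \<open>auto simp: good_def tame_def numeral_2_eq_2 numeral_3_eq_3 intro!: van_diff\<close>)
qed

lemma close_good: "good x \<Longrightarrow> close 1 x' x \<Longrightarrow> good x'"
proof -
  assume x: "good x" and c: "close 1 x' x"
  have d: "van wt 2 (x' (SF i) - x (SF i))" "van wt 3 (x' SG - x SG)" "van wt 1 (x' (SZ i k) - x (SZ i k))"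
    "van wt 2 (x' (SW k) - x (SW k))" for i k
    using c[unfolded close_def, rule_format, of "SF i"] c[unfolded close_def, rule_format, of "SG"]
      c[unfolded close_def, rule_format, of "SZ i k"] c[unfolded close_def, rule_format, of "SW k"]
    by (simp_all add: numeral_2_eq_2 numeral_3_eq_3)
  have g: "van wt 2 (x (SF i))" "van wt 3 (x SG)" "van wt 1 (x (SZ i k))" "van wt 2 (x (SW k) - el k)" for i k
    using x by (auto simp: good_def tame_def)
  have "van wt 2 ((x' (SW k) - x (SW k)) + (x (SW k) - el k))" "van wt 2 ((x' (SF i) - x (SF i)) + x (SF i))"
    "van wt 3 ((x' SG - x SG) + x SG)" "van wt 1 ((x' (SZ i k) - x (SZ i k)) + x (SZ i k))" for i k
    using d g by (blast intro: van_add)+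
  then show ?thesis unfolding good_def tame_def by simp
qed

lemma close_mono: "close m x x' \<Longrightarrow> j \<le> m \<Longrightarrow> close j x x'"
  unfolding close_def by (auto intro: van_mono)

lemma close_all_eq: "(\<And>m. close m x x') \<Longrightarrow> x = x'"
proof
  fix s assume "\<And>m. close m x x'"
  then have "van wt m (x s - x' s)" for m unfolding close_def by (meson van_mono le_add1)
  then show "x s = x' s" using van_all_eq_0 by fastforce
qed

abbreviation "x0 \<equiv> start a c"

lemma good_x0: "good x0"
  by (simp add: start_def good_def tame_def)

lemma good_iter: "good ((stp ^^ j) x0)"
  by (induction j) (auto intro: good_x0 good_step)

lemma close_iter: "m \<le> Suc i \<Longrightarrow> m \<le> Suc j \<Longrightarrow> close m ((stp ^^ i) x0) ((stp ^^ j) x0)"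
proof (induction m arbitrary: i j)
  case 0
  then show ?case using close_mono[OF good_close[OF good_iter good_iter]] by simp
next
  case (Suc m)
  show ?case
  proof (cases m)
    case 0
    then show ?thesis using good_close[OF good_iter good_iter] by simp
  next
    case (Suc m')
    then obtain i' j' where ij: "i = Suc i'" "j = Suc j'" using Suc.prems
      by (metis Suc_le_D Suc_le_mono)
    show ?thesis unfolding ij funpow.simps comp_def
      by (rule close_step[OF good_iter good_iter Suc.IH]) (use Suc.prems ij in auto)
  qed
qed

abbreviation "xlim \<equiv> slot_limit stp x0"

lemma close_xlim: "m \<le> Suc j \<Longrightarrow> close m xlim ((stp ^^ j) x0)"
  unfolding close_def van_def
proof (intro allI impI)
  fix s :: "'a slot" and \<alpha> :: "'a cvar \<Rightarrow> nat"
  assume m: "m \<le> Suc j" and \<alpha>: "wdeg wt \<alpha> < m + shift s"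
  \<comment> \<open>The limit takes its coefficient from the iterate
    \<open>wdeg wt \<alpha> + 3\<close>. Comparison with iterate \<open>j\<close> is available up to
    the smaller of the two orders, which still covers \<open>\<alpha>\<close>.\<close>
  let ?k = "min m (wdeg wt \<alpha> + 3)"
  have "close ?k ((stp ^^ (wdeg wt \<alpha> + 3)) x0) ((stp ^^ j) x0)"
    by (rule close_iter) (use m in auto)
  moreover have "wdeg wt \<alpha> < ?k + shift s" using \<alpha> by auto
  ultimately have "mcoeff ((stp ^^ (wdeg wt \<alpha> + 3)) x0 s - (stp ^^ j) x0 s) \<alpha> = 0"
    unfolding close_def van_def by blast
  then show "mcoeff (xlim s - (stp ^^ j) x0 s) \<alpha> = 0" by (simp add: slot_limit_def)
qed

lemma good_xlim: "good xlim"
  by (rule close_good[OF good_iter close_xlim]) simp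

lemma close_sym: "close m x x' \<Longrightarrow> close m x' x"
  unfolding close_def using van_minus by fastforce

lemma close_trans: "close m x x' \<Longrightarrow> close m x' x'' \<Longrightarrow> close m x x''"
  unfolding close_def
proof
  fix s assume "\<forall>s. van wt (m + shift s) (x s - x' s)" "\<forall>s. van wt (m + shift s) (x' s - x'' s)"
  then have "van wt (m + shift s) ((x s - x' s) + (x' s - x'' s))" by (intro van_add) auto
  then show "van wt (m + shift s) (x s - x'' s)" by simp
qed

lemma step_xlim: "stp xlim = xlim"
proof (rule close_all_eq)
  fix m
  have "close (Suc m) (stp xlim) (stp ((stp ^^ m) x0))"
    by (rule close_step[OF good_xlim good_iter close_xlim]) simp
  moreover have "close (Suc m) xlim ((stp ^^ Suc m) x0)" by (rule close_xlim) simp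
  ultimately have "close (Suc m) (stp xlim) xlim" using close_sym close_trans by fastforce
  then show "close m (stp xlim) xlim" by (rule close_mono) simp
qed

lemma fixpoint_unique: 
  assumes "good x" "stp x = x" shows "x = xlim"
proof (rule close_all_eq)
  fix m show "close m x xlim"
  proof (induction m)
    case 0
    then show ?case using close_mono[OF good_close[OF assms(1) good_xlim]] by simp
  next
    case (Suc m)
    then show ?case using close_step[OF assms(1) good_xlim Suc] by (simp add: assms(2) step_xlim)
  qed
qed

definition red_sol :: "('a slot \<Rightarrow> 'a ser) \<Rightarrow> bool" where
  "red_sol x \<longleftrightarrow> good x \<and> (\<forall>i k. Mz lz lw x i k = x (SZ i k)) \<and> (\<forall>k. Mw lz lw x k = x (SW k)) \<and>
     (\<forall>i. (\<Sum>k\<in>UNIV. mvar (Z k) * x (SZ i k)) = 0) \<and>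
     nrm ci ((\<Sum>k\<in>UNIV. mvar (Z k) * x (SW k)) - mconst \<i> * q) \<and>
     ser_conj (x SG) = x SG \<and> (\<forall>i. mcoeff (x (SF i)) (uexp 1) = 0) \<and> mcoeff (x SG) (uexp 2) = of_real r / 2"

text \<open>A solution of the nonlinear problem solves the linear problem with data computed from
  itself. Uniqueness for the latter identifies its \<open>(f, g)\<close> with the value of the
  solution operator.\<close>

lemma red_sol_iff_fixpoint: "red_sol x \<longleftrightarrow> good x \<and> stp x = x"
proof (cases "good x")
  case x: True
  let ?f = "\<lambda>i. x (SF i)" and ?g = "x SG"
  let ?L = "lin_sol c ci a (p_of c lz lw x) (y_of c a lz lw x) r ?f ?g"
  have L: "?L \<longleftrightarrow> (\<forall>i. ?f i = fs x i) \<and> ?g = gs x"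
  proof
    assume l: ?L
    have "van wt m (?f i - fs x i)" "van wt (m + 1) (?g - gs x)" for m i
      using lin_stable[OF l sol[OF x] lin_data_of[OF x] lin_data_of[OF x], of m] by simp_all
    then show "(\<forall>i. ?f i = fs x i) \<and> ?g = gs x"
      by (metis eq_iff_diff_eq_0 van_all_eq_0 van_mono le_add1)
  next
    assume "(\<forall>i. ?f i = fs x i) \<and> ?g = gs x"
    then have "?f = fs x" "?g = gs x" by auto
    then show ?L using sol[OF x] by (simp only:)
  qed
  have u: "upd_map x (fs x) (gs x) = x" if "(\<forall>i. ?f i = fs x i) \<and> ?g = gs x"
  proof
    show "upd_map x (fs x) (gs x) s = x s" for s using that by (cases s) (simp_all add: upd_map_def)
  qed
  have "stp x = x \<longleftrightarrow> ?L \<and> (\<forall>i k. Mz lz lw x i k = x (SZ i k)) \<and> (\<forall>k. Mw lz lw x k = x (SW k))"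
  proof
    assume s: "stp x = x"
    have "?f i = fs x i" "?g = gs x" for i
      using fun_cong[OF s, of "SF i"] fun_cong[OF s, of SG] by (simp_all add: step_def upd_str_def upd_map_def)
    then have 1: "(\<forall>i. ?f i = fs x i) \<and> ?g = gs x" by simp
    have "Mz lz lw x i k = x (SZ i k)" "Mw lz lw x k = x (SW k)" for i k
      using fun_cong[OF s, of "SZ i k"] fun_cong[OF s, of "SW k"] 
      unfolding step_def u[OF 1] by (simp_all add: upd_str_def)
    then show "?L \<and> (\<forall>i k. Mz lz lw x i k = x (SZ i k)) \<and> (\<forall>k. Mw lz lw x k = x (SW k))" using 1 L by simp
  next
    assume a: "?L \<and> (\<forall>i k. Mz lz lw x i k = x (SZ i k)) \<and> (\<forall>k. Mw lz lw x k = x (SW k))"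
    then have 1: "(\<forall>i. ?f i = fs x i) \<and> ?g = gs x" using L by blast
    show "stp x = x"
    proof
      show "stp x s = x s" for s
        unfolding step_def u[OF 1] using a by (cases s) (simp_all add: upd_str_def)
    qed
  qed
  moreover have "?L \<longleftrightarrow> (\<forall>i. (\<Sum>k\<in>UNIV. mvar (Z k) * x (SZ i k)) = 0) \<and>
     nrm ci ((\<Sum>k\<in>UNIV. mvar (Z k) * x (SW k)) - mconst \<i> * q) \<and>
     ser_conj (x SG) = x SG \<and> (\<forall>i. mcoeff (x (SF i)) (uexp 1) = 0) \<and> mcoeff (x SG) (uexp 2) = of_real r / 2"
    if "\<forall>i k. Mz lz lw x i k = x (SZ i k)" "\<forall>k. Mw lz lw x k = x (SW k)"
  proof -
    have "Dz c (ser_conj (?f i)) + p_of c lz lw x i = (\<Sum>k\<in>UNIV. mvar (Z k) * x (SZ i k))" for i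
      using that by (simp add: p_of_def)
    moreover have "y_of c a lz lw x + Rlin a c ?f ?g = (\<Sum>k\<in>UNIV. mvar (Z k) * x (SW k)) - mconst \<i> * q"
      using that by (simp add: y_of_def)
    ultimately show ?thesis using x unfolding lin_sol_def good_def tame_def by auto
  qed
  ultimately show ?thesis using x unfolding red_sol_def by blast
qed (simp add: red_sol_def)

lemma red_sol_xlim: "red_sol x \<longleftrightarrow> x = xlim"
  using red_sol_iff_fixpoint fixpoint_unique good_xlim step_xlim by blast

end

section \<open>The iteration stays in the coefficient ring\<close>

context coeff_ring
begin

lemma fam_vfield: "(\<And>v. fam (\<lambda>x. \<xi> x v)) \<Longrightarrow> fam s \<Longrightarrow> fam (\<lambda>x. vfield (\<xi> x) (s x))"
  unfolding vfield_def by (intro fam_sum fam_mult fam_mderiv)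

lemma fam_cmap: "(\<And>s. fam (\<lambda>p. x p s)) \<Longrightarrow> fam (\<lambda>p. cmap (x p) v)"
  by (cases v) (auto simp: cmap_def intro!: fam_add fam_const fam_ser_conj)

lemma fam_crf: "(\<And>i k. fam (\<lambda>p. lz p i k)) \<Longrightarrow> (\<And>k. fam (\<lambda>p. lw p k)) \<Longrightarrow> fam (\<lambda>p. crf (lz p) (lw p) k v)"
  by (cases v) (auto simp: crf_def fam_const)

context
  fixes lz :: "'p \<Rightarrow> 'n::finite \<Rightarrow> 'n \<Rightarrow> 'n ser" and lw :: "'p \<Rightarrow> 'n \<Rightarrow> 'n ser"
  assumes lz: "\<And>i k. fam (\<lambda>p. lz p i k)" and lw: "\<And>k. fam (\<lambda>p. lw p k)"
begin

lemma fam_X: "fam s \<Longrightarrow> fam (\<lambda>p. vfield (crf (lz p) (lw p) k) (s p))"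
  by (intro fam_vfield fam_crf lz lw)

lemma fam_M:
  assumes x: "\<And>s. fam (\<lambda>p. x p s)"
  shows "fam (\<lambda>p. Mz (lz p) (lw p) (x p) i k)" "fam (\<lambda>p. Mw (lz p) (lw p) (x p) k)"
  unfolding Mz_def Mw_def
  by (intro fam_diff fam_add fam_sum fam_mult fam_X fam_msubst fam_cmap fam_ser_conj lz lw x)+

lemma fam_step:
  assumes cc: "cfam c" "cfam ci" "cfam a" "cfam M1" "cfam M2" and rr: "r \<in> S"
    and x: "\<And>s. fam (\<lambda>p. x p s)"
  shows "fam (\<lambda>p. step (c p) (ci p) (a p) (M1 p) (M2 p) (r p) (lz p) (lw p) (x p) s)"
proof -
  have p: "fam (\<lambda>p. p_of (c p) (lz p) (lw p) (x p) i)" for i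
    unfolding p_of_def by (intro fam_diff fam_sum fam_mult fam_const fam_M fam_Dz fam_ser_conj cc x)
  have y: "fam (\<lambda>p. y_of (c p) (a p) (lz p) (lw p) (x p))"
    unfolding y_of_def by (intro fam_diff fam_sum fam_mult fam_const fam_M fam_Rlin fam_mconst_const fam_qf cc x)
  have u: "fam (\<lambda>p. upd_map (x p) (f_sol (c p) (ci p) (a p) (M1 p) (M2 p) (r p) (p_of (c p) (lz p) (lw p) (x p)) (y_of (c p) (a p) (lz p) (lw p) (x p)))
     (g_sol (c p) (ci p) (a p) (M1 p) (M2 p) (r p) (p_of (c p) (lz p) (lw p) (x p)) (y_of (c p) (a p) (lz p) (lw p) (x p))) s)" for s
    using fam_sol[where p = "\<lambda>p. p_of (c p) (lz p) (lw p) (x p)" and y = "\<lambda>p. y_of (c p) (a p) (lz p) (lw p) (x p)", OF cc rr p y] x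
    by (cases s) (simp_all add: upd_map_def)
  show ?thesis
    using fam_M[OF u] u by (cases s) (simp_all add: step_def upd_str_def)
qed

lemma fam_slot_limit:
  assumes cc: "cfam c" "cfam ci" "cfam a" "cfam M1" "cfam M2" and rr: "r \<in> S"
  shows "fam (\<lambda>p. slot_limit (step (c p) (ci p) (a p) (M1 p) (M2 p) (r p) (lz p) (lw p)) (start (a p) (c p)) s)"
proof -
  let ?T = "\<lambda>p. step (c p) (ci p) (a p) (M1 p) (M2 p) (r p) (lz p) (lw p)"
  have ell: "fam (\<lambda>p. ell (a p) (c p) k)" for k
    unfolding ell_def by (intro fam_sum fam_add fam_mult fam_mconst fam_const S_mult S_const cfamD cc)
  have it: "fam (\<lambda>p. (?T p ^^ j) (start (a p) (c p)) s)" for j s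
  proof (induction j arbitrary: s)
    case 0
    show ?case using ell by (cases s) (simp_all add: start_def fam_const)
  next
    case (Suc j)
    show ?case unfolding funpow.simps comp_def by (rule fam_step[OF cc rr Suc])
  qed
  show ?thesis unfolding fam_def slot_limit_def using famD[OF it] by simp
qed

end

end

section \<open>Universal polynomials\<close>

definition pmon :: "('x \<Rightarrow>\<^sub>0 nat) \<Rightarrow> ('x \<Rightarrow> complex) \<Rightarrow> complex" where
  "pmon m x = (\<Prod>i\<in>Poly_Mapping.keys m. x i ^ Poly_Mapping.lookup m i)"

lemma pmon_superset:
  assumes "finite A" "Poly_Mapping.keys m \<subseteq> A"
  shows "pmon m x = (\<Prod>i\<in>A. x i ^ Poly_Mapping.lookup m i)"
  unfolding pmon_def using assms
  by (intro prod.mono_neutral_left) (auto simp: in_keys_iff)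

lemma pmon_add: "pmon (m + m') x = pmon m x * pmon m' x"
proof -
  let ?A = "Poly_Mapping.keys m \<union> Poly_Mapping.keys m'"
  have "pmon (m + m') x = (\<Prod>i\<in>?A. x i ^ Poly_Mapping.lookup (m + m') i)"
    by (rule pmon_superset) (use Poly_Mapping.keys_add[of m m'] in auto)
  also have "\<dots> = (\<Prod>i\<in>?A. x i ^ Poly_Mapping.lookup m i) * (\<Prod>i\<in>?A. x i ^ Poly_Mapping.lookup m' i)"
    by (simp add: lookup_add power_add prod.distrib)
  also have "\<dots> = pmon m x * pmon m' x"
    by (simp add: pmon_superset[of ?A m] pmon_superset[of ?A m'])
  finally show ?thesis .
qed

lemma poly_eval_superset:
  assumes "finite A" "Poly_Mapping.keys P \<subseteq> A"
  shows "poly_eval P x = (\<Sum>m\<in>A. Poly_Mapping.lookup P m * pmon m x)"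
  unfolding poly_eval_def pmon_def[symmetric] using assms
  by (intro sum.mono_neutral_left) (auto simp: in_keys_iff)

lemma poly_eval_add: "poly_eval (P + Q) x = poly_eval P x + poly_eval Q x"
proof -
  let ?A = "Poly_Mapping.keys P \<union> Poly_Mapping.keys Q"
  have "poly_eval (P + Q) x = (\<Sum>m\<in>?A. Poly_Mapping.lookup (P + Q) m * pmon m x)"
    by (rule poly_eval_superset) (use Poly_Mapping.keys_add[of P Q] in auto)
  also have "\<dots> = poly_eval P x + poly_eval Q x"
    by (simp add: lookup_add distrib_right sum.distrib poly_eval_superset[of ?A P] poly_eval_superset[of ?A Q])
  finally show ?thesis .
qed

lemma poly_eval_single: "poly_eval (Poly_Mapping.single m k) x = k * pmon m x"
proof -
  have "poly_eval (Poly_Mapping.single m k) x = (\<Sum>m'\<in>{m}. Poly_Mapping.lookup (Poly_Mapping.single m k) m' * pmon m' x)"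
    by (rule poly_eval_superset) auto
  then show ?thesis by simp
qed

lemma poly_vars_add: "poly_vars (P + Q) \<subseteq> poly_vars P \<union> poly_vars Q"
  using Poly_Mapping.keys_add[of P Q] unfolding poly_vars_def by blast

lemma poly_vars_single: "poly_vars (Poly_Mapping.single m k) \<subseteq> Poly_Mapping.keys m"
  by (auto simp: poly_vars_def split: if_splits)

definition polyfun :: "('p \<Rightarrow> 'x \<Rightarrow> complex) \<Rightarrow> 'x set \<Rightarrow> ('p \<Rightarrow> complex) set" where
  "polyfun v X = {F. \<exists>P. poly_vars P \<subseteq> X \<and> (\<forall>p. F p = poly_eval P (v p))}"

lemma polyfun_const: "(\<lambda>p. k) \<in> polyfun v X"
  unfolding polyfun_def using poly_vars_single[of 0 k]
  by (auto intro!: exI[of _ "Poly_Mapping.single 0 k"] simp: poly_eval_single pmon_def)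

lemma polyfun_var: "i \<in> X \<Longrightarrow> (\<lambda>p. v p i) \<in> polyfun v X"
proof -
  assume i: "i \<in> X"
  let ?m = "Poly_Mapping.single i 1 :: _ \<Rightarrow>\<^sub>0 nat"
  have "poly_vars (Poly_Mapping.single ?m 1) \<subseteq> X" using poly_vars_single[of ?m 1] i by auto
  moreover have "v p i = poly_eval (Poly_Mapping.single ?m 1) (v p)" for p
    by (simp add: poly_eval_single pmon_def)
  ultimately show ?thesis unfolding polyfun_def by blast
qed

lemma polyfun_add: "F \<in> polyfun v X \<Longrightarrow> G \<in> polyfun v X \<Longrightarrow> (\<lambda>p. F p + G p) \<in> polyfun v X"
proof -
  assume "F \<in> polyfun v X" "G \<in> polyfun v X"
  then obtain P Q where "poly_vars P \<subseteq> X" "\<forall>p. F p = poly_eval P (v p)" "poly_vars Q \<subseteq> X" "\<forall>p. G p = poly_eval Q (v p)"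
    unfolding polyfun_def by blast
  then have "poly_vars (P + Q) \<subseteq> X" "\<forall>p. F p + G p = poly_eval (P + Q) (v p)"
    using poly_vars_add[of P Q] by (auto simp: poly_eval_add)
  then show ?thesis unfolding polyfun_def by blast
qed

lemma polyfun_sum: "(\<And>i. i \<in> A \<Longrightarrow> F i \<in> polyfun v X) \<Longrightarrow> (\<lambda>p. \<Sum>i\<in>A. F i p) \<in> polyfun v X"
  by (induction A rule: infinite_finite_induct) (auto intro: polyfun_const polyfun_add)

lemma polyfun_mult: "F \<in> polyfun v X \<Longrightarrow> G \<in> polyfun v X \<Longrightarrow> (\<lambda>p. F p * G p) \<in> polyfun v X"
proof -
  assume "F \<in> polyfun v X" "G \<in> polyfun v X"
  then obtain P Q where P: "poly_vars P \<subseteq> X" "\<And>p. F p = poly_eval P (v p)" 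
      and Q: "poly_vars Q \<subseteq> X" "\<And>p. G p = poly_eval Q (v p)"
    unfolding polyfun_def by blast
  have "F p * G p = (\<Sum>m\<in>Poly_Mapping.keys P. \<Sum>m'\<in>Poly_Mapping.keys Q.
      (Poly_Mapping.lookup P m * Poly_Mapping.lookup Q m') * pmon (m + m') (v p))" for p
    unfolding P Q poly_eval_def pmon_def[symmetric] pmon_add sum_product by (simp add: mult_ac)
  then have "(\<lambda>p. F p * G p) = (\<lambda>p. \<Sum>m\<in>Poly_Mapping.keys P. \<Sum>m'\<in>Poly_Mapping.keys Q.
      (Poly_Mapping.lookup P m * Poly_Mapping.lookup Q m') * pmon (m + m') (v p))" by blast
  also have "\<dots> \<in> polyfun v X"
  proof (intro polyfun_sum)
    fix m m' assume m: "m \<in> Poly_Mapping.keys P" "m' \<in> Poly_Mapping.keys Q"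
    let ?P = "Poly_Mapping.single (m + m') (Poly_Mapping.lookup P m * Poly_Mapping.lookup Q m')"
    have "Poly_Mapping.keys (m + m') \<subseteq> X"
      using Poly_Mapping.keys_add[of m m'] m P(1) Q(1) unfolding poly_vars_def by blast
    then have "poly_vars ?P \<subseteq> X" by (rule subset_trans[OF poly_vars_single])
    moreover have "\<forall>p. Poly_Mapping.lookup P m * Poly_Mapping.lookup Q m' * pmon (m + m') (v p) = poly_eval ?P (v p)"
      by (simp only: poly_eval_single simp_thms)
    ultimately show "(\<lambda>p. Poly_Mapping.lookup P m * Poly_Mapping.lookup Q m' * pmon (m + m') (v p)) \<in> polyfun v X"
      unfolding polyfun_def mem_Collect_eq by (intro exI[of _ ?P] conjI)
  qed
  finally show ?thesis .
qed

lemma polyfun_pow: "F \<in> polyfun v X \<Longrightarrow> (\<lambda>p. F p ^ m) \<in> polyfun v X"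
  by (induction m) (auto intro: polyfun_const polyfun_mult)

lemma polyfun_prod: "(\<And>i. i \<in> A \<Longrightarrow> F i \<in> polyfun v X) \<Longrightarrow> (\<lambda>p. \<Prod>i\<in>A. F i p) \<in> polyfun v X"
  by (induction A rule: infinite_finite_induct) (auto intro: polyfun_const polyfun_mult)

lemma polyfun_mono: "F \<in> polyfun v X \<Longrightarrow> X \<subseteq> Y \<Longrightarrow> F \<in> polyfun v Y"
  unfolding polyfun_def by blast

lemma polyfun_cnj:
  assumes "\<And>i. i \<in> X \<Longrightarrow> (\<lambda>p. cnj (v p i)) \<in> polyfun v X" and "F \<in> polyfun v X"
  shows "(\<lambda>p. cnj (F p)) \<in> polyfun v X"
proof -
  obtain P where P: "poly_vars P \<subseteq> X" "\<And>p. F p = poly_eval P (v p)"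
    using assms(2) unfolding polyfun_def by blast
  have "(\<lambda>p. cnj (F p)) = (\<lambda>p. \<Sum>m\<in>Poly_Mapping.keys P. cnj (Poly_Mapping.lookup P m) *
      (\<Prod>i\<in>Poly_Mapping.keys m. cnj (v p i) ^ Poly_Mapping.lookup m i))"
    by (rule ext) (simp add: P(2) poly_eval_def)
  also have "\<dots> \<in> polyfun v X"
    by (intro polyfun_sum polyfun_mult polyfun_const polyfun_prod polyfun_pow assms(1))
       (use P(1) in \<open>auto simp: poly_vars_def\<close>)
  finally show ?thesis .
qed

definition jetval :: "'n::finite cr_graph \<times> real \<Rightarrow> 'n jet \<Rightarrow> complex" where
  "jetval p = jet_value (fst p) (snd p)"

definition admissible :: "'n::finite cr_graph \<Rightarrow> bool" where
  "admissible L \<longleftrightarrow> no_constant_term L \<and> strongly_nondegenerate L"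

text \<open>Numerators range over the jets in \<open>X\<close>, denominators over first order jets
  only, as in \<open>universal\<close>. The quotient formula is claimed for admissible structures,
  for which the determinants to be inverted do not vanish.\<close>

definition ratfun :: "'n::finite jet set \<Rightarrow> ('n cr_graph \<times> real \<Rightarrow> complex) set" where
  "ratfun X = {F. \<exists>N\<in>polyfun jetval X. \<exists>Q\<in>polyfun jetval first_order_jets.
     \<forall>p. admissible (fst p) \<longrightarrow> Q p \<noteq> 0 \<and> F p = N p / Q p}"

lemma ratfunI: "N \<in> polyfun jetval X \<Longrightarrow> Q \<in> polyfun jetval first_order_jets \<Longrightarrow>
   (\<And>p. admissible (fst p) \<Longrightarrow> Q p \<noteq> 0 \<and> F p = N p / Q p) \<Longrightarrow> F \<in> ratfun X"
  unfolding ratfun_def by blast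

lemma ratfunE:
  assumes "F \<in> ratfun X"
  obtains N Q where "N \<in> polyfun jetval X" "Q \<in> polyfun jetval first_order_jets"
    "\<forall>p. admissible (fst p) \<longrightarrow> Q p \<noteq> 0 \<and> F p = N p / Q p"
  using assms unfolding ratfun_def by blast

lemma polyfun_ratfun: "F \<in> polyfun jetval X \<Longrightarrow> F \<in> ratfun X"
  by (rule ratfunI[where Q = "\<lambda>p. 1"]) (auto intro: polyfun_const)

lemma ratfun_mono: "F \<in> ratfun X \<Longrightarrow> X \<subseteq> Y \<Longrightarrow> F \<in> ratfun Y"
  unfolding ratfun_def using polyfun_mono by blast

lemma jetval_cnj:
  assumes "X = first_order_jets \<or> X = UNIV" "i \<in> X" shows "(\<lambda>p. cnj (jetval p i)) \<in> polyfun jetval X"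
proof (cases i)
  case JetParam
  then have "(\<lambda>p. cnj (jetval p i)) = (\<lambda>p. jetval p JetParam)" by (simp add: jetval_def)
  then show ?thesis using polyfun_var[of i X jetval] assms JetParam by simp
next
  case (JetDeriv e \<alpha>)
  then have "(\<lambda>p. cnj (jetval p i)) = (\<lambda>p. jetval p (JetCnj e \<alpha>))" by (simp add: jetval_def)
  moreover have "JetCnj e \<alpha> \<in> X" using assms JetDeriv by (auto simp: first_order_jets_def)
  ultimately show ?thesis using polyfun_var[of "JetCnj e \<alpha>" X jetval] by simp
next
  case (JetCnj e \<alpha>)
  then have "(\<lambda>p. cnj (jetval p i)) = (\<lambda>p. jetval p (JetDeriv e \<alpha>))" by (simp add: jetval_def)
  moreover have "JetDeriv e \<alpha> \<in> X" using assms JetCnj by (auto simp: first_order_jets_def)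
  ultimately show ?thesis using polyfun_var[of "JetDeriv e \<alpha>" X jetval] by simp
qed

text \<open>Both choices of \<open>X\<close> contain the denominators' variables and are closed
  under exchanging a derivative with its conjugate, which closure under \<open>cnj\<close> requires;
  the parameter \<open>r\<close> is real.\<close>

lemma coeff_ring_ratfun:
  assumes X: "X = first_order_jets \<or> X = UNIV"
  shows "coeff_ring (ratfun X)"
proof
  have sub: "first_order_jets \<subseteq> X" using X by auto
  show "(\<lambda>p. k) \<in> ratfun X" for k by (intro polyfun_ratfun polyfun_const)
  show "(\<lambda>p. u p + v p) \<in> ratfun X" if u: "u \<in> ratfun X" and v: "v \<in> ratfun X" for u v
  proof -
    obtain N Q where n1: "N \<in> polyfun jetval X" and q1: "Q \<in> polyfun jetval first_order_jets"
      and e1: "\<forall>p. admissible (fst p) \<longrightarrow> Q p \<noteq> 0 \<and> u p = N p / Q p"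
      using u by (rule ratfunE)
    obtain N' Q' where n2: "N' \<in> polyfun jetval X" and q2: "Q' \<in> polyfun jetval first_order_jets"
      and e2: "\<forall>p. admissible (fst p) \<longrightarrow> Q' p \<noteq> 0 \<and> v p = N' p / Q' p"
      using v by (rule ratfunE)
    note n = n1 n2 and q = q1 q2 and e = e1 e2
    show ?thesis
      by (rule ratfunI[where N = "\<lambda>p. N p * Q' p + N' p * Q p" and Q = "\<lambda>p. Q p * Q' p"])
         (intro polyfun_add polyfun_mult n q polyfun_mono[OF q(1) sub] polyfun_mono[OF q(2) sub],
          intro polyfun_mult q, use e in \<open>auto simp: add_frac_eq\<close>)
  qed
  show "(\<lambda>p. u p * v p) \<in> ratfun X" if u: "u \<in> ratfun X" and v: "v \<in> ratfun X" for u v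
  proof -
    obtain N Q where n1: "N \<in> polyfun jetval X" and q1: "Q \<in> polyfun jetval first_order_jets"
      and e1: "\<forall>p. admissible (fst p) \<longrightarrow> Q p \<noteq> 0 \<and> u p = N p / Q p"
      using u by (rule ratfunE)
    obtain N' Q' where n2: "N' \<in> polyfun jetval X" and q2: "Q' \<in> polyfun jetval first_order_jets"
      and e2: "\<forall>p. admissible (fst p) \<longrightarrow> Q' p \<noteq> 0 \<and> v p = N' p / Q' p"
      using v by (rule ratfunE)
    note n = n1 n2 and q = q1 q2 and e = e1 e2
    show ?thesis
      by (rule ratfunI[where N = "\<lambda>p. N p * N' p" and Q = "\<lambda>p. Q p * Q' p"])
         (intro polyfun_mult n, intro polyfun_mult q, use e in auto)
  qed
  show "(\<lambda>p. cnj (u p)) \<in> ratfun X" if u: "u \<in> ratfun X" for u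
  proof -
    obtain N Q where n: "N \<in> polyfun jetval X" and q: "Q \<in> polyfun jetval first_order_jets"
      and e: "\<forall>p. admissible (fst p) \<longrightarrow> Q p \<noteq> 0 \<and> u p = N p / Q p"
      using u by (rule ratfunE)
    show ?thesis
    proof (rule ratfunI)
      show "(\<lambda>p. cnj (N p)) \<in> polyfun jetval X" by (rule polyfun_cnj[OF jetval_cnj[OF X] n])
      show "(\<lambda>p. cnj (Q p)) \<in> polyfun jetval first_order_jets" by (rule polyfun_cnj[OF jetval_cnj q]) auto
    qed (use e in auto)
  qed
qed

text \<open>Inversion exchanges numerator and denominator, so the numerator too must involve first
  order jets only.\<close>

lemma ratfun_inverse:
  assumes "F \<in> ratfun first_order_jets" "\<And>p. admissible (fst p) \<Longrightarrow> F p \<noteq> 0"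
  shows "(\<lambda>p. 1 / F p) \<in> ratfun first_order_jets"
proof -
  obtain N Q where n: "N \<in> polyfun jetval first_order_jets" and q: "Q \<in> polyfun jetval first_order_jets"
    and e: "\<forall>p. admissible (fst p) \<longrightarrow> Q p \<noteq> 0 \<and> F p = N p / Q p"
    using assms(1) by (rule ratfunE)
  show ?thesis
    by (rule ratfunI[OF q n]) (use e assms(2) in fastforce)
qed

lemma universalI:
  fixes \<Phi> :: "'a::finite ser ^ 'a \<Rightarrow> 'a ser \<Rightarrow> 'a cr_graph \<Rightarrow> complex"
  assumes F: "F \<in> ratfun UNIV"
    and \<Phi>: "\<And>L r f g L'. admissible L \<Longrightarrow> normalizes L r f g L' \<Longrightarrow> \<Phi> f g L' = F (L, r)"
  shows "universal \<Phi>"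
proof -
  obtain N Q where n: "N \<in> polyfun jetval UNIV" and q: "Q \<in> polyfun jetval first_order_jets"
    and e: "\<forall>p. admissible (fst p) \<longrightarrow> Q p \<noteq> 0 \<and> F p = N p / Q p"
    using F by (rule ratfunE)
  obtain P where P: "\<And>p. N p = poly_eval P (jetval p)" using n unfolding polyfun_def by blast
  obtain Q' where Q': "poly_vars Q' \<subseteq> first_order_jets" "\<And>p. Q p = poly_eval Q' (jetval p)" using q unfolding polyfun_def by blast
  have "poly_eval Q' (jet_value L r) \<noteq> 0 \<and> (\<forall>f g L'. normalizes L r f g L' \<longrightarrow>
      \<Phi> f g L' = poly_eval P (jet_value L r) / poly_eval Q' (jet_value L r))"
    if "no_constant_term L" "strongly_nondegenerate L" for L r
  proof -
    have L: "admissible L" using that by (simp add: admissible_def)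
    show ?thesis
      using \<Phi>[OF L] e[rule_format, of "(L, r)"] Q'(2)[of "(L, r)"] P[of "(L, r)"] L
      by (simp add: jetval_def)
  qed
  then show ?thesis unfolding universal_def using Q'(1) by blast
qed

subsection \<open>Determinants and inverse matrices\<close>

lemma matrix_inv_inverse:
  assumes "invertible A" shows "A ** matrix_inv A = mat 1" "matrix_inv A ** A = mat 1"
proof -
  have "A ** matrix_inv A = mat 1 \<and> matrix_inv A ** A = mat 1"
    using assms unfolding matrix_inv_def invertible_def by (rule someI_ex)
  then show "A ** matrix_inv A = mat 1" "matrix_inv A ** A = mat 1" by auto
qed

text \<open>Exhibits each entry of the inverse as a quotient of determinants, hence of polynomials
  in the entries of the matrix.\<close>

lemma matrix_inv_cramer:
  fixes A :: "complex ^ 'm::finite ^ 'm"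
  assumes "det A \<noteq> 0"
  shows "matrix_inv A $ k $ t = det (\<chi> i j. if j = k then (if i = t then 1 else 0) else A $ i $ j) / det A"
proof -
  have inv: "invertible A" using assms by (simp add: invertible_det_nz)
  define x where "x = matrix_inv A *v axis t 1"
  have "A *v x = axis t 1"
    unfolding x_def matrix_vector_mul_assoc using matrix_inv_inverse(1)[OF inv] by simp
  then have x: "x = (\<chi> k. det (\<chi> i j. if j = k then axis t 1 $ i else A $ i $ j) / det A)"
    using cramer[OF assms] by blast
  have ax: "(axis t 1 :: complex ^ 'm) $ i = (if i = t then 1 else 0)" for i by (simp add: axis_def)
  have "matrix_inv A $ k $ t = x $ k"
    by (simp add: x_def matrix_vector_mult_def ax if_distrib cong: if_cong)
  also have "\<dots> = det (\<chi> i j. if j = k then axis t 1 $ i else A $ i $ j) / det A"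
    using arg_cong[OF x, of "\<lambda>v. v $ k"] by (simp only: vec_lambda_beta)
  finally show ?thesis unfolding ax .
qed

lemma det_ratfun:
  fixes A :: "'n::finite cr_graph \<times> real \<Rightarrow> complex ^ 'm::finite ^ 'm"
  assumes "\<And>i j. (\<lambda>p. A p $ i $ j) \<in> ratfun first_order_jets"
  shows "(\<lambda>p. det (A p)) \<in> ratfun first_order_jets"
proof -
  interpret coeff_ring "ratfun first_order_jets :: ('n cr_graph \<times> real \<Rightarrow> complex) set" by (rule coeff_ring_ratfun) simp
  show ?thesis unfolding det_def by (intro S_sum S_mult S_prod S_const assms)
qed

lemma matrix_inv_ratfun:
  fixes A :: "'n::finite cr_graph \<times> real \<Rightarrow> complex ^ 'm::finite ^ 'm"
  assumes A: "\<And>i j. (\<lambda>p. A p $ i $ j) \<in> ratfun first_order_jets"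
    and nz: "\<And>p. admissible (fst p) \<Longrightarrow> det (A p) \<noteq> 0"
  shows "(\<lambda>p. matrix_inv (A p) $ k $ t) \<in> ratfun first_order_jets"
proof -
  interpret coeff_ring "ratfun first_order_jets :: ('n cr_graph \<times> real \<Rightarrow> complex) set" by (rule coeff_ring_ratfun) simp
  have 1: "(\<lambda>p. det (\<chi> i j. if j = k then (if i = t then 1 else 0) else A p $ i $ j)) \<in> ratfun first_order_jets"
  proof (rule det_ratfun)
    fix i j
    show "(\<lambda>p. (\<chi> i j. if j = k then (if i = t then 1 else 0) else A p $ i $ j) $ i $ j) \<in> ratfun first_order_jets"
      using A[of i j] S_const by (cases "i = t"; cases "j = k") simp_all
  qed
  have "(\<lambda>p. det (\<chi> i j. if j = k then (if i = t then 1 else 0) else A p $ i $ j) * (1 / det (A p))) \<in> ratfun first_order_jets"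
    by (intro S_mult 1 ratfun_inverse det_ratfun A nz)
  then obtain N Q where "N \<in> polyfun jetval first_order_jets" "Q \<in> polyfun jetval first_order_jets"
    "\<forall>p. admissible (fst p) \<longrightarrow> Q p \<noteq> 0 \<and> det (\<chi> i j. if j = k then (if i = t then 1 else 0) else A p $ i $ j) * (1 / det (A p)) = N p / Q p"
    by (rule ratfunE)
  then show ?thesis
    by (intro ratfunI[of N _ Q]) (auto simp: matrix_inv_cramer[OF nz])
qed

section \<open>The data of a strongly nondegenerate structure\<close>

definition lzf :: "'n::finite cr_graph \<Rightarrow> 'n \<Rightarrow> 'n \<Rightarrow> 'n ser" where "lzf L i k = Lzb L $ i $ k"
definition lwf :: "'n::finite cr_graph \<Rightarrow> 'n \<Rightarrow> 'n ser" where "lwf L k = Lw L $ k"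

definition unit :: "'v \<Rightarrow> 'v \<Rightarrow> nat" where "unit v = (\<lambda>_. 0)(v := 1)"

definition zcoef :: "'n::finite cr_graph \<Rightarrow> 'n \<Rightarrow> 'n \<Rightarrow> complex" where
  "zcoef L j k = mcoeff (lwf L k) (unit (Z j))"
definition zbcoef :: "'n::finite cr_graph \<Rightarrow> 'n \<Rightarrow> 'n \<Rightarrow> complex" where
  "zbcoef L j k = mcoeff (lwf L k) (unit (Zbar j))"

definition levi_c :: "'n::finite cr_graph \<Rightarrow> 'n \<Rightarrow> 'n \<Rightarrow> complex" where
  "levi_c L j k = (zbcoef L j k - cnj (zbcoef L k j)) / (2 * \<i>)"
definition tors_a :: "'n::finite cr_graph \<Rightarrow> 'n \<Rightarrow> 'n \<Rightarrow> complex" where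
  "tors_a L j k = (zcoef L j k - zcoef L k j) / 2"
definition levi_ci :: "'n::finite cr_graph \<Rightarrow> 'n \<Rightarrow> 'n \<Rightarrow> complex" where
  "levi_ci L j k = matrix_inv (transpose (levi_matrix L)) $ j $ k"

text \<open>The matrix of the real-linear operator in the second condition of strong nondegeneracy, acting
  on a vector and its conjugate.\<close>

definition sys_matrix :: "'n::finite cr_graph \<Rightarrow> complex ^ ('n + 'n) ^ ('n + 'n)" where
  "sys_matrix L = (\<chi> s t. case s of
      Inl k \<Rightarrow> (case t of Inl j \<Rightarrow> tors_a L k j | Inr j \<Rightarrow> - 3 * \<i> * levi_c L j k)
    | Inr k \<Rightarrow> (case t of Inl j \<Rightarrow> 3 * \<i> * levi_c L k j | Inr j \<Rightarrow> cnj (tors_a L k j)))"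

text \<open>The upper blocks of the inverse. The lower ones are their conjugates by
  \<open>sys_inv_swap\<close>, so the inverse has the form
  \<open>v \<mapsto> M1 v + M2 vbar\<close>.\<close>

definition sys_M1 :: "'n::finite cr_graph \<Rightarrow> 'n \<Rightarrow> 'n \<Rightarrow> complex" where
  "sys_M1 L j k = matrix_inv (sys_matrix L) $ Inl j $ Inl k"
definition sys_M2 :: "'n::finite cr_graph \<Rightarrow> 'n \<Rightarrow> 'n \<Rightarrow> complex" where
  "sys_M2 L j k = matrix_inv (sys_matrix L) $ Inl j $ Inr k"

lemma sys_matrix_entry:
  "sys_matrix L $ Inl k $ Inl j = tors_a L k j" "sys_matrix L $ Inl k $ Inr j = - 3 * \<i> * levi_c L j k"
  "sys_matrix L $ Inr k $ Inl j = 3 * \<i> * levi_c L k j" "sys_matrix L $ Inr k $ Inr j = cnj (tors_a L k j)"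
  by (simp_all add: sys_matrix_def)

lemma sum_sum: "(\<Sum>t\<in>(UNIV :: ('n::finite + 'n) set). F t) = (\<Sum>j\<in>UNIV. F (Inl j)) + (\<Sum>j\<in>UNIV. F (Inr j) :: 'b::comm_monoid_add)"
proof -
  have "(\<Sum>t\<in>(UNIV :: 'n set) <+> (UNIV :: 'n set). F t) = (\<Sum>j\<in>UNIV. F (Inl j)) + (\<Sum>j\<in>UNIV. F (Inr j))"
    by (subst sum.Plus) (simp_all add: comp_def)
  then show ?thesis by (simp only: UNIV_Plus_UNIV)
qed

lemma mcoeff_mderiv_0: "mcoeff (mderiv v q) (\<lambda>_. 0) = mcoeff q (unit v)"
  by (simp add: unit_def)

lemma dLw_zb_eq: "dLw_zb L \<zeta> \<eta> = (\<Sum>j\<in>UNIV. \<Sum>k\<in>UNIV. zbcoef L j k * \<zeta> $ j * \<eta> $ k)"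
  unfolding dLw_zb_def mcoeff_mderiv_0 zbcoef_def lwf_def ..

lemma dLw_z_eq: "dLw_z L \<zeta> \<eta> = (\<Sum>j\<in>UNIV. \<Sum>k\<in>UNIV. zcoef L j k * \<zeta> $ j * \<eta> $ k)"
  unfolding dLw_z_def mcoeff_mderiv_0 zcoef_def lwf_def ..

lemma levi_eq: "levi L \<xi> \<eta> = (\<Sum>j\<in>UNIV. \<Sum>k\<in>UNIV. levi_c L j k * cnj (\<xi> $ j) * \<eta> $ k)"
proof -
  have "cnj (dLw_zb L (cnj_vec \<eta>) \<xi>) = (\<Sum>j\<in>UNIV. \<Sum>k\<in>UNIV. cnj (zbcoef L j k) * \<eta> $ j * cnj (\<xi> $ k))"
    by (simp add: dLw_zb_eq cnj_vec_def)
  also have "\<dots> = (\<Sum>j\<in>UNIV. \<Sum>k\<in>UNIV. cnj (zbcoef L k j) * cnj (\<xi> $ j) * \<eta> $ k)"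
    by (subst sum.swap) (simp add: mult_ac)
  finally have "levi L \<xi> \<eta> = (\<Sum>j\<in>UNIV. \<Sum>k\<in>UNIV. 1 / (2 * \<i>) *
      (zbcoef L j k * cnj (\<xi> $ j) * \<eta> $ k - cnj (zbcoef L k j) * cnj (\<xi> $ j) * \<eta> $ k))"
    unfolding levi_def dLw_zb_eq[of L "cnj_vec \<xi>"] by (simp only: cnj_vec_def vec_lambda_beta sum_distrib_left sum_subtractf[symmetric])
  also have "\<dots> = (\<Sum>j\<in>UNIV. \<Sum>k\<in>UNIV. levi_c L j k * cnj (\<xi> $ j) * \<eta> $ k)"
    by (intro sum.cong refl) (simp add: levi_c_def field_simps)
  finally show ?thesis .
qed

lemma sum_axis: "(\<Sum>k\<in>UNIV. F k * axis j (1 :: complex) $ k) = F (j :: 'n::finite)"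
  by (simp add: axis_def if_distrib cong: if_cong)

lemma levi_axis: "levi L \<xi> (axis k 1) = (\<Sum>j\<in>UNIV. levi_c L j k * cnj (\<xi> $ j))"
  unfolding levi_eq sum_axis ..

lemma levi_matrix_eq: "levi_matrix L $ j $ k = levi_c L j k"
proof -
  have "cnj (axis j 1 $ l) = (axis j 1 $ l :: complex)" for l by (simp add: axis_def)
  then show ?thesis by (simp add: levi_matrix_def levi_axis sum_axis)
qed

lemma nonint_axis: "nonint_w L \<xi> (axis k 1) = 2 * (\<Sum>j\<in>UNIV. tors_a L j k * \<xi> $ j)"
proof -
  have "dLw_z L (axis k 1) \<xi> = (\<Sum>l\<in>UNIV. \<Sum>j\<in>UNIV. zcoef L j l * \<xi> $ l * axis k 1 $ j)"
    unfolding dLw_z_eq by (subst sum.swap) (simp add: mult_ac)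
  then have "dLw_z L (axis k 1) \<xi> = (\<Sum>l\<in>UNIV. zcoef L k l * \<xi> $ l)" unfolding sum_axis .
  moreover have "dLw_z L \<xi> (axis k 1) = (\<Sum>l\<in>UNIV. zcoef L l k * \<xi> $ l)"
    unfolding dLw_z_eq sum_axis ..
  ultimately show ?thesis
    by (simp add: nonint_w_def tors_a_def sum_subtractf[symmetric] sum_distrib_left left_diff_distrib[symmetric])
qed

lemma levi_c_herm: "cnj (levi_c L j k) = levi_c L k j"
  by (simp add: levi_c_def field_simps)

lemma tors_a_skew: "tors_a L k j = - tors_a L j k"
  by (simp add: tors_a_def field_simps)

context
  fixes L :: "'n::finite cr_graph"
  assumes L: "strongly_nondegenerate L"
begin

lemma invertible_levi: "invertible (transpose (levi_matrix L))"
proof -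
  have "x = 0" if "transpose (levi_matrix L) *v x = 0" for x
  proof -
    have "levi L (cnj_vec x) \<eta> = (\<Sum>k\<in>UNIV. (transpose (levi_matrix L) *v x) $ k * \<eta> $ k)" for \<eta>
      unfolding levi_eq
      by (subst sum.swap) (simp add: matrix_vector_mult_def transpose_def levi_matrix_eq cnj_vec_def sum_distrib_right)
    then have "\<forall>\<eta>. levi L (cnj_vec x) \<eta> = 0" unfolding that by simp
    then have "cnj_vec x = 0" using L by (simp add: strongly_nondegenerate_def)
    then show "x = 0" by (simp add: cnj_vec_def vec_eq_iff)
  qed
  then show ?thesis unfolding invertible_left_inverse matrix_left_invertible_ker by blast
qed

lemma ci_left: "(\<Sum>k\<in>UNIV. levi_ci L j k * levi_c L l k) = (if j = l then 1 else 0)"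
proof -
  have "(matrix_inv (transpose (levi_matrix L)) ** transpose (levi_matrix L)) $ j $ l = (if j = l then 1 else 0)"
    unfolding matrix_inv_inverse(2)[OF invertible_levi] by (simp add: mat_def)
  then show ?thesis by (simp add: matrix_matrix_mult_def transpose_def levi_matrix_eq levi_ci_def)
qed

lemma ci_right: "(\<Sum>j\<in>UNIV. levi_ci L j k * levi_c L j l) = (if k = l then 1 else 0)"
proof -
  have "(transpose (levi_matrix L) ** matrix_inv (transpose (levi_matrix L))) $ l $ k = (if k = l then 1 else 0)"
    unfolding matrix_inv_inverse(1)[OF invertible_levi] by (simp add: mat_def)
  then show ?thesis by (simp add: matrix_matrix_mult_def transpose_def levi_matrix_eq levi_ci_def mult.commute)
qed

text \<open>The Levi matrix is Hermitian, so the conjugate transpose of its inverse is an inverse as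
  well; the computation is the uniqueness of inverses.\<close>

lemma ci_herm: "cnj (levi_ci L j k) = levi_ci L k j"
proof -
  have n: "(\<Sum>k\<in>UNIV. cnj (levi_ci L k j) * levi_c L l k) = (if j = l then 1 else 0)" for j l
    using arg_cong[OF ci_right[of j l], of cnj] by (simp add: levi_c_herm)
  have "cnj (levi_ci L k j) = (\<Sum>m\<in>UNIV. cnj (levi_ci L m j) * (if k = m then 1 else 0))"
    by (simp add: if_distrib cong: if_cong)
  also have "\<dots> = (\<Sum>m\<in>UNIV. cnj (levi_ci L m j) * (\<Sum>l\<in>UNIV. levi_ci L l k * levi_c L l m))"
    unfolding ci_right ..
  also have "\<dots> = (\<Sum>l\<in>UNIV. levi_ci L l k * (\<Sum>m\<in>UNIV. cnj (levi_ci L m j) * levi_c L l m))"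
    unfolding sum_distrib_left by (subst sum.swap) (simp add: mult_ac)
  also have "\<dots> = levi_ci L j k" unfolding n by (simp add: if_distrib cong: if_cong)
  finally have "cnj (levi_ci L k j) = levi_ci L j k" .
  then show ?thesis by (metis complex_cnj_cnj)
qed

text \<open>\<open>tors_a\<close> is skew and half of the non-integrability tensor. Multiplied by
  \<open>- 2\<close>, the equations are the second condition of strong nondegeneracy tested on the
  basis vectors, hence on all \<open>\<eta>\<close> by linearity.\<close>

lemma sys_ker:
  assumes "\<And>k. (\<Sum>j\<in>UNIV. tors_a L k j * x j) + (\<Sum>j\<in>UNIV. - 3 * \<i> * levi_c L j k * cnj (x j)) = 0"
  shows "x j = 0"
proof -
  define \<xi> :: "complex ^ 'n" where "\<xi> = (\<chi> j. x j)"
  have axis: "6 * \<i> * levi L \<xi> (axis k 1) + nonint_w L \<xi> (axis k 1) = 0" for k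
  proof -
    have "(\<Sum>j\<in>UNIV. tors_a L k j * x j) = - (\<Sum>j\<in>UNIV. tors_a L j k * \<xi> $ j)"
      by (simp add: tors_a_skew[of L k] sum_negf \<xi>_def)
    moreover have "(\<Sum>j\<in>UNIV. - 3 * \<i> * levi_c L j k * cnj (x j)) = - 3 * \<i> * levi L \<xi> (axis k 1)"
      unfolding levi_axis by (simp add: \<xi>_def sum_distrib_left mult.assoc)
    ultimately have "- (\<Sum>j\<in>UNIV. tors_a L j k * \<xi> $ j) + - 3 * \<i> * levi L \<xi> (axis k 1) = 0"
      using assms[of k] by simp
    then have "- 2 * (- (\<Sum>j\<in>UNIV. tors_a L j k * \<xi> $ j) + - 3 * \<i> * levi L \<xi> (axis k 1)) = 0" by simp
    then show ?thesis unfolding nonint_axis by (simp add: algebra_simps)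
  qed
  have lin: "6 * \<i> * levi L \<xi> \<eta> + nonint_w L \<xi> \<eta> = (\<Sum>k\<in>UNIV. (6 * \<i> * levi L \<xi> (axis k 1) + nonint_w L \<xi> (axis k 1)) * \<eta> $ k)" for \<eta>
  proof -
    have "levi L \<xi> \<eta> = (\<Sum>k\<in>UNIV. levi L \<xi> (axis k 1) * \<eta> $ k)"
      unfolding levi_axis unfolding levi_eq sum_distrib_right by (rule sum.swap)
    moreover have "nonint_w L \<xi> \<eta> = (\<Sum>k\<in>UNIV. nonint_w L \<xi> (axis k 1) * \<eta> $ k)"
    proof -
      have sw: "dLw_z L \<eta> \<xi> = (\<Sum>j\<in>UNIV. \<Sum>k\<in>UNIV. zcoef L k j * \<xi> $ j * \<eta> $ k)"
        unfolding dLw_z_eq by (subst sum.swap) (simp add: mult_ac)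
      have "nonint_w L \<xi> \<eta> = (\<Sum>j\<in>UNIV. \<Sum>k\<in>UNIV. 2 * (tors_a L j k * \<xi> $ j) * \<eta> $ k)"
        unfolding nonint_w_def sw dLw_z_eq[of L \<xi> \<eta>]
        unfolding sum_subtractf[symmetric] by (intro sum.cong refl) (simp add: tors_a_def left_diff_distrib)
      then show ?thesis unfolding nonint_axis sum_distrib_left sum_distrib_right by (subst sum.swap) simp
    qed
    ultimately show ?thesis by (simp add: sum_distrib_left distrib_right sum.distrib mult.assoc)
  qed
  have "\<forall>\<eta>. 6 * \<i> * levi L \<xi> \<eta> + nonint_w L \<xi> \<eta> = 0"
    by (intro allI trans[OF lin]) (simp add: axis)
  then have "\<xi> = 0" using L by (simp add: strongly_nondegenerate_def)
  then show ?thesis by (simp add: \<xi>_def vec_eq_iff)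
qed

text \<open>Injectivity of a real-linear map passes to its complexification: for
  \<open>(x, y)\<close> in the kernel both \<open>x + cnj y\<close> and
  \<open>\<i> * (x - cnj y)\<close> are annihilated by the real-linear map, so both vanish.\<close>

lemma invertible_sys: "invertible (sys_matrix L)"
proof -
  have "v = 0" if v: "sys_matrix L *v v = 0" for v
  proof -
    define x where "x j = v $ Inl j" for j
    define y where "y j = v $ Inr j" for j
    have r1: "(\<Sum>j\<in>UNIV. tors_a L k j * x j) + (\<Sum>j\<in>UNIV. - 3 * \<i> * levi_c L j k * y j) = 0" for k
      using arg_cong[OF v, of "\<lambda>u. u $ Inl k"]
      by (simp add: matrix_vector_mult_def sys_matrix_def sum_sum x_def y_def)
    have "(\<Sum>j\<in>UNIV. 3 * \<i> * levi_c L k j * x j) + (\<Sum>j\<in>UNIV. cnj (tors_a L k j) * y j) = 0" for k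
      using arg_cong[OF v, of "\<lambda>u. u $ Inr k"]
      by (simp add: matrix_vector_mult_def sys_matrix_def sum_sum x_def y_def)
    from arg_cong[OF this, of cnj]
    have r2: "(\<Sum>j\<in>UNIV. tors_a L k j * cnj (y j)) + (\<Sum>j\<in>UNIV. - 3 * \<i> * levi_c L j k * cnj (x j)) = 0" for k
      by (simp add: levi_c_herm add.commute)
    have e1: "x j + cnj (y j) = 0" for j
    proof (rule sys_ker)
      fix k
      have "(\<Sum>j\<in>UNIV. tors_a L k j * (x j + cnj (y j))) + (\<Sum>j\<in>UNIV. - 3 * \<i> * levi_c L j k * cnj (x j + cnj (y j)))
          = ((\<Sum>j\<in>UNIV. tors_a L k j * x j) + (\<Sum>j\<in>UNIV. - 3 * \<i> * levi_c L j k * y j))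
          + ((\<Sum>j\<in>UNIV. tors_a L k j * cnj (y j)) + (\<Sum>j\<in>UNIV. - 3 * \<i> * levi_c L j k * cnj (x j)))"
        by (simp only: complex_cnj_add complex_cnj_cnj distrib_left sum.distrib add_ac)
      then show "(\<Sum>j\<in>UNIV. tors_a L k j * (x j + cnj (y j))) + (\<Sum>j\<in>UNIV. - 3 * \<i> * levi_c L j k * cnj (x j + cnj (y j))) = 0"
        unfolding r1 r2 by simp
    qed
    have e2: "\<i> * x j - \<i> * cnj (y j) = 0" for j
    proof (rule sys_ker)
      fix k
      have c: "cnj (\<i> * x j - \<i> * cnj (y j)) = \<i> * y j - \<i> * cnj (x j)" for j by simp
      have "(\<Sum>j\<in>UNIV. tors_a L k j * (\<i> * x j - \<i> * cnj (y j))) + (\<Sum>j\<in>UNIV. - 3 * \<i> * levi_c L j k * cnj (\<i> * x j - \<i> * cnj (y j)))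
          = \<i> * ((\<Sum>j\<in>UNIV. tors_a L k j * x j) + (\<Sum>j\<in>UNIV. - 3 * \<i> * levi_c L j k * y j))
          - \<i> * ((\<Sum>j\<in>UNIV. tors_a L k j * cnj (y j)) + (\<Sum>j\<in>UNIV. - 3 * \<i> * levi_c L j k * cnj (x j)))"
        unfolding c right_diff_distrib sum_subtractf distrib_left sum_distrib_left
        by (simp only: mult.left_commute[of _ \<i>]) simp
      then show "(\<Sum>j\<in>UNIV. tors_a L k j * (\<i> * x j - \<i> * cnj (y j))) + (\<Sum>j\<in>UNIV. - 3 * \<i> * levi_c L j k * cnj (\<i> * x j - \<i> * cnj (y j))) = 0"
        unfolding r1 r2 by simp
    qed
    have x0: "x j = 0" and y0: "y j = 0" for j
    proof -
      have "x j = cnj (y j)" using e2[of j] by (simp flip: right_diff_distrib)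
      then show "x j = 0" using e1[of j] by simp
      then show "y j = 0" using e1[of j] by simp
    qed
    show "v = 0"
    proof (rule vec_eq_iff[THEN iffD2], rule allI)
      show "v $ s = 0 $ s" for s
        using x0 y0 by (cases s) (auto simp: x_def y_def)
    qed
  qed
  then show ?thesis unfolding invertible_left_inverse matrix_left_invertible_ker by blast
qed

primrec swap_sum :: "'n + 'n \<Rightarrow> 'n + 'n" where
  "swap_sum (Inl j) = Inr j" | "swap_sum (Inr j) = Inl j"

lemma swap_swap: "swap_sum (swap_sum s) = s" by (cases s) auto

lemma sys_swap: "cnj (sys_matrix L $ swap_sum s $ swap_sum t) = sys_matrix L $ s $ t"
  by (cases s; cases t) (simp_all add: sys_matrix_def levi_c_herm)

text \<open>The system is invariant under conjugation combined with exchange of the two blocks, and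
  by uniqueness the inverse inherits this symmetry.\<close>

lemma sys_inv_swap: "cnj (matrix_inv (sys_matrix L) $ swap_sum s $ swap_sum t) = matrix_inv (sys_matrix L) $ s $ t"
proof -
  define W where "W = sys_matrix L"
  define V :: "complex ^ ('n + 'n) ^ ('n + 'n)" where "V = (\<chi> s t. cnj (matrix_inv W $ swap_sum s $ swap_sum t))"
  have inv: "invertible W" unfolding W_def by (rule invertible_sys)
  have "V ** W = mat 1"
  proof (rule vec_eq_iff[THEN iffD2], intro allI vec_eq_iff[THEN iffD2])
    fix s t
    have "(V ** W) $ s $ t = (\<Sum>u\<in>UNIV. cnj (matrix_inv W $ swap_sum s $ swap_sum u) * cnj (W $ swap_sum u $ swap_sum t))"
      by (simp add: V_def W_def matrix_matrix_mult_def sys_swap)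
    also have "\<dots> = (\<Sum>u\<in>UNIV. cnj (matrix_inv W $ swap_sum s $ u) * cnj (W $ u $ swap_sum t))"
      by (rule sum.reindex_bij_witness[where i = swap_sum and j = swap_sum]) (auto simp: swap_swap)
    also have "\<dots> = cnj ((matrix_inv W ** W) $ swap_sum s $ swap_sum t)"
      by (simp add: matrix_matrix_mult_def)
    also have "\<dots> = mat 1 $ s $ t"
      unfolding matrix_inv_inverse(2)[OF inv] by (cases s; cases t) (simp_all add: mat_def)
    finally show "(V ** W) $ s $ t = mat 1 $ s $ t" .
  qed
  have "V = V ** (W ** matrix_inv W)" unfolding matrix_inv_inverse(1)[OF inv] by simp
  also have "\<dots> = matrix_inv W" unfolding matrix_mul_assoc \<open>V ** W = mat 1\<close> by simp
  finally have "V $ s $ t = matrix_inv W $ s $ t" by simp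
  then show ?thesis by (simp add: V_def W_def)
qed

lemma levi_data_L: "levi_data (levi_c L) (levi_ci L) (tors_a L) (sys_M1 L) (sys_M2 L) (of_nat CARD('n))"
proof
  let ?W = "sys_matrix L" and ?V = "matrix_inv (sys_matrix L)"
  have VW: "(\<Sum>k\<in>UNIV. ?V $ s $ Inl k * ?W $ Inl k $ t) + (\<Sum>k\<in>UNIV. ?V $ s $ Inr k * ?W $ Inr k $ t)
      = (if s = t then 1 else 0)" for s t
    using arg_cong[OF matrix_inv_inverse(2)[OF invertible_sys], of "\<lambda>A. A $ s $ t"]
    by (simp add: matrix_matrix_mult_def sum_sum mat_def)
  have WV: "(\<Sum>k\<in>UNIV. ?W $ s $ Inl k * ?V $ Inl k $ t) + (\<Sum>k\<in>UNIV. ?W $ s $ Inr k * ?V $ Inr k $ t)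
      = (if s = t then 1 else 0)" for s t
    using arg_cong[OF matrix_inv_inverse(1)[OF invertible_sys], of "\<lambda>A. A $ s $ t"]
    by (simp add: matrix_matrix_mult_def sum_sum mat_def)
  have V21: "?V $ Inr j $ Inl m = cnj (sys_M2 L j m)" for j m
    using sys_inv_swap[of "Inr j" "Inl m"] by (simp add: sys_M2_def)
  have V22: "?V $ Inr j $ Inr m = cnj (sys_M1 L j m)" for j m
    using sys_inv_swap[of "Inr j" "Inr m"] by (simp add: sys_M1_def)
  note V = sys_M1_def[symmetric] sys_M2_def[symmetric] V21 V22 sys_matrix_entry
  show "(\<Sum>k\<in>UNIV. sys_M1 L j k * tors_a L k m + sys_M2 L j k * (3 * \<i> * levi_c L k m)) = (if j = m then 1 else 0)" for j m
    using VW[of "Inl j" "Inl m"] unfolding V by (simp only: sum.distrib sum.inject)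
  show "(\<Sum>k\<in>UNIV. sys_M1 L j k * (- 3 * \<i> * levi_c L m k) + sys_M2 L j k * cnj (tors_a L k m)) = 0" for j m
    using VW[of "Inl j" "Inr m"] unfolding V by (simp only: sum.distrib sum.simps if_False)
  have m: "x - 3 * \<i> * y * w = x + - 3 * \<i> * y * w" for x y w :: complex by simp
  show "(\<Sum>j\<in>UNIV. tors_a L k j * sys_M1 L j m - 3 * \<i> * levi_c L j k * cnj (sys_M2 L j m)) = (if k = m then 1 else 0)" for k m
    using WV[of "Inl k" "Inl m"] unfolding V m by (simp only: sum.distrib sum.inject)
  show "(\<Sum>j\<in>UNIV. tors_a L k j * sys_M2 L j m - 3 * \<i> * levi_c L j k * cnj (sys_M1 L j m)) = 0" for k m
    using WV[of "Inl k" "Inr m"] unfolding V m by (simp only: sum.distrib sum.simps if_False)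
qed (fact levi_c_herm ci_herm tors_a_skew ci_left ci_right refl)+

end

subsection \<open>Universality of the data\<close>

lemma coeff_polyfun:
  assumes "JetDeriv e \<alpha> \<in> X"
  shows "(\<lambda>p. mcoeff (entry_of (fst p) e) \<alpha>) \<in> polyfun jetval X"
proof -
  let ?N = "of_nat (\<Prod>v\<in>UNIV. fact (\<alpha> v)) :: complex"
  have "?N \<noteq> 0" unfolding of_nat_eq_0_iff by (simp add: prod_zero_iff)
  then have "(\<lambda>p. mcoeff (entry_of (fst p) e) \<alpha>) = (\<lambda>p. 1 / ?N * jetval p (JetDeriv e \<alpha>))"
    by (simp add: jetval_def deriv_at0_def)
  then show ?thesis using polyfun_mult[OF polyfun_const polyfun_var[OF assms]] by (simp only:)
qed

lemma unit_first_order: "JetDeriv e (unit v) \<in> first_order_jets"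
  by (auto simp: first_order_jets_def unit_def edeg_eq_wdeg)

lemma zcoef_ratfun: "(\<lambda>p. zcoef (fst p) j k) \<in> ratfun first_order_jets" "(\<lambda>p. zbcoef (fst p) j k) \<in> ratfun first_order_jets"
  using polyfun_ratfun[OF coeff_polyfun[OF unit_first_order[of "EntW k" "Z j"]]]
    polyfun_ratfun[OF coeff_polyfun[OF unit_first_order[of "EntW k" "Zbar j"]]]
  by (simp_all add: zcoef_def zbcoef_def lwf_def)

lemma data_ratfun:
  shows "(\<lambda>p. levi_c (fst p) j k) \<in> ratfun (first_order_jets :: 'n::finite jet set)"
    "(\<lambda>p. tors_a (fst p) j k) \<in> ratfun (first_order_jets :: 'n::finite jet set)"
    "(\<lambda>p. levi_ci (fst p) j k) \<in> ratfun (first_order_jets :: 'n::finite jet set)"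
    "(\<lambda>p. sys_M1 (fst p) j k) \<in> ratfun (first_order_jets :: 'n::finite jet set)"
    "(\<lambda>p. sys_M2 (fst p) j k) \<in> ratfun (first_order_jets :: 'n::finite jet set)"
proof -
  interpret coeff_ring "ratfun first_order_jets :: ('n cr_graph \<times> real \<Rightarrow> complex) set" by (rule coeff_ring_ratfun) simp
  show c: "(\<lambda>p. levi_c (fst p) j k) \<in> ratfun (first_order_jets :: 'n::finite jet set)" for j k
    unfolding levi_c_def by (intro S_divide S_diff S_cnj zcoef_ratfun)
  show a: "(\<lambda>p. tors_a (fst p) j k) \<in> ratfun (first_order_jets :: 'n::finite jet set)" for j k
    unfolding tors_a_def by (intro S_divide S_diff zcoef_ratfun)
  have "(\<lambda>p. transpose (levi_matrix (fst p)) $ i $ j) \<in> ratfun (first_order_jets :: 'n::finite jet set)" for i j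
    using c by (simp add: transpose_def levi_matrix_eq)
  then show "(\<lambda>p. levi_ci (fst p) j k) \<in> ratfun (first_order_jets :: 'n::finite jet set)"
    unfolding levi_ci_def
  proof (rule matrix_inv_ratfun)
    show "det (transpose (levi_matrix (fst p))) \<noteq> 0" if "admissible (fst p)" for p :: "'n cr_graph \<times> real"
      using invertible_levi[of "fst p"] that unfolding admissible_def invertible_det_nz by blast
  qed
  have "(\<lambda>p. sys_matrix (fst p) $ s $ t) \<in> ratfun (first_order_jets :: 'n::finite jet set)" for s t
    by (cases s; cases t) (simp_all add: sys_matrix_def S_mult S_const S_cnj S_minus c a)
  then have i: "(\<lambda>p. matrix_inv (sys_matrix (fst p)) $ s $ t) \<in> ratfun (first_order_jets :: 'n::finite jet set)" for s t
  proof (rule matrix_inv_ratfun)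
    show "det (sys_matrix (fst p)) \<noteq> 0" if "admissible (fst p)" for p :: "'n cr_graph \<times> real"
      using invertible_sys[of "fst p"] that unfolding admissible_def invertible_det_nz by blast
  qed
  show "(\<lambda>p. sys_M1 (fst p) j k) \<in> ratfun (first_order_jets :: 'n::finite jet set)"
    "(\<lambda>p. sys_M2 (fst p) j k) \<in> ratfun (first_order_jets :: 'n::finite jet set)"
    unfolding sys_M1_def sys_M2_def by (rule i)+
qed

section \<open>The transformation rule and the normalization\<close>

definition state :: "'n::finite ser ^ 'n \<Rightarrow> 'n ser \<Rightarrow> 'n cr_graph \<Rightarrow> 'n slot \<Rightarrow> 'n ser" where
  "state f g L s = (case s of SF i \<Rightarrow> f $ i | SG \<Rightarrow> g | SZ i k \<Rightarrow> Lzb L $ i $ k | SW k \<Rightarrow> Lw L $ k)"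

lemma coord_change_eq: "coord_change f g = cmap (state f g L')"
proof
  show "coord_change f g v = cmap (state f g L') v" for v
    by (cases v) (simp_all add: coord_change_def cmap_def state_def vec_conj_def)
qed

lemma vfield_crf: "vfield (crf lz lw k) s = mderiv (Z k) s + (\<Sum>j\<in>UNIV. lz j k * mderiv (Zbar j) s) + lw k * mderiv U s"
  unfolding vfield_def sum_cvar by (simp add: crf_def if_01_mult)

definition teq where
  "teq lz lw x \<longleftrightarrow> (\<forall>k. vfield (crf lz lw k) (cmap x U) = 
      (\<Sum>i\<in>UNIV. msubst (x (SW i)) (cmap x) * vfield (crf lz lw k) (cmap x (Z i)))) \<and>
    (\<forall>i k. vfield (crf lz lw k) (cmap x (Zbar i)) = 
      (\<Sum>j\<in>UNIV. msubst (x (SZ i j)) (cmap x) * vfield (crf lz lw k) (cmap x (Z j))))"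

lemma vfield_cmap:
  "vfield (crf lz lw k) (cmap x U) = lw k + vfield (crf lz lw k) (x SG)"
  "vfield (crf lz lw k) (cmap x (Z i)) = (if i = k then 1 else 0) + vfield (crf lz lw k) (x (SF i))"
  "vfield (crf lz lw k) (cmap x (Zbar i)) = lz i k + vfield (crf lz lw k) (ser_conj (x (SF i)))"
  by (simp_all add: cmap_def vfield_add) (simp_all add: crf_def)

lemma sum_delta_mult:
  fixes W V :: "'n::finite \<Rightarrow> 'v::finite mps"
  shows "(\<Sum>i\<in>UNIV. W i * ((if i = k then 1 else 0) + V i)) = W k + (\<Sum>i\<in>UNIV. W i * V i)"
  by (simp add: distrib_left sum.distrib if_01_mult)

lemma teq_iff_M: "teq lz lw x \<longleftrightarrow> (\<forall>i k. Mz lz lw x i k = x (SZ i k)) \<and> (\<forall>k. Mw lz lw x k = x (SW k))"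
proof -
  have 1: "A - S - (W - w) = w \<longleftrightarrow> A = W + S" for A S W w :: "'a ser"
    by (auto simp: algebra_simps)
  show ?thesis
    unfolding teq_def vfield_cmap sum_delta_mult Mz_def Mw_def 1 by blast
qed

text \<open>The entries of the matrix \<open>J\<close> and of both left-hand sides are the
  derivatives of the components of \<open>h\<close> along the frame fields. The matrix identities
  thus become the equations for each \<open>X\<^sub>k\<close>.\<close>

lemma transforms_iff:
  "transforms L f g L' \<longleftrightarrow> teq (lzf L) (lwf L) (state f g L')"
proof -
  let ?x = "state f g L'"
  let ?X = "\<lambda>k. vfield (crf (lzf L) (lwf L) k)"
  let ?J = "mat 1 + jac_z f + jac_zb f ** Lzb L + du_outer f (Lw L)"
  have X: "?X k s = mderiv (Z k) s + (\<Sum>j\<in>UNIV. mderiv (Zbar j) s * Lzb L $ j $ k) + mderiv U s * Lw L $ k" for k s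
    by (simp add: vfield_crf lzf_def lwf_def mult.commute)
  have J: "?J $ i $ k = ?X k (cmap ?x (Z i))" for i k
    unfolding vfield_cmap X
    by (simp add: mat_def jac_z_def jac_zb_def du_outer_def matrix_matrix_mult_def state_def)
  have S: "cr_subst L' (coord_change f g) = (\<chi> i k. msubst (Lzb L' $ i $ k) (cmap ?x), \<chi> k. msubst (Lw L' $ k) (cmap ?x))"
    unfolding cr_subst_def coord_change_eq[of f g L'] ..
  have w: "(grad_z g + grad_zb g v* Lzb L + (1 + mderiv U g) *s Lw L) $ k = ?X k (cmap ?x U)" for k
    unfolding vfield_cmap X
    by (simp add: grad_z_def grad_zb_def vector_matrix_mult_def vector_scalar_mult_def state_def lwf_def algebra_simps)
  have z: "(jac_z (vec_conj f) + (mat 1 + jac_zb (vec_conj f)) ** Lzb L + du_outer (vec_conj f) (Lw L)) $ i $ k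
      = ?X k (cmap ?x (Zbar i))" for i k
    unfolding vfield_cmap X
    by (simp add: jac_z_def jac_zb_def du_outer_def matrix_matrix_mult_def state_def lzf_def vec_conj_def
        mat_def distrib_right sum.distrib if_01_mult add_ac)
  have w': "(Lw (cr_subst L' (coord_change f g)) v* ?J) $ k = (\<Sum>i\<in>UNIV. msubst (?x (SW i)) (cmap ?x) * ?X k (cmap ?x (Z i)))" for k
    unfolding S by (simp add: vector_matrix_mult_def state_def del: vector_add_component) (simp only: J mult.commute)
  have z': "(Lzb (cr_subst L' (coord_change f g)) ** ?J) $ i $ k = (\<Sum>j\<in>UNIV. msubst (?x (SZ i j)) (cmap ?x) * ?X k (cmap ?x (Z j)))" for i k
  proof -
    have "(A ** ?J) $ i $ k = (\<Sum>j\<in>UNIV. A $ i $ j * ?J $ j $ k)" for A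
      by (simp only: matrix_matrix_mult_def vec_lambda_beta)
    then show ?thesis unfolding J by (simp add: S state_def)
  qed
  show ?thesis
    unfolding transforms_def Let_def teq_def vec_eq_iff w z w' z' ..
qed

subsection \<open>Normalization\<close>

definition ucomp :: "nat \<Rightarrow> 'n::finite ser \<Rightarrow> 'n ser" where
  "ucomp c q = mscale (\<lambda>\<alpha>. if \<alpha> U = c then 1 else 0) q"

lemma mcoeff_ucomp [simp]: "mcoeff (ucomp c q) \<alpha> = (if \<alpha> U = c then mcoeff q \<alpha> else 0)"
  by (simp add: ucomp_def)

lemma ucomp_all_0: "(\<forall>c. ucomp c q = 0) \<longleftrightarrow> q = 0"
proof
  assume "\<forall>c. ucomp c q = 0"
  then have "mcoeff (ucomp (\<alpha> U) q) \<alpha> = 0" for \<alpha> by simp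
  then show "q = 0" by (intro mps_eqI) simp
qed (auto intro: mps_eqI)

lemma mhom_eq: "mhom q a b c = mconst (fact a * fact b * fact c) * ucomp c (bh a b q)"
  by (rule mps_eqI) (auto simp: mhom_def zdeg_eq zbdeg_eq)

lemma mconst_times_eq_0: "k \<noteq> 0 \<Longrightarrow> mconst k * (s :: 'v::finite mps) = 0 \<longleftrightarrow> s = 0"
  by (auto dest: mconst_cancel)

lemma fact3_nz: "(fact a * fact b * fact c :: complex) \<noteq> 0" by simp

lemma mhom_eq_0: "mhom q a b c = 0 \<longleftrightarrow> ucomp c (bh a b q) = 0"
  unfolding mhom_eq by (rule mconst_times_eq_0[OF fact3_nz])

lemma ltrace_ucomp: "ltrace ci (ucomp c q) = ucomp c (ltrace ci q)"
  by (rule mps_eqI) (simp add: ltrace_def mcoeff_sum)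

lemma ser_conj_ucomp: "ser_conj (ucomp c q) = ucomp c (ser_conj q)"
  by (rule mps_eqI) simp

lemma ucomp_add: "ucomp c (p + q) = ucomp c p + ucomp c q"
  by (rule mps_eqI) simp

lemma ucomp_Suc_all: "(\<forall>c. ucomp (c + 1) q = 0) \<longleftrightarrow> mderiv U q = 0"
proof
  assume a: "\<forall>c. ucomp (c + 1) q = 0"
  show "mderiv U q = 0"
  proof (rule mps_eqI)
    fix \<alpha>
    show "mcoeff (mderiv U q) \<alpha> = mcoeff 0 \<alpha>"
      using arg_cong[OF spec[OF a, of "\<alpha> U"], of "\<lambda>s. mcoeff s (\<alpha>(U := Suc (\<alpha> U)))"] by simp
  qed
next
  assume a: "mderiv U q = 0"
  show "\<forall>c. ucomp (c + 1) q = 0"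
  proof (intro allI mps_eqI)
    fix c \<alpha>
    have "mcoeff q \<alpha> = 0" if "\<alpha> U = c + 1"
    proof -
      have "\<alpha>(U := Suc c) = \<alpha>" using that by (simp add: fun_upd_idem)
      then have "of_nat (Suc c) * mcoeff q \<alpha> = 0"
        using arg_cong[OF a, of "\<lambda>s. mcoeff s (\<alpha>(U := c))"] by simp
      then show ?thesis using of_nat_Suc_neq_0[of c] by simp
    qed
    then show "mcoeff (ucomp (c + 1) q) \<alpha> = mcoeff 0 \<alpha>" by simp
  qed
qed

lemma levi_trace_eq: "levi_trace L q = ltrace (levi_ci L) q"
  unfolding levi_trace_def ltrace_def levi_ci_def ..

lemma normalized_iff:
  "normalized L \<longleftrightarrow> (\<forall>i. (\<Sum>k\<in>UNIV. mvar (Z k) * Lzb L $ i $ k) = 0) \<and>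
     nrm (levi_ci L) (\<Sum>k\<in>UNIV. mvar (Z k) * Lw L $ k)"
proof -
  let ?tr = "ltrace (levi_ci L)" and ?R = "\<Sum>k\<in>UNIV. mvar (Z k) * Lw L $ k"
  have zb: "euler_zb L $ i = (\<Sum>k\<in>UNIV. mvar (Z k) * Lzb L $ i $ k)" for i
    by (simp add: euler_zb_def euler_field_def matrix_vector_mult_def mult.commute)
  have w: "euler_w L = ?R" by (simp add: euler_w_def euler_field_def mult.commute)
  have 1: "(\<forall>a b c. mhom s a b c = 0) \<longleftrightarrow> s = 0" for s
  proof
    assume "\<forall>a b c. mhom s a b c = 0"
    then have "bh a b s = 0" for a b unfolding mhom_eq_0 ucomp_all_0 by blast
    then show "s = 0" using eq_bhI[of s 0] by simp
  qed (simp add: mhom_eq_0 ucomp_all_0)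
  \<comment> \<open>Conjugation exchanges the two degrees, so the condition for all
    \<open>a\<close>, \<open>b\<close>, \<open>c\<close> together says that the whole series is
    imaginary.\<close>
  have 2: "mhom s a b c + ser_conj (mhom s b a c) = mhom (s + ser_conj s) a b c" for s a b c
    unfolding mhom_eq ser_conj_mconst_times ser_conj_ucomp ser_conj_bh ucomp_add bh_add distrib_left
    by (simp add: mult.commute[of "fact b"])
  have t1: "?tr (mhom s a b c) = mconst (fact a * fact b * fact c) * ucomp c (?tr (bh a b s))" for s a b c
    by (simp only: mhom_eq ltrace_mconst_times ltrace_ucomp)
  have t2: "?tr (?tr (mhom s a b c)) = mconst (fact a * fact b * fact c) * ucomp c (?tr (?tr (bh a b s)))" for s a b c
    by (simp only: t1 ltrace_mconst_times ltrace_ucomp)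
  have t3: "?tr (?tr (?tr (mhom s a b c))) = mconst (fact a * fact b * fact c) * ucomp c (?tr (?tr (?tr (bh a b s))))" for s a b c
    by (simp only: t2 ltrace_mconst_times ltrace_ucomp)
  have pw: "(levi_trace L ^^ 2) s = ?tr (?tr s)" "(levi_trace L ^^ 3) s = ?tr (?tr (?tr s))" for s
    by (simp_all add: levi_trace_eq numeral_2_eq_2 numeral_3_eq_3)
  have "normalized L \<longleftrightarrow> (\<forall>i. \<forall>a b c. mhom (\<Sum>k\<in>UNIV. mvar (Z k) * Lzb L $ i $ k) a b c = 0) \<and>
     (\<forall>a b c. mhom (?R + ser_conj ?R) a b c = 0) \<and> (\<forall>c. ucomp (c + 1) (bh 1 1 ?R) = 0) \<and>
     (\<forall>a. \<forall>c. ucomp c (bh (a + 2) 1 ?R) = 0) \<and> (\<forall>c. ucomp c (?tr (bh 2 2 ?R)) = 0) \<and>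
     (\<forall>c. ucomp c (?tr (?tr (bh 3 2 ?R))) = 0) \<and> (\<forall>c. ucomp c (?tr (?tr (?tr (bh 3 3 ?R)))) = 0)"
    unfolding normalized_def zb w 2 pw t3 unfolding t2 unfolding levi_trace_eq t1 mconst_times_eq_0[OF fact3_nz] mhom_eq_0 by blast
  then show ?thesis unfolding 1 ucomp_all_0 ucomp_Suc_all nrm_def by blast
qed

text \<open>\<open>\<i> * q\<close> is imaginary, of bidegree (1, 1) and free of \<open>u\<close>,
  and at this bidegree \<open>nrm\<close> restricts the \<open>u\<close>-derivative only.\<close>

lemma nrm_iq:
  assumes "\<And>j k. cnj (c j k) = c k j"
  shows "nrm ci (R - mconst \<i> * qf c) \<longleftrightarrow> nrm ci R"
proof -
  have s: "bh a b (qf c) = (if a = 1 \<and> b = 1 then qf c else 0)" for a b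
  proof -
    have 1: "bh a b (1 :: 'a ser) = (if a = 0 \<and> b = 0 then 1 else 0)" for a b
      by (rule mps_eqI) (auto simp: mcoeff_one)
    show ?thesis
      using bh_qf_Suc[of "a - 1" "b - 1" c 1] bh_qf_0[of b c 1] bh_qf_0'[of a c 1] by (cases a; cases b) (auto simp: 1)
  qed
  have r: "R - mconst \<i> * qf c + ser_conj (R - mconst \<i> * qf c) = R + ser_conj R"
    by (simp add: ser_conj_diff ser_conj_mconst_times ser_conj_qf[OF assms] mconst_minus)
  show ?thesis
    unfolding nrm_def r bh_diff bh_mconst_times s mderiv_diff
    by (simp add: mderiv_U_mconst_times)
qed

section \<open>Reduction of the first order terms\<close>

lemma unit_eq_iff: "unit v = unit w \<longleftrightarrow> v = w"
proof
  assume "unit v = unit w"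
  then have "unit v w = unit w w" by simp
  then show "v = w" by (simp add: unit_def split: if_splits)
qed simp

lemma wdeg_1_less_2:
  assumes "wdeg (\<lambda>_. 1) \<alpha> < 2" shows "\<alpha> = (\<lambda>_. 0) \<or> (\<exists>v. \<alpha> = unit v)"
proof (cases "\<alpha> = (\<lambda>_. 0)")
  case False
  then obtain v where v: "\<alpha> v \<noteq> 0" by auto
  have "wdeg (\<lambda>_. 1) (\<alpha>(v := \<alpha> v - 1)) = 0"
    using wdeg_upd_pred[where \<alpha> = \<alpha> and v = v and \<omega> = "\<lambda>_. 1", OF v] assms by simp
  then have 0: "(\<alpha>(v := \<alpha> v - 1)) w = 0" for w by (simp add: wdeg_def)
  have "\<alpha> w = unit v w" for w
    using 0[of w] v by (cases "w = v") (auto simp: unit_def)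
  then show ?thesis by blast
qed simp

lemma wdeg_1_le_wt: "wdeg (\<lambda>_. 1) \<alpha> \<le> wdeg wt \<alpha>"
  unfolding wdeg_def by (intro sum_mono mult_right_mono wt_pos) simp

lemma van_ord_wt: "van (\<lambda>_. 1) k s \<Longrightarrow> van wt k s"
  unfolding van_def by (intro allI impI) (blast intro: le_less_trans[OF wdeg_1_le_wt])

text \<open>The part of weight 1: a term linear in \<open>u\<close> has weight 2 and belongs to the
  remainder.\<close>

definition lin_part :: "'n::finite ser \<Rightarrow> 'n ser" where
  "lin_part s = (\<Sum>j\<in>UNIV. mconst (mcoeff s (unit (Z j))) * mvar (Z j) + mconst (mcoeff s (unit (Zbar j))) * mvar (Zbar j))"

lemma mcoeff_mvar_unit: "mcoeff (mvar v) (unit w) = (if w = v then 1 else 0)"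
  unfolding mcoeff_mvar unit_def[symmetric] unit_eq_iff ..

lemma mcoeff_mvar_0: "mcoeff (mvar v) (\<lambda>_. 0) = 0"
proof -
  have "(\<lambda>_. 0 :: nat) v \<noteq> ((\<lambda>_. 0)(v := 1)) v" by simp
  then have "(\<lambda>_. 0 :: nat) \<noteq> (\<lambda>_. 0)(v := 1)" by metis
  then show ?thesis unfolding mcoeff_mvar by (rule if_not_P)
qed

lemma mcoeff_lin_form:
  "mcoeff (\<Sum>j\<in>UNIV. mconst (u j) * mvar (Z j) + mconst (w j) * mvar (Zbar j)) (unit (Z i)) = u i"
  "mcoeff (\<Sum>j\<in>UNIV. mconst (u j) * mvar (Z j) + mconst (w j) * mvar (Zbar j)) (unit (Zbar i)) = w i"
  "mcoeff (\<Sum>j\<in>UNIV. mconst (u j) * mvar (Z j) + mconst (w j) * mvar (Zbar j)) (\<lambda>_. 0) = 0"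
  by (simp_all add: mcoeff_sum mcoeff_mvar_unit mcoeff_mvar_0 if_distrib sum.distrib cong: if_cong)

lemma van_lin_part:
  assumes "van (\<lambda>_. 1) 1 s" shows "van wt 2 (s - lin_part s)"
  unfolding van_def
proof (intro allI impI)
  fix \<alpha> :: "'a cvar \<Rightarrow> nat" assume a: "wdeg wt \<alpha> < 2"
  have "wdeg (\<lambda>_. 1) \<alpha> < 2" using wdeg_1_le_wt[of \<alpha>] a by simp
  then consider "\<alpha> = (\<lambda>_. 0)" | v where "\<alpha> = unit v" using wdeg_1_less_2 by blast
  then show "mcoeff (s - lin_part s) \<alpha> = 0"
  proof cases
    case 1
    then show ?thesis using assms by (simp add: van_def lin_part_def mcoeff_lin_form)
  next
    case 2
    have "wt v < 2" using a by (simp add: 2 unit_def)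
    then show ?thesis by (cases v) (auto simp: 2 lin_part_def mcoeff_lin_form)
  qed
qed

definition qz :: "('n::finite \<Rightarrow> 'n \<Rightarrow> complex) \<Rightarrow> 'n ser" where
  "qz c = (\<Sum>j\<in>UNIV. \<Sum>k\<in>UNIV. mconst (c j k) * (mvar (Z j) * mvar (Z k)))"

lemma ser_conj_qz: "ser_conj (qz c) = (\<Sum>j\<in>UNIV. \<Sum>k\<in>UNIV. mconst (cnj (c j k)) * (mvar (Zbar j) * mvar (Zbar k)))"
  by (simp add: qz_def ser_conj_sum ser_conj_mconst_times ser_conj_mult)

lemma mderiv_Z_qz: "mderiv (Z k) (qz c) = (\<Sum>j\<in>UNIV. mconst (c j k + c k j) * mvar (Z j))"
proof -
  have "mderiv (Z k) (qz c) = (\<Sum>j\<in>UNIV. \<Sum>l\<in>UNIV. mconst (c j l) * ((if j = k then mvar (Z l) else 0) + (if l = k then mvar (Z j) else 0)))"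
    unfolding qz_def mderiv_sum
    by (intro sum.cong refl) (auto simp: mderiv_mult mderiv_mvar)
  also have "\<dots> = (\<Sum>l\<in>UNIV. mconst (c k l) * mvar (Z l)) + (\<Sum>j\<in>UNIV. mconst (c j k) * mvar (Z j))"
  proof -
    have "(\<Sum>j\<in>UNIV. \<Sum>l\<in>UNIV. mconst (c j l) * (if j = k then mvar (Z l) else 0)) =
      (\<Sum>l\<in>UNIV. mconst (c k l) * (mvar (Z l) :: 'a ser))"
      by (subst sum.swap) (simp add: if_01_mult)
    then show ?thesis by (simp add: distrib_left sum.distrib if_01_mult)
  qed
  finally show ?thesis by (simp add: mconst_add distrib_right sum.distrib add.commute)
qed

lemma mderiv_Z_ser_conj_qz: "mderiv (Z k) (ser_conj (qz c)) = 0"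
  by (simp add: ser_conj_qz mderiv_sum mderiv_mult mderiv_mvar)

text \<open>The quadratic part of \<open>g\<close>, apart from its \<open>u\<^sup>2\<close>-term, is determined by the
  normalization; it turns the linear part of \<open>L\<^sup>w\<close> into the form required in \<open>reduced\<close>.\<close>

definition quad :: "'n::finite cr_graph \<Rightarrow> 'n ser" where
  "quad L = qz (\<lambda>j k. - zcoef L j k / 2) + ser_conj (qz (\<lambda>j k. - zcoef L j k / 2))
     + qf (\<lambda>j k. - (zbcoef L j k + cnj (zbcoef L k j)) / 2)"

lemma ser_conj_quad: "ser_conj (quad L) = quad L"
proof -
  have "ser_conj (qf (\<lambda>j k. - (zbcoef L j k + cnj (zbcoef L k j)) / 2)) = qf (\<lambda>j k. - (zbcoef L j k + cnj (zbcoef L k j)) / 2)"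
    by (rule ser_conj_qf) (simp add: add.commute)
  then show ?thesis by (simp add: quad_def ser_conj_add add.commute)
qed

lemma van_quad:
  assumes "\<And>j. 1 \<le> \<omega> (Z j)" "\<And>j. 1 \<le> \<omega> (Zbar j)" shows "van \<omega> 2 (quad L)"
proof -
  have "van \<omega> 2 (mvar (Z j) * mvar (Z k))" "van \<omega> 2 (mvar (Zbar j) * mvar (Z k))" "van \<omega> 2 (mvar (Zbar j) * mvar (Zbar k))" for j k
    by (rule van_mult'[where j = 1 and k = 1, OF van_mvar van_mvar]; simp add: assms[simplified])+
  then show ?thesis unfolding quad_def ser_conj_qz unfolding qz_def qf_def
    by (intro van_add van_sum van_mconst_times)
qed

lemma mderiv_U_quad: "mderiv U (quad L) = 0"
  unfolding quad_def ser_conj_qz by (simp add: qz_def mderiv_add mderiv_sum mderiv_mult mderiv_mvar)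

lemma levi_c_i: "\<i> * levi_c L j k = (zbcoef L j k - cnj (zbcoef L k j)) / 2"
  by (simp add: levi_c_def field_simps)

text \<open>Adding the derivative of \<open>quad\<close> removes the symmetric part of the
  coefficients of \<open>z\<close> and the Hermitian part of those of \<open>zbar\<close>. Left are
  the skew part and the skew-Hermitian part, which is \<open>\<i>\<close> times the Levi
  form.\<close>

lemma mderiv_Z_quad: "lin_part (lwf L k) + mderiv (Z k) (quad L) = ell (tors_a L) (levi_c L) k"
proof -
  have "lin_part (lwf L k) + mderiv (Z k) (quad L) = (\<Sum>j\<in>UNIV.
      (mconst (zcoef L j k) + mconst (- zcoef L j k / 2 + - zcoef L k j / 2)) * mvar (Z j)
      + (mconst (zbcoef L j k) + mconst (- (zbcoef L j k + cnj (zbcoef L k j)) / 2)) * mvar (Zbar j))"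
    unfolding quad_def mderiv_add mderiv_Z_ser_conj_qz mderiv_Z_qz mderiv_Z_qf lin_part_def zcoef_def[symmetric] zbcoef_def[symmetric]
    by (simp add: sum.distrib distrib_right add_ac)
  also have "\<dots> = ell (tors_a L) (levi_c L) k"
    unfolding ell_def mconst_add[symmetric] by (intro sum.cong refl) (simp add: tors_a_def levi_c_i diff_divide_distrib add_divide_distrib)
  finally show ?thesis .
qed

section \<open>The shear in \<open>u\<close> that normalizes the linear part of the transversal
  component\<close>

definition ush :: "'n ser \<Rightarrow> 'n::finite cvar \<Rightarrow> 'n ser" where
  "ush t v = mvar v + (if v = U then t else 0)"

lemma ush_simps [simp]: "ush t (Z j) = mvar (Z j)" "ush t (Zbar j) = mvar (Zbar j)" "ush t U = mvar U + t"
  by (simp_all add: ush_def)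

lemma van_ush: "van wt 2 t \<Longrightarrow> van wt (wt v) (ush t v)"
  by (cases v) (auto intro!: van_add van_mvar)

lemma ord_ush: "van wt 2 t \<Longrightarrow> van (\<lambda>_. 1) 1 (ush t v)"
  by (rule van_ord_1[OF van_mono[OF van_ush wt_pos]])

lemma van_wt_quad: "van wt 2 (quad L)" "van wt 2 (- quad L)"
proof -
  show "van wt 2 (quad L)" by (rule van_quad) auto
  then show "van wt 2 (- quad L)" by (rule van_minus)
qed

context
  fixes L :: "'n::finite cr_graph"
begin

abbreviation "h0 \<equiv> ush (quad L)"
abbreviation "k0 \<equiv> ush (- quad L)"

lemma ord_h0: "van (\<lambda>_. 1) 1 (h0 v)" "van (\<lambda>_. 1) 1 (k0 v)"
  by (rule ord_ush, rule van_wt_quad)+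

lemma msubst_quad:
  assumes "van wt 2 t" shows "msubst (quad L) (ush t) = quad L"
proof -
  have m: "msubst (mvar v * mvar w) (ush t) = ush t v * ush t w" for v w
    by (simp only: msubst_mult[where \<sigma> = "ush t", OF ord_ush[OF assms]] msubst_mvar[where \<sigma> = "ush t", OF ord_ush[OF assms]])
  show ?thesis
    unfolding quad_def ser_conj_qz unfolding qz_def qf_def
    by (simp add: msubst_add msubst_sum msubst_mconst_times m)
qed

text \<open>\<open>quad\<close> does not contain \<open>u\<close> and is therefore unchanged by both
  shears, so the shear with the opposite sign is the inverse.\<close>

lemma msubst_inverse: "msubst (msubst s h0) k0 = s" "msubst (msubst s k0) h0 = s"
proof -
  have "msubst (h0 v) k0 = mvar v" for v
    by (cases v) (simp_all add: msubst_mvar[where \<sigma> = k0, OF ord_h0(2)] msubst_add msubst_quad[OF van_wt_quad(2)])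
  then show "msubst (msubst s h0) k0 = s"
    by (simp add: msubst_msubst[where \<sigma> = h0 and \<tau> = k0, OF ord_h0] msubst_mvar_id)
  have "msubst (k0 v) h0 = mvar v" for v
    by (cases v) (simp_all add: msubst_mvar[where \<sigma> = h0, OF ord_h0(1)] msubst_diff msubst_quad[OF van_wt_quad(1)])
  then show "msubst (msubst s k0) h0 = s"
    by (simp add: msubst_msubst[where \<sigma> = k0 and \<tau> = h0, OF ord_h0(2) ord_h0(1)] msubst_mvar_id)
qed

lemma ser_conj_msubst_ush: "ser_conj (msubst s h0) = msubst (ser_conj s) h0" "ser_conj (msubst s k0) = msubst (ser_conj s) k0"
proof -
  have "ser_conj (ush t v) = ush t (cvar_conj v)" if "ser_conj t = t" for t :: "'n ser" and v
    using that by (cases v) (simp_all add: ser_conj_add)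
  note c = this[OF ser_conj_quad] this[of "- quad L"]
  show "ser_conj (msubst s h0) = msubst (ser_conj s) h0"
    by (rule ser_conj_msubst[where \<sigma> = h0, OF ord_h0(1) c(1)])
  show "ser_conj (msubst s k0) = msubst (ser_conj s) k0"
    by (rule ser_conj_msubst[where \<sigma> = k0, OF ord_h0(2) c(2)]) (simp add: ser_conj_minus ser_conj_quad)
qed

abbreviation "XL k \<equiv> vfield (crf (lzf L) (lwf L) k)"

text \<open>With \<open>red_w\<close>, the structure in the coordinates
  \<open>(z, u + quad)\<close>. The shear fixes \<open>z\<close>, so the derivative of the new
  coordinate \<open>u + quad\<close> along the frame is the new transversal component;
  \<open>k0\<close> rewrites it in the new coordinates.\<close>

definition red_z :: "'n \<Rightarrow> 'n \<Rightarrow> 'n ser" where "red_z i k = msubst (lzf L i k) k0"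
definition red_w :: "'n \<Rightarrow> 'n ser" where "red_w k = msubst (lwf L k + XL k (quad L)) k0"

abbreviation "X0 k \<equiv> vfield (crf red_z red_w k)"

lemma XL_msubst: "XL k (msubst s h0) = msubst (X0 k s) h0"
proof -
  have "XL k (h0 w) = msubst (crf red_z red_w k w) h0" for w
    by (cases w) (simp_all add: crf_def red_z_def red_w_def msubst_inverse vfield_add)
  then show ?thesis
    unfolding vfield_msubst[where \<sigma> = h0, OF ord_h0(1)] vfield_def[of "crf red_z red_w k"]
    by (simp add: msubst_sum msubst_mult[where \<sigma> = h0, OF ord_h0(1)] mult.commute)
qed

text \<open>Composition of a coordinate change for the reduced structure with the shear
  \<open>h0\<close>. The structure slots describe the target, so they stay.\<close>

definition lift :: "('n slot \<Rightarrow> 'n ser) \<Rightarrow> 'n slot \<Rightarrow> 'n ser" where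
  "lift x s = (case s of SF i \<Rightarrow> msubst (x (SF i)) h0 | SG \<Rightarrow> quad L + msubst (x SG) h0 | _ \<Rightarrow> x s)"

lemma lift_simps [simp]: "lift x (SF i) = msubst (x (SF i)) h0" "lift x SG = quad L + msubst (x SG) h0"
  "lift x (SZ i k) = x (SZ i k)" "lift x (SW k) = x (SW k)"
  by (simp_all add: lift_def)

definition unlift :: "('n slot \<Rightarrow> 'n ser) \<Rightarrow> 'n slot \<Rightarrow> 'n ser" where
  "unlift x s = (case s of SF i \<Rightarrow> msubst (x (SF i)) k0 | SG \<Rightarrow> msubst (x SG - quad L) k0 | _ \<Rightarrow> x s)"

lemma unlift_simps [simp]: "unlift x (SF i) = msubst (x (SF i)) k0" "unlift x SG = msubst (x SG - quad L) k0"
  "unlift x (SZ i k) = x (SZ i k)" "unlift x (SW k) = x (SW k)"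
  by (simp_all add: unlift_def)

lemma lift_unlift: "lift (unlift x) = x"
proof
  show "lift (unlift x) s = x s" for s by (cases s) (simp_all add: msubst_inverse)
qed

lemma teq_lift:
  assumes x: "\<And>i. van (\<lambda>_. 1) 1 (x (SF i))" "van (\<lambda>_. 1) 1 (x SG)"
  shows "teq (lzf L) (lwf L) (lift x) \<longleftrightarrow> teq red_z red_w x"
proof -
  have c: "cmap (lift x) v = msubst (cmap x v) h0" for v
    by (cases v) (simp_all add: cmap_def msubst_add msubst_mvar[where \<sigma> = h0, OF ord_h0(1)] ser_conj_msubst_ush)
  have o: "van (\<lambda>_. 1) 1 (cmap x v)" for v
    unfolding cmap_def by (rule van_add[OF van_mvar]) (cases v; simp add: x van_ord_ser_conj del: One_nat_def)+
  have s: "msubst q (cmap (lift x)) = msubst (msubst q (cmap x)) h0" for q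
    unfolding c[abs_def] msubst_msubst[where \<sigma> = "cmap x" and \<tau> = h0, OF o ord_h0(1)] by (simp add: c)
  have inj: "msubst p h0 = msubst q h0 \<longleftrightarrow> p = q" for p q
    using msubst_inverse(1) by metis
  show ?thesis
    unfolding teq_def lift_simps s c XL_msubst msubst_mult[where \<sigma> = h0, OF ord_h0(1), symmetric] msubst_sum[symmetric] inj ..
qed

text \<open>In the grading that ignores \<open>u\<close> the shear differs from the identity by
  higher order terms, so pure powers of \<open>u\<close> keep their coefficients. The prescribed
  values of \<open>f\<^sub>u(0)\<close> and \<open>g\<^sub>u\<^sub>u(0)\<close> thus pass to the
  reduced problem.\<close>

lemma mcoeff_uexp_msubst:
  assumes t: "t = quad L \<or> t = - quad L" shows "mcoeff (msubst s (ush t)) (uexp m) = mcoeff s (uexp m)"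
proof -
  let ?\<omega> = "\<lambda>v :: 'n cvar. zwt v + zbwt v"
  have "van ?\<omega> 2 (quad L)" by (rule van_quad) auto
  then have w: "van ?\<omega> 1 t" using t van_minus van_mono by (metis one_le_numeral)
  have "van ?\<omega> (0 + 1) (msubst s (ush t) - msubst s mvar)"
  proof (rule van_msubst_diff)
    show "van ?\<omega> (?\<omega> v) (ush t v)" for v by (cases v) (auto intro: van_mvar)
    show "van ?\<omega> (?\<omega> v + 1) (ush t v - mvar v)" for v using w by (cases v) auto
  qed (auto intro: van_mvar)
  moreover have "wdeg ?\<omega> (uexp m) < 0 + 1" by (simp add: uexp_def)
  ultimately have "mcoeff (msubst s (ush t) - msubst s mvar) (uexp m) = 0" unfolding van_def by blast
  then show ?thesis by (simp add: msubst_mvar_id)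
qed

lemma mcoeff_uexp_quad: "mcoeff (quad L) (uexp m) = 0"
proof -
  have "van (\<lambda>v. zwt v + zbwt v) 2 (quad L)" by (rule van_quad) auto
  moreover have "wdeg (\<lambda>v. zwt v + zbwt v) (uexp m) < 2" by (simp add: uexp_def)
  ultimately show ?thesis unfolding van_def by blast
qed

end

lemma deriv_at0_uu:
  fixes g :: "'a::finite ser"
  shows "deriv_at0 ((\<lambda>v. 0)(U := 2)) g = of_real r \<longleftrightarrow> mcoeff g (uexp 2) = of_real r / 2"
proof -
  have "(\<Prod>v\<in>UNIV. fact (((\<lambda>v :: 'a cvar. 0)(U := 2)) v)) = (2 :: nat)"
    by (subst prod.remove[of UNIV U]) auto
  then have "deriv_at0 ((\<lambda>v. 0)(U := 2)) g = 2 * mcoeff g (uexp 2)" by (simp add: deriv_at0_def uexp_def)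
  then show ?thesis by (auto simp: field_simps)
qed

text \<open>\<open>normalized L'\<close> is stated with the trace of \<open>L'\<close>, the linear
  theory with that of \<open>L\<close>. The two agree since \<open>L'\<close> has the Levi form of
  \<open>L\<close>.\<close>

lemma levi_ci_cong:
  assumes "\<And>k. van wt 2 (lwf L' k - ell a (levi_c L) k)" shows "levi_ci L' = levi_ci L"
proof -
  have "zbcoef L' j k = \<i> * levi_c L j k" for j k
  proof -
    have "mcoeff (lwf L' k - ell a (levi_c L) k) (unit (Zbar j)) = 0"
      using assms[of k] by (simp add: van_def unit_def)
    then show ?thesis by (simp add: zbcoef_def ell_def mcoeff_lin_form)
  qed
  then have "levi_c L' j k = levi_c L j k" for j k
    by (simp add: levi_c_def[of L'] levi_c_herm)
  then have "levi_matrix L' = levi_matrix L" by (simp add: vec_eq_iff levi_matrix_eq)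
  then show ?thesis by (intro ext) (simp add: levi_ci_def)
qed

lemma state_eq_iff: "state f g L = state f' g' L' \<longleftrightarrow> f = f' \<and> g = g' \<and> L = L'"
proof
  assume e: "state f g L = state f' g' L'"
  have "f $ i = f' $ i" "g = g'" "Lzb L $ i $ k = Lzb L' $ i $ k" "Lw L $ k = Lw L' $ k" for i k
    using fun_cong[OF e, of "SF i"] fun_cong[OF e, of SG] fun_cong[OF e, of "SZ i k"] fun_cong[OF e, of "SW k"]
    by (simp_all add: state_def)
  then show "f = f' \<and> g = g' \<and> L = L'" by (simp add: vec_eq_iff prod_eq_iff)
qed simp

lemma state_surj: "\<exists>f g L. state f g L = x"
proof (intro exI ext)
  show "state (\<chi> i. x (SF i)) (x SG) (\<chi> i k. x (SZ i k), \<chi> k. x (SW k)) s = x s" for s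
    by (cases s) (simp_all add: state_def)
qed

lemma no_constant_term_iff:
  "no_constant_term L \<longleftrightarrow> (\<forall>i k. van (\<lambda>_. 1) 1 (lzf L i k)) \<and> (\<forall>k. van (\<lambda>_. 1) 1 (lwf L k))"
  by (simp add: no_constant_term_def vanishes_to_order_eq_van lzf_def lwf_def)

definition sol_state :: "'n::finite cr_graph \<times> real \<Rightarrow> 'n slot \<Rightarrow> 'n ser" where
  "sol_state p = lift (fst p) (slot_limit
     (step (levi_c (fst p)) (levi_ci (fst p)) (tors_a (fst p)) (sys_M1 (fst p)) (sys_M2 (fst p)) (of_real (snd p))
       (red_z (fst p)) (red_w (fst p)))
     (start (tors_a (fst p)) (levi_c (fst p))))"

section \<open>Equivalence of the original and the reduced problem\<close>

context
  fixes L :: "'n::finite cr_graph" and r :: real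
  assumes L: "admissible L"
begin

lemma ord_lz: "van (\<lambda>_. 1) 1 (lzf L i k)" and ord_lw: "van (\<lambda>_. 1) 1 (lwf L k)"
  using L by (simp_all add: admissible_def no_constant_term_iff)

lemma van_lw_quad: "van wt 2 (lwf L k + mderiv (Z k) (quad L) - ell (tors_a L) (levi_c L) k)"
  using van_lin_part[OF ord_lw[of k]] by (simp add: mderiv_Z_quad[symmetric])

lemma van_red_w: "van wt 2 (red_w L k - ell (tors_a L) (levi_c L) k)"
proof -
  let ?k = "ush (- quad L)"
  have "van wt 2 (lzf L j k * mderiv (Zbar j) (quad L))" for j
    by (rule van_mult'[OF van_ord_wt[OF ord_lz] van_mderiv'[OF van_wt_quad(1)]]) simp
  then have "van wt 2 (\<Sum>j\<in>UNIV. lzf L j k * mderiv (Zbar j) (quad L))" by (rule van_sum)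
  from van_add[OF van_lw_quad[of k] this]
  have "van wt 2 (lwf L k + XL L k (quad L) - ell (tors_a L) (levi_c L) k)"
    by (simp add: vfield_crf mderiv_U_quad algebra_simps)
  moreover have "msubst (ell (tors_a L) (levi_c L) k) ?k = ell (tors_a L) (levi_c L) k"
    by (simp add: ell_def msubst_sum msubst_add msubst_mconst_times msubst_mvar[where \<sigma> = ?k, OF ord_h0(2)])
  ultimately show ?thesis
    using van_msubst[where \<sigma> = ?k, OF _ van_ush[OF van_wt_quad(2)], of 2 "lwf L k + XL L k (quad L) - ell (tors_a L) (levi_c L) k"]
    by (simp add: red_w_def msubst_diff)
qed

interpretation reduced "levi_c L" "levi_ci L" "tors_a L" "sys_M1 L" "sys_M2 L" "of_nat CARD('n)" "red_z L" "red_w L" r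
proof -
  interpret levi_data "levi_c L" "levi_ci L" "tors_a L" "sys_M1 L" "sys_M2 L" "of_nat CARD('n)"
    by (rule levi_data_L) (use L in \<open>simp add: admissible_def\<close>)
  show "reduced (levi_c L) (levi_ci L) (tors_a L) (sys_M1 L) (sys_M2 L) (of_nat CARD('n)) (red_z L) (red_w L)"
  proof
    show "van wt 1 (red_z L i k)" for i k
      unfolding red_z_def by (intro van_msubst van_ord_wt ord_lz van_ush van_wt_quad)
  qed (rule van_red_w)
qed

text \<open>In the real part of the transversal equation along the Euler field the normalization
  removes \<open>L'\<close>, which prescribes \<open>Ez g + Eb g\<close> below weight 3.
  \<open>quad\<close> satisfies the same relation, and the Euler degree can be divided out.\<close>

lemma quad_forced:
  assumes n: "normalizes L r f g L'" shows "van wt 3 (g - quad L)"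
proof -
  let ?x = "state f g L'"
  define P where "P = (\<Sum>k\<in>UNIV. mvar (Z k) * lwf L k)"
  define R where "R = (\<Sum>k\<in>UNIV. mvar (Z k) * lwf L' k)"
  have f: "van (\<lambda>_. 1) 2 (f $ i)" and g: "van (\<lambda>_. 1) 2 g" and gr: "ser_conj g = g"
    and L': "van (\<lambda>_. 1) 1 (lwf L' i)" and R: "R + ser_conj R = 0"
    and teq: "teq (lzf L) (lwf L) ?x" for i
    using n by (simp_all add: normalizes_def vanishes_to_order_eq_van no_constant_term_iff transforms_iff
        normalized_iff nrm_def R_def lwf_def)
  have c0: "van (\<lambda>_. 1) 0 (crf (lzf L) (lwf L) k v)" for k v by simp
  have Xf: "van (\<lambda>_. 1) 1 (XL L k (f $ i))" for i k
    by (rule van_vfield[where a = "\<lambda>_. 0", OF f]) auto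
  have cm: "van (\<lambda>_. 1) (1 + 1) (cmap ?x v - mvar v)" for v
    using f van_ord_ser_conj[OF f] g by (cases v) (simp_all add: cmap_def state_def numeral_2_eq_2)
  have cm1: "van (\<lambda>_. 1) 1 (cmap ?x v)" for v
    using van_add[OF van_mono[OF cm[of v], of 1] van_mvar[of 1 "\<lambda>_. 1" v]] by simp
  have W: "van (\<lambda>_. 1) 1 (msubst (lwf L' i) (cmap ?x))" for i
    by (rule van_msubst[OF L' cm1])
  have d: "van (\<lambda>_. 1) 2 (msubst (lwf L' k) (cmap ?x) - lwf L' k)" for k
  proof -
    have "van (\<lambda>_. 1) (1 + 1) (msubst (lwf L' k) (cmap ?x) - msubst (lwf L' k) mvar)"
      by (rule van_msubst_diff[where \<sigma> = "cmap ?x" and \<tau> = mvar, OF L' cm1 van_mvar cm]) simp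
    then show ?thesis by (simp add: msubst_mvar_id numeral_2_eq_2)
  qed
  \<comment> \<open>The ordinary order is essential here: \<open>mderiv U g\<close> still has order
    1, whereas the weight bound on \<open>g\<close> would only give 0 for it.\<close>
  have main: "van (\<lambda>_. 1) 2 (lwf L k + mderiv (Z k) g - lwf L' k)" for k
  proof -
    have "lwf L k + XL L k g = msubst (lwf L' k) (cmap ?x) + (\<Sum>i\<in>UNIV. msubst (lwf L' i) (cmap ?x) * XL L k (f $ i))"
      using teq unfolding teq_def vfield_cmap sum_delta_mult by (simp add: state_def lwf_def)
    then have e: "lwf L k + mderiv (Z k) g - lwf L' k = (msubst (lwf L' k) (cmap ?x) - lwf L' k)
        + (\<Sum>i\<in>UNIV. msubst (lwf L' i) (cmap ?x) * XL L k (f $ i))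
        - (\<Sum>j\<in>UNIV. lzf L j k * mderiv (Zbar j) g) - lwf L k * mderiv U g"
      unfolding vfield_crf[of _ _ _ g] by (simp add: algebra_simps)
    have d1: "van (\<lambda>_. 1) 1 (mderiv v g)" for v using van_mderiv'[OF g, of v] by simp
    have "van (\<lambda>_. 1) 2 (lzf L j k * mderiv v g)" "van (\<lambda>_. 1) 2 (lwf L k * mderiv v g)" for j v
      by (rule van_mult'[OF ord_lz d1] van_mult'[OF ord_lw d1]; simp)+
    moreover have "van (\<lambda>_. 1) 2 (msubst (lwf L' i) (cmap ?x) * XL L k (f $ i))" for i
      by (rule van_mult'[OF W Xf]) simp
    ultimately show ?thesis unfolding e by (intro van_diff van_add van_sum d)
  qed
  have "van (\<lambda>_. 1) 3 (\<Sum>k\<in>UNIV. mvar (Z k) * (lwf L k + mderiv (Z k) g - lwf L' k))"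
    by (intro van_sum van_mult'[where j = 1 and k = 2] van_mvar main) auto
  then have "van (\<lambda>_. 1) 3 (P + Ez g - R)"
    by (simp add: P_def R_def Ez_eq distrib_left right_diff_distrib sum.distrib sum_subtractf)
  from van_add[OF this van_ord_ser_conj[OF this]]
  have "van (\<lambda>_. 1) 3 ((P + ser_conj P) + (Ez g + Eb g) - (R + ser_conj R))"
    by (simp add: ser_conj_add ser_conj_diff ser_conj_Ez gr algebra_simps)
  then have A: "van wt 3 ((P + ser_conj P) + (Ez g + Eb g))" unfolding R by (intro van_ord_wt) simp
  have "van wt 3 (\<Sum>k\<in>UNIV. mvar (Z k) * (lwf L k + mderiv (Z k) (quad L) - ell (tors_a L) (levi_c L) k))"
    by (intro van_sum van_mult'[where j = 1 and k = 2] van_mvar van_lw_quad) auto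
  then have "van wt 3 (P + Ez (quad L) - mconst \<i> * qf (levi_c L))"
    by (simp add: P_def Ez_eq distrib_left right_diff_distrib sum.distrib sum_subtractf Z_times_l)
  from van_add[OF this van_wt_ser_conj[OF this]]
  have B: "van wt 3 ((P + ser_conj P) + (Ez (quad L) + Eb (quad L)))"
    by (simp add: ser_conj_add ser_conj_diff ser_conj_Ez ser_conj_quad ser_conj_mconst_times ser_conj_qf levi_c_herm
        mconst_minus algebra_simps)
  have E: "van wt 3 (Ez (g - quad L) + Eb (g - quad L))"
    using van_diff[OF A B] by (simp add: Ez_diff Eb_diff algebra_simps)
  have o2: "van (\<lambda>_. 1) 2 (g - quad L)" by (intro van_diff g van_quad) auto
  show ?thesis
    unfolding van_def
  proof (intro allI impI)
    fix \<alpha> :: "'n cvar \<Rightarrow> nat" assume a: "wdeg wt \<alpha> < 3"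
    show "mcoeff (g - quad L) \<alpha> = 0"
    proof (cases "zdeg \<alpha> + zbdeg \<alpha> = 0")
      case True
      \<comment> \<open>Only the monomials 1 and \<open>u\<close> have Euler degree 0 and weight
        below 3, and both have total degree below 2.\<close>
      then have "wdeg (\<lambda>_. 1) \<alpha> < 2" using a unfolding edeg_eq_wdeg[symmetric] edeg_cvar wdeg_wt by simp
      then show ?thesis using o2 unfolding van_def by blast
    next
      case False
      have "(of_nat (zdeg \<alpha>) + of_nat (zbdeg \<alpha>)) * mcoeff (g - quad L) \<alpha> = 0"
        using E a unfolding van_def by (simp add: distrib_right)
      then have "of_nat (zdeg \<alpha> + zbdeg \<alpha>) * mcoeff (g - quad L) \<alpha> = 0" by simp
      then show ?thesis using False by (simp only: mult_eq_0_iff of_nat_eq_0_iff) simp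
    qed
  qed
qed

lemma normalizes_red_sol:
  assumes n: "normalizes L r f g L'" shows "red_sol (unlift L (state f g L'))"
proof -
  let ?x = "state f g L'"
  let ?y = "unlift L ?x"
  have f: "van (\<lambda>_. 1) 2 (f $ i)" and gr: "ser_conj g = g" and u2: "mcoeff g (uexp 2) = of_real r / 2"
    and L': "van (\<lambda>_. 1) 1 (lzf L' i k)" "van (\<lambda>_. 1) 1 (lwf L' k)" and nz: "normalized L'"
    and teq: "teq (lzf L) (lwf L) ?x" for i k
    using n by (simp_all add: normalizes_def vanishes_to_order_eq_van no_constant_term_iff transforms_iff deriv_at0_uu)
  have y: "?y (SF i) = msubst (f $ i) (k0 L)" "?y SG = msubst (g - quad L) (k0 L)" "?y (SZ i k) = lzf L' i k" "?y (SW k) = lwf L' k" for i k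
    by (simp_all add: state_def lzf_def lwf_def)
  have tame: "tame ?y"
    unfolding tame_def y by (intro conjI allI van_msubst van_ord_wt f quad_forced[OF n] van_ush van_wt_quad)
  have "teq (red_z L) (red_w L) ?y"
  proof (rule teq_lift[THEN iffD1])
    show "van (\<lambda>_. 1) 1 (?y (SF i))" "van (\<lambda>_. 1) 1 (?y SG)" for i
      using van_ord_1[OF van_mono[of wt 2 "?y (SF i)" 1]] van_ord_1[OF van_mono[of wt 3 "?y SG" 1]] tame
      by (simp_all only: tame_def one_le_numeral simp_thms)
  qed (simp add: lift_unlift teq)
  then have M: "\<forall>i k. Mz (red_z L) (red_w L) ?y i k = ?y (SZ i k)" "\<forall>k. Mw (red_z L) (red_w L) ?y k = ?y (SW k)"
    unfolding teq_iff_M by blast+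
  \<comment> \<open>The linear part of \<open>L'\<close> is not among the hypotheses; it follows
    from the transformation rule, since \<open>L'\<close> is the value of \<open>Mw\<close> at a
    tame map.\<close>
  have w2: "van wt 2 (lwf L' k - ell (tors_a L) (levi_c L) k)" for k
    using good_M(2)[OF tame, of k] unfolding M(2)[rule_format] y by (simp only: van_ord_wt L')
  have good: "good ?y"
    unfolding good_def y by (intro conjI allI tame w2 van_ord_wt L')
  have ci: "levi_ci L' = levi_ci L" by (rule levi_ci_cong) (rule w2)
  have N: "(\<Sum>k\<in>UNIV. mvar (Z k) * lzf L' i k) = 0" "nrm (levi_ci L) (\<Sum>k\<in>UNIV. mvar (Z k) * lwf L' k)" for i
    using nz unfolding normalized_iff ci lzf_def lwf_def by blast+
  have u1: "mcoeff (msubst (f $ i) (k0 L)) (uexp 1) = 0" for i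
    unfolding mcoeff_uexp_msubst[of "- quad L" L, simplified] using f[of i, unfolded van_def, rule_format, of "uexp 1"]
    by (simp only: uexp_simps)
  have "mcoeff (msubst (g - quad L) (k0 L)) (uexp 2) = of_real r / 2"
    unfolding mcoeff_uexp_msubst[of "- quad L" L, simplified] by (simp add: mcoeff_uexp_quad u2)
  moreover have "ser_conj (msubst (g - quad L) (k0 L)) = msubst (g - quad L) (k0 L)"
    by (simp add: ser_conj_msubst_ush ser_conj_diff gr ser_conj_quad)
  ultimately show ?thesis
    unfolding red_sol_def y nrm_iq[of "levi_c L", OF levi_c_herm]
    using good M N u1 unfolding y by blast
qed

lemma red_sol_normalizes:
  assumes s: "red_sol y" and e: "state f g L' = lift L y" shows "normalizes L r f g L'"
proof -
  have good: "good y" and M: "\<forall>i k. Mz (red_z L) (red_w L) y i k = y (SZ i k)" "\<forall>k. Mw (red_z L) (red_w L) y k = y (SW k)"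
    and N: "(\<Sum>k\<in>UNIV. mvar (Z k) * y (SZ i k)) = 0" "nrm (levi_ci L) (\<Sum>k\<in>UNIV. mvar (Z k) * y (SW k))"
    and gr: "ser_conj (y SG) = y SG" and u1: "mcoeff (y (SF i)) (uexp 1) = 0" and u2: "mcoeff (y SG) (uexp 2) = of_real r / 2" for i
    using s unfolding red_sol_def nrm_iq[of "levi_c L", OF levi_c_herm] by blast+
  have tame: "van wt 2 (y (SF i))" "van wt 3 (y SG)" and z1: "van wt 1 (y (SZ i k))" and w2: "van wt 2 (y (SW k) - ell (tors_a L) (levi_c L) k)" for i k
    using good by (auto simp: good_def tame_def)
  have x: "f $ i = msubst (y (SF i)) (h0 L)" "g = quad L + msubst (y SG) (h0 L)" "lzf L' i k = y (SZ i k)" "lwf L' k = y (SW k)" for i k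
    using fun_cong[OF e, of "SF i"] fun_cong[OF e, of SG] fun_cong[OF e, of "SZ i k"] fun_cong[OF e, of "SW k"]
    by (simp_all add: state_def lzf_def lwf_def)
  \<comment> \<open>Among the monomials of total degree below 2 only \<open>u\<close> has weight 2,
    and its coefficient vanishes separately.\<close>
  have "van (\<lambda>_. 1) 2 (y (SF i))" for i
    unfolding van_def
  proof (intro allI impI)
    fix \<alpha> :: "'n cvar \<Rightarrow> nat" assume "wdeg (\<lambda>_. 1) \<alpha> < 2"
    then consider "\<alpha> = (\<lambda>_. 0)" | v where "\<alpha> = unit v" using wdeg_1_less_2 by blast
    then show "mcoeff (y (SF i)) \<alpha> = 0"
    proof cases
      case 1
      then show ?thesis using tame(1)[of i] by (simp add: van_def)
    next
      case 2
      show ?thesis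
      proof (cases "v = U")
        case True
        then show ?thesis using u1[of i] by (simp add: 2 unit_def uexp_def)
      next
        case False
        then have "wdeg wt \<alpha> < 2" by (cases v) (simp_all add: 2 unit_def)
        then show ?thesis using tame(1)[of i] unfolding van_def by blast
      qed
    qed
  qed
  then have F: "van (\<lambda>_. 1) 2 (f $ i)" for i
    unfolding x by (rule van_order_msubst[where \<sigma> = "h0 L", OF _ ord_h0(1)])
  have "van (\<lambda>_. 1) 2 (y SG)"
    unfolding van_def
  proof (intro allI impI)
    fix \<alpha> :: "'n cvar \<Rightarrow> nat" assume "wdeg (\<lambda>_. 1) \<alpha> < 2"
    then have "wdeg wt \<alpha> < 3" unfolding edeg_eq_wdeg[symmetric] edeg_cvar wdeg_wt by simp
    then show "mcoeff (y SG) \<alpha> = 0" using tame(2) unfolding van_def by blast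
  qed
  then have "van (\<lambda>_. 1) 2 (msubst (y SG) (h0 L))" by (rule van_order_msubst[where \<sigma> = "h0 L", OF _ ord_h0(1)])
  then have G: "van (\<lambda>_. 1) 2 g" unfolding x by (intro van_add van_quad) auto
  have "teq (lzf L) (lwf L) (lift L y)"
  proof (rule teq_lift[THEN iffD2])
    show "van (\<lambda>_. 1) 1 (y (SF i))" "van (\<lambda>_. 1) 1 (y SG)" for i
      by (rule van_ord_1, rule van_mono[OF tame(1)], simp) (rule van_ord_1, rule van_mono[OF tame(2)], simp)
  qed (use M in \<open>simp add: teq_iff_M\<close>)
  then have T: "transforms L f g L'" unfolding transforms_iff e .
  have "levi_ci L' = levi_ci L" by (rule levi_ci_cong) (use w2 x in simp)
  then have nz: "normalized L'" using N unfolding normalized_iff lzf_def[symmetric] lwf_def[symmetric] x by simp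
  have "no_constant_term L'" unfolding no_constant_term_iff x by (intro conjI allI van_ord_1 z1 van_from_l[OF w2])
  moreover have "ser_conj g = g" unfolding x by (simp add: ser_conj_add ser_conj_quad ser_conj_msubst_ush gr)
  moreover have "mcoeff g (uexp 2) = of_real r / 2"
    unfolding x by (simp add: mcoeff_uexp_quad mcoeff_uexp_msubst[of "quad L" L] u2)
  ultimately show ?thesis
    using F G T nz by (simp add: normalizes_def vanishes_to_order_eq_van deriv_at0_uu)
qed

text \<open>Existence, uniqueness and a formula in one statement: the normalizing data are exactly
  the lifted limit of the iteration.\<close>

lemma normalizes_iff: "normalizes L r f g L' \<longleftrightarrow> state f g L' = sol_state (L, r)"
proof
  assume "normalizes L r f g L'"
  then have "unlift L (state f g L') = xlim" by (rule normalizes_red_sol[unfolded red_sol_xlim])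
  then have "lift L (unlift L (state f g L')) = lift L xlim" by simp
  then show "state f g L' = sol_state (L, r)" by (simp add: lift_unlift sol_state_def)
next
  assume "state f g L' = sol_state (L, r)"
  then have "state f g L' = lift L xlim" by (simp add: sol_state_def)
  then show "normalizes L r f g L'" by (rule red_sol_normalizes[rotated]) (simp add: red_sol_xlim)
qed

end

section \<open>Universality of the solution\<close>

lemma sol_state_ratfun: "(\<lambda>p. mcoeff (sol_state p s) \<alpha>) \<in> ratfun (UNIV :: 'n::finite jet set)"
proof -
  interpret coeff_ring "ratfun UNIV :: ('n cr_graph \<times> real \<Rightarrow> complex) set" by (rule coeff_ring_ratfun) simp
  have l: "fam (\<lambda>p. lzf (fst p :: 'n cr_graph) i k)" "fam (\<lambda>p. lwf (fst p :: 'n cr_graph) k)" for i k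
    using polyfun_ratfun[OF coeff_polyfun[of "EntZb i k" _ UNIV]] polyfun_ratfun[OF coeff_polyfun[of "EntW k" _ UNIV]]
    by (simp_all add: fam_def lzf_def lwf_def)
  note zc = zcoef_ratfun[THEN ratfun_mono[OF _ subset_UNIV]]
  have q: "fam (\<lambda>p. quad (fst p :: 'n cr_graph))"
    unfolding quad_def qz_def qf_def
    by (intro fam_add fam_ser_conj fam_sum fam_mult fam_mconst fam_const S_divide S_minus S_add S_cnj zc)
  have ush: "fam (\<lambda>p. ush (quad (fst p :: 'n cr_graph)) v)" "fam (\<lambda>p. ush (- quad (fst p :: 'n cr_graph)) v)" for v
    using q by (cases v; simp add: fam_add fam_minus fam_diff fam_const)+
  have rz: "fam (\<lambda>p. red_z (fst p :: 'n cr_graph) i k)" for i k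
    unfolding red_z_def by (intro fam_msubst l ush)
  have rw: "fam (\<lambda>p. red_w (fst p :: 'n cr_graph) k)" for k
    unfolding red_w_def by (intro fam_msubst fam_add fam_X l q ush)
  note d = data_ratfun[THEN ratfun_mono[OF _ subset_UNIV]]
  have c: "cfam (\<lambda>p. levi_c (fst p :: 'n cr_graph))" "cfam (\<lambda>p. levi_ci (fst p :: 'n cr_graph))"
    "cfam (\<lambda>p. tors_a (fst p :: 'n cr_graph))" "cfam (\<lambda>p. sys_M1 (fst p :: 'n cr_graph))"
    "cfam (\<lambda>p. sys_M2 (fst p :: 'n cr_graph))"
    unfolding cfam_def using d by blast+
  have "(\<lambda>p :: 'n cr_graph \<times> real. of_real (snd p)) \<in> polyfun jetval UNIV"
    using polyfun_var[of JetParam UNIV jetval] by (simp add: jetval_def)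
  then have r: "(\<lambda>p :: 'n cr_graph \<times> real. of_real (snd p)) \<in> ratfun UNIV" by (rule polyfun_ratfun)
  note lim = fam_slot_limit[OF rz rw c r]
  have "fam (\<lambda>p. sol_state (p :: 'n cr_graph \<times> real) s)"
  proof (cases s)
    case (SF i)
    show ?thesis unfolding SF sol_state_def lift_simps by (intro fam_msubst lim ush)
  next
    case SG
    show ?thesis unfolding SG sol_state_def lift_simps by (intro fam_add q fam_msubst lim ush)
  next
    case (SZ i k)
    show ?thesis unfolding SZ sol_state_def lift_simps by (rule lim)
  next
    case (SW k)
    show ?thesis unfolding SW sol_state_def lift_simps by (rule lim)
  qed
  then show ?thesis by (rule famD)
qed

lemma universal_state:
  assumes "\<And>f g L'. \<Phi> f g L' = deriv_at0 \<alpha> (state f g L' s)"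
  shows "universal (\<Phi> :: 'n::finite ser ^ 'n \<Rightarrow> 'n ser \<Rightarrow> 'n cr_graph \<Rightarrow> complex)"
proof (rule universalI)
  interpret coeff_ring "ratfun UNIV :: ('n cr_graph \<times> real \<Rightarrow> complex) set" by (rule coeff_ring_ratfun) simp
  show "(\<lambda>p. deriv_at0 \<alpha> (sol_state p s)) \<in> ratfun (UNIV :: 'n jet set)"
    unfolding deriv_at0_def by (intro S_mult S_const sol_state_ratfun)
  show "\<Phi> f g L' = deriv_at0 \<alpha> (sol_state (L, r) s)" if "admissible L" "normalizes L r f g L'" for L r f g L'
    using normalizes_iff[OF that(1), of r f g L'] that(2) by (simp add: assms)
qed

theorem theorem7p2:
  shows "(\<forall>(L :: 'n::finite cr_graph) r. no_constant_term L \<longrightarrow> strongly_nondegenerate L \<longrightarrow>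
            (\<exists>!(f, g). \<exists>L'. normalizes L r f g L')) \<and>
         (\<forall>\<alpha> e. universal (\<lambda>(f :: 'n ser ^ 'n) g L'. deriv_at0 \<alpha> (entry_of L' e))) \<and>
         (\<forall>\<alpha> i. universal (\<lambda>(f :: 'n ser ^ 'n) g L'. deriv_at0 \<alpha> (f $ i))) \<and>
         (\<forall>\<alpha>. universal (\<lambda>(f :: 'n ser ^ 'n) g L'. deriv_at0 \<alpha> g))"
proof (intro conjI allI impI)
  fix L :: "'n cr_graph" and r :: real
  assume "no_constant_term L" "strongly_nondegenerate L"
  then have L: "admissible L" by (simp add: admissible_def)
  obtain f g L' where s: "state f g L' = sol_state (L, r)" using state_surj by blast
  show "\<exists>!(f, g). \<exists>L'. normalizes L r f g L'"
    unfolding normalizes_iff[OF L] s[symmetric] state_eq_iff by auto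
next
  fix \<alpha> :: "'n cvar \<Rightarrow> nat" and e :: "'n entry"
  show "universal (\<lambda>(f :: 'n ser ^ 'n) g L'. deriv_at0 \<alpha> (entry_of L' e))"
  proof (cases e)
    case (EntZb i k)
    show ?thesis by (rule universal_state[where s = "SZ i k"]) (simp add: EntZb state_def)
  next
    case (EntW k)
    show ?thesis by (rule universal_state[where s = "SW k"]) (simp add: EntW state_def)
  qed
next
  fix \<alpha> :: "'n cvar \<Rightarrow> nat" and i :: 'n
  show "universal (\<lambda>(f :: 'n ser ^ 'n) g L'. deriv_at0 \<alpha> (f $ i))"
    by (rule universal_state[where s = "SF i"]) (simp add: state_def)
next
  fix \<alpha> :: "'n cvar \<Rightarrow> nat"
  show "universal (\<lambda>(f :: 'n ser ^ 'n) g L'. deriv_at0 \<alpha> g)"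
    by (rule universal_state[where s = SG]) (simp add: state_def)
qed

end
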